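(* Let $\Sigma$ be a closed, connected, oriented surface. Any reduced alternating diagram $D$ on $\Sigma$ for a link in the thickened surface $\Sigma\times I$ is adequate.
   Context: A link diagram on $\Sigma$ is a regular projection of a link in $\Sigma\times I$, $I=[0,1]$ (a tetravalent graph, closed loops without vertices allowed) with over/under information at the double points. It is alternating if crossings alternate over/under along every component. A crossing $c$ is nugatory if there is a simple closed curve in $\Sigma$ which separates $\Sigma$ and meets $D$ only in the double point $c$ (passing through $c$ from one corner to the opposite corner). $D$ is reduced if $\Sigma\smallsetminus D$ is a union of open disks (cellularly embedded) and $D$ has no nugatory crossings. At each crossing there is an $A$-smoothing and a $B$-smoothing: rotating the overstrand counterclockwise sweeps out two opposite regions, the $A$-smoothing joins these two regions, the $B$-smoothing joins the other two. A state $S$ is the collection of disjoint simple closed curves in $\Sigma$ obtained by choosing a smoothing at every crossing; $k(S)=\dim\ker(H_1(S;\mathbb Z/2)\to H_1(\Sigma;\mathbb Z/2))$. Let $S_A$, $S_B$ be the all-$A$ and all-$B$ states. $D$ is adequate if $k(S')\le k(S_A)$ for every state $S'$ with exactly one $B$-smoothing ($A$-adequate), and $k(S')\le k(S_B)$ for every state $S'$ with exactly one $A$-smoothing ($B$-adequate). *)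

theory Defs
  imports "HOL-Homology.Homology" "HOL-Complex_Analysis.Complex_Analysis"
begin

section \<open>Closed connected oriented surfaces\<close>

definition chart :: "'a topology \<Rightarrow> 'a set \<Rightarrow> ('a \<Rightarrow> complex) \<Rightarrow> bool" where
  "chart X U \<phi> \<longleftrightarrow> openin X U \<and> open (\<phi> ` U) \<and>
     homeomorphic_map (subtopology X U) (top_of_set (\<phi> ` U)) \<phi>"

text \<open>
  The transition map \<open>\<psi> \<circ> \<phi>\<inverse>\<close> is a homeomorphism between open subsets of the plane; it preserves
  orientation iff its local degree is \<open>1\<close> everywhere, that is, iff the image of a small
  counterclockwise circle around a point winds once counterclockwise around the image of the point.
\<close>

definition orientation_compatible ::
    "'a set \<Rightarrow> ('a \<Rightarrow> complex) \<Rightarrow> 'a set \<Rightarrow> ('a \<Rightarrow> complex) \<Rightarrow> bool" where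
  "orientation_compatible U \<phi> V \<psi> \<longleftrightarrow>
     (\<forall>p \<in> U \<inter> V. \<forall>r > 0. cball (\<phi> p) r \<subseteq> \<phi> ` (U \<inter> V) \<longrightarrow>
        winding_number (\<psi> \<circ> inv_into U \<phi> \<circ> circlepath (\<phi> p) r) (\<psi> p) = 1)"

text \<open>
  The orientation is given by the atlas \<open>\<A>\<close>. Second countability follows from compactness.
\<close>

definition closed_connected_oriented_surface ::
    "'a topology \<Rightarrow> ('a set \<times> ('a \<Rightarrow> complex)) set \<Rightarrow> bool" where
  "closed_connected_oriented_surface X \<A> \<longleftrightarrow>
     topspace X \<noteq> {} \<and> Hausdorff_space X \<and> compact_space X \<and> connected_space X \<and>
     (\<forall>(U, \<phi>) \<in> \<A>. chart X U \<phi>) \<and> (\<Union>(U, \<phi>) \<in> \<A>. U) = topspace X \<and>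
     (\<forall>(U, \<phi>) \<in> \<A>. \<forall>(V, \<psi>) \<in> \<A>. orientation_compatible U \<phi> V \<psi>)"

definition oriented_chart ::
    "'a topology \<Rightarrow> ('a set \<times> ('a \<Rightarrow> complex)) set \<Rightarrow> 'a set \<Rightarrow> ('a \<Rightarrow> complex) \<Rightarrow> bool" where
  "oriented_chart X \<A> U \<phi> \<longleftrightarrow>
     chart X U \<phi> \<and> (\<forall>(V, \<psi>) \<in> \<A>. orientation_compatible V \<psi> U \<phi>)"


section \<open>Link diagrams on a surface\<close>

text \<open>
  A link with \<open>n\<close> components in \<open>X \<times> [0,1]\<close>; component \<open>i < n\<close> is the embedded circle \<open>\<real>/\<int>\<close>
  parametrised by the 1-periodic map \<open>L i\<close>.
\<close>

definition link_in_thickening :: "'a topology \<Rightarrow> nat \<Rightarrow> (nat \<Rightarrow> real \<Rightarrow> 'a \<times> real) \<Rightarrow> bool" where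
  "link_in_thickening X n L \<longleftrightarrow>
     (\<forall>i<n. continuous_map euclideanreal (prod_topology X (top_of_set {0..1})) (L i)) \<and>
     (\<forall>i<n. \<forall>j<n. \<forall>s t. L i s = L j t \<longleftrightarrow> i = j \<and> s - t \<in> \<int>)"

definition projection :: "nat \<Rightarrow> (nat \<Rightarrow> real \<Rightarrow> 'a \<times> real) \<Rightarrow> 'a set" where
  "projection n L = {fst (L i t) | i t. i < n}"

definition strands_at :: "nat \<Rightarrow> (nat \<Rightarrow> real \<Rightarrow> 'a \<times> real) \<Rightarrow> 'a \<Rightarrow> (nat \<times> real) set" where
  "strands_at n L p = {(i, t). i < n \<and> t \<in> {0..<1} \<and> fst (L i t) = p}"

definition crossings :: "nat \<Rightarrow> (nat \<Rightarrow> real \<Rightarrow> 'a \<times> real) \<Rightarrow> 'a set" where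
  "crossings n L = {p. card (strands_at n L p) = 2}"

text \<open>The coordinate in \<open>[0,1]\<close> is the height: the strand of larger height is the overstrand.\<close>

definition passes_over :: "nat \<Rightarrow> (nat \<Rightarrow> real \<Rightarrow> 'a \<times> real) \<Rightarrow> nat \<Rightarrow> real \<Rightarrow> bool" where
  "passes_over n L i t \<longleftrightarrow> (\<exists>j<n. \<exists>s. fst (L j s) = fst (L i t) \<and> snd (L j s) < snd (L i t))"

definition passes_under :: "nat \<Rightarrow> (nat \<Rightarrow> real \<Rightarrow> 'a \<times> real) \<Rightarrow> nat \<Rightarrow> real \<Rightarrow> bool" where
  "passes_under n L i t \<longleftrightarrow> (\<exists>j<n. \<exists>s. fst (L j s) = fst (L i t) \<and> snd (L j s) > snd (L i t))"

definition flat_chart ::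
    "'a topology \<Rightarrow> ('a set \<times> ('a \<Rightarrow> complex)) set \<Rightarrow> nat \<Rightarrow> (nat \<Rightarrow> real \<Rightarrow> 'a \<times> real) \<Rightarrow>
     'a \<Rightarrow> 'a set \<Rightarrow> ('a \<Rightarrow> complex) \<Rightarrow> bool" where
  "flat_chart X \<A> n L p U \<phi> \<longleftrightarrow>
     oriented_chart X \<A> U \<phi> \<and> p \<in> U \<and> \<phi> p = 0 \<and> \<phi> ` U = ball 0 2 \<and>
     \<phi> ` (projection n L \<inter> U) = {z \<in> ball 0 2. Im z = 0}"

text \<open>
  At a crossing the two strands meet transversally: in a suitable positively oriented chart the
  overstrand runs along the real axis and the understrand along the imaginary axis.
\<close>

definition crossing_chart ::
    "'a topology \<Rightarrow> ('a set \<times> ('a \<Rightarrow> complex)) set \<Rightarrow> nat \<Rightarrow> (nat \<Rightarrow> real \<Rightarrow> 'a \<times> real) \<Rightarrow>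
     'a \<Rightarrow> 'a set \<Rightarrow> ('a \<Rightarrow> complex) \<Rightarrow> bool" where
  "crossing_chart X \<A> n L c U \<phi> \<longleftrightarrow>
     oriented_chart X \<A> U \<phi> \<and> c \<in> U \<and> \<phi> c = 0 \<and> \<phi> ` U = ball 0 2 \<and>
     \<phi> ` (projection n L \<inter> U) = {z \<in> ball 0 2. Im z = 0 \<or> Re z = 0} \<and>
     (\<forall>i<n. \<forall>t. fst (L i t) = c \<longrightarrow>
        (passes_over n L i t \<longrightarrow> (\<forall>\<^sub>F s in nhds t. Im (\<phi> (fst (L i s))) = 0)) \<and>
        (passes_under n L i t \<longrightarrow> (\<forall>\<^sub>F s in nhds t. Re (\<phi> (fst (L i s))) = 0)))"

definition link_diagram ::
    "'a topology \<Rightarrow> ('a set \<times> ('a \<Rightarrow> complex)) set \<Rightarrow> nat \<Rightarrow> (nat \<Rightarrow> real \<Rightarrow> 'a \<times> real) \<Rightarrow> bool"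
  where
  "link_diagram X \<A> n L \<longleftrightarrow>
     link_in_thickening X n L \<and> finite (crossings n L) \<and>
     (\<forall>p \<in> projection n L.
        card (strands_at n L p) = 1 \<and> (\<exists>U \<phi>. flat_chart X \<A> n L p U \<phi>) \<or>
        card (strands_at n L p) = 2 \<and> (\<exists>U \<phi>. crossing_chart X \<A> n L p U \<phi>))"

text \<open>Since \<open>s\<close> and \<open>t\<close> range over \<open>\<real>\<close>, the condition is cyclic along each component.\<close>

definition alternating :: "nat \<Rightarrow> (nat \<Rightarrow> real \<Rightarrow> 'a \<times> real) \<Rightarrow> bool" where
  "alternating n L \<longleftrightarrow>
     (\<forall>i<n. \<forall>s t. s < t \<and> fst (L i s) \<in> crossings n L \<and> fst (L i t) \<in> crossings n L \<and>
        (\<forall>u. s < u \<and> u < t \<longrightarrow> fst (L i u) \<notin> crossings n L) \<longrightarrow>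
        (passes_over n L i s \<longleftrightarrow> passes_under n L i t))"

text \<open>
  The closed curve \<open>\<beta>\<close> leaves \<open>c\<close> into one corner (a quadrant of a crossing chart) and returns
  through the opposite one: near \<open>c\<close> both coordinates have opposite signs at its two ends.
\<close>

definition nugatory ::
    "'a topology \<Rightarrow> ('a set \<times> ('a \<Rightarrow> complex)) set \<Rightarrow> nat \<Rightarrow> (nat \<Rightarrow> real \<Rightarrow> 'a \<times> real) \<Rightarrow>
     'a \<Rightarrow> bool" where
  "nugatory X \<A> n L c \<longleftrightarrow>
     (\<exists>\<beta>. pathin X \<beta> \<and> \<beta> 0 = c \<and> \<beta> 1 = c \<and> inj_on \<beta> {0..<1} \<and>
        \<not> connectedin X (topspace X - \<beta> ` {0..1}) \<and>
        \<beta> ` {0..1} \<inter> projection n L = {c} \<and>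
        (\<exists>U \<phi>. crossing_chart X \<A> n L c U \<phi> \<and>
          (\<exists>\<epsilon>>0. \<forall>s t. 0 < s \<and> s < \<epsilon> \<and> 0 < t \<and> t < \<epsilon> \<longrightarrow>
             \<beta> s \<in> U \<and> \<beta> (1 - t) \<in> U \<and>
             Re (\<phi> (\<beta> s)) * Re (\<phi> (\<beta> (1 - t))) < 0 \<and>
             Im (\<phi> (\<beta> s)) * Im (\<phi> (\<beta> (1 - t))) < 0)))"

definition reduced_diagram ::
    "'a topology \<Rightarrow> ('a set \<times> ('a \<Rightarrow> complex)) set \<Rightarrow> nat \<Rightarrow> (nat \<Rightarrow> real \<Rightarrow> 'a \<times> real) \<Rightarrow> bool"
  where
  "reduced_diagram X \<A> n L \<longleftrightarrow>
     (\<forall>F \<in> connected_components_of (subtopology X (topspace X - projection n L)).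
        subtopology X F homeomorphic_space top_of_set (ball (0::complex) 1)) \<and>
     (\<forall>c \<in> crossings n L. \<not> nugatory X \<A> n L c)"


section \<open>Homology with coefficients in \<open>\<int>/2\<close>\<close>

text \<open>
  The singular chain groups with coefficients in \<open>\<int>/2\<close> are the integral ones modulo twice
  themselves. Cycles and boundaries mod 2 are represented here by integral chains, so that the
  quotient below is \<open>H\<^sub>p(X; \<int>/2)\<close>.
\<close>

definition mod2_cycles :: "nat \<Rightarrow> 'a topology \<Rightarrow> 'a chain set" where
  "mod2_cycles p X = {c. singular_chain p X c \<and> (\<exists>b. chain_boundary p c = frag_cmul 2 b)}"

definition mod2_boundaries :: "nat \<Rightarrow> 'a topology \<Rightarrow> 'a chain set" where
  "mod2_boundaries p X =
     {chain_boundary (Suc p) d + frag_cmul 2 e | d e.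
        singular_chain (Suc p) X d \<and> singular_chain p X e}"

definition mod2_homology_group :: "nat \<Rightarrow> 'a topology \<Rightarrow> 'a chain set monoid" where
  "mod2_homology_group p X =
     subgroup_generated (chain_group p X) (mod2_cycles p X) Mod mod2_boundaries p X"

text \<open>A class, that is a coset \<open>K\<close>, is sent to the coset of the image of any of its elements.\<close>

definition mod2_hom_induced ::
    "nat \<Rightarrow> 'b topology \<Rightarrow> ('a \<Rightarrow> 'b) \<Rightarrow> 'a chain set \<Rightarrow> 'b chain set" where
  "mod2_hom_induced p Y f K = mod2_boundaries p Y <#>\<^bsub>chain_group p Y\<^esub> chain_map p f ` K"

text \<open>
  For an elementary abelian 2-group, i.e. a vector space over \<open>\<int>/2\<close>, a linear combination is
  the product (in the multiplicative notation of \<open>monoid\<close>) over a finite subset.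
\<close>

definition Z2_basis :: "('g, 'm) monoid_scheme \<Rightarrow> 'g set \<Rightarrow> bool" where
  "Z2_basis G B \<longleftrightarrow> B \<subseteq> carrier G \<and>
     bij_betw (\<lambda>T. finprod G (\<lambda>x. x) T) {T. finite T \<and> T \<subseteq> B} (carrier G)"

definition Z2_dim :: "('g, 'm) monoid_scheme \<Rightarrow> nat" where
  "Z2_dim G = card (SOME B. Z2_basis G B)"

definition homological_defect :: "'a topology \<Rightarrow> 'a set \<Rightarrow> nat" where
  "homological_defect X S =
     (let H = mod2_homology_group 1 (subtopology X S)
      in Z2_dim (subgroup_generated H
           (kernel H (mod2_homology_group 1 X) (mod2_hom_induced 1 X id))))"


section \<open>States and adequacy\<close>

datatype smoothing = A_smoothing | B_smoothing

text \<open>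
  In a crossing chart, rotating the overstrand (the real axis) counterclockwise sweeps out the first
  and third quadrants. The arcs of the \<open>A\<close>-smoothing cut off the other two quadrants and so join
  these two.
\<close>

fun smoothing_arcs :: "smoothing \<Rightarrow> complex set" where
  "smoothing_arcs A_smoothing = closed_segment \<i> (-1) \<union> closed_segment (-\<i>) 1"
| "smoothing_arcs B_smoothing = closed_segment 1 \<i> \<union> closed_segment (-1) (-\<i>)"

text \<open>
  The smoothings are carried out in the unit discs of disjoint crossing charts. Such charts exist for
  every link diagram (restrict and rescale given ones), and other ones yield isotopic states.
\<close>

definition smoothing_charts ::
    "'a topology \<Rightarrow> ('a set \<times> ('a \<Rightarrow> complex)) set \<Rightarrow> nat \<Rightarrow> (nat \<Rightarrow> real \<Rightarrow> 'a \<times> real) \<Rightarrow>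
     ('a \<Rightarrow> 'a set) \<Rightarrow> ('a \<Rightarrow> 'a \<Rightarrow> complex) \<Rightarrow> bool" where
  "smoothing_charts X \<A> n L U \<phi> \<longleftrightarrow>
     (\<forall>c \<in> crossings n L. crossing_chart X \<A> n L c (U c) (\<phi> c)) \<and>
     disjoint_family_on U (crossings n L)"

definition state ::
    "nat \<Rightarrow> (nat \<Rightarrow> real \<Rightarrow> 'a \<times> real) \<Rightarrow> ('a \<Rightarrow> 'a set) \<Rightarrow> ('a \<Rightarrow> 'a \<Rightarrow> complex) \<Rightarrow>
     ('a \<Rightarrow> smoothing) \<Rightarrow> 'a set" where
  "state n L U \<phi> \<sigma> =
     (projection n L - (\<Union>c \<in> crossings n L. {p \<in> U c. \<phi> c p \<in> ball 0 1})) \<union>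
     (\<Union>c \<in> crossings n L. {p \<in> U c. \<phi> c p \<in> smoothing_arcs (\<sigma> c)})"

definition A_adequate ::
    "'a topology \<Rightarrow> ('a set \<times> ('a \<Rightarrow> complex)) set \<Rightarrow> nat \<Rightarrow> (nat \<Rightarrow> real \<Rightarrow> 'a \<times> real) \<Rightarrow> bool"
  where
  "A_adequate X \<A> n L \<longleftrightarrow>
     (\<forall>U \<phi>. smoothing_charts X \<A> n L U \<phi> \<longrightarrow>
       (\<forall>c \<in> crossings n L.
          homological_defect X (state n L U \<phi> ((\<lambda>_. A_smoothing)(c := B_smoothing)))
          \<le> homological_defect X (state n L U \<phi> (\<lambda>_. A_smoothing))))"

definition B_adequate ::
    "'a topology \<Rightarrow> ('a set \<times> ('a \<Rightarrow> complex)) set \<Rightarrow> nat \<Rightarrow> (nat \<Rightarrow> real \<Rightarrow> 'a \<times> real) \<Rightarrow> bool"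
  where
  "B_adequate X \<A> n L \<longleftrightarrow>
     (\<forall>U \<phi>. smoothing_charts X \<A> n L U \<phi> \<longrightarrow>
       (\<forall>c \<in> crossings n L.
          homological_defect X (state n L U \<phi> ((\<lambda>_. B_smoothing)(c := A_smoothing)))
          \<le> homological_defect X (state n L U \<phi> (\<lambda>_. B_smoothing))))"

definition adequate ::
    "'a topology \<Rightarrow> ('a set \<times> ('a \<Rightarrow> complex)) set \<Rightarrow> nat \<Rightarrow> (nat \<Rightarrow> real \<Rightarrow> 'a \<times> real) \<Rightarrow> bool"
  where
  "adequate X \<A> n L \<longleftrightarrow> A_adequate X \<A> n L \<and> B_adequate X \<A> n L"


section \<open>The definitions are well posed\<close>

subsection \<open>\<open>H\<^sub>p(X; \<int>/2)\<close> is an abelian group of exponent 2, and induced maps act on representatives\<close>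

lemma frag_cmul_uminus2: "frag_cmul k (- b) = frag_cmul (- k) b"
  using frag_cmul_cmul[of k "-1" b] by simp

lemma mod2_boundaries_cycles: "mod2_boundaries p X \<subseteq> mod2_cycles p X"
proof
  fix c assume "c \<in> mod2_boundaries p X"
  then obtain d e where c: "c = chain_boundary (Suc p) d + frag_cmul 2 e"
    and d: "singular_chain (Suc p) X d" and e: "singular_chain p X e"
    by (auto simp: mod2_boundaries_def)
  have "singular_chain p X c"
    using singular_chain_boundary[OF d] singular_chain_cmul[OF e]
    by (simp add: c singular_chain_add)
  moreover have "chain_boundary p c = frag_cmul 2 (chain_boundary p e)"
    using chain_boundary_boundary_alt[OF d]
    by (simp add: c chain_boundary_add chain_boundary_cmul)
  ultimately show "c \<in> mod2_cycles p X" by (auto simp: mod2_cycles_def)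
qed

lemma subgroup_mod2_cycles: "subgroup (mod2_cycles p X) (chain_group p X)"
proof (rule group.subgroupI)
  show "group (chain_group p X)" by simp
  show "mod2_cycles p X \<subseteq> carrier (chain_group p X)" by (auto simp: mod2_cycles_def)
  have "0 \<in> mod2_cycles p X" by (auto simp: mod2_cycles_def intro: exI[of _ 0])
  then show "mod2_cycles p X \<noteq> {}" by blast
  fix a assume a: "a \<in> mod2_cycles p X"
  then obtain b where b: "chain_boundary p a = frag_cmul 2 b" by (auto simp: mod2_cycles_def)
  have "chain_boundary p (-a) = frag_cmul 2 (-b)" by (simp add: chain_boundary_minus b frag_cmul_uminus2)
  then show "inv\<^bsub>chain_group p X\<^esub> a \<in> mod2_cycles p X"
    using a by (auto simp: mod2_cycles_def singular_chain_minus chain_group_def singular_chain_def)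
  fix a' assume a': "a' \<in> mod2_cycles p X"
  then obtain b' where b': "chain_boundary p a' = frag_cmul 2 b'" by (auto simp: mod2_cycles_def)
  have "chain_boundary p (a+a') = frag_cmul 2 (b+b')"
    by (simp add: chain_boundary_add b b' frag_cmul_distrib2)
  then show "a \<otimes>\<^bsub>chain_group p X\<^esub> a' \<in> mod2_cycles p X"
    using a a' by (auto simp: mod2_cycles_def singular_chain_add)
qed

lemma subgroup_mod2_boundaries: "subgroup (mod2_boundaries p X) (chain_group p X)"
proof (rule group.subgroupI)
  show "group (chain_group p X)" by simp
  show "mod2_boundaries p X \<subseteq> carrier (chain_group p X)"
    using mod2_boundaries_cycles[of p X] by (auto simp: mod2_cycles_def)
  have "0 \<in> mod2_boundaries p X"
    unfolding mod2_boundaries_def by (rule CollectI, intro exI[of _ 0]) auto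
  then show "mod2_boundaries p X \<noteq> {}" by blast
  fix a assume a: "a \<in> mod2_boundaries p X"
  then obtain d e where c: "a = chain_boundary (Suc p) d + frag_cmul 2 e"
    and d: "singular_chain (Suc p) X d" and e: "singular_chain p X e"
    by (auto simp: mod2_boundaries_def)
  have "-a = chain_boundary (Suc p) (-d) + frag_cmul 2 (-e)" by (simp add: c chain_boundary_minus frag_cmul_uminus2)
  then have "-a \<in> mod2_boundaries p X"
    using d e unfolding mod2_boundaries_def
    by (metis (mono_tags, lifting) mem_Collect_eq singular_chain_minus)
  moreover have "singular_chain p X a" using a mod2_boundaries_cycles[of p X] by (auto simp: mod2_cycles_def)
  ultimately show "inv\<^bsub>chain_group p X\<^esub> a \<in> mod2_boundaries p X"
    by (auto simp: chain_group_def singular_chain_def)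
  fix a' assume a': "a' \<in> mod2_boundaries p X"
  then obtain d' e' where c': "a' = chain_boundary (Suc p) d' + frag_cmul 2 e'"
    and d': "singular_chain (Suc p) X d'" and e': "singular_chain p X e'"
    by (auto simp: mod2_boundaries_def)
  have "a + a' = chain_boundary (Suc p) (d+d') + frag_cmul 2 (e+e')"
    by (simp add: c c' chain_boundary_add frag_cmul_distrib2)
  then show "a \<otimes>\<^bsub>chain_group p X\<^esub> a' \<in> mod2_boundaries p X"
    using singular_chain_add[OF d d'] singular_chain_add[OF e e'] unfolding mod2_boundaries_def
    by auto
qed

lemma comm_group_mod2: "comm_group (mod2_homology_group p X)"
proof -
  interpret C: comm_group "subgroup_generated (chain_group p X) (mod2_cycles p X)"
    by (rule group.abelian_subgroup_generated) (simp_all add: chain_group_def abelian_free_Abelian_group)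
  have "subgroup (mod2_boundaries p X) (subgroup_generated (chain_group p X) (mod2_cycles p X))"
    by (simp add: group.subgroup_of_subgroup_generated mod2_boundaries_cycles subgroup_mod2_boundaries)
  then show ?thesis
    unfolding mod2_homology_group_def by (rule C.abelian_FactGroup)
qed

lemma carrier_mod2: "carrier (mod2_homology_group p X) =
   (\<lambda>c. (\<lambda>b. b + c) ` mod2_boundaries p X) ` mod2_cycles p X"
proof -
  have "carrier (subgroup_generated (chain_group p X) (mod2_cycles p X)) = mod2_cycles p X"
    by (simp add: subgroup.carrier_subgroup_generated_subgroup subgroup_mod2_cycles)
  then show ?thesis
    by (auto simp: mod2_homology_group_def FactGroup_def RCOSETS_def r_coset_def)
qed

lemma set_mult_mod2: "K <#>\<^bsub>chain_group p X\<^esub> K' = {a + b | a b. a \<in> K \<and> b \<in> K'}"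
  by (auto simp: set_mult_def)

lemma mod2_add: "a \<in> mod2_boundaries p X \<Longrightarrow> b \<in> mod2_boundaries p X \<Longrightarrow> a + b \<in> mod2_boundaries p X"
  using subgroup.m_closed[OF subgroup_mod2_boundaries] by fastforce

lemma mod2_zero: "0 \<in> mod2_boundaries p X"
  using subgroup.one_closed[OF subgroup_mod2_boundaries[of p X]] by simp

lemma mod2_boundaries_image:
  assumes "continuous_map X Y f" "c \<in> mod2_boundaries p X"
  shows "chain_map p f c \<in> mod2_boundaries p Y"
proof -
  obtain d e where c: "c = chain_boundary (Suc p) d + frag_cmul 2 e"
    and d: "singular_chain (Suc p) X d" and e: "singular_chain p X e"
    using assms by (auto simp: mod2_boundaries_def)
  have "chain_map p f c = chain_boundary (Suc p) (chain_map (Suc p) f d) + frag_cmul 2 (chain_map p f e)"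
    using chain_boundary_chain_map[OF d, of f]
    by (simp add: c chain_map_add chain_map_cmul)
  then show ?thesis using singular_chain_chain_map[OF d assms(1)] singular_chain_chain_map[OF e assms(1)]
    unfolding mod2_boundaries_def by blast
qed

lemma mod2_hom_coset:
  assumes "continuous_map X Y f"
  shows "mod2_hom_induced p Y f ((\<lambda>b. b + c) ` mod2_boundaries p X) = (\<lambda>b. b + chain_map p f c) ` mod2_boundaries p Y"
proof (rule Set.set_eqI, rule iffI)
  fix x assume "x \<in> mod2_hom_induced p Y f ((\<lambda>b. b + c) ` mod2_boundaries p X)"
  then obtain a b where "a \<in> mod2_boundaries p Y" "b \<in> mod2_boundaries p X" "x = a + chain_map p f (b + c)"
    unfolding mod2_hom_induced_def set_mult_mod2 by blast
  then show "x \<in> (\<lambda>b. b + chain_map p f c) ` mod2_boundaries p Y"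
    using mod2_boundaries_image[OF assms]
    by (intro image_eqI[of _ _ "a + chain_map p f b"]) (auto simp: chain_map_add mod2_add add.assoc)
next
  fix x assume "x \<in> (\<lambda>b. b + chain_map p f c) ` mod2_boundaries p Y"
  then obtain a where "a \<in> mod2_boundaries p Y" "x = a + chain_map p f (0 + c)" by auto
  then show "x \<in> mod2_hom_induced p Y f ((\<lambda>b. b + c) ` mod2_boundaries p X)"
    unfolding mod2_hom_induced_def set_mult_mod2 using mod2_zero by blast
qed

lemma mod2_order2: "K \<in> carrier (mod2_homology_group p X) \<Longrightarrow>
   K \<otimes>\<^bsub>mod2_homology_group p X\<^esub> K = \<one>\<^bsub>mod2_homology_group p X\<^esub>"
proof -
  interpret comm_group "mod2_homology_group p X" by (rule comm_group_mod2)
  assume K: "K \<in> carrier (mod2_homology_group p X)"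
  then obtain c where c: "c \<in> mod2_cycles p X" "K = (\<lambda>b. b + c) ` mod2_boundaries p X"
    by (auto simp: carrier_mod2)
  have one: "\<one>\<^bsub>mod2_homology_group p X\<^esub> = mod2_boundaries p X"
    by (simp add: mod2_homology_group_def FactGroup_def)
  have cc: "c + c \<in> mod2_boundaries p X"
  proof -
    have "c + c = chain_boundary (Suc p) 0 + frag_cmul 2 c"
      using frag_cmul_distrib[of 1 1 c] by simp
    then show ?thesis using c unfolding mod2_boundaries_def mod2_cycles_def
      by (metis (mono_tags, lifting) mem_Collect_eq singular_chain_0)
  qed
  have m: "K \<otimes>\<^bsub>mod2_homology_group p X\<^esub> K = {a + b | a b. a \<in> K \<and> b \<in> K}"
    by (auto simp: mod2_homology_group_def FactGroup_def set_mult_def)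
  have "K \<otimes>\<^bsub>mod2_homology_group p X\<^esub> K \<subseteq> mod2_boundaries p X"
  proof
    fix x assume "x \<in> K \<otimes>\<^bsub>mod2_homology_group p X\<^esub> K"
    then obtain a b where "a \<in> mod2_boundaries p X" "b \<in> mod2_boundaries p X" "x = (a + b) + (c + c)"
      unfolding m unfolding c(2) by (auto simp: add.assoc add.left_commute)
    then show "x \<in> mod2_boundaries p X" using mod2_add cc by blast
  qed
  moreover obtain c' where c': "K \<otimes>\<^bsub>mod2_homology_group p X\<^esub> K = (\<lambda>b. b + c') ` mod2_boundaries p X"
    using m_closed[OF K K] by (auto simp: carrier_mod2)
  moreover have "c' \<in> (\<lambda>b. b + c') ` mod2_boundaries p X"
    using mod2_zero by force
  ultimately have c'b: "c' \<in> mod2_boundaries p X" by auto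
  have "(\<lambda>b. b + c') ` mod2_boundaries p X = mod2_boundaries p X"
  proof
    show "(\<lambda>b. b + c') ` mod2_boundaries p X \<subseteq> mod2_boundaries p X" using c'b mod2_add by auto
    show "mod2_boundaries p X \<subseteq> (\<lambda>b. b + c') ` mod2_boundaries p X"
    proof
      fix b assume b: "b \<in> mod2_boundaries p X"
      have "c' \<in> carrier (chain_group p X)" using c'b mod2_boundaries_cycles by (auto simp: mod2_cycles_def)
      then have "inv\<^bsub>chain_group p X\<^esub> c' = - c'"
        by (auto simp: chain_group_def singular_chain_def)
      then have "- c' \<in> mod2_boundaries p X"
        using subgroup.m_inv_closed[OF subgroup_mod2_boundaries c'b] by simp
      then have "b + - c' \<in> mod2_boundaries p X" using b mod2_add by blast
      then show "b \<in> (\<lambda>b. b + c') ` mod2_boundaries p X" by force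
    qed
  qed
  then show ?thesis using c' one by simp
qed


subsection \<open>Every link diagram has smoothing charts\<close>

lemma winding_scale:
  assumes "path p" "pathfinish p = pathstart p" "w \<notin> path_image p" "k > (0::real)"
  shows "winding_number (\<lambda>t. of_real k * p t) (of_real k * w) = winding_number p w"
proof -
  have "winding_number (\<lambda>t. of_real k * p t) (of_real k * w) = winding_number (\<lambda>t. of_real k * (p t - w)) 0"
    by (subst winding_number_offset) (simp add: algebra_simps)
  also have "\<dots> = winding_number (\<lambda>t. p t - w) 0"
  proof (rule winding_number_loops_linear_eq)
    show "path (\<lambda>t. p t - w)" "path (\<lambda>t. of_real k * (p t - w))"
      using assms(1) by (auto simp: path_def intro!: continuous_intros)
    show "pathfinish (\<lambda>t. p t - w) = pathstart (\<lambda>t. p t - w)"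
      "pathfinish (\<lambda>t. of_real k * (p t - w)) = pathstart (\<lambda>t. of_real k * (p t - w))"
      using assms(2) by (auto simp: pathfinish_def pathstart_def)
    fix t :: real assume t: "t \<in> {0..1}"
    show "0 \<notin> closed_segment (p t - w) (of_real k * (p t - w))"
    proof
      assume "0 \<in> closed_segment (p t - w) (of_real k * (p t - w))"
      then obtain u where u: "0 \<le> u" "u \<le> 1"
        "0 = (1-u) *\<^sub>R (p t - w) + u *\<^sub>R (of_real k * (p t - w))"
        by (auto simp: closed_segment_def)
      have "0 = complex_of_real (1 - u + u*k) * (p t - w)"
        using u(3) by (simp add: scaleR_conv_of_real algebra_simps)
      moreover have "p t \<noteq> w" using assms(3) t by (auto simp: path_image_def)
      ultimately have "1 - u + u*k = 0" by (metis mult_eq_0_iff of_real_eq_0_iff right_minus_eq)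
      moreover have "1 - u + u*k > 0"
        using u(1,2) assms(4) by (cases "u = 1") (auto simp: add_pos_nonneg)
      ultimately show False by simp
    qed
  qed
  also have "\<dots> = winding_number p w" by (metis winding_number_offset)
  finally show ?thesis .
qed

lemma chart_facts:
  assumes "chart X U \<phi>"
  shows "inj_on \<phi> U" "U \<subseteq> topspace X" "continuous_map (subtopology X U) euclidean \<phi>"
    "\<And>W. openin X W \<Longrightarrow> W \<subseteq> U \<Longrightarrow> open (\<phi> ` W)"
    "continuous_map (top_of_set (\<phi> ` U)) (subtopology X U) (inv_into U \<phi>)"
proof -
  have U: "openin X U" "open (\<phi> ` U)" and h: "homeomorphic_map (subtopology X U) (top_of_set (\<phi> ` U)) \<phi>"
    using assms by (auto simp: chart_def)
  show sub: "U \<subseteq> topspace X" using U openin_subset by blast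
  have ts: "topspace (subtopology X U) = U" using sub by (simp add: Int_absorb1)
  show inj: "inj_on \<phi> U" using h ts unfolding homeomorphic_map_def by metis
  show "continuous_map (subtopology X U) euclidean \<phi>"
    using homeomorphic_imp_continuous_map[OF h] continuous_map_into_fulltopology by blast
  show "open (\<phi> ` W)" if "openin X W" "W \<subseteq> U" for W
  proof -
    have "openin (subtopology X U) W" using that by (auto simp: openin_subtopology intro!: exI[of _ W])
    then have "openin (top_of_set (\<phi> ` U)) (\<phi> ` W)"
      using homeomorphic_imp_open_map[OF h] unfolding open_map_def by blast
    then show ?thesis using U(2) openin_open_trans by blast
  qed
  obtain g where g: "homeomorphic_maps (subtopology X U) (top_of_set (\<phi> ` U)) \<phi> g"
    using h homeomorphic_map_maps by blast
  then have gc: "continuous_map (top_of_set (\<phi> ` U)) (subtopology X U) g"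
    and gi: "\<And>x. x \<in> U \<Longrightarrow> g (\<phi> x) = x"
    using ts unfolding homeomorphic_maps_def by auto
  show "continuous_map (top_of_set (\<phi> ` U)) (subtopology X U) (inv_into U \<phi>)"
  proof (rule continuous_map_eq[OF gc])
    fix y assume "y \<in> topspace (top_of_set (\<phi> ` U))"
    then obtain x where "x \<in> U" "y = \<phi> x" by auto
    then show "g y = inv_into U \<phi> y" using gi inj by simp
  qed
qed

lemma shrink_oriented_chart:
  assumes surf: "\<And>V \<psi>. (V,\<psi>) \<in> \<A> \<Longrightarrow> chart X V \<psi>"
    and oc: "oriented_chart X \<A> U \<phi>" and W: "openin X W" "W \<subseteq> U" and k: "(k::real) > 0"
  shows "oriented_chart X \<A> W (\<lambda>p. of_real k * \<phi> p)"
proof -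
  have ch: "chart X U \<phi>" using oc by (simp add: oriented_chart_def)
  note cf = chart_facts[OF ch]
  let ?f = "\<lambda>p. of_real k * \<phi> p"
  have ts: "topspace (subtopology X W) = W" using W cf(2) by auto
  have "open ((\<lambda>z. of_real k * z) ` (\<phi> ` W))"
  proof -
    have "(\<lambda>z. of_real k * z) ` (\<phi> ` W) = (\<lambda>z. k *\<^sub>R z) ` (\<phi> ` W)"
      by (simp add: scaleR_conv_of_real)
    then show ?thesis using open_scaling[of k "\<phi> ` W"] cf(4)[OF W] k by simp
  qed
  then have op: "open (?f ` W)" by (simp add: image_image)
  have h1: "homeomorphic_map (subtopology X W) (top_of_set (\<phi> ` W)) \<phi>"
  proof -
    have "homeomorphic_map (subtopology (subtopology X U) W) (subtopology (top_of_set (\<phi> ` U)) (\<phi> ` W)) \<phi>"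
    proof (rule homeomorphic_map_subtopologies)
      show "homeomorphic_map (subtopology X U) (top_of_set (\<phi> ` U)) \<phi>" using ch by (simp add: chart_def)
      show "\<phi> ` (topspace (subtopology X U) \<inter> W) = topspace (top_of_set (\<phi> ` U)) \<inter> \<phi> ` W"
        using W cf(2) by auto
    qed
    then show ?thesis using W by (simp add: subtopology_subtopology Int_absorb1 Int_absorb2 image_mono)
  qed
  have h2: "homeomorphic_map (top_of_set (\<phi> ` W)) (top_of_set (?f ` W)) (\<lambda>z. of_real k * z)"
    unfolding homeomorphic_map_maps homeomorphic_maps_def
    using k by (intro exI[of _ "\<lambda>z. z / of_real k"])
       (auto intro!: continuous_intros)
  have "chart X W ?f"
    unfolding chart_def using W op homeomorphic_map_compose[OF h1 h2] by (simp add: o_def)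
  moreover have "orientation_compatible V \<psi> W ?f" if "(V,\<psi>) \<in> \<A>" for V \<psi>
    unfolding orientation_compatible_def
  proof (intro ballI allI impI)
    fix p r assume p: "p \<in> V \<inter> W" and r: "(0::real) < r" and cb: "cball (\<psi> p) r \<subseteq> \<psi> ` (V \<inter> W)"
    have cV: "chart X V \<psi>" using surf that by blast
    note vf = chart_facts[OF cV]
    have cb': "cball (\<psi> p) r \<subseteq> \<psi> ` (V \<inter> U)" using cb W by blast
    let ?g = "\<phi> \<circ> inv_into V \<psi> \<circ> circlepath (\<psi> p) r"
    have w1: "winding_number ?g (\<phi> p) = 1"
      using oc that p r cb' W unfolding oriented_chart_def orientation_compatible_def by blast
    have pic: "path_image (circlepath (\<psi> p) r) \<subseteq> \<psi> ` (V \<inter> U)"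
      using cb' r sphere_cball by (auto simp: path_image_circlepath)
    have "continuous_map (top_of_set (\<psi> ` (V \<inter> U))) (subtopology X (V \<inter> U)) (inv_into V \<psi>)"
    proof -
      have "continuous_map (top_of_set (\<psi> ` (V \<inter> U))) X (inv_into V \<psi>)"
        using vf(5) by (metis continuous_map_from_subtopology_mono continuous_map_into_fulltopology image_mono inf_le1)
      moreover have "inv_into V \<psi> ` (\<psi> ` (V \<inter> U)) \<subseteq> V \<inter> U" using vf(1) by auto
      ultimately show ?thesis by (auto simp: continuous_map_in_subtopology)
    qed
    moreover have "continuous_map (subtopology X (V \<inter> U)) euclidean \<phi>"
      using cf(3) by (meson continuous_map_from_subtopology_mono inf_le2)
    ultimately have "continuous_map (top_of_set (\<psi> ` (V \<inter> U))) euclidean (\<phi> \<circ> inv_into V \<psi>)"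
      using continuous_map_compose by blast
    then have co: "continuous_on (\<psi> ` (V \<inter> U)) (\<phi> \<circ> inv_into V \<psi>)" by simp
    have pg: "path ?g"
      by (metis co continuous_on_subset path_circlepath path_continuous_image pic)
    have "winding_number (\<lambda>t. of_real k * ?g t) (of_real k * \<phi> p) = winding_number ?g (\<phi> p)"
    proof (rule winding_scale[OF pg _ _ k])
      show "pathfinish ?g = pathstart ?g"
        by (simp add: pathfinish_compose pathstart_compose)
      show "\<phi> p \<notin> path_image ?g"
      proof
        assume "\<phi> p \<in> path_image ?g"
        then obtain z where z: "z \<in> sphere (\<psi> p) r" "\<phi> p = \<phi> (inv_into V \<psi> z)"
          using r by (auto simp: path_image_compose path_image_circlepath)
        then have "z \<in> \<psi> ` (V \<inter> U)" using cb' by auto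
        then obtain q where q: "q \<in> V \<inter> U" "z = \<psi> q" by auto
        then have "\<phi> p = \<phi> q" using z vf(1) by auto
        then have "p = q" using cf(1) q p W by (auto dest: inj_onD)
        then show False using z q r by auto
      qed
    qed
    then show "winding_number ((\<lambda>p. of_real k * \<phi> p) \<circ> inv_into V \<psi> \<circ> circlepath (\<psi> p) r) (of_real k * \<phi> p) = 1"
      using w1 by (simp add: o_def)
  qed
  ultimately show ?thesis by (auto simp: oriented_chart_def)
qed

lemma smoothing_charts_exist:
  assumes S: "closed_connected_oriented_surface X \<A>" and D: "link_diagram X \<A> n L"
  shows "\<exists>U \<phi>. smoothing_charts X \<A> n L U \<phi>"
proof -
  let ?C = "crossings n L"
  have fin: "finite ?C" and Hd: "Hausdorff_space X"
    using S D by (auto simp: closed_connected_oriented_surface_def link_diagram_def)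
  have surf: "\<And>V \<psi>. (V,\<psi>) \<in> \<A> \<Longrightarrow> chart X V \<psi>"
    using S by (auto simp: closed_connected_oriented_surface_def)
  have ex: "\<exists>U \<phi>. crossing_chart X \<A> n L c U \<phi>" if "c \<in> ?C" for c
  proof -
    have c2: "card (strands_at n L c) = 2" using that by (simp add: crossings_def)
    then have "strands_at n L c \<noteq> {}" by auto
    then have "c \<in> projection n L" by (auto simp: strands_at_def projection_def)
    then show ?thesis using D c2 unfolding link_diagram_def by force
  qed
  have Csub: "c \<in> topspace X" if "c \<in> ?C" for c
  proof -
    obtain U \<phi> where "chart X U \<phi>" "c \<in> U"
      using ex[OF \<open>c \<in> ?C\<close>] unfolding crossing_chart_def oriented_chart_def by metis
    then show ?thesis using chart_facts(2) by (metis subsetD)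
  qed
  have "\<forall>c d. \<exists>P Q. c \<in> ?C \<and> d \<in> ?C \<and> c \<noteq> d \<longrightarrow> openin X P \<and> openin X Q \<and> c \<in> P \<and> d \<in> Q \<and> disjnt P Q"
    using Hd Csub unfolding Hausdorff_space_def by meson
  then obtain P Q where PQ: "\<And>c d. c \<in> ?C \<Longrightarrow> d \<in> ?C \<Longrightarrow> c \<noteq> d \<Longrightarrow>
      openin X (P c d) \<and> openin X (Q c d) \<and> c \<in> P c d \<and> d \<in> Q c d \<and> disjnt (P c d) (Q c d)"
    by metis
  define N where "N c = topspace X \<inter> \<Inter>((\<lambda>d. P c d \<inter> Q d c) ` (?C - {c}))" for c
  have N: "openin X (N c)" "c \<in> N c" if "c \<in> ?C" for c
  proof -
    show "c \<in> N c" using PQ Csub that unfolding N_def by auto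
    show "openin X (N c)"
    proof (cases "?C - {c} = {}")
      case True then show ?thesis unfolding N_def by (simp only: True) simp
    next
      case False
      have "openin X (\<Inter>((\<lambda>d. P c d \<inter> Q d c) ` (?C - {c})))"
        using False fin PQ that by (intro openin_Inter) (auto intro!: openin_Int)
      then show ?thesis unfolding N_def by (intro openin_Int) auto
    qed
  qed
  have Ndisj: "N c \<inter> N d = {}" if "c \<in> ?C" "d \<in> ?C" "c \<noteq> d" for c d
  proof -
    have "N c \<subseteq> P c d" "N d \<subseteq> Q c d" using that by (auto simp: N_def)
    then show ?thesis using PQ[OF that] by (auto simp: disjnt_iff)
  qed
  have "\<exists>W \<psi>. crossing_chart X \<A> n L c W \<psi> \<and> W \<subseteq> N c" if c: "c \<in> ?C" for c
  proof -
    obtain U \<phi> where cc: "crossing_chart X \<A> n L c U \<phi>" using ex[OF c] by blast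
    have oc: "oriented_chart X \<A> U \<phi>" and cU: "c \<in> U" "\<phi> c = 0" "\<phi> ` U = ball 0 2"
      and im: "\<phi> ` (projection n L \<inter> U) = {z \<in> ball 0 2. Im z = 0 \<or> Re z = 0}"
      and st: "\<And>i t. i < n \<Longrightarrow> fst (L i t) = c \<Longrightarrow>
        (passes_over n L i t \<longrightarrow> (\<forall>\<^sub>F s in nhds t. Im (\<phi> (fst (L i s))) = 0)) \<and>
        (passes_under n L i t \<longrightarrow> (\<forall>\<^sub>F s in nhds t. Re (\<phi> (fst (L i s))) = 0))"
      using cc by (auto simp: crossing_chart_def)
    have ch: "chart X U \<phi>" using oc by (simp add: oriented_chart_def)
    note cf = chart_facts[OF ch]
    have oU: "openin X U" using ch by (simp add: chart_def)
    have "open (\<phi> ` (U \<inter> N c))" using cf(4) oU N(1)[OF c] by auto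
    moreover have "0 \<in> \<phi> ` (U \<inter> N c)" using cU N(2)[OF c] by (metis IntI image_eqI)
    ultimately obtain r where r: "r > 0" "ball 0 r \<subseteq> \<phi> ` (U \<inter> N c)"
      using open_contains_ball by metis
    define W where "W = {p \<in> U. \<phi> p \<in> ball 0 r}"
    have WN: "W \<subseteq> U \<inter> N c"
    proof
      fix p assume "p \<in> W"
      then have "p \<in> U" "\<phi> p \<in> \<phi> ` (U \<inter> N c)" using r by (auto simp: W_def)
      then show "p \<in> U \<inter> N c" using cf(1) by (metis IntE imageE inj_onD)
    qed
    have oW: "openin X W"
    proof -
      have "openin (subtopology X U) {p \<in> topspace (subtopology X U). \<phi> p \<in> ball 0 r}"
        using cf(3) open_ball by (intro openin_continuous_map_preimage) auto
      moreover have "{p \<in> topspace (subtopology X U). \<phi> p \<in> ball 0 r} = W"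
        using cf(2) by (auto simp: W_def)
      ultimately show ?thesis using oU openin_trans_full by metis
    qed
    define k where "k = 2 / r"
    have k: "k > 0" "k * r = 2" using r by (auto simp: k_def)
    let ?f = "\<lambda>p. of_real k * \<phi> p"
    have rsub: "ball 0 r \<subseteq> ball (0::complex) 2" using r(2) cU(3) by auto
    have imW: "\<phi> ` W = ball 0 r" unfolding W_def using rsub unfolding cU(3)[symmetric] by auto
    have imWD: "\<phi> ` (projection n L \<inter> W) = {z \<in> ball 0 r. Im z = 0 \<or> Re z = 0}"
    proof -
      have "\<phi> ` (projection n L \<inter> W) = \<phi> ` (projection n L \<inter> U) \<inter> ball 0 r"
        unfolding W_def by auto
      then show ?thesis using im rsub by auto
    qed
    have sc: "z \<in> (\<lambda>z. of_real k * z) ` Z \<longleftrightarrow> z / of_real k \<in> Z" for z :: complex and Z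
    proof
      assume "z / of_real k \<in> Z" then show "z \<in> (\<lambda>z. of_real k * z) ` Z"
        using k by (intro image_eqI[of _ _ "z / of_real k"]) auto
    qed (use k in auto)
    have nb: "cmod z / k < r \<longleftrightarrow> cmod z < 2" for z
      using k by (simp add: divide_simps mult.commute)
    have "?f ` W = (\<lambda>z. of_real k * z) ` (\<phi> ` W)" by (simp add: image_image)
    also have "\<dots> = ball 0 2" unfolding imW
    proof (rule Set.set_eqI)
      fix z :: complex show "z \<in> (\<lambda>z. of_real k * z) ` ball 0 r \<longleftrightarrow> z \<in> ball 0 2"
        unfolding sc using k nb by (simp add: norm_divide)
    qed
    finally have i1: "?f ` W = ball 0 2" .
    have "?f ` (projection n L \<inter> W) = (\<lambda>z. of_real k * z) ` (\<phi> ` (projection n L \<inter> W))" by (simp add: image_image)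
    also have "\<dots> = {z \<in> ball 0 2. Im z = 0 \<or> Re z = 0}"
      unfolding imWD
    proof (rule Set.set_eqI)
      fix z :: complex
      have "z / of_real k \<in> {z \<in> ball 0 r. Im z = 0 \<or> Re z = 0} \<longleftrightarrow> z \<in> {z \<in> ball 0 2. Im z = 0 \<or> Re z = 0}"
        using k nb[of z] by (simp add: norm_divide)
      then show "z \<in> (\<lambda>z. of_real k * z) ` {z \<in> ball 0 r. Im z = 0 \<or> Re z = 0} \<longleftrightarrow> z \<in> {z \<in> ball 0 2. Im z = 0 \<or> Re z = 0}"
        unfolding sc .
    qed
    finally have i2: "?f ` (projection n L \<inter> W) = {z \<in> ball 0 2. Im z = 0 \<or> Re z = 0}" .
    have "crossing_chart X \<A> n L c W ?f"
      unfolding crossing_chart_def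
    proof (intro conjI allI impI)
      show "oriented_chart X \<A> W ?f" using shrink_oriented_chart[OF surf oc oW _ k(1)] WN by blast
      show "c \<in> W" using cU r by (simp add: W_def)
      show "of_real k * \<phi> c = 0" using cU by simp
      show "?f ` W = ball 0 2" by (rule i1)
      show "?f ` (projection n L \<inter> W) = {z \<in> ball 0 2. Im z = 0 \<or> Re z = 0}" by (rule i2)
      show "\<forall>\<^sub>F s in nhds t. Im (of_real k * \<phi> (fst (L i s))) = 0"
        if "i < n" "fst (L i t) = c" "passes_over n L i t" for i t
        using st[OF that(1,2)] that(3) by simp
      show "\<forall>\<^sub>F s in nhds t. Re (of_real k * \<phi> (fst (L i s))) = 0"
        if "i < n" "fst (L i t) = c" "passes_under n L i t" for i t
        using st[OF that(1,2)] that(3) by simp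
    qed
    then show ?thesis using WN by blast
  qed
  then obtain W \<psi> where W: "\<And>c. c \<in> ?C \<Longrightarrow> crossing_chart X \<A> n L c (W c) (\<psi> c) \<and> W c \<subseteq> N c"
    by metis
  have "disjoint_family_on W ?C"
    unfolding disjoint_family_on_def using W Ndisj by blast
  then show ?thesis using W unfolding smoothing_charts_def by blast
qed


end

theory Submission
  imports Defs
begin

text \<open>
  Direct every strand from its overcrossing to its undercrossing. Because the diagram alternates, one
  side of the strands is the same side throughout: the all-\<open>A\<close> state can be pushed off the diagram to
  this black side, and since the faces are discs, all its cycles bound in the surface. Switching the
  smoothing at \<open>c\<close> replaces two arcs of the state. A null-homologous cycle of the new state that runs
  over just one of the new arcs could be pushed into the two black corners at \<open>c\<close>; these would then
  lie in one face, and a loop through \<open>c\<close> inside this face would be null-homologous modulo 2, hence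
  separate the surface, and \<open>c\<close> would be nugatory. So null-homologous cycles run over both new arcs or
  over neither, and exchanging these arcs for the old ones embeds the kernel for the new state into
  that for the old one.

  A closed curve \<open>K\<close> bounding a chain \<open>w\<close> separates because a point \<open>p\<close> near \<open>K\<close> can be joined off \<open>K\<close>
  only to points \<open>q\<close> on its own side: the property that \<open>K\<close> still bounds in the complement of
  \<open>{p, q}\<close> is locally constant in \<open>q\<close>, but fails for a point \<open>q\<close> just across \<open>K\<close>, since the part of \<open>w\<close>
  near \<open>K\<close> covers exactly one of the two sides.
\<close>

text \<open>The charts are merely topological, so sides, pushing and crossing a curve must be given
  a meaning without derivatives. A side is pinned down by the winding number in the definition of an
  oriented chart. Pushing needs just one path for every single point, with no continuity from point
  to point, because after subdivision only the ends of small simplices are moved. Crossing a curve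
  is read off from the parities of winding around two points beside it. The kernels are never
  computed. The two states share a subspace \<open>core\<close>, the state without the two open arcs
  at the crossing; every cycle is a chain in \<open>core\<close> plus multiples of the two arcs, and
  only the parities of these multiples matter. As \<open>Z2_dim\<close> gives 0 for an infinite
  group, an injection between the kernels is not enough: finiteness has to pass from the kernel of
  the new state to that of the old one. The all-\<open>B\<close> state is treated together with the
  all-\<open>A\<close> state: the sign \<kappa> exchanges the two sides of the strands, and a unit
  \<omega> turns the crossing charts accordingly.\<close>

section \<open>Singular chains modulo 2\<close>

text \<open>Evaluation of an integral cochain \<open>F\<close> on a chain. Winding parities,
  coboundaries of functions and membership in a component are all expressed by it.\<close>

definition coeff_sum :: "('s \<Rightarrow> int) \<Rightarrow> ('s \<Rightarrow>\<^sub>0 int) \<Rightarrow> int" where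
  "coeff_sum F c = (\<Sum>\<sigma>\<in>Poly_Mapping.keys c. Poly_Mapping.lookup c \<sigma> * F \<sigma>)"

lemma coeff_sum_superset:
  assumes "finite A" "Poly_Mapping.keys c \<subseteq> A"
  shows "coeff_sum F c = (\<Sum>\<sigma>\<in>A. Poly_Mapping.lookup c \<sigma> * F \<sigma>)"
  unfolding coeff_sum_def using assms
  by (intro sum.mono_neutral_left) (auto simp: in_keys_iff)

lemma coeff_sum_0 [simp]: "coeff_sum F 0 = 0"
  by (simp add: coeff_sum_def)

lemma coeff_sum_add: "coeff_sum F (a + b) = coeff_sum F a + coeff_sum F b"
proof -
  let ?A = "Poly_Mapping.keys a \<union> Poly_Mapping.keys b"
  have "finite ?A" "Poly_Mapping.keys (a + b) \<subseteq> ?A" using keys_add[of a b] by auto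
  then show ?thesis
    using coeff_sum_superset[of ?A a F] coeff_sum_superset[of ?A b F] coeff_sum_superset[of ?A "a+b" F]
    by (simp add: lookup_add algebra_simps sum.distrib)
qed

lemma coeff_sum_cmul: "coeff_sum F (frag_cmul k c) = k * coeff_sum F c"
  using coeff_sum_superset[OF finite_keys keys_cmul, of F k c]
  by (simp add: coeff_sum_def sum_distrib_left mult.assoc)

lemma coeff_sum_minus: "coeff_sum F (- c) = - coeff_sum F c"
  using coeff_sum_cmul[of F "-1" c] by simp

lemma coeff_sum_diff: "coeff_sum F (a - b) = coeff_sum F a - coeff_sum F b"
  using coeff_sum_add[of F a "-b"] coeff_sum_minus[of F b] by simp

lemma coeff_sum_of [simp]: "coeff_sum F (frag_of \<sigma>) = F \<sigma>"
  by (simp add: coeff_sum_def)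

lemma coeff_sum_cong:
  assumes "\<And>\<sigma>. \<sigma> \<in> Poly_Mapping.keys c \<Longrightarrow> F \<sigma> = G \<sigma>" shows "coeff_sum F c = coeff_sum G c"
  using assms by (simp add: coeff_sum_def)

lemma coeff_sum_diff_fun: "coeff_sum (\<lambda>\<sigma>. F \<sigma> - G \<sigma>) c = coeff_sum F c - coeff_sum G c"
  by (simp add: coeff_sum_def algebra_simps sum_subtractf)

lemma coeff_sum_extend: "coeff_sum F (frag_extend b c) = coeff_sum (\<lambda>\<sigma>. coeff_sum F (b \<sigma>)) c"
  using subset_UNIV
  by (induction c rule: frag_induction) (auto simp: frag_extend_diff coeff_sum_diff)

text \<open>The coefficients are split into remainder and quotient modulo 2. A chain can thus be
  replaced modulo 2 by one in which only the simplices of odd coefficient occur; this keeps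
  simplices that cancel in pairs out of its support.\<close>

lemma odd_part:
  fixes c :: "'s \<Rightarrow>\<^sub>0 int"
  obtains c' e where "c = c' + frag_cmul 2 e" "Poly_Mapping.keys c' = {\<sigma>. odd (Poly_Mapping.lookup c \<sigma>)}"
    "Poly_Mapping.keys e \<subseteq> Poly_Mapping.keys c"
proof
  let ?c = "Poly_Mapping.map (\<lambda>k. k mod 2) c" and ?e = "Poly_Mapping.map (\<lambda>k. k div 2) c"
  show "c = ?c + frag_cmul 2 ?e"
    by (rule poly_mapping_eqI) (auto simp: lookup_add Poly_Mapping.map.rep_eq when_def)
  show "Poly_Mapping.keys ?c = {\<sigma>. odd (Poly_Mapping.lookup c \<sigma>)}"
    by (auto simp: in_keys_iff Poly_Mapping.map.rep_eq when_def odd_iff_mod_2_eq_one split: if_splits)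
  show "Poly_Mapping.keys ?e \<subseteq> Poly_Mapping.keys c"
    by (auto simp: in_keys_iff Poly_Mapping.map.rep_eq when_def)
qed

subsection \<open>Paths as singular 1-simplices\<close>

text \<open>The barycentric coordinate of index 1 serves as time, so face 0 is the end and face 1
  the start of the path. The restriction makes the map extensional, as is required of singular
  simplices.\<close>

definition path_simplex :: "(real \<Rightarrow> 'a) \<Rightarrow> (nat \<Rightarrow> real) \<Rightarrow> 'a" where
  "path_simplex g = restrict (\<lambda>x. g (x 1)) (standard_simplex 1)"

definition point_simplex :: "'a \<Rightarrow> (nat \<Rightarrow> real) \<Rightarrow> 'a" where
  "point_simplex a = restrict (\<lambda>_. a) (standard_simplex 0)"

definition edge_point :: "real \<Rightarrow> nat \<Rightarrow> real" where
  "edge_point t = (\<lambda>i. if i = 0 then 1 - t else if i = 1 then t else 0)"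

definition simplex_path :: "((nat \<Rightarrow> real) \<Rightarrow> 'a) \<Rightarrow> real \<Rightarrow> 'a" where
  "simplex_path \<sigma> t = \<sigma> (edge_point t)"

lemma edge_point_in: "edge_point t \<in> standard_simplex 1 \<longleftrightarrow> 0 \<le> t \<and> t \<le> 1"
proof -
  have "{..1::nat} = {0,1}" by auto
  then show ?thesis by (auto simp: standard_simplex_def edge_point_def)
qed

lemma edge_point_surj: "x \<in> standard_simplex 1 \<Longrightarrow> edge_point (x 1) = x"
proof -
  have "{..1::nat} = {0,1}" by auto
  then show "x \<in> standard_simplex 1 \<Longrightarrow> edge_point (x 1) = x" 
    by (auto simp: standard_simplex_def edge_point_def fun_eq_iff)
qed

lemma standard_simplex_1: "standard_simplex 1 = edge_point ` {0..1}"
proof (intro equalityI subsetI)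
  fix x assume x: "x \<in> standard_simplex 1"
  then have "x 1 \<in> {0..1}" by (simp add: standard_simplex_def)
  then show "x \<in> edge_point ` {0..1}" using edge_point_surj[OF x] by (metis image_eqI)
qed (auto simp: edge_point_in[unfolded One_nat_def])

lemma continuous_map_edge_point:
  "continuous_map (top_of_set {0..1}) (subtopology (powertop_real UNIV) (standard_simplex 1)) edge_point"
proof -
  have "continuous_map (top_of_set {0..1}) (powertop_real UNIV) edge_point"
    unfolding continuous_map_componentwise_UNIV
  proof
    fix k show "continuous_map (top_of_set {0..1}) euclideanreal (\<lambda>t. edge_point t k)"
      by (cases "k = 0"; cases "k = 1") (auto simp: edge_point_def intro!: continuous_intros)
  qed
  then show ?thesis by (auto simp: continuous_map_in_subtopology edge_point_in[unfolded One_nat_def])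
qed

lemma simplex_path_path_simplex: "t \<in> {0..1} \<Longrightarrow> simplex_path (path_simplex g) t = g t"
  by (simp add: simplex_path_def path_simplex_def edge_point_in[unfolded One_nat_def]) (simp add: edge_point_def)

lemma singular_simplex_path_simplex: "singular_simplex 1 X (path_simplex g) \<longleftrightarrow> pathin X g"
proof
  assume "singular_simplex 1 X (path_simplex g)"
  then have "continuous_map (top_of_set {0..1}) X (path_simplex g \<circ> edge_point)"
    unfolding singular_simplex_def using continuous_map_compose continuous_map_edge_point by blast
  then show "pathin X g" unfolding pathin_def
    by (rule continuous_map_eq) (use simplex_path_path_simplex in \<open>auto simp: simplex_path_def\<close>)
next
  assume g: "pathin X g"
  have "continuous_map (subtopology (powertop_real UNIV) (standard_simplex 1)) (top_of_set {0..1}) (\<lambda>x. x 1)"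
    using continuous_map_from_subtopology[OF continuous_map_product_projection[of 1 UNIV "\<lambda>_. euclideanreal"], of "standard_simplex 1"]
    by (simp add: continuous_map_in_subtopology) (auto simp: standard_simplex_def)
  then have "continuous_map (subtopology (powertop_real UNIV) (standard_simplex 1)) X (g \<circ> (\<lambda>x. x 1))"
    using g unfolding pathin_def by (rule continuous_map_compose)
  then have "continuous_map (subtopology (powertop_real UNIV) (standard_simplex 1)) X (path_simplex g)"
    by (rule continuous_map_eq) (auto simp: path_simplex_def)
  then show "singular_simplex 1 X (path_simplex g)"
    by (simp add: singular_simplex_def) (simp add: path_simplex_def)
qed

lemma pathin_simplex_path:
  assumes "singular_simplex 1 X \<sigma>"
  shows "pathin X (simplex_path \<sigma>)" "path_simplex (simplex_path \<sigma>) = \<sigma>"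
proof -
  show "path_simplex (simplex_path \<sigma>) = \<sigma>"
  proof
    fix x show "path_simplex (simplex_path \<sigma>) x = \<sigma> x"
      using assms edge_point_surj[of x]
      by (cases "x \<in> standard_simplex 1")
         (auto simp: path_simplex_def simplex_path_def singular_simplex_def extensional_def)
  qed
  then show "pathin X (simplex_path \<sigma>)"
    using assms singular_simplex_path_simplex by metis
qed

lemma simplex_path_image: "simplex_path \<sigma> ` {0..1} = \<sigma> ` standard_simplex 1"
  unfolding standard_simplex_1 by (simp add: simplex_path_def image_image)

lemma singular_face_1:
  "singular_face 1 0 \<sigma> = point_simplex (simplex_path \<sigma> 1)"
  "singular_face 1 1 \<sigma> = point_simplex (simplex_path \<sigma> 0)"
proof -
  have 0: "simplical_face 0 (\<lambda>j. if j = 0 then 1 else 0 :: real) = edge_point 1"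
    by (auto simp: simplical_face_def edge_point_def fun_eq_iff)
  have 1: "simplical_face 1 (\<lambda>j. if j = 0 then 1 else 0 :: real) = edge_point 0"
    by (auto simp: simplical_face_def edge_point_def fun_eq_iff)
  show "singular_face 1 0 \<sigma> = point_simplex (simplex_path \<sigma> 1)"
    "singular_face 1 1 \<sigma> = point_simplex (simplex_path \<sigma> 0)"
    unfolding singular_face_def point_simplex_def simplex_path_def
    by (auto simp: standard_simplex_0 0 1[unfolded One_nat_def] intro!: restrict_ext)
qed

lemma chain_boundary_1: "chain_boundary 1 c =
    frag_extend (\<lambda>\<sigma>. frag_of (point_simplex (simplex_path \<sigma> 1)) - frag_of (point_simplex (simplex_path \<sigma> 0))) c"
proof -
  have "{..1::nat} = {0,1}" by auto
  then show ?thesis by (simp add: chain_boundary_def singular_face_1[unfolded One_nat_def])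
qed

lemma chain_boundary_1_of: "chain_boundary 1 (frag_of \<sigma>) =
    frag_of (point_simplex (simplex_path \<sigma> 1)) - frag_of (point_simplex (simplex_path \<sigma> 0))"
  unfolding chain_boundary_1 by simp

lemma chain_boundary_path: "chain_boundary 1 (frag_of (path_simplex g)) =
    frag_of (point_simplex (g 1)) - frag_of (point_simplex (g 0))"
  unfolding chain_boundary_1_of by (simp add: simplex_path_path_simplex)

lemma point_simplex_eq [simp]: "point_simplex a = point_simplex b \<longleftrightarrow> a = b"
  by (metis point_simplex_def restrict_apply' standard_simplex_0 singletonI)

lemma singular_simplex_0: "singular_simplex 0 X \<sigma> \<longleftrightarrow> (\<exists>a \<in> topspace X. \<sigma> = point_simplex a)"
proof
  assume s: "singular_simplex 0 X \<sigma>"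
  let ?v = "\<lambda>j. if j = 0 then 1 else 0 :: real"
  have "\<sigma> = point_simplex (\<sigma> ?v)"
  proof
    fix x show "\<sigma> x = point_simplex (\<sigma> ?v) x"
      using s by (cases "x = ?v") (simp_all add: singular_simplex_def point_simplex_def standard_simplex_0 extensional_def)
  qed
  moreover have "\<sigma> ?v \<in> topspace X"
    using s by (auto simp: singular_simplex_def continuous_map_def standard_simplex_0)
  ultimately show "\<exists>a \<in> topspace X. \<sigma> = point_simplex a" by blast
qed (auto simp: singular_simplex_def point_simplex_def)

lemma simplex_map_path_simplex: "simplex_map 1 f (path_simplex g) = path_simplex (f \<circ> g)"
  by (auto simp: simplex_map_def path_simplex_def fun_eq_iff)

lemma coeff_sum_boundary_1: "coeff_sum F (chain_boundary 1 c) =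
    coeff_sum (\<lambda>\<sigma>. F (point_simplex (simplex_path \<sigma> 1)) - F (point_simplex (simplex_path \<sigma> 0))) c"
  unfolding chain_boundary_1 by (simp add: coeff_sum_extend coeff_sum_diff)

definition point_fun :: "('a \<Rightarrow> int) \<Rightarrow> ((nat \<Rightarrow> real) \<Rightarrow> 'a) \<Rightarrow> int" where
  "point_fun h \<sigma> = h (\<sigma> (\<lambda>j. if j = 0 then 1 else 0))"

lemma point_fun_point [simp]: "point_fun h (point_simplex a) = h a"
  by (simp add: point_fun_def point_simplex_def standard_simplex_0)

text \<open>The coboundary of the 0-cochain given by \<open>h\<close>.\<close>

definition path_diff :: "('a \<Rightarrow> int) \<Rightarrow> ((nat \<Rightarrow> real) \<Rightarrow> 'a) \<Rightarrow> int" where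
  "path_diff h \<sigma> = h (simplex_path \<sigma> 1) - h (simplex_path \<sigma> 0)"

lemma coeff_sum_path_diff: "coeff_sum (path_diff h) c = coeff_sum (point_fun h) (chain_boundary 1 c)"
  unfolding coeff_sum_boundary_1 by (simp add: path_diff_def[abs_def])

subsection \<open>Boundaries\<close>

abbreviation "int_boundary X c \<equiv> singular_relboundary 1 X {} c"

lemma int_boundary_mod2: "int_boundary X c \<Longrightarrow> c \<in> mod2_boundaries 1 X"
proof -
  assume "int_boundary X c"
  then obtain d where "singular_chain 2 X d" "chain_boundary 2 d = c"
    by (auto simp: singular_boundary numeral_2_eq_2)
  then show ?thesis unfolding mod2_boundaries_def
    by (intro CollectI exI[of _ d] exI[of _ 0]) (auto simp: numeral_2_eq_2)
qed

lemma mod2_minus: "a \<in> mod2_boundaries p X \<Longrightarrow> - a \<in> mod2_boundaries p X"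
  using subgroup.m_inv_closed[OF subgroup_mod2_boundaries, of a p X] mod2_boundaries_cycles[of p X]
  by (auto simp: mod2_cycles_def singular_chain_def)

lemma mod2_diff: "a \<in> mod2_boundaries p X \<Longrightarrow> b \<in> mod2_boundaries p X \<Longrightarrow> a - b \<in> mod2_boundaries p X"
  using mod2_add[of a p X "-b"] mod2_minus[of b p X] by simp

lemma mod2_even: "singular_chain p X e \<Longrightarrow> frag_cmul 2 e \<in> mod2_boundaries p X"
  unfolding mod2_boundaries_def by (intro CollectI exI[of _ 0] exI[of _ e]) auto

lemma mod2_cycles_add: "a \<in> mod2_cycles p X \<Longrightarrow> b \<in> mod2_cycles p X \<Longrightarrow> a + b \<in> mod2_cycles p X"
  using subgroup.m_closed[OF subgroup_mod2_cycles] by fastforce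

lemma mod2_cycles_minus: "a \<in> mod2_cycles p X \<Longrightarrow> - a \<in> mod2_cycles p X"
  using subgroup.m_inv_closed[OF subgroup_mod2_cycles, of a p X]
  by (auto simp: mod2_cycles_def singular_chain_def)

lemma mod2_cycles_diff: "a \<in> mod2_cycles p X \<Longrightarrow> b \<in> mod2_cycles p X \<Longrightarrow> a - b \<in> mod2_cycles p X"
  using mod2_cycles_add[of a p X "-b"] mod2_cycles_minus[of b p X] by simp

lemma mod2_boundaries_mono:
  "S \<subseteq> T \<Longrightarrow> c \<in> mod2_boundaries p (subtopology X S) \<Longrightarrow> c \<in> mod2_boundaries p (subtopology X T)"
  unfolding mod2_boundaries_def using singular_chain_mono by blast

lemma mod2_boundaries_sub: "c \<in> mod2_boundaries p (subtopology X S) \<Longrightarrow> c \<in> mod2_boundaries p X"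
  unfolding mod2_boundaries_def using singular_chain_subtopology by blast

lemma mod2_cycles_mono:
  "S \<subseteq> T \<Longrightarrow> c \<in> mod2_cycles p (subtopology X S) \<Longrightarrow> c \<in> mod2_cycles p (subtopology X T)"
  unfolding mod2_cycles_def using singular_chain_mono by blast

lemma int_boundary_of_contractible:
  assumes "contractible_space X" "singular_chain 1 X c" "chain_boundary 1 c = 0"
  shows "int_boundary X c"
proof -
  have "trivial_group (homology_group 1 X)"
    using trivial_reduced_homology_group_contractible_space[OF assms(1), of 1]
    by (simp add: un_reduced_homology_group)
  then have t: "carrier (homology_group 1 X) = {\<one>\<^bsub>homology_group 1 X\<^esub>}"
    by (simp add: trivial_group_def)
  have cyc: "singular_relcycle 1 X {} c" using assms by (simp add: singular_cycle)
  then have "homologous_rel_set 1 X {} c \<in> carrier (homology_group (int 1) X)"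
    unfolding carrier_relative_homology_group by blast
  moreover have "\<one>\<^bsub>homology_group (int 1) X\<^esub> = singular_relboundary_set 1 X {}"
    by (rule one_relative_homology_group)
  ultimately have "homologous_rel_set 1 X {} c = singular_relboundary_set 1 X {}"
    using t by simp
  then show ?thesis by (simp add: homologous_rel_set_eq_relboundary)
qed

lemma int_boundary_sub: "int_boundary (subtopology X S) c \<Longrightarrow> int_boundary X c"
  by (metis singular_boundary singular_chain_subtopology)

text \<open>\<open>E\<close> and \<open>\<Delta>\<close> play the roles of the end of a homotopy and of the traces of its vertices.\<close>

lemma int_boundary_push:
  assumes "\<And>\<sigma>. \<sigma> \<in> Poly_Mapping.keys y \<Longrightarrow>
     int_boundary X (frag_of \<sigma> - E \<sigma> + frag_extend \<Delta> (chain_boundary 1 (frag_of \<sigma>)))"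
  shows "int_boundary X (y - frag_extend E y + frag_extend \<Delta> (chain_boundary 1 y))"
proof -
  have "Poly_Mapping.keys y \<subseteq> {\<sigma>. int_boundary X (frag_of \<sigma> - E \<sigma> + frag_extend \<Delta> (chain_boundary 1 (frag_of \<sigma>)))}"
    using assms by auto
  then show ?thesis
  proof (induction y rule: frag_induction)
    case (diff a b)
    then have "int_boundary X ((a - frag_extend E a + frag_extend \<Delta> (chain_boundary 1 a))
        - (b - frag_extend E b + frag_extend \<Delta> (chain_boundary 1 b)))"
      using singular_relboundary_diff by blast
    then show ?case by (simp add: frag_extend_diff chain_boundary_diff algebra_simps)
  qed auto
qed

text \<open>A constant 1-simplex is the boundary of the constant 2-simplex, whose three faces
  coincide and carry the signs 1, -1, 1.\<close>

lemma int_boundary_constant: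
  assumes "singular_chain 1 (subtopology X {a}) c" shows "int_boundary X c"
proof (cases "a \<in> topspace X")
  case True
  then have "topspace (subtopology X {a}) = {a}" by auto
  then have "int_boundary (subtopology X {a}) c"
    using assms by (simp add: singular_boundary_singleton)
  then show ?thesis by (rule int_boundary_sub)
next
  case False
  then have "c = 0" using assms singular_chain_empty[of "subtopology X {a}" 1 c] by auto
  then show ?thesis by simp
qed

declare One_nat_def [simp del]

lemma frag_cmul_2: "frag_cmul 2 c = c + c"
  using frag_cmul_distrib[of 1 1 c] by simp

subsection \<open>Subdivision\<close>

lemma singular_chain_subdivision_power:
  "singular_chain p X c \<Longrightarrow> singular_chain p X ((singular_subdivision p ^^ n) c)"
  by (induction n) (auto simp: singular_chain_singular_subdivision)

lemma chain_boundary_subdivision_power: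
  "singular_chain p X c \<Longrightarrow> chain_boundary p ((singular_subdivision p ^^ n) c) =
     (singular_subdivision (p - Suc 0) ^^ n) (chain_boundary p c)"
  by (induction n)
     (auto simp: chain_boundary_singular_subdivision[OF singular_chain_subdivision_power])

lemma subdivision_power_0: "singular_chain 0 X c \<Longrightarrow> (singular_subdivision 0 ^^ n) c = c"
  by (induction n) (auto simp: singular_subdivision_zero)

lemma subdivision_power_add:
  "(singular_subdivision p ^^ n) (a + b) = (singular_subdivision p ^^ n) a + (singular_subdivision p ^^ n) b"
  by (induction n) (auto simp: singular_subdivision_add)

lemma subdivision_power_double:
  "(singular_subdivision p ^^ n) (frag_cmul 2 c) = frag_cmul 2 ((singular_subdivision p ^^ n) c)"
  by (simp add: frag_cmul_2 subdivision_power_add)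

text \<open>This holds for every chain and not only for cycles: on the boundary of \<open>c\<close>
  the chain homotopy yields constant 1-simplices, and these bound.\<close>

lemma int_boundary_subdivision:
  assumes "singular_chain 1 X c"
  shows "int_boundary X ((singular_subdivision 1 ^^ n) c - c)"
proof -
  obtain h where h: "\<And>p. h p 0 = (0 :: 'a chain)" "\<And>p c1 c2. h p (c1-c2) = h p c1 - h p c2"
     "\<And>p X c. singular_chain p X c \<Longrightarrow> singular_chain (Suc p) X (h p c)"
     "\<And>p X c. singular_chain p X c \<Longrightarrow>
         chain_boundary (Suc p) (h p c) + h (p - Suc 0) (chain_boundary p c) = (singular_subdivision p ^^ n) c - c"
    by (rule chain_homotopic_iterated_singular_subdivision[of n]) (rule that)
  have pt: "int_boundary X (h 0 b)" if "singular_chain 0 X b" for b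
    using that unfolding singular_chain_def
  proof (induction b rule: frag_induction)
    case (one \<sigma>)
    then obtain a where a: "a \<in> topspace X" "\<sigma> = point_simplex a" by (auto simp: singular_simplex_0)
    \<comment> \<open>The chain homotopy maps chains in any space to chains in the same space; for
      the subspace \<open>{a}\<close> its value is a chain of constant simplices.\<close>
    have "singular_chain 0 (subtopology X {a}) (frag_of \<sigma>)"
      using a by (auto simp: singular_chain_of singular_simplex_0)
    then show ?case
      using int_boundary_constant[of X a "h 0 (frag_of \<sigma>)"] h(3)[of 0 "subtopology X {a}" "frag_of \<sigma>"]
      by (simp add: One_nat_def)
  qed (auto simp: h intro: singular_relboundary_diff)
  have "int_boundary X (chain_boundary 2 (h 1 c) + h 0 (chain_boundary 1 c))"
  proof (rule singular_relboundary_add)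
    show "int_boundary X (chain_boundary 2 (h 1 c))"
      using h(3)[OF assms] by (auto simp: singular_boundary numeral_2_eq_2)
    show "int_boundary X (h 0 (chain_boundary 1 c))"
      using pt singular_chain_boundary[OF assms] by simp
  qed
  then show ?thesis using h(4)[OF assms] by (simp add: numeral_2_eq_2)
qed

lemma mod2_boundary_subdivision:
  assumes "singular_chain 1 X c"
  shows "(singular_subdivision 1 ^^ n) c - c \<in> mod2_boundaries 1 X"
  using int_boundary_mod2 int_boundary_subdivision assms by blast

lemma mod2_boundary_subdivision_iff:
  assumes "singular_chain 1 X c"
  shows "(singular_subdivision 1 ^^ n) c \<in> mod2_boundaries 1 X \<longleftrightarrow> c \<in> mod2_boundaries 1 X"
proof
  let ?s = "(singular_subdivision 1 ^^ n) c"
  have d: "?s - c \<in> mod2_boundaries 1 X" using mod2_boundary_subdivision[OF assms] .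
  show "?s \<in> mod2_boundaries 1 X \<Longrightarrow> c \<in> mod2_boundaries 1 X" using mod2_diff[OF _ d] by fastforce
  show "c \<in> mod2_boundaries 1 X \<Longrightarrow> ?s \<in> mod2_boundaries 1 X" using mod2_add[OF d] by fastforce
qed

subsection \<open>Cycles in spaces with contractible pieces\<close>

lemma mod2_cycleE:
  assumes "c \<in> mod2_cycles p X"
  obtains b where "chain_boundary p c = frag_cmul 2 b" "singular_chain (p - Suc 0) X b"
proof -
  obtain b where b: "chain_boundary p c = frag_cmul 2 b" and c: "singular_chain p X c"
    using assms by (auto simp: mod2_cycles_def)
  have "Poly_Mapping.keys b = Poly_Mapping.keys (frag_cmul 2 b)" by (auto simp: in_keys_iff)
  then have "singular_chain (p - Suc 0) X b"
    using singular_chain_boundary[OF c] by (simp add: b singular_chain_def)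
  then show thesis using b that by blast
qed

lemma frag_extend_double: "frag_extend f (frag_cmul 2 b) = frag_cmul 2 (frag_extend f b)"
  by (simp add: frag_extend_cmul)

text \<open>Every vertex is joined to the base point of its piece. A simplex and the joining paths
  of its two ends form a loop in a contractible piece, so a chain is homologous to the joining paths
  over its boundary. For a cycle modulo 2 each of these occurs an even number of times. Giving the
  pieces as a function of the points treats all components at once.\<close>

lemma mod2_cycles_contractible_pieces:
  assumes Q: "\<And>x. x \<in> topspace Y \<Longrightarrow> x \<in> Q x" "\<And>x. x \<in> topspace Y \<Longrightarrow> Q x \<subseteq> topspace Y"
      "\<And>x. x \<in> topspace Y \<Longrightarrow> contractible_space (subtopology Y (Q x))"
    and path: "\<And>g. pathin Y g \<Longrightarrow> g ` {0..1} \<subseteq> Q (g 0) \<and> Q (g 1) = Q (g 0)"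
    and c: "c \<in> mod2_cycles 1 Y"
  shows "c \<in> mod2_boundaries 1 Y"
proof -
  \<comment> \<open>The base point depends on \<open>x\<close> only through the piece
    \<open>Q x\<close>, so the two ends of a path receive the same one.\<close>
  define base where "base x = (SOME y. y \<in> Q x)" for x
  have base: "base x \<in> Q x" if "x \<in> topspace Y" for x
    using Q(1)[OF that] unfolding base_def by (rule someI)
  have "\<exists>g. pathin (subtopology Y (Q x)) g \<and> g 0 = x \<and> g 1 = base x" if "x \<in> topspace Y" for x
  proof -
    have "path_connected_space (subtopology Y (Q x))"
      using Q(3)[OF that] contractible_imp_path_connected_space by blast
    moreover have "topspace (subtopology Y (Q x)) = Q x" using Q(2)[OF that] by auto
    ultimately show ?thesis using base[OF that] Q(1)[OF that]
      unfolding path_connected_space_def by auto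
  qed
  then obtain P where P: "\<And>x. x \<in> topspace Y \<Longrightarrow> pathin (subtopology Y (Q x)) (P x) \<and> P x 0 = x \<and> P x 1 = base x"
    by metis
  define \<Delta> where "\<Delta> \<sigma> = frag_of (path_simplex (P (\<sigma> (\<lambda>j. if j = 0 then 1 else 0))))"
    for \<sigma> :: "(nat \<Rightarrow> real) \<Rightarrow> 'a"
  have \<Delta>: "\<Delta> (point_simplex a) = frag_of (path_simplex (P a))" for a
    by (simp add: \<Delta>_def point_simplex_def standard_simplex_0)
  have sc: "singular_chain 1 Y c" using c by (simp add: mod2_cycles_def)
  have "int_boundary Y (c - frag_extend (\<lambda>_. 0) c + frag_extend \<Delta> (chain_boundary 1 c))"
  proof (rule int_boundary_push)
    fix \<sigma> assume "\<sigma> \<in> Poly_Mapping.keys c"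
    then have "singular_simplex 1 Y \<sigma>" using sc by (auto simp: singular_chain_def)
    then obtain g where g: "pathin Y g" "\<sigma> = path_simplex g" using pathin_simplex_path by metis
    have x: "g 0 \<in> topspace Y" "g 1 \<in> topspace Y"
      using g by (auto simp: pathin_def continuous_map_def)
    have gQ: "g ` {0..1} \<subseteq> Q (g 0)" and Qe: "Q (g 1) = Q (g 0)" using path[OF g(1)] by auto
    let ?T = "subtopology Y (Q (g 0))"
    let ?c = "frag_of \<sigma> - 0 + frag_extend \<Delta> (chain_boundary 1 (frag_of \<sigma>))"
    have e: "?c = frag_of (path_simplex g) + (frag_of (path_simplex (P (g 1))) - frag_of (path_simplex (P (g 0))))"
      unfolding g chain_boundary_path by (simp add: frag_extend_diff \<Delta>)
    have pg: "pathin ?T g" using g gQ by (auto simp: pathin_def continuous_map_in_subtopology)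
    have be: "base (g 1) = base (g 0)" using Qe by (simp add: base_def)
    have "int_boundary ?T ?c"
    proof (rule int_boundary_of_contractible)
      show "contractible_space ?T" using Q(3) x by blast
      show "singular_chain 1 ?T ?c" unfolding e
        using pg P[OF x(1)] P[OF x(2)] Qe
        by (intro singular_chain_add singular_chain_diff) (simp_all only: singular_chain_of singular_simplex_path_simplex)
      show "chain_boundary 1 ?c = 0" unfolding e
        using P[OF x(1)] P[OF x(2)] be
        by (simp only: chain_boundary_add chain_boundary_diff chain_boundary_path) simp
    qed
    then show "int_boundary Y ?c" by (rule int_boundary_sub)
  qed
  moreover have "frag_extend (\<lambda>_. 0) c = 0" by (rule frag_extend_eq_0) auto
  moreover obtain b where b: "chain_boundary 1 c = frag_cmul 2 b" "singular_chain 0 Y b"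
    using mod2_cycleE[OF c] by auto
  ultimately have "int_boundary Y (c - 0 + frag_extend \<Delta> (frag_cmul 2 b))"
    by metis
  then have "int_boundary Y (c + frag_cmul 2 (frag_extend \<Delta> b))"
    by (simp add: frag_extend_cmul)
  moreover have "singular_chain 1 Y (frag_extend \<Delta> b)"
  proof (rule singular_chain_extend)
    fix \<sigma> assume "\<sigma> \<in> Poly_Mapping.keys b"
    then obtain a where a: "a \<in> topspace Y" "\<sigma> = point_simplex a"
      using b(2) unfolding singular_chain_def singular_simplex_0 by blast
    then show "singular_chain 1 Y (\<Delta> \<sigma>)"
      using P[OF a(1)] by (simp only: \<Delta> singular_chain_of singular_simplex_path_simplex)
         (auto simp: pathin_def continuous_map_in_subtopology)
  qed
  ultimately show ?thesis
    using int_boundary_mod2 mod2_even mod2_diff by (metis add_diff_cancel_right')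
qed

lemma mod2_cycles_contractible:
  assumes "contractible_space Y" "c \<in> mod2_cycles 1 Y"
  shows "c \<in> mod2_boundaries 1 Y"
  by (rule mod2_cycles_contractible_pieces[where Q = "\<lambda>_. topspace Y"])
     (use assms in \<open>auto simp: pathin_def continuous_map_def\<close>)

section \<open>The winding cochain\<close>

text \<open>The signed number of passages through the branch cut of \<open>Arg\<close>: a continuous
  angle along \<open>g\<close> changes by the difference of the principal arguments plus 2 pi times
  this integer. In contrast to a winding number it makes sense for paths that are not closed and
  stays integral, so it defines an integral 1-cochain.\<close>

definition turn :: "(real \<Rightarrow> complex) \<Rightarrow> int" where
  "turn g = (SOME k. \<exists>q. continuous_on {0..1} q \<and> (\<forall>t\<in>{0..1}. g t = exp (q t)) \<and>
     Im (q 1 - q 0) = Arg (g 1) - Arg (g 0) + 2 * pi * of_int k)"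

text \<open>Independence of the logarithm: two continuous logarithms differ by a continuous function
  whose distinct values are at least 2 pi apart, hence by a constant.\<close>

lemma turn_eq:
  assumes q: "continuous_on {0..1} q" "\<And>t. t \<in> {0..1} \<Longrightarrow> g t = exp (q t)"
  shows "Im (q 1 - q 0) = Arg (g 1) - Arg (g 0) + 2 * pi * of_int (turn g)"
proof -
  have "\<exists>n::int. Im (q t) = Arg (g t) + 2 * pi * n" if "t \<in> {0..1}" for t
  proof -
    have "g t \<noteq> 0" using q that by simp
    then have "exp (Ln (g t)) = exp (q t)" using q that by simp
    then obtain n :: int where "Ln (g t) = q t + of_real (of_int (2 * n) * pi) * \<i>"
      unfolding exp_eq by blast
    then have "Im (Ln (g t)) = Im (q t) + 2 * n * pi" by simp
    then show ?thesis using \<open>g t \<noteq> 0\<close> by (intro exI[of _ "-n"]) (simp add: Arg_eq_Im_Ln algebra_simps)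
  qed
  then obtain n0 n1 :: int where n: "Im (q 0) = Arg (g 0) + 2 * pi * n0" "Im (q 1) = Arg (g 1) + 2 * pi * n1"
    by (meson atLeastAtMost_iff order_refl zero_le_one)
  have "\<exists>k::int. \<exists>q. continuous_on {0..1} q \<and> (\<forall>t\<in>{0..1}. g t = exp (q t)) \<and>
     Im (q 1 - q 0) = Arg (g 1) - Arg (g 0) + 2 * pi * of_int k"
    using n q by (intro exI[of _ "n1 - n0"] exI[of _ q]) (auto simp: algebra_simps)
  from someI_ex[OF this] obtain r where r: "continuous_on {0..1} r" "\<forall>t\<in>{0..1}. g t = exp (r t)"
    "Im (r 1 - r 0) = Arg (g 1) - Arg (g 0) + 2 * pi * of_int (turn g)"
    unfolding turn_def by blast
  have "(\<lambda>t. q t - r t) constant_on {0..1}"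
  proof (rule continuous_discrete_range_constant)
    show "connected {0..1::real}" by simp
    show "continuous_on {0..1} (\<lambda>t. q t - r t)" using q r by (intro continuous_intros) auto
    fix s :: real assume s: "s \<in> {0..1}"
    show "\<exists>e>0. \<forall>t. t \<in> {0..1} \<and> q t - r t \<noteq> q s - r s \<longrightarrow> e \<le> norm (q t - r t - (q s - r s))"
    proof (intro exI[of _ "2*pi"] conjI allI impI)
      fix t :: real assume t: "t \<in> {0..1} \<and> q t - r t \<noteq> q s - r s"
      have "exp (q t) = exp (r t)" "exp (q s) = exp (r s)" using q r t s by metis+
      then obtain m n :: int where "q t = r t + of_real (of_int (2 * n) * pi) * \<i>" "q s = r s + of_real (of_int (2 * m) * pi) * \<i>"
        unfolding exp_eq by blast
      then have *: "q t - r t - (q s - r s) = of_real (2 * pi * of_int (n - m)) * \<i>"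
        by (simp add: algebra_simps)
      have "norm (q t - r t - (q s - r s)) = 2 * pi * \<bar>of_int (n - m)\<bar>"
        unfolding * norm_mult norm_of_real by (simp add: abs_mult)
      moreover have "n \<noteq> m" using * t by auto
      then have "1 \<le> \<bar>of_int (n - m)::real\<bar>" by linarith
      ultimately show "2 * pi \<le> norm (q t - r t - (q s - r s))" by (simp add: mult_le_cancel_left1)
    qed auto
  qed
  then have "q 1 - r 1 = q 0 - r 0" unfolding constant_on_def by (metis atLeastAtMost_iff order_refl zero_le_one)
  then have "q 1 - q 0 = r 1 - r 0" by (simp add: algebra_simps)
  then show ?thesis using r by simp
qed

lemma turn_cong: "(\<And>t. t \<in> {0..1} \<Longrightarrow> f t = g t) \<Longrightarrow> turn f = turn g"
  by (simp add: turn_def)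

lemma turn_cut:
  assumes "continuous_on {0..1} g" "\<And>t. t \<in> {0..1} \<Longrightarrow> g t \<notin> \<real>\<^sub>\<le>\<^sub>0"
  shows "turn g = 0"
proof -
  have nz: "g t \<noteq> 0" if "t \<in> {0..1}" for t using assms(2)[OF that] by auto
  have "continuous_on {0..1} (\<lambda>t. Ln (g t))" using assms by (intro continuous_intros) auto
  moreover have "g t = exp (Ln (g t))" if "t \<in> {0..1}" for t using nz that by simp
  ultimately have "Im (Ln (g 1) - Ln (g 0)) = Arg (g 1) - Arg (g 0) + 2 * pi * of_int (turn g)"
    by (rule turn_eq)
  then show ?thesis using nz by (simp add: Arg_eq_Im_Ln)
qed

definition wind :: "('a \<Rightarrow> complex) \<Rightarrow> ((nat \<Rightarrow> real) \<Rightarrow> 'a) \<Rightarrow> int" where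
  "wind f \<sigma> = turn (f \<circ> simplex_path \<sigma>)"

lemma wind_path: "wind f (path_simplex g) = turn (f \<circ> g)"
  unfolding wind_def by (rule turn_cong) (simp add: simplex_path_path_simplex)

text \<open>The standard 2-simplex as the triangle with vertices 0, 1, \<i>; in this form a function
  on it is defined on a convex set of the plane and has a logarithm.\<close>

definition triangle_point :: "complex \<Rightarrow> nat \<Rightarrow> real" where
  "triangle_point z = (\<lambda>i. if i = 0 then 1 - Re z - Im z else if i = 1 then Re z else if i = 2 then Im z else 0)"

text \<open>\<open>wind f\<close> is a cocycle. With one logarithm of \<open>f\<close> on the whole
  triangle, its value on an edge is the difference, between the two ends, of a single function: the
  imaginary part of the logarithm minus \<open>Arg\<close>, divided by 2 pi. The alternating sum
  over the edges therefore cancels.\<close>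

lemma wind_triangle:
  assumes f: "continuous_map Y euclidean f" "\<And>y. y \<in> topspace Y \<Longrightarrow> f y \<noteq> (0::complex)"
    and \<tau>: "singular_simplex 2 Y \<tau>"
  shows "wind f (singular_face 2 0 \<tau>) - wind f (singular_face 2 1 \<tau>) + wind f (singular_face 2 2 \<tau>) = 0"
proof -
  define T where "T = {z::complex. 0 \<le> Re z \<and> 0 \<le> Im z \<and> Re z + Im z \<le> 1}"
  have "T = {z. 0 \<le> Re z} \<inter> ({z. 0 \<le> Im z} \<inter> {z. Re z + Im z \<le> 1})" by (auto simp: T_def)
  moreover have "convex {z. Re z + Im z \<le> 1}"
    using convex_halfspace_le[of "1 + \<i>" 1] by (simp add: inner_complex_def)
  ultimately have cT: "convex T"
    using convex_halfspace_Re_ge[of 0] convex_halfspace_Im_ge[of 0] by (auto intro!: convex_Int)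
  have "{..2::nat} = {0,1,2}" by auto
  then have P: "triangle_point z \<in> standard_simplex 2" if "z \<in> T" for z
    using that by (auto simp: T_def standard_simplex_def triangle_point_def)
  have "continuous_map (top_of_set T) (powertop_real UNIV) triangle_point"
    unfolding continuous_map_componentwise_UNIV
  proof
    fix k show "continuous_map (top_of_set T) euclideanreal (\<lambda>t. triangle_point t k)"
    proof -
      consider "k = 0" | "k = 1" | "k = 2" | "k > 2" by linarith
      then show ?thesis
        by cases (auto simp: triangle_point_def intro!: continuous_on_diff continuous_on_Re continuous_on_Im continuous_on_id continuous_on_const)
    qed
  qed
  then have "continuous_map (top_of_set T) (subtopology (powertop_real UNIV) (standard_simplex 2)) triangle_point"
    using P by (auto simp: continuous_map_in_subtopology)
  moreover have \<tau>c: "continuous_map (subtopology (powertop_real UNIV) (standard_simplex 2)) Y \<tau>"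
    using \<tau> by (simp add: singular_simplex_def)
  ultimately have "continuous_map (top_of_set T) Y (\<tau> \<circ> triangle_point)"
    by (rule continuous_map_compose)
  then have "continuous_map (top_of_set T) euclidean (f \<circ> (\<tau> \<circ> triangle_point))"
    using f(1) by (rule continuous_map_compose)
  then have cont: "continuous_on T (f \<circ> (\<tau> \<circ> triangle_point))" by simp
  have nz: "(f \<circ> (\<tau> \<circ> triangle_point)) z \<noteq> 0" if "z \<in> T" for z
  proof -
    have "\<tau> (triangle_point z) \<in> topspace Y" using \<tau>c P[OF that] by (auto simp: continuous_map_def)
    then show ?thesis using f(2) by simp
  qed
  obtain l where l: "continuous_on T l" "\<And>z. z \<in> T \<Longrightarrow> (f \<circ> (\<tau> \<circ> triangle_point)) z = exp (l z)"
    using continuous_logarithm_on_contractible[OF cont convex_imp_contractible[OF cT] nz] by blast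
  have edge: "2 * pi * of_int (wind f (singular_face 2 k \<tau>)) =
      Im (l (p 1) - l (p 0)) - (Arg (f (\<tau> (triangle_point (p 1)))) - Arg (f (\<tau> (triangle_point (p 0)))))"
    if p: "continuous_on {0..1} p" "\<And>t. t \<in> {0..1} \<Longrightarrow> p t \<in> T"
      and face: "\<And>t. t \<in> {0..1} \<Longrightarrow> simplical_face k (edge_point t) = triangle_point (p t)"
    for p k
  proof -
    have e: "(f \<circ> simplex_path (singular_face 2 k \<tau>)) t = f (\<tau> (triangle_point (p t)))" if "t \<in> {0..1}" for t
      using that face[OF that] edge_point_in[of t]
      by (simp add: simplex_path_def singular_face_def)
    have "Im (l (p 1) - l (p 0)) = Arg (f (\<tau> (triangle_point (p 1)))) - Arg (f (\<tau> (triangle_point (p 0))))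
       + 2 * pi * of_int (turn (\<lambda>t. f (\<tau> (triangle_point (p t)))))"
    proof (rule turn_eq[where q = "\<lambda>t. l (p t)"])
      show "continuous_on {0..1} (\<lambda>t. l (p t))"
        using continuous_on_compose2[OF l(1) p(1)] p(2) by blast
      show "f (\<tau> (triangle_point (p t))) = exp (l (p t))" if "t \<in> {0..1}" for t
        using l(2)[OF p(2)[OF that]] by simp
    qed
    moreover have "wind f (singular_face 2 k \<tau>) = turn (\<lambda>t. f (\<tau> (triangle_point (p t))))"
      unfolding wind_def by (rule turn_cong) (rule e)
    ultimately show ?thesis by simp
  qed
  have face0: "simplical_face 0 (edge_point t) = triangle_point (of_real (1 - t) + \<i> * of_real t)" for t
    unfolding simplical_face_def edge_point_def triangle_point_def by (rule ext) auto
  have face1: "simplical_face 1 (edge_point t) = triangle_point (\<i> * of_real t)" for t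
    unfolding simplical_face_def edge_point_def triangle_point_def by (rule ext) auto
  have face2: "simplical_face 2 (edge_point t) = triangle_point (of_real t)" for t
    unfolding simplical_face_def edge_point_def triangle_point_def by (rule ext) auto
  have e0: "2 * pi * of_int (wind f (singular_face 2 0 \<tau>)) =
      Im (l \<i> - l 1) - (Arg (f (\<tau> (triangle_point \<i>))) - Arg (f (\<tau> (triangle_point 1))))"
    using edge[of "\<lambda>t. of_real (1 - t) + \<i> * of_real t" 0, OF _ _ face0]
    by (simp add: T_def) (simp add: continuous_intros)
  have e1: "2 * pi * of_int (wind f (singular_face 2 1 \<tau>)) =
      Im (l \<i> - l 0) - (Arg (f (\<tau> (triangle_point \<i>))) - Arg (f (\<tau> (triangle_point 0))))"
    using edge[of "\<lambda>t. \<i> * of_real t" 1, OF _ _ face1]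
    by (simp add: T_def) (simp add: continuous_intros)
  have e2: "2 * pi * of_int (wind f (singular_face 2 2 \<tau>)) =
      Im (l 1 - l 0) - (Arg (f (\<tau> (triangle_point 1))) - Arg (f (\<tau> (triangle_point 0))))"
    using edge[of "\<lambda>t. of_real t" 2, OF _ _ face2]
    by (simp add: T_def continuous_intros)
  have "2 * pi * of_int (wind f (singular_face 2 0 \<tau>) - wind f (singular_face 2 1 \<tau>) + wind f (singular_face 2 2 \<tau>)) = 0"
    unfolding of_int_add of_int_diff distrib_left right_diff_distrib e0 e1 e2 by simp
  then show ?thesis
    by (metis mult_eq_0_iff of_int_eq_0_iff pi_neq_zero zero_neq_numeral)
qed

lemma coeff_sum_boundary_2: "coeff_sum F (chain_boundary 2 w) =
   coeff_sum (\<lambda>\<tau>. F (singular_face 2 0 \<tau>) - F (singular_face 2 1 \<tau>) + F (singular_face 2 2 \<tau>)) w"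
proof -
  have "{..2::nat} = {0,1,2}" by auto
  then show ?thesis
    by (simp add: chain_boundary_def coeff_sum_extend coeff_sum_add coeff_sum_minus coeff_sum_diff algebra_simps)
qed

lemma wind_boundary:
  assumes "continuous_map Y euclidean f" "\<And>y. y \<in> topspace Y \<Longrightarrow> f y \<noteq> (0::complex)"
    and "singular_chain 2 Y w"
  shows "coeff_sum (wind f) (chain_boundary 2 w) = 0"
proof -
  have "coeff_sum (wind f) (chain_boundary 2 w) = coeff_sum (\<lambda>_. 0) w"
    unfolding coeff_sum_boundary_2
  proof (rule coeff_sum_cong)
    fix \<tau> assume "\<tau> \<in> Poly_Mapping.keys w"
    then have "singular_simplex 2 Y \<tau>" using assms(3) by (auto simp: singular_chain_def)
    then show "wind f (singular_face 2 0 \<tau>) - wind f (singular_face 2 1 \<tau>) + wind f (singular_face 2 2 \<tau>) = 0"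
      using wind_triangle assms(1,2) by blast
  qed
  then show ?thesis by (simp add: coeff_sum_def)
qed

lemma wind_mod2_boundary:
  assumes "continuous_map Y euclidean f" "\<And>y. y \<in> topspace Y \<Longrightarrow> f y \<noteq> (0::complex)"
    and "c \<in> mod2_boundaries 1 Y"
  shows "even (coeff_sum (wind f) c)"
proof -
  obtain d e where "c = chain_boundary 2 d + frag_cmul 2 e" "singular_chain 2 Y d"
    using assms(3) by (auto simp: mod2_boundaries_def numeral_2_eq_2)
  then show ?thesis using wind_boundary[OF assms(1,2)] by (simp add: coeff_sum_add coeff_sum_cmul)
qed

lemma wind_cut:
  assumes "continuous_map Y euclidean f" "pathin Y g" "\<And>t. t \<in> {0..1} \<Longrightarrow> f (g t) \<notin> \<real>\<^sub>\<le>\<^sub>0"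
  shows "wind f (path_simplex g) = 0"
proof -
  have "continuous_map (top_of_set {0..1}) euclidean (f \<circ> g)"
    using assms continuous_map_compose unfolding pathin_def by blast
  then show ?thesis unfolding wind_path using assms by (intro turn_cut) auto
qed

subsection \<open>The punctured plane\<close>

text \<open>The exponential is the universal covering of the punctured plane. A chain bounds there
  as soon as it lifts to an integral cycle in the contractible plane.\<close>

lemma exp_int_boundary:
  assumes "singular_chain 1 euclidean c" "chain_boundary 1 c = 0"
  shows "int_boundary (top_of_set (-{0})) (chain_map 1 exp (c :: complex chain))"
proof -
  have "contractible_space (euclidean :: complex topology)"
    using convex_imp_contractible[OF convex_UNIV, where 'a = complex] contractible_space_top_of_set[of "UNIV :: complex set"] by simp
  then have "int_boundary euclidean c" using assms int_boundary_of_contractible by blast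
  then obtain d where d: "singular_chain 2 euclidean d" "chain_boundary 2 d = c"
    by (auto simp: singular_boundary numeral_2_eq_2)
  have "continuous_map euclidean (top_of_set (-{0})) (exp :: complex \<Rightarrow> complex)"
    by (auto simp: continuous_map_in_subtopology intro!: continuous_intros)
  then have "singular_chain 2 (top_of_set (-{0})) (chain_map 2 exp d)"
    using singular_chain_chain_map d by blast
  moreover have "chain_boundary 2 (chain_map 2 exp d) = chain_map 1 exp c"
    using chain_boundary_chain_map[OF d(1), of exp] d(2) by simp
  ultimately show ?thesis by (auto simp: singular_boundary numeral_2_eq_2)
qed

definition circle_power :: "int \<Rightarrow> complex chain" where
  "circle_power k = frag_of (path_simplex (\<lambda>t. exp (of_real t * (2 * of_real pi * of_int k * \<i>))))"

lemma singular_chain_path_euclidean: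
  "continuous_on {0..1} g \<Longrightarrow> singular_chain 1 euclidean (frag_of (path_simplex g))"
  by (simp only: singular_chain_of singular_simplex_path_simplex) (simp add: pathin_def)

text \<open>The segment from 0 to 2 pi (k+1) \<i> and the two successive segments with the
  intermediate point 2 pi k \<i> form a cycle in the plane. The exponential forgets the translation
  of the second one, so a loop with \<open>k + 1\<close> turns is homologous to one with
  \<open>k\<close> turns plus one with a single turn.\<close>

lemma circle_power: "int_boundary (top_of_set (-{0})) (circle_power k - frag_cmul k (circle_power 1))"
proof -
  have step: "int_boundary (top_of_set (-{0})) (circle_power (k + 1) - circle_power k - circle_power 1)" for k
  proof -
    let ?p = "\<lambda>k t. of_real t * (2 * of_real pi * of_int k * \<i>) :: complex"
    let ?c = "frag_of (path_simplex (?p (k+1))) - frag_of (path_simplex (?p k))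
        - frag_of (path_simplex (\<lambda>t. 2 * of_real pi * of_int k * \<i> + ?p 1 t))"
    have "int_boundary (top_of_set (-{0})) (chain_map 1 exp ?c)"
    proof (rule exp_int_boundary)
      show "singular_chain 1 euclidean ?c"
        by (intro singular_chain_diff singular_chain_path_euclidean continuous_intros)
      show "chain_boundary 1 ?c = 0"
        by (simp only: chain_boundary_diff chain_boundary_path) (simp add: algebra_simps)
    qed
    moreover have "chain_map 1 exp ?c = circle_power (k + 1) - circle_power k - circle_power 1"
    proof -
      have "exp (2 * of_real pi * of_int k * \<i> + w) = exp w" for w
        using exp_plus_2pin[of w k] by (simp add: algebra_simps)
      then have "exp \<circ> (\<lambda>t. 2 * of_real pi * of_int k * \<i> + ?p 1 t) = exp \<circ> ?p 1"
        by (simp only: o_def)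
      then show ?thesis
        by (simp only: chain_map_diff chain_map_of simplex_map_path_simplex) (simp add: circle_power_def o_def)
    qed
    ultimately show ?thesis by simp
  qed
  show ?thesis
  proof (induction k rule: int_induct[where k = 1])
    case (step1 i)
    have "int_boundary (top_of_set (-{0})) ((circle_power i - frag_cmul i (circle_power 1)) + (circle_power (i + 1) - circle_power i - circle_power 1))"
      using step1 step singular_relboundary_add by blast
    then show ?case by (simp add: algebra_simps frag_cmul_distrib)
  next
    case (step2 i)
    have "int_boundary (top_of_set (-{0})) ((circle_power i - frag_cmul i (circle_power 1)) - (circle_power (i - 1 + 1) - circle_power (i - 1) - circle_power 1))"
      using step2 step[of "i-1"] singular_relboundary_diff by blast
    then show ?case by (simp add: algebra_simps frag_cmul_diff_distrib)
  qed auto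
qed

text \<open>The parity of the winding cochain is the only obstruction. The ends of a simplex are
  pulled to 1 by the paths \<open>\<Delta>\<close>, along principal logarithms; what results is
  homologous to the circle traversed as often as \<open>wind id\<close> says. For a cycle modulo 2
  the paths \<open>\<Delta>\<close> occur evenly, and the circle does so by hypothesis.\<close>

lemma punctured_plane_mod2:
  assumes c: "c \<in> mod2_cycles 1 (top_of_set (-{0}))" and ev: "even (coeff_sum (wind id) c)"
  shows "c \<in> mod2_boundaries 1 (top_of_set (-{0::complex}))"
proof -
  let ?Y = "top_of_set (-{0::complex})"
  define \<Delta> where "\<Delta> \<sigma> = frag_of (path_simplex (\<lambda>t. exp (of_real (1 - t) * Ln (\<sigma> (\<lambda>j. if j = 0 then 1 else 0)))))"
    for \<sigma> :: "(nat \<Rightarrow> real) \<Rightarrow> complex"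
  have \<Delta>: "\<Delta> (point_simplex a) = frag_of (path_simplex (\<lambda>t. exp (of_real (1 - t) * Ln a)))" for a
    by (simp add: \<Delta>_def point_simplex_def standard_simplex_0)
  have sc: "singular_chain 1 ?Y c" using c by (simp add: mod2_cycles_def)
  have sc\<Delta>: "singular_chain 1 ?Y (\<Delta> \<sigma>)" for \<sigma>
    unfolding \<Delta>_def
    by (simp only: singular_chain_of singular_simplex_path_simplex) (auto simp: pathin_def continuous_map_in_subtopology intro!: continuous_intros)
  have "int_boundary ?Y (c - frag_extend (\<lambda>\<sigma>. circle_power (wind id \<sigma>)) c + frag_extend \<Delta> (chain_boundary 1 c))"
  proof (rule int_boundary_push)
    fix \<sigma> assume "\<sigma> \<in> Poly_Mapping.keys c"
    then have "singular_simplex 1 ?Y \<sigma>" using sc by (auto simp: singular_chain_def)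
    then obtain g where g: "pathin ?Y g" "\<sigma> = path_simplex g" using pathin_simplex_path by metis
    then have gc: "continuous_on {0..1} g" and gn: "\<And>t. t \<in> {0..1} \<Longrightarrow> g t \<noteq> 0"
      by (auto simp: pathin_def continuous_map_in_subtopology)
    obtain q where q: "continuous_on {0..1} q" "\<And>t. t \<in> {0..1} \<Longrightarrow> g t = exp (q t)"
      using continuous_logarithm_on_contractible[OF gc convex_imp_contractible[of "{0..1::real}"] gn] by auto
    define k where "k = wind id \<sigma>"
    have im: "Im (q 1 - q 0) = Arg (g 1) - Arg (g 0) + 2 * pi * of_int k"
      using turn_eq[OF q] by (simp add: k_def g wind_path)
    have gn01: "g 0 \<noteq> 0" "g 1 \<noteq> 0" using gn by auto
    have re: "Re (q 1) = ln (norm (g 1))" "Re (q 0) = ln (norm (g 0))" using q(2)[of 0] q(2)[of 1] by auto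
    have q1: "q 1 - q 0 = Ln (g 1) - Ln (g 0) + 2 * of_real pi * of_int k * \<i>"
      using im re gn01 by (auto simp: complex_eq_iff Arg_eq_Im_Ln)
    \<comment> \<open>The lift \<open>q\<close> is shifted by a period so as to start at the
      principal logarithm of \<open>g 0\<close>. It then ends at \<open>Ln (g 1)\<close> plus
      \<open>k\<close> periods, for which reason \<open>?b1\<close> carries the same
      periods.\<close>
    define c0 where "c0 = Ln (g 0) - q 0"
    have ec0: "exp c0 = 1"
      using gn01 q(2)[of 0] by (simp add: c0_def exp_diff)
    let ?s = "\<lambda>t. q t + c0"
    let ?b1 = "\<lambda>t. of_real (1 - t) * Ln (g 1) + 2 * of_real pi * of_int k * \<i>"
    let ?b0 = "\<lambda>t. of_real (1 - t) * Ln (g 0) :: complex"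
    let ?w = "\<lambda>t. of_real t * (2 * of_real pi * of_int k * \<i>)"
    let ?c = "frag_of (path_simplex ?s) - frag_of (path_simplex ?w) + (frag_of (path_simplex ?b1) - frag_of (path_simplex ?b0))"
    have "int_boundary ?Y (chain_map 1 exp ?c)"
    proof (rule exp_int_boundary)
      show "singular_chain 1 euclidean ?c"
        by (intro singular_chain_diff singular_chain_add singular_chain_path_euclidean continuous_intros q)
      have "q 1 + c0 = Ln (g 1) + 2 * of_real pi * of_int k * \<i>" using q1 by (simp add: c0_def algebra_simps)
      moreover have "q 0 + c0 = Ln (g 0)" by (simp add: c0_def)
      ultimately show "chain_boundary 1 ?c = 0"
        by (simp only: chain_boundary_diff chain_boundary_add chain_boundary_path) (simp add: algebra_simps)
    qed
    moreover have "path_simplex (exp \<circ> ?s) = path_simplex g"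
      unfolding path_simplex_def using q(2) ec0
      by (intro restrict_ext) (auto simp: exp_add standard_simplex_def)
    moreover have "path_simplex (exp \<circ> ?b1) = path_simplex (\<lambda>t. exp (of_real (1 - t) * Ln (g 1)))"
    proof -
      have "exp (w + 2 * of_real pi * of_int k * \<i>) = exp w" for w
        using exp_plus_2pin[of w k] by (simp add: algebra_simps)
      then have "exp \<circ> ?b1 = (\<lambda>t. exp (of_real (1 - t) * Ln (g 1)))"
        by (simp only: o_def)
      then show ?thesis by simp
    qed
    ultimately have "int_boundary ?Y (frag_of (path_simplex g) - circle_power k
       + (frag_of (path_simplex (\<lambda>t. exp (of_real (1 - t) * Ln (g 1)))) - frag_of (path_simplex (\<lambda>t. exp (of_real (1 - t) * Ln (g 0))))))"
      by (simp only: chain_map_diff chain_map_add chain_map_of simplex_map_path_simplex) (simp add: circle_power_def o_def)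
    then show "int_boundary ?Y (frag_of \<sigma> - circle_power (wind id \<sigma>) + frag_extend \<Delta> (chain_boundary 1 (frag_of \<sigma>)))"
      unfolding k_def[symmetric] unfolding g(2) chain_boundary_path by (simp add: frag_extend_diff \<Delta>)
  qed
  then have 1: "c - frag_extend (\<lambda>\<sigma>. circle_power (wind id \<sigma>)) c + frag_extend \<Delta> (chain_boundary 1 c) \<in> mod2_boundaries 1 ?Y"
    by (rule int_boundary_mod2)
  obtain b where b: "chain_boundary 1 c = frag_cmul 2 b" using c by (auto simp: mod2_cycles_def)
  have 2: "frag_extend \<Delta> (chain_boundary 1 c) \<in> mod2_boundaries 1 ?Y"
    unfolding b frag_extend_cmul by (intro mod2_even singular_chain_extend sc\<Delta>)
  have "int_boundary ?Y (frag_extend (\<lambda>\<sigma>. circle_power (wind id \<sigma>)) y - frag_cmul (coeff_sum (wind id) y) (circle_power 1))" for y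
    using subset_UNIV
  proof (induction y rule: frag_induction)
    case (diff a b)
    then show ?case
      using singular_relboundary_diff[OF diff]
      by (simp add: frag_extend_diff coeff_sum_diff frag_cmul_diff_distrib algebra_simps)
  qed (auto simp: circle_power)
  then have 3: "frag_extend (\<lambda>\<sigma>. circle_power (wind id \<sigma>)) c - frag_cmul (coeff_sum (wind id) c) (circle_power 1) \<in> mod2_boundaries 1 ?Y"
    by (rule int_boundary_mod2)
  obtain m where m: "coeff_sum (wind id) c = 2 * m" using ev by (elim evenE)
  have "singular_chain 1 ?Y (circle_power 1)"
    unfolding circle_power_def
    by (simp only: singular_chain_of singular_simplex_path_simplex) (auto simp: pathin_def continuous_map_in_subtopology intro!: continuous_intros)
  then have "frag_cmul (coeff_sum (wind id) c) (circle_power 1) \<in> mod2_boundaries 1 ?Y"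
    using mod2_even[OF singular_chain_cmul[of 1 ?Y "circle_power 1" m]] by (simp add: m)
  from mod2_add[OF 3 this] have 4: "frag_extend (\<lambda>\<sigma>. circle_power (wind id \<sigma>)) c \<in> mod2_boundaries 1 ?Y" by simp
  from mod2_add[OF mod2_diff[OF 1 2] 4] show ?thesis by simp
qed

lemma contractible_convex_image:
  fixes K :: "'b::real_normed_vector set"
  assumes "convex K" "continuous_map (top_of_set K) X f" "continuous_map (subtopology X (f ` K)) euclidean g"
    and "\<And>t. t \<in> K \<Longrightarrow> g (f t) = t"
  shows "contractible_space (subtopology X (f ` K))"
proof -
  have "f ` K \<subseteq> topspace X" using assms(2) by (auto simp: continuous_map_def)
  then have "homeomorphic_maps (top_of_set K) (subtopology X (f ` K)) f g"
    unfolding homeomorphic_maps_def using assms by (auto simp: continuous_map_in_subtopology)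
  then have "top_of_set K homeomorphic_space subtopology X (f ` K)"
    unfolding homeomorphic_space_def by blast
  then have "contractible_space (top_of_set K) = contractible_space (subtopology X (f ` K))"
    using homeomorphic_imp_homotopy_equivalent_space homotopy_equivalent_space_contractibility by blast
  then show ?thesis using convex_imp_contractible[OF assms(1)] by simp
qed

lemma continuous_map_real_affine:
  assumes "continuous_map (top_of_set K) X f" "continuous_on {0..1::real} h" "h ` {0..1} \<subseteq> K"
  shows "pathin X (\<lambda>t. f (h t))"
proof -
  have "continuous_map (top_of_set {0..1}) (top_of_set K) h"
    using assms by (auto simp: continuous_map_in_subtopology)
  from continuous_map_compose[OF this assms(1)] show ?thesis by (simp add: pathin_def o_def)
qed

lemma singular_chain_path: "singular_chain 1 X (frag_of (path_simplex g)) \<longleftrightarrow> pathin X g"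
  by (simp add: singular_chain_of singular_simplex_path_simplex)

definition simplex_point :: "((nat \<Rightarrow> real) \<Rightarrow> 'a) \<Rightarrow> 'a" where
  "simplex_point \<sigma> = \<sigma> (\<lambda>j. if j = 0 then 1 else 0)"

lemma simplex_point_point [simp]: "simplex_point (point_simplex a) = a"
  by (simp add: simplex_point_def point_simplex_def standard_simplex_0)

section \<open>Pushing chains off the diagram\<close>

lemma push_off_aux:
  assumes "finite K" and f: "\<And>\<sigma>. \<sigma> \<in> K \<Longrightarrow> \<forall>\<^sub>F s in at_right (0::real). A \<sigma> s" and "d0 > 0"
  shows "\<exists>d>0. d \<le> d0 \<and> d \<le> 1 \<and> (\<forall>\<sigma>\<in>K. \<forall>s. 0 < s \<and> s \<le> d \<longrightarrow> A \<sigma> s)"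
proof -
  have "\<forall>\<^sub>F s in at_right (0::real). \<forall>\<sigma>\<in>K. A \<sigma> s"
    by (rule eventually_ball_finite) (use assms in auto)
  then obtain b where b: "b > 0" "\<And>s. 0 < s \<Longrightarrow> s < b \<Longrightarrow> \<forall>\<sigma>\<in>K. A \<sigma> s"
    unfolding eventually_at_right_field by auto
  show ?thesis
    by (rule exI[of _ "min (b/2) (min d0 1)"]) (use b \<open>d0 > 0\<close> in \<open>auto simp: min_less_iff_disj\<close>)
qed

text \<open>The paths \<open>\<delta> x\<close> need not depend continuously on \<open>x\<close>.
  After subdivision every simplex of \<open>y\<close> lies in one of the sets \<open>W\<close>; its
  ends are moved along their paths into \<open>P\<close> and joined there, and the resulting
  quadrilateral lies in the contractible \<open>Q\<close>. The time \<open>d x\<close> may vary with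
  \<open>x\<close>, since all simplices with a vertex at \<open>x\<close> use the same value there.
  What remains are the traces over the boundary of \<open>y\<close>.\<close>

lemma push_off:
  assumes \<delta>: "\<And>x. x \<in> S \<Longrightarrow> pathin X (\<delta> x) \<and> \<delta> x 0 = x"
    and cover: "\<And>x. x \<in> S \<Longrightarrow> \<exists>W Q P. (W, Q, P) \<in> \<W> \<and> x \<in> W"
    and W: "\<And>W Q P. (W, Q, P) \<in> \<W> \<Longrightarrow> openin X W \<and> S \<inter> W \<subseteq> Q \<and> P \<subseteq> Q \<and> P \<subseteq> R \<and>
        path_connectedin X P \<and> contractible_space (subtopology X Q)"
    and germ: "\<And>W Q P x. (W, Q, P) \<in> \<W> \<Longrightarrow> x \<in> S \<Longrightarrow> x \<in> W \<Longrightarrow> \<forall>\<^sub>F s in at_right 0. \<delta> x s \<in> P"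
    and y: "singular_chain 1 (subtopology X S) y" and S: "S \<subseteq> topspace X"
    and d0: "\<And>x. d0 x > (0::real)"
  obtains u d where "singular_chain 1 (subtopology X R) u" "\<And>x. 0 < d x" "\<And>x. d x \<le> d0 x" "\<And>x. d x \<le> 1"
    "y - u + frag_extend (\<lambda>\<sigma>. frag_of (path_simplex (\<lambda>t. \<delta> (simplex_point \<sigma>) (t * d (simplex_point \<sigma>)))))
        (chain_boundary 1 y) \<in> mod2_boundaries 1 X"
proof -
  let ?C = "(\<lambda>(W,Q,P). S \<inter> W) ` \<W>"
  have tS: "topspace (subtopology X S) = S" using S by auto
  obtain n where n: "\<And>m f. n \<le> m \<Longrightarrow> f \<in> Poly_Mapping.keys ((singular_subdivision 1 ^^ m) y) \<Longrightarrow>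
      \<exists>V \<in> ?C. f \<in> standard_simplex 1 \<rightarrow> V"
  proof (rule sufficient_iterated_singular_subdivision_exists[OF _ _ y])
    show "openin (subtopology X S) U" if "U \<in> ?C" for U
      using that W by (auto simp: openin_subtopology_Int2)
    show "topspace (subtopology X S) \<subseteq> \<Union>?C" using cover unfolding tS by fastforce
  qed blast
  define y' where "y' = (singular_subdivision 1 ^^ n) y"
  have scy': "singular_chain 1 (subtopology X S) y'"
    unfolding y'_def by (rule singular_chain_subdivision_power[OF y])
  have "\<exists>W Q P. (W,Q,P) \<in> \<W> \<and> f ` standard_simplex 1 \<subseteq> S \<inter> W" if "f \<in> Poly_Mapping.keys y'" for f
    using n[OF order_refl that[unfolded y'_def]] by fastforce
  then obtain W Q P where WQP: "\<And>f. f \<in> Poly_Mapping.keys y' \<Longrightarrow> (W f, Q f, P f) \<in> \<W> \<and> f ` standard_simplex 1 \<subseteq> S \<inter> W f"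
    by metis
  \<comment> \<open>Only finitely many simplices of \<open>y'\<close> restrict the time at
    \<open>x\<close>, so their germ conditions hold simultaneously up to a positive time.\<close>
  have "\<exists>d>0. d \<le> d0 x \<and> d \<le> 1 \<and> (\<forall>f\<in>{f \<in> Poly_Mapping.keys y'. x \<in> S \<inter> W f}. \<forall>s. 0 < s \<and> s \<le> d \<longrightarrow> \<delta> x s \<in> P f)" for x
  proof (rule push_off_aux)
    show "\<forall>\<^sub>F s in at_right 0. \<delta> x s \<in> P f" if "f \<in> {f \<in> Poly_Mapping.keys y'. x \<in> S \<inter> W f}" for f
      using germ[of "W f" "Q f" "P f" x] WQP[of f] that by auto
  qed (use d0 in auto)
  then obtain d where d: "\<And>x. 0 < d x" "\<And>x. d x \<le> d0 x" "\<And>x. d x \<le> 1"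
    "\<And>x f s. f \<in> Poly_Mapping.keys y' \<Longrightarrow> x \<in> S \<inter> W f \<Longrightarrow> 0 < s \<Longrightarrow> s \<le> d x \<Longrightarrow> \<delta> x s \<in> P f"
    by (metis (mono_tags, lifting) mem_Collect_eq)
  define \<Delta> where "\<Delta> \<sigma> = frag_of (path_simplex (\<lambda>t. \<delta> (simplex_point \<sigma>) (t * d (simplex_point \<sigma>))))" for \<sigma>
  have "\<exists>e. pathin (subtopology X (P f)) e \<and>
      e 0 = \<delta> (simplex_path f 0) (d (simplex_path f 0)) \<and> e 1 = \<delta> (simplex_path f 1) (d (simplex_path f 1))"
    if f: "f \<in> Poly_Mapping.keys y'" for f
  proof -
    have v: "simplex_path f t \<in> S \<inter> W f" if "t \<in> {0..1}" for t
      using WQP[OF f] simplex_path_image[of f] that by blast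
    have "\<delta> (simplex_path f t) (d (simplex_path f t)) \<in> P f" if "t \<in> {0..1}" for t
      using d(4)[OF f v[OF that]] d(1) by blast
    moreover have "path_connectedin X (P f)" using W WQP[OF f] by blast
    ultimately show ?thesis
      unfolding path_connectedin_def path_connected_space_def by (auto simp: Int_absorb1)
  qed
  then obtain e where e: "\<And>f. f \<in> Poly_Mapping.keys y' \<Longrightarrow> pathin (subtopology X (P f)) (e f) \<and>
      e f 0 = \<delta> (simplex_path f 0) (d (simplex_path f 0)) \<and> e f 1 = \<delta> (simplex_path f 1) (d (simplex_path f 1))"
    by metis
  define E where "E f = frag_of (path_simplex (e f))" for f
  have "int_boundary X (y' - frag_extend E y' + frag_extend \<Delta> (chain_boundary 1 y'))"
  proof (rule int_boundary_push)
    fix f assume f: "f \<in> Poly_Mapping.keys y'"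
    let ?T = "subtopology X (Q f)"
    let ?g = "simplex_path f"
    have wf: "S \<inter> W f \<subseteq> Q f" "P f \<subseteq> Q f" "contractible_space ?T" using W WQP[OF f] by blast+
    have v: "?g t \<in> S \<inter> W f" if "t \<in> {0..1}" for t
      using WQP[OF f] simplex_path_image[of f] that by blast
    have sf: "singular_simplex 1 (subtopology X S) f" using f scy' by (auto simp: singular_chain_def)
    have gp: "pathin (subtopology X S) ?g" and fg: "path_simplex ?g = f" using pathin_simplex_path[OF sf] by auto
    have gQ: "pathin ?T ?g" using gp v wf(1) by (fastforce simp: pathin_subtopology)
    have dQ: "pathin ?T (\<lambda>t. \<delta> (?g r) (t * d (?g r)))" if r: "r \<in> {0..1}" for r
      unfolding pathin_subtopology
    proof (intro conjI ballI)
      have "pathin X (\<delta> (?g r))" using \<delta> v[OF r] by blast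
      then show "pathin X (\<lambda>t. \<delta> (?g r) (t * d (?g r)))"
        unfolding pathin_def[of X "\<delta> (?g r)"]
        by (rule continuous_map_real_affine) (use d(1)[of "?g r"] d(3)[of "?g r"] in \<open>auto intro!: continuous_intros mult_le_one mult_nonneg_nonneg\<close>)
      fix t :: real assume t: "t \<in> {0..1}"
      show "\<delta> (?g r) (t * d (?g r)) \<in> Q f"
      proof (cases "t = 0")
        case True then show ?thesis using \<delta> v[OF r] wf(1) by auto
      next
        case False
        then have "0 < t * d (?g r)" "t * d (?g r) \<le> d (?g r)" using t d(1)[of "?g r"] by (auto simp: mult_le_cancel_right1)
        then show ?thesis using d(4)[OF f v[OF r]] wf(2) by blast
      qed
    qed
    have eQ: "pathin ?T (e f)" using e[OF f] wf(2) by (auto simp: pathin_subtopology)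
    let ?c = "frag_of f - E f + (\<Delta> (point_simplex (?g 1)) - \<Delta> (point_simplex (?g 0)))"
    have "int_boundary ?T ?c"
    proof (rule int_boundary_of_contractible[OF wf(3)])
      show "singular_chain 1 ?T ?c"
        using gQ eQ dQ[of 0] dQ[of 1] unfolding E_def \<Delta>_def simplex_point_point
        by (subst (1) fg[symmetric]) (intro singular_chain_add singular_chain_diff; simp add: singular_chain_path)
      have "\<delta> (?g 0) 0 = ?g 0" "\<delta> (?g 1) 0 = ?g 1" using \<delta> v[of 0] v[of 1] by auto
      then show "chain_boundary 1 ?c = 0"
        using e[OF f] chain_boundary_1_of[of f] unfolding E_def \<Delta>_def simplex_point_point
        by (simp add: chain_boundary_add chain_boundary_diff chain_boundary_path)
    qed
    then have "int_boundary X ?c" by (rule int_boundary_sub)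
    then show "int_boundary X (frag_of f - E f + frag_extend \<Delta> (chain_boundary 1 (frag_of f)))"
      by (simp add: chain_boundary_1_of frag_extend_diff)
  qed
  \<comment> \<open>Subdivision is the identity on 0-chains; the traces at the vertices that it
    introduces cancel.\<close>
  moreover have "chain_boundary 1 y' = chain_boundary 1 y"
    using chain_boundary_subdivision_power[OF y] subdivision_power_0[OF singular_chain_boundary[OF y, unfolded One_nat_def, simplified]]
    by (simp add: y'_def One_nat_def)
  ultimately have 1: "y' - frag_extend E y' + frag_extend \<Delta> (chain_boundary 1 y) \<in> mod2_boundaries 1 X"
    using int_boundary_mod2 by metis
  have 2: "y' - y \<in> mod2_boundaries 1 X"
    unfolding y'_def using mod2_boundaries_sub[OF mod2_boundary_subdivision[OF y]] .
  show thesis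
  proof (rule that[OF _ d(1-3)])
    show "singular_chain 1 (subtopology X R) (frag_extend E y')"
    proof (rule singular_chain_extend)
      fix f assume f: "f \<in> Poly_Mapping.keys y'"
      have "P f \<subseteq> R" using W WQP[OF f] by blast
      then show "singular_chain 1 (subtopology X R) (E f)"
        unfolding E_def singular_chain_path using e[OF f] by (auto simp: pathin_subtopology)
    qed
    have "y - frag_extend E y' + frag_extend \<Delta> (chain_boundary 1 y) \<in> mod2_boundaries 1 X"
      using mod2_diff[OF 1 2] by (simp add: algebra_simps)
    then show "y - frag_extend E y' + frag_extend
     (\<lambda>\<sigma>. frag_of (path_simplex (\<lambda>t. \<delta> (simplex_point \<sigma>) (t * d (simplex_point \<sigma>))))) (chain_boundary 1 y)
     \<in> mod2_boundaries 1 X" unfolding \<Delta>_def .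
  qed
qed

section \<open>An arc in a one-dimensional space\<close>

text \<open>The arc proper is the parameter interval from -1 to 1, closed in \<open>Y\<close>; the
  collars up to -2 and 2 make it overlap with the complement in open sets. The locale compares the
  homology of \<open>Y\<close> modulo 2 with that of \<open>Y\<close> without the open arc:
  \<open>decompose\<close> says what the chains of \<open>Y\<close> are, \<open>injective\<close>
  that no further cycles become boundaries, and \<open>arc_parity\<close> that the arc is
  independent of the rest.\<close>

locale open_arc =
  fixes Y :: "'a topology" and \<theta> :: "real \<Rightarrow> 'a" and \<iota> :: "'a \<Rightarrow> real"
  assumes cont: "continuous_map (top_of_set {-2<..<2}) Y \<theta>"
    and op: "openin Y (\<theta> ` {-2<..<2})"
    and inv: "continuous_map (subtopology Y (\<theta> ` {-2<..<2})) euclideanreal \<iota>"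
    and inv_eq: "\<And>t. t \<in> {-2<..<2} \<Longrightarrow> \<iota> (\<theta> t) = t"
    and clo: "closedin Y (\<theta> ` {-1..1})"
begin

definition rest :: "'a set" where "rest = topspace Y - \<theta> ` {-1<..<1}"

definition arc :: "'a chain" where "arc = frag_of (path_simplex (\<lambda>t. \<theta> (2 * t - 1)))"

lemma theta_eq: "s \<in> {-2<..<2} \<Longrightarrow> t \<in> {-2<..<2} \<Longrightarrow> \<theta> s = \<theta> t \<longleftrightarrow> s = t"
  using inv_eq by metis

lemma theta_in_iff: "t \<in> {-2<..<2} \<Longrightarrow> K \<subseteq> {-2<..<2} \<Longrightarrow> \<theta> t \<in> \<theta> ` K \<longleftrightarrow> t \<in> K"
  using theta_eq by blast

lemma theta_top: "t \<in> {-2<..<2} \<Longrightarrow> \<theta> t \<in> topspace Y"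
  using cont by (auto simp: continuous_map_def)

lemma open_image:
  assumes "open K" "K \<subseteq> {-2<..<2}" shows "openin Y (\<theta> ` K)"
proof -
  have "openin (subtopology Y (\<theta> ` {-2<..<2})) {x \<in> topspace (subtopology Y (\<theta> ` {-2<..<2})). \<iota> x \<in> K}"
    by (rule openin_continuous_map_preimage[OF inv]) (use assms in simp)
  moreover have "{x \<in> topspace (subtopology Y (\<theta> ` {-2<..<2})). \<iota> x \<in> K} = \<theta> ` K"
    using assms(2) inv_eq theta_top by force
  ultimately show ?thesis using op openin_trans_full by metis
qed

lemma contractible_image:
  assumes "convex K" "K \<subseteq> {-2<..<2}" shows "contractible_space (subtopology Y (\<theta> ` K))"
proof (rule contractible_convex_image[OF assms(1)])
  show "continuous_map (top_of_set K) Y \<theta>" using cont assms(2) continuous_map_from_subtopology_mono by blast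
  show "continuous_map (subtopology Y (\<theta> ` K)) euclidean \<iota>"
    using inv assms(2) continuous_map_from_subtopology_mono by blast
qed (use inv_eq assms in blast)

lemma path_theta:
  assumes "continuous_on {0..1} h" "h ` {0..1} \<subseteq> K" "K \<subseteq> {-2<..<2}"
  shows "pathin (subtopology Y (\<theta> ` K)) (\<lambda>t. \<theta> (h t))"
  unfolding pathin_subtopology using assms
  by (intro conjI continuous_map_real_affine[OF cont]) auto

text \<open>A point of the open arc is moved to the end on its side. The jump at 0 does no harm, as
  only vertices of chains are moved; a simplex whose ends are moved to different sides has its
  passage counted by a multiple of the arc.\<close>

definition out :: "real \<Rightarrow> real" where
  "out t = (if \<bar>t\<bar> < 1 then (if t \<le> 0 then -1 else 1) else t)"

definition side :: "real \<Rightarrow> real" where "side t = (if t \<le> 0 then -1 else 1)"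

definition trace :: "'a \<Rightarrow> real \<Rightarrow> 'a" where
  "trace v r = (if v \<in> \<theta> ` {-2<..<2} then \<theta> ((1 - r) * \<iota> v + r * out (\<iota> v)) else v)"

lemma out_in: "t \<in> {-2<..<2} \<Longrightarrow> out t \<in> {-2<..<2} \<and> \<not> \<bar>out t\<bar> < 1"
  by (auto simp: out_def)

lemma theta_sub: "{-1<..<1} \<subseteq> {-2<..<(2::real)}" "{-2<..<0} \<subseteq> {-2<..<(2::real)}" "{0<..<2} \<subseteq> {-2<..<(2::real)}"
  "{-1<..<0} \<subseteq> {-2<..<(2::real)}" "{0<..<1} \<subseteq> {-2<..<(2::real)}" "{-1..1} \<subseteq> {-2<..<(2::real)}"
  by auto

lemma theta_half_iff:
  assumes "t \<in> {-2<..<2}"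
  shows "\<theta> t \<in> \<theta> ` {-2<..<0} \<longleftrightarrow> t < 0" "\<theta> t \<in> \<theta> ` {0<..<2} \<longleftrightarrow> t > 0"
  using assms theta_in_iff[OF assms theta_sub(2)] theta_in_iff[OF assms theta_sub(3)] by auto

lemma theta_image_punctured:
  assumes "K \<subseteq> {-2<..<2}" shows "\<theta> ` K \<inter> (topspace Y - {\<theta> 0}) = \<theta> ` (K - {0})"
proof (intro equalityI subsetI)
  fix x assume "x \<in> \<theta> ` (K - {0})"
  then obtain t where t: "x = \<theta> t" "t \<in> K" "t \<noteq> 0" by auto
  then show "x \<in> \<theta> ` K \<inter> (topspace Y - {\<theta> 0})" using assms theta_top theta_eq[of t 0] by auto
qed auto

lemma theta_image_avoids:
  assumes "K \<subseteq> {-2<..<2}" "0 \<notin> K" shows "\<theta> ` K \<subseteq> topspace Y - {\<theta> 0}"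
  using theta_image_punctured[OF assms(1)] assms(2) by auto

lemma rest_iff: "t \<in> {-2<..<2} \<Longrightarrow> \<theta> t \<in> rest \<longleftrightarrow> \<not> \<bar>t\<bar> < 1"
  using theta_in_iff[OF _ theta_sub(1), of t] theta_top[of t] by (auto simp: rest_def abs_less_iff)

lemma trace_rest: "v \<in> rest \<Longrightarrow> trace v r = v"
proof (cases "v \<in> \<theta> ` {-2<..<2}")
  case True
  assume "v \<in> rest"
  then obtain t where t: "t \<in> {-2<..<2}" "v = \<theta> t" "\<not> \<bar>t\<bar> < 1" using True rest_iff by auto
  then show ?thesis by (simp add: trace_def out_def inv_eq algebra_simps)
qed (simp add: trace_def)

lemma segment_in_interval:
  assumes "a \<in> {-2<..<2}" "b \<in> {-2<..<2}" "r \<in> {0..1::real}" shows "(1 - r) * a + r * b \<in> {-2<..<2}"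
  using convexD[OF convex_real_interval(8)[of "-2" 2] assms(1,2), of "1-r" r] assms(3) by auto

lemma trace_theta:
  assumes "t \<in> {-2<..<2}" shows "trace (\<theta> t) = (\<lambda>r. \<theta> ((1 - r) * t + r * out t))"
  using assms by (auto simp: trace_def inv_eq)

lemma pathin_trace: "v \<in> topspace Y \<Longrightarrow> pathin Y (trace v)"
proof (cases "v \<in> \<theta> ` {-2<..<2}")
  case True
  then obtain t where t: "t \<in> {-2<..<2}" "v = \<theta> t" by auto
  show ?thesis unfolding t(2) trace_theta[OF t(1)]
    by (rule continuous_map_real_affine[OF cont])
       (use segment_in_interval[OF t(1)] out_in[OF t(1)] in \<open>auto intro!: continuous_intros\<close>)
next
  case False
  assume "v \<in> topspace Y"
  then show ?thesis using False by (simp add: trace_def[abs_def] pathin_def)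
qed

lemma subdivide_arc:
  assumes "singular_chain p Y c" "\<And>t. t \<in> \<V> \<Longrightarrow> openin Y t" "topspace Y \<subseteq> \<Union>\<V>"
  obtains n where "\<And>f. f \<in> Poly_Mapping.keys ((singular_subdivision p ^^ n) c) \<Longrightarrow> \<exists>V\<in>\<V>. f ` standard_simplex p \<subseteq> V"
proof (rule sufficient_iterated_singular_subdivision_exists[OF assms(2,3,1)])
  fix n assume n: "\<And>m f. n \<le> m \<Longrightarrow> f \<in> Poly_Mapping.keys ((singular_subdivision p ^^ m) c) \<Longrightarrow>
      \<exists>V\<in>\<V>. f \<in> standard_simplex p \<rightarrow> V"
  show thesis by (rule that[of n]) (use n[OF order_refl] in \<open>simp add: image_subset_iff_funcset\<close>)
qed

text \<open>A small simplex either avoids the closed arc and is kept, or lies in the contractible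
  neighbourhood of the arc; there only its ends matter, and after moving these off the open arc
  along \<open>trace\<close> it is replaced by paths outside and a multiple of the arc. The boundary
  term \<open>b\<close> is allowed since it will be present when a second arc is split off.\<close>

lemma decompose:
  assumes y: "singular_chain 1 Y y" and b: "chain_boundary 1 y = b + frag_cmul 2 b'"
    and bE: "singular_chain 0 (subtopology Y rest) b" and b'Y: "singular_chain 0 Y b'"
  obtains e n where "singular_chain 1 (subtopology Y rest) e" "y - (e + frag_cmul n arc) \<in> mod2_boundaries 1 Y"
proof -
  let ?I = "\<theta> ` {-2<..<2}" and ?a = "\<theta> ` {-1..1}"
  obtain n where n: "\<And>f. f \<in> Poly_Mapping.keys ((singular_subdivision 1 ^^ n) y) \<Longrightarrow>
     \<exists>V\<in>{?I, topspace Y - ?a}. f ` standard_simplex 1 \<subseteq> V"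
  proof (rule subdivide_arc[OF y])
    show "openin Y t" if "t \<in> {?I, topspace Y - ?a}" for t using that op clo by auto
    show "topspace Y \<subseteq> \<Union>{?I, topspace Y - ?a}" by auto
  qed blast
  define y' where "y' = (singular_subdivision 1 ^^ n) y"
  have scy': "singular_chain 1 Y y'" unfolding y'_def by (rule singular_chain_subdivision_power[OF y])
  define \<Delta> where "\<Delta> \<sigma> = frag_of (path_simplex (trace (simplex_point \<sigma>)))" for \<sigma> :: "(nat \<Rightarrow> real) \<Rightarrow> 'a"
  \<comment> \<open>For a simplex near the arc: from its moved start to the end of the arc on that
    side, and from the end of the arc on the other vertex's side to that moved vertex. Both paths
    run in \<open>rest\<close>.\<close>
  define e where "e f = (if f ` standard_simplex 1 \<subseteq> ?I then
       let s0 = out (\<iota> (simplex_path f 0)); s1 = out (\<iota> (simplex_path f 1)) in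
         frag_of (path_simplex (\<lambda>r. \<theta> ((1 - r) * s0 + r * side s0))) + frag_of (path_simplex (\<lambda>r. \<theta> ((1 - r) * side s1 + r * s1)))
       else frag_of f)" for f
  \<comment> \<open>1 for a passage from the left to the right half of the arc, -1 for the reverse,
    0 if both ends are on the same side; the midpoint counts as left, as in \<open>out\<close> and
    \<open>side\<close>.\<close>
  define k where "k f = (if f ` standard_simplex 1 \<subseteq> ?I then
      (if \<iota> (simplex_path f 1) \<le> 0 then 0 else 1) - (if \<iota> (simplex_path f 0) \<le> 0 then 0 else 1) else (0::int))" for f
  have sub: "(1 - r) * out t + r * side (out t) \<in> {-2<..<2} - {-1<..<1} \<and> (1 - r) * side (out t) + r * out t \<in> {-2<..<2} - {-1<..<1}"
    if "t \<in> {-2<..<2}" "r \<in> {0..1}" for t r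
  proof -
    have o: "out t \<in> {-2<..-1} \<and> side (out t) = -1 \<or> out t \<in> {1..<2} \<and> side (out t) = 1"
      using that by (auto simp: out_def side_def)
    have 1: "(1 - r) * a + r * b \<in> {-2<..-1}" if "a \<in> {-2<..-1}" "b \<in> {-2<..-1}" for a b
      using convexD[OF convex_real_interval(6)[of "-2" "-1"] that, of "1-r" r] \<open>r \<in> {0..1}\<close> by auto
    have 2: "(1 - r) * a + r * b \<in> {1..<2}" if "a \<in> {1..<2}" "b \<in> {1..<2}" for a b
      using convexD[OF convex_real_interval(7)[of 1 2] that, of "1-r" r] \<open>r \<in> {0..1}\<close> by auto
    show ?thesis using o
    proof
      assume "out t \<in> {-2<..-1} \<and> side (out t) = -1"
      then show ?thesis using 1[of "out t" "-1"] 1[of "-1" "out t"] by auto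
    next
      assume "out t \<in> {1..<2} \<and> side (out t) = 1"
      then show ?thesis using 2[of "out t" "1"] 2[of "1" "out t"] by auto
    qed
  qed
  have restI: "\<theta> ` ({-2<..<2} - {-1<..<1}) \<subseteq> rest" using rest_iff by fastforce
  have cont_sub: "pathin (subtopology Y (\<theta> ` ({-2<..<2} - {-1<..<1}))) (\<lambda>r. \<theta> ((1 - r) * out t + r * side (out t)))"
     "pathin (subtopology Y (\<theta> ` ({-2<..<2} - {-1<..<1}))) (\<lambda>r. \<theta> ((1 - r) * side (out t) + r * out t))"
    if "t \<in> {-2<..<2}" for t
    by (rule path_theta; use sub[OF that] in \<open>auto intro!: continuous_intros\<close>)+
  have inI: "simplex_path f t \<in> ?I" if "f ` standard_simplex 1 \<subseteq> ?I" "t \<in> {0..1}" for f t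
    using simplex_path_image[of f] that by blast
  have iI: "\<iota> (simplex_path f t) \<in> {-2<..<2}" "\<theta> (\<iota> (simplex_path f t)) = simplex_path f t"
    if "f ` standard_simplex 1 \<subseteq> ?I" "t \<in> {0..1}" for f t
    using inI[OF that] inv_eq by auto
  have eE: "singular_chain 1 (subtopology Y rest) (e f)" if f: "f \<in> Poly_Mapping.keys y'" for f
  proof (cases "f ` standard_simplex 1 \<subseteq> ?I")
    case True
    have p: "pathin (subtopology Y rest) g" if "pathin (subtopology Y (\<theta> ` ({-2<..<2} - {-1<..<1}))) g" for g
      using that restI by (auto simp: pathin_subtopology)
    show ?thesis using True p[OF cont_sub(1)[OF iI(1)[OF True]]] p[OF cont_sub(2)[OF iI(1)[OF True]]]
      unfolding e_def Let_def by (simp add: singular_chain_add singular_chain_path)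
  next
    case False
    then have "f ` standard_simplex 1 \<subseteq> topspace Y - ?a" using n[of f] f unfolding y'_def by blast
    moreover have "topspace Y - ?a \<subseteq> rest" by (force simp: rest_def)
    ultimately show ?thesis using False f scy'
      by (auto simp: e_def singular_chain_of singular_simplex_subtopology singular_chain_def)
  qed
  have 0: "int_boundary Y (y' - frag_extend (\<lambda>f. e f + frag_cmul (k f) arc) y' + frag_extend \<Delta> (chain_boundary 1 y'))"
  proof (rule int_boundary_push)
    fix f assume f: "f \<in> Poly_Mapping.keys y'"
    have sf: "singular_simplex 1 Y f" using f scy' by (auto simp: singular_chain_def)
    let ?g = "simplex_path f"
    have g: "pathin Y ?g" "path_simplex ?g = f" using pathin_simplex_path[OF sf] by auto
    let ?c = "frag_of f - (e f + frag_cmul (k f) arc) + (\<Delta> (point_simplex (?g 1)) - \<Delta> (point_simplex (?g 0)))"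
    have "int_boundary Y ?c"
    proof (cases "f ` standard_simplex 1 \<subseteq> ?I")
      case True
      let ?T = "subtopology Y ?I"
      let ?t = "\<lambda>r. \<iota> (?g r)"
      have t: "?t r \<in> {-2<..<2}" "\<theta> (?t r) = ?g r" if "r \<in> {0..1}" for r using iI[OF True that] by auto
      have e': "e f = frag_of (path_simplex (\<lambda>r. \<theta> ((1 - r) * out (?t 0) + r * side (out (?t 0)))))
         + frag_of (path_simplex (\<lambda>r. \<theta> ((1 - r) * side (out (?t 1)) + r * out (?t 1))))"
        using True by (simp add: e_def Let_def)
      have \<Delta>': "\<Delta> (point_simplex (?g r)) = frag_of (path_simplex (\<lambda>s. \<theta> ((1 - s) * ?t r + s * out (?t r))))" if "r \<in> {0..1}" for r
        using trace_theta[OF t(1)[OF that]] t(2)[OF that] by (simp add: \<Delta>_def)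
      have 01: "0 \<in> {0..1::real}" "1 \<in> {0..1::real}" by auto
      have "int_boundary ?T ?c"
      proof (rule int_boundary_of_contractible)
        show "contractible_space ?T" by (rule contractible_image) auto
        have a: "singular_chain 1 ?T (frag_of f)"
          using sf True by (simp add: singular_chain_of singular_simplex_subtopology)
        have pI: "pathin ?T g" if "pathin (subtopology Y (\<theta> ` ({-2<..<2} - {-1<..<1}))) g" for g
          using that by (auto simp: pathin_subtopology)
        have "singular_chain 1 ?T (e f)"
          unfolding e' using pI[OF cont_sub(1)[OF t(1)[OF 01(1)]]] pI[OF cont_sub(2)[OF t(1)[OF 01(2)]]]
          by (simp add: singular_chain_add singular_chain_path)
        moreover have "singular_chain 1 ?T arc"
          unfolding arc_def singular_chain_path by (rule path_theta) (auto intro!: continuous_intros)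
        moreover have "singular_chain 1 ?T (\<Delta> (point_simplex (?g r)))" if "r \<in> {0..1}" for r
          unfolding \<Delta>'[OF that] singular_chain_path
          by (rule path_theta) (use segment_in_interval[OF t(1)[OF that] conjunct1[OF out_in[OF t(1)[OF that]]]] in \<open>auto intro!: continuous_intros\<close>)
        ultimately show "singular_chain 1 ?T ?c" using a 01
          by (intro singular_chain_add singular_chain_diff singular_chain_cmul) auto
        have so: "side (out s) = side s" for s by (auto simp: side_def out_def)
        have kf: "k f = (if side (?t 1) = 1 then 1 else 0) - (if side (?t 0) = 1 then 1 else 0)"
          using True by (simp add: k_def side_def)
        have si: "side s = 1 \<or> side s = -1" for s by (simp add: side_def)
        show "chain_boundary 1 ?c = 0"
          using si[of "?t 0"] si[of "?t 1"] t(2)[OF 01(1)] t(2)[OF 01(2)]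
          unfolding e' \<Delta>'[OF 01(1)] \<Delta>'[OF 01(2)] arc_def
          using chain_boundary_1_of[of f]
          by (auto simp: chain_boundary_add chain_boundary_diff chain_boundary_cmul chain_boundary_path so kf)
      qed
      then show ?thesis by (rule int_boundary_sub)
    next
      case False
      then have "f ` standard_simplex 1 \<subseteq> topspace Y - ?a" using n[of f] f unfolding y'_def by blast
      moreover have "topspace Y - ?a \<subseteq> rest" by (force simp: rest_def)
      ultimately have r: "?g r \<in> rest" if "r \<in> {0..1}" for r
        using simplex_path_image[of f] that by blast
      have "int_boundary Y (\<Delta> (point_simplex (?g r)))" if "r \<in> {0..1}" for r
      proof (rule int_boundary_constant)
        have "?g r \<in> topspace Y" using r[OF that] by (auto simp: rest_def)
        then show "singular_chain 1 (subtopology Y {?g r}) (\<Delta> (point_simplex (?g r)))"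
          using trace_rest[OF r[OF that]] pathin_trace by (simp add: \<Delta>_def singular_chain_path pathin_subtopology)
      qed
      then have "int_boundary Y (\<Delta> (point_simplex (?g 1)) - \<Delta> (point_simplex (?g 0)))"
        by (intro singular_relboundary_diff) auto
      then show ?thesis using False by (simp add: e_def k_def)
    qed
    then show "int_boundary Y (frag_of f - (e f + frag_cmul (k f) arc) + frag_extend \<Delta> (chain_boundary 1 (frag_of f)))"
      by (simp add: chain_boundary_1_of frag_extend_diff)
  qed
  have cb: "chain_boundary 1 y' = b + frag_cmul 2 b'"
    using chain_boundary_subdivision_power[OF y] subdivision_power_0[OF singular_chain_boundary[OF y, unfolded One_nat_def, simplified]]
    by (simp add: y'_def One_nat_def flip: b)
  have 1: "y' - frag_extend (\<lambda>f. e f + frag_cmul (k f) arc) y' + (frag_extend \<Delta> b + frag_cmul 2 (frag_extend \<Delta> b')) \<in> mod2_boundaries 1 Y"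
    using int_boundary_mod2[OF 0] unfolding cb frag_extend_add frag_extend_cmul .
  have 2: "int_boundary Y (frag_extend \<Delta> b)"
    using bE unfolding singular_chain_def
  proof (induction b rule: frag_induction)
    case (one f)
    then obtain v where v: "v \<in> rest" "v \<in> topspace Y" "f = point_simplex v" by (auto simp: singular_simplex_0)
    have "int_boundary Y (\<Delta> f)"
    proof (rule int_boundary_constant)
      show "singular_chain 1 (subtopology Y {v}) (\<Delta> f)"
        using trace_rest[OF v(1)] pathin_trace[OF v(2)] v by (simp add: \<Delta>_def singular_chain_path pathin_subtopology)
    qed
    then show ?case by simp
  qed (auto simp: frag_extend_diff intro: singular_relboundary_diff)
  have 3: "frag_cmul 2 (frag_extend \<Delta> b') \<in> mod2_boundaries 1 Y"
  proof (rule mod2_even, rule singular_chain_extend)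
    fix f assume "f \<in> Poly_Mapping.keys b'"
    then obtain v where "v \<in> topspace Y" "f = point_simplex v" using b'Y unfolding singular_chain_def singular_simplex_0 by blast
    then show "singular_chain 1 Y (\<Delta> f)" using pathin_trace by (simp add: \<Delta>_def singular_chain_path)
  qed
  have 4: "y' - y \<in> mod2_boundaries 1 Y" unfolding y'_def using mod2_boundary_subdivision[OF y] .
  have 5: "frag_extend (\<lambda>f. e f + frag_cmul (k f) arc) c = frag_extend e c + frag_cmul (coeff_sum k c) arc" for c
    using subset_UNIV
    by (induction c rule: frag_induction) (auto simp: frag_extend_diff coeff_sum_diff frag_cmul_diff_distrib)
  show thesis
  proof (rule that)
    show "singular_chain 1 (subtopology Y rest) (frag_extend e y')" by (rule singular_chain_extend) (rule eE)
    show "y - (frag_extend e y' + frag_cmul (coeff_sum k y') arc) \<in> mod2_boundaries 1 Y"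
      using mod2_diff[OF mod2_diff[OF mod2_diff[OF 1 int_boundary_mod2[OF 2]] 3] 4] unfolding 5 by (simp add: algebra_simps)
  qed
qed

lemma continuous_map_clamp:
  assumes "continuous_on {-2<..<2} h" "h ` {-2<..<2} \<subseteq> {-2<..<2}" "J \<subseteq> \<theta> ` {-2<..<2}"
  shows "continuous_map (subtopology Y J) Y (\<lambda>v. \<theta> (h (\<iota> v)))"
proof -
  have i: "continuous_map (subtopology Y J) (top_of_set {-2<..<2}) \<iota>"
    using continuous_map_from_subtopology_mono[OF inv assms(3)] assms(3) inv_eq
    by (auto simp: continuous_map_in_subtopology)
  have h: "continuous_map (top_of_set {-2<..<2}) (top_of_set {-2<..<2}) h"
    using assms by (auto simp: continuous_map_in_subtopology)
  show ?thesis using continuous_map_compose[OF continuous_map_compose[OF i h] cont] by (simp add: o_def)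
qed

text \<open>Without its midpoint the arc falls into two halves, each of which is pushed to its own
  end while the collars stay fixed.\<close>

definition retract :: "'a \<Rightarrow> 'a" where
  "retract v = (if v \<in> \<theta> ` {-2<..<0} then \<theta> (min (-1) (\<iota> v)) else if v \<in> \<theta> ` {0<..<2} then \<theta> (max 1 (\<iota> v)) else v)"

lemma retract_rest: "v \<in> rest \<Longrightarrow> retract v = v"
proof -
  assume v: "v \<in> rest"
  show ?thesis
  proof (cases "v \<in> \<theta> ` {-2<..<2}")
    case True
    then obtain t where t: "v = \<theta> t" "t \<in> {-2<..<2}" by auto
    then have "\<not> \<bar>t\<bar> < 1" using v rest_iff by auto
    then show ?thesis using t theta_half_iff[OF t(2)] by (auto simp: retract_def inv_eq)
  next
    case False
    then show ?thesis using theta_sub(2,3) by (auto simp: retract_def)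
  qed
qed

lemma continuous_map_retract:
  "continuous_map (subtopology Y (topspace Y - {\<theta> 0})) (subtopology Y rest) retract"
proof -
  let ?M = "topspace Y - {\<theta> 0}"
  let ?T = "\<lambda>i. if i = (0::nat) then \<theta> ` {-2<..<0} else if i = 1 then \<theta> ` {0<..<2} else topspace Y - \<theta> ` {-1..1}"
  let ?f = "\<lambda>i v. if i = (0::nat) then \<theta> (min (-1) (\<iota> v)) else if i = 1 then \<theta> (max 1 (\<iota> v)) else v"
  have "continuous_map (subtopology Y ?M) Y retract"
  proof (rule pasting_lemma[where I = "{0,1,2}" and T = ?T and f = ?f])
    have "\<theta> 0 \<in> \<theta> ` {-1..1}" by auto
    then have TM: "?T i \<subseteq> ?M" for i
      using theta_image_avoids[OF theta_sub(2)] theta_image_avoids[OF theta_sub(3)] by auto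
    show "openin (subtopology Y ?M) (?T i)" if "i \<in> {0,1,2}" for i
    proof -
      have "openin Y (?T i)" using open_image[OF _ theta_sub(2)] open_image[OF _ theta_sub(3)] clo by auto
      then show ?thesis using TM by (metis openin_subtopology inf.absorb1)
    qed
    show "continuous_map (subtopology (subtopology Y ?M) (?T i)) Y (?f i)" if i: "i \<in> {0,1,2}" for i
    proof -
      consider "i = 0" | "i = 1" | "i = 2" using i by auto
      then show ?thesis
      proof cases
        case 1
        have "continuous_map (subtopology Y (?M \<inter> ?T i)) Y (\<lambda>v. \<theta> (min (-1) (\<iota> v)))"
          by (rule continuous_map_clamp[where h = "min (-1)"]) (use 1 in \<open>auto intro!: continuous_intros\<close>)
        then show ?thesis using 1 by (simp add: subtopology_subtopology)
      next
        case 2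
        have "continuous_map (subtopology Y (?M \<inter> ?T i)) Y (\<lambda>v. \<theta> (max 1 (\<iota> v)))"
          by (rule continuous_map_clamp[where h = "max 1"]) (use 2 in \<open>auto intro!: continuous_intros\<close>)
        then show ?thesis using 2 by (simp add: subtopology_subtopology)
      next
        case 3 then show ?thesis by (simp add: subtopology_subtopology)
      qed
    qed
    have r1: "retract v = ?f i v" if i: "i \<in> {0,1,2}" "v \<in> ?T i" for i v
    proof (cases "i = 2")
      case True
      then have "v \<in> rest" using i by (force simp: rest_def)
      then show ?thesis using retract_rest True by simp
    next
      case False
      then consider t where "i = 0" "v = \<theta> t" "t \<in> {-2<..<0}" | t where "i = 1" "v = \<theta> t" "t \<in> {0<..<2}"
        using i by auto
      then show ?thesis by cases (auto simp: retract_def theta_half_iff)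
    qed
    show "?f i x = ?f j x" if "i \<in> {0,1,2}" "j \<in> {0,1,2}" "x \<in> topspace (subtopology Y ?M) \<inter> ?T i \<inter> ?T j" for i j x
      using r1[OF that(1), of x] r1[OF that(2), of x] that(3) by auto
    show "\<exists>j. j \<in> {0,1,2} \<and> x \<in> ?T j \<and> retract x = ?f j x" if x: "x \<in> topspace (subtopology Y ?M)" for x
    proof -
      have "\<exists>j \<in> {0,1,2}. x \<in> ?T j"
      proof (cases "x \<in> \<theta> ` {-1..1}")
        case True
        then obtain t where t: "x = \<theta> t" "t \<in> {-1..1}" by auto
        then have "t \<noteq> 0" using x by auto
        then have "t < 0 \<or> t > 0" by auto
        then show ?thesis using t by (auto intro!: image_eqI)
      qed (use x in auto)
      then show ?thesis using r1 by blast
    qed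
  qed
  moreover have "retract ` ?M \<subseteq> rest"
  proof
    fix x assume "x \<in> retract ` ?M"
    then obtain v where v: "v \<in> ?M" "x = retract v" by auto
    show "x \<in> rest"
    proof (cases "v \<in> \<theta> ` {-2<..<2}")
      case True
      then obtain t where t: "v = \<theta> t" "t \<in> {-2<..<2}" by auto
      then have "t \<noteq> 0" using v by auto
      have "v \<in> \<theta> ` {-2<..<0} \<longleftrightarrow> t < 0" "v \<in> \<theta> ` {0<..<2} \<longleftrightarrow> t > 0"
        using theta_half_iff[OF t(2)] t by auto
      then show ?thesis using t v(2) \<open>t \<noteq> 0\<close> rest_iff[of "min (-1) t"] rest_iff[of "max 1 t"]
        by (auto simp: retract_def inv_eq)
    next
      case False
      then have "retract v = v" using theta_sub(2,3) by (auto simp: retract_def)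
      then show ?thesis using v False theta_sub(1) by (auto simp: rest_def)
    qed
  qed
  ultimately show ?thesis by (auto simp: continuous_map_in_subtopology)
qed

text \<open>A chain bounded by \<open>e\<close> is divided into a part \<open>w1\<close> in the open
  arc and a part \<open>w0\<close> off its midpoint. Modulo 2 the boundary of \<open>w1\<close> lies
  in both, that is in two contractible half arcs, and hence bounds there. So \<open>e\<close> bounds
  off the midpoint, and the retraction carries this to \<open>rest\<close>, where it fixes
  \<open>e\<close>.\<close>

lemma injective:
  assumes e: "e \<in> mod2_cycles 1 (subtopology Y rest)" and eb: "e \<in> mod2_boundaries 1 Y"
  shows "e \<in> mod2_boundaries 1 (subtopology Y rest)"
proof -
  let ?O = "\<theta> ` {-1<..<1}" and ?M = "topspace Y - {\<theta> 0}"
  obtain w f where w: "e = chain_boundary 2 w + frag_cmul 2 f" "singular_chain 2 Y w" "singular_chain 1 Y f"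
    using eb by (auto simp: mod2_boundaries_def numeral_2_eq_2 One_nat_def)
  have cl0: "openin Y ?M"
  proof -
    have "?M = (topspace Y - \<theta> ` {-1..1}) \<union> (\<theta> ` ({-2<..<0} \<union> {0<..<2}))"
    proof (intro equalityI subsetI)
      fix x assume x: "x \<in> ?M"
      show "x \<in> (topspace Y - \<theta> ` {-1..1}) \<union> (\<theta> ` ({-2<..<0} \<union> {0<..<2}))"
      proof (cases "x \<in> \<theta> ` {-1..1}")
        case True
        then obtain t where "x = \<theta> t" "t \<in> {-1..1}" by auto
        then show ?thesis using x by (cases "t = 0") auto
      qed (use x in auto)
    next
      fix x assume x: "x \<in> (topspace Y - \<theta> ` {-1..1}) \<union> (\<theta> ` ({-2<..<0} \<union> {0<..<2}))"
      have "\<theta> 0 \<in> \<theta> ` {-1..1}" by auto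
      then show "x \<in> ?M"
        using x theta_image_avoids[OF theta_sub(2)] theta_image_avoids[OF theta_sub(3)] by auto
    qed
    moreover have "openin Y (\<theta> ` ({-2<..<0} \<union> {0<..<2}))" by (rule open_image) auto
    ultimately show ?thesis using clo by auto
  qed
  obtain n where n: "\<And>h. h \<in> Poly_Mapping.keys ((singular_subdivision 2 ^^ n) w) \<Longrightarrow>
     \<exists>V\<in>{?O, ?M}. h ` standard_simplex 2 \<subseteq> V"
  proof (rule subdivide_arc[OF w(2)])
    show "openin Y t" if "t \<in> {?O, ?M}" for t using that open_image[OF _ theta_sub(1)] cl0 by auto
    show "topspace Y \<subseteq> \<Union>{?O, ?M}" by (auto intro!: image_eqI[of _ _ 0])
  qed blast
  let ?Sd = "\<lambda>p. singular_subdivision p ^^ n"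
  have ec: "singular_chain 1 (subtopology Y rest) e" using e by (simp add: mod2_cycles_def)
  define e' where "e' = ?Sd 1 e"
  have e'c: "singular_chain 1 (subtopology Y rest) e'" unfolding e'_def by (rule singular_chain_subdivision_power[OF ec])
  have restM: "rest \<subseteq> ?M" by (auto simp: rest_def intro!: image_eqI[of _ _ 0])
  have e'M: "singular_chain 1 (subtopology Y ?M) e'" using e'c restM singular_chain_mono by blast
  have "chain_boundary 2 (?Sd 2 w) = ?Sd 1 (chain_boundary 2 w)"
    using chain_boundary_subdivision_power[OF w(2)] by (simp add: One_nat_def)
  then have e'eq: "e' = chain_boundary 2 (?Sd 2 w) + frag_cmul 2 (?Sd 1 f)"
    unfolding e'_def w(1) by (simp add: subdivision_power_add subdivision_power_double)
  have kw: "Poly_Mapping.keys (?Sd 2 w) \<subseteq> singular_simplex_set 2 (subtopology Y ?O) \<union> singular_simplex_set 2 (subtopology Y ?M)"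
    using n singular_chain_subdivision_power[OF w(2), of n]
    by (fastforce simp: singular_chain_def singular_simplex_subtopology)
  obtain w1 w0 where w10: "Poly_Mapping.keys w1 \<subseteq> singular_simplex_set 2 (subtopology Y ?O)"
    "Poly_Mapping.keys w0 \<subseteq> singular_simplex_set 2 (subtopology Y ?M)" "w1 + w0 = ?Sd 2 w"
    using frag_split[OF kw] by blast
  have w1c: "singular_chain 2 (subtopology Y ?O) w1" and w0c: "singular_chain 2 (subtopology Y ?M) w0"
    using w10 by (auto simp: singular_chain_def)
  let ?c = "chain_boundary 2 w1"
  obtain c' c'' where c: "?c = c' + frag_cmul 2 c''" "Poly_Mapping.keys c' = {\<sigma>. odd (Poly_Mapping.lookup ?c \<sigma>)}"
    "Poly_Mapping.keys c'' \<subseteq> Poly_Mapping.keys ?c" by (rule odd_part)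
  have cO: "singular_chain 1 (subtopology Y ?O) ?c" using singular_chain_boundary[OF w1c] by (simp add: One_nat_def)
  have b0M: "singular_chain 1 (subtopology Y ?M) (chain_boundary 2 w0)" using singular_chain_boundary[OF w0c] by (simp add: One_nat_def)
  have ceq: "?c = e' - chain_boundary 2 w0 - frag_cmul 2 (?Sd 1 f)"
    unfolding e'eq w10(3)[symmetric] by (simp add: chain_boundary_add)
  have c'O: "Poly_Mapping.keys c' \<subseteq> singular_simplex_set 1 (subtopology Y ?O)"
  proof -
    have "Poly_Mapping.keys c' \<subseteq> Poly_Mapping.keys ?c" unfolding c(2) by (auto simp: in_keys_iff)
    then show ?thesis using cO unfolding singular_chain_def by blast
  qed
  \<comment> \<open>A simplex of odd coefficient in the boundary of \<open>w1\<close> cannot be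
    cancelled by an even chain alone; it occurs in \<open>e'\<close> or in the boundary of
    \<open>w0\<close> and so misses the midpoint.\<close>
  have c'M: "Poly_Mapping.keys c' \<subseteq> singular_simplex_set 1 (subtopology Y ?M)"
  proof
    fix \<sigma> assume "\<sigma> \<in> Poly_Mapping.keys c'"
    then have "odd (Poly_Mapping.lookup (e' - chain_boundary 2 w0 - frag_cmul 2 (?Sd 1 f)) \<sigma>)"
      unfolding c(2) ceq by simp
    then have "\<sigma> \<in> Poly_Mapping.keys e' \<or> \<sigma> \<in> Poly_Mapping.keys (chain_boundary 2 w0)"
      by (auto simp: lookup_minus in_keys_iff)
    then show "\<sigma> \<in> singular_simplex_set 1 (subtopology Y ?M)"
      using e'M b0M by (auto simp: singular_chain_def)
  qed
  let ?H = "subtopology Y (?O \<inter> ?M)"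
  have c'H: "singular_chain 1 ?H c'"
    unfolding singular_chain_def
  proof
    fix \<sigma> assume "\<sigma> \<in> Poly_Mapping.keys c'"
    then have "singular_simplex 1 (subtopology Y ?O) \<sigma>" "singular_simplex 1 (subtopology Y ?M) \<sigma>"
      using c'O c'M by blast+
    then show "\<sigma> \<in> singular_simplex_set 1 ?H" by (simp add: singular_simplex_subtopology)
  qed
  have "c' \<in> mod2_boundaries 1 ?H"
  \<comment> \<open>The pieces are the two open halves of the arc, told apart by the sign of the
    coordinate; a path off the midpoint cannot change this sign.\<close>
  proof (rule mod2_cycles_contractible_pieces[where Q = "\<lambda>x. if \<iota> x < 0 then \<theta> ` {-1<..<0} else \<theta> ` {0<..<1}"])
    have "{-1<..<1} - {0} = {-1<..<0} \<union> {0<..<(1::real)}" by auto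
    then have OM: "?O \<inter> ?M = \<theta> ` {-1<..<0} \<union> \<theta> ` {0<..<1}"
      using theta_image_punctured[OF theta_sub(1)] by (simp add: image_Un)
    have tH: "topspace ?H = \<theta> ` {-1<..<0} \<union> \<theta> ` {0<..<1}" unfolding OM using theta_top by auto
    let ?Q = "\<lambda>x. if \<iota> x < 0 then \<theta> ` {-1<..<0} else \<theta> ` {0<..<1}"
    show Qx: "x \<in> ?Q x" if "x \<in> topspace ?H" for x using that unfolding tH by (auto simp: inv_eq)
    show Qs: "?Q x \<subseteq> topspace ?H" for x unfolding tH by auto
    show "contractible_space (subtopology ?H (?Q x))" for x
    proof -
      have "?O \<inter> ?M \<inter> ?Q x = ?Q x" unfolding OM by auto
      then show ?thesis using contractible_image[OF _ theta_sub(4)] contractible_image[OF _ theta_sub(5)]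
        by (auto simp: subtopology_subtopology)
    qed
    fix g assume g: "pathin ?H g"
    have gin: "g t \<in> \<theta> ` {-1<..<0} \<union> \<theta> ` {0<..<1}" if "t \<in> {0..1}" for t
      using g that unfolding tH[symmetric] by (auto simp: pathin_def continuous_map_def)
    have "continuous_map ?H euclideanreal \<iota>"
      by (rule continuous_map_from_subtopology_mono[OF inv]) auto
    then have "continuous_on {0..1} (\<iota> \<circ> g)"
      using continuous_map_compose[OF g[unfolded pathin_def]] by fastforce
    then have conn: "connected ((\<iota> \<circ> g) ` {0..1})" by (rule connected_continuous_image) simp
    have nz: "(\<iota> \<circ> g) t \<noteq> 0" if "t \<in> {0..1}" for t using gin[OF that] inv_eq by auto
    have same: "(\<iota> \<circ> g) t < 0 \<longleftrightarrow> (\<iota> \<circ> g) 0 < 0" if t: "t \<in> {0..1}" for t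
    proof (rule ccontr)
      assume "((\<iota> \<circ> g) t < 0) \<noteq> ((\<iota> \<circ> g) 0 < 0)"
      then have "(\<iota> \<circ> g) t \<le> 0 \<and> 0 \<le> (\<iota> \<circ> g) 0 \<or> (\<iota> \<circ> g) 0 \<le> 0 \<and> 0 \<le> (\<iota> \<circ> g) t" by auto
      moreover have "(\<iota> \<circ> g) t \<in> (\<iota> \<circ> g) ` {0..1}" "(\<iota> \<circ> g) 0 \<in> (\<iota> \<circ> g) ` {0..1}" using t by auto
      ultimately have "0 \<in> (\<iota> \<circ> g) ` {0..1}" using conn unfolding connected_iff_interval by blast
      then show False using nz by auto
    qed
    have "g ` {0..1} \<subseteq> ?Q (g 0)"
    proof
      fix x assume "x \<in> g ` {0..1}"
      then obtain t where t: "t \<in> {0..1}" "x = g t" by auto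
      show "x \<in> ?Q (g 0)" using gin[OF t(1)] same[OF t(1)] t(2) by (auto simp: inv_eq)
    qed
    then show "g ` {0..1} \<subseteq> ?Q (g 0) \<and> ?Q (g 1) = ?Q (g 0)" using same[of 1] by auto
  next
    have "chain_boundary 1 ?c = 0"
      using chain_boundary_boundary[OF w1c] by (simp add: One_nat_def numeral_2_eq_2)
    then have "chain_boundary 1 c' = frag_cmul 2 (- chain_boundary 1 c'')"
      unfolding c(1) chain_boundary_add chain_boundary_cmul by (simp add: frag_cmul_2 eq_neg_iff_add_eq_0 algebra_simps)
    then show "c' \<in> mod2_cycles 1 ?H" using c'H unfolding mod2_cycles_def by blast
  qed
  then have c'B: "c' \<in> mod2_boundaries 1 (subtopology Y ?M)" by (rule mod2_boundaries_mono[rotated]) simp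
  have w0B: "chain_boundary 2 w0 \<in> mod2_boundaries 1 (subtopology Y ?M)"
    using w0c by (intro int_boundary_mod2) (auto simp: singular_boundary numeral_2_eq_2 One_nat_def)
  have rem: "e' - chain_boundary 2 w0 - c' = frag_cmul 2 (c'' + ?Sd 1 f)"
    using ceq c(1) by (simp add: frag_cmul_distrib2 algebra_simps)
  have "singular_chain 1 (subtopology Y ?M) (frag_cmul 2 (c'' + ?Sd 1 f))"
    unfolding rem[symmetric] using e'M b0M c'M by (intro singular_chain_diff) (auto simp: singular_chain_def)
  then have "singular_chain 1 (subtopology Y ?M) (c'' + ?Sd 1 f)"
    unfolding singular_chain_def by (auto simp: in_keys_iff)
  then have "e' - chain_boundary 2 w0 - c' \<in> mod2_boundaries 1 (subtopology Y ?M)"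
    unfolding rem by (rule mod2_even)
  from mod2_add[OF mod2_add[OF this c'B] w0B] have "e' \<in> mod2_boundaries 1 (subtopology Y ?M)" by simp
  then have "chain_map 1 retract e' \<in> mod2_boundaries 1 (subtopology Y rest)"
    using mod2_boundaries_image continuous_map_retract by blast
  moreover have "chain_map 1 retract e' = e'"
    by (rule chain_map_id_gen[OF e'c]) (use retract_rest in auto)
  ultimately show ?thesis
    unfolding e'_def using mod2_boundary_subdivision_iff[OF ec] by auto
qed

text \<open>Wrapping the arc once around the unit circle and sending everything else to 1 gives a
  map whose winding cochain vanishes on \<open>rest\<close> and is 1 on the arc. On boundaries
  modulo 2 it is even.\<close>

lemma arc_parity:
  assumes e: "singular_chain 1 (subtopology Y rest) e" and b: "e + frag_cmul n arc \<in> mod2_boundaries 1 Y"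
  shows "even n"
proof -
  \<comment> \<open>The parameter is clamped to the interval from -1 to 1 and its angle runs from 0
    to 2 pi, so the collars go to 1 and the formula fits the constant outside.\<close>
  define f where "f v = (if v \<in> \<theta> ` {-2<..<2} then exp (\<i> * of_real (pi * (max (-1) (min 1 (\<iota> v)) + 1))) else 1)" for v
  have f1: "f v = 1" if "v \<in> rest" for v
  proof (cases "v \<in> \<theta> ` {-2<..<2}")
    case True
    then obtain t where t: "v = \<theta> t" "t \<in> {-2<..<2}" "\<not> \<bar>t\<bar> < 1" using \<open>v \<in> rest\<close> rest_iff by auto
    then have "max (-1) (min 1 t) = -1 \<or> max (-1) (min 1 t) = 1" by auto
    moreover have "exp (\<i> * of_real (pi * (1 + 1))) = 1" using exp_two_pi_i by (simp add: mult.commute)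
    ultimately show ?thesis using t by (auto simp: f_def inv_eq)
  qed (simp add: f_def)
  define T where "T i = (if i then \<theta> ` {-2<..<2} else topspace Y - \<theta> ` {-1..1})" for i
  define F where "F i v = (if i then exp (\<i> * of_real (pi * (max (-1) (min 1 (\<iota> v)) + 1))) else 1)" for i v
  have r: "f x = F i x" if "x \<in> T i" for i x
  proof (cases i)
    case True then show ?thesis using that by (simp add: f_def F_def T_def)
  next
    case False
    then have "x \<in> rest" using that by (force simp: rest_def T_def)
    then show ?thesis using False f1 by (simp add: F_def)
  qed
  have fc: "continuous_map Y euclidean f"
  proof (rule pasting_lemma[where I = UNIV and T = T and f = F])
    show "openin Y (T i)" for i using op clo by (auto simp: T_def)
    have "continuous_map euclideanreal euclidean (\<lambda>t. exp (\<i> * of_real (pi * (max (-1) (min 1 t) + 1))))"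
      by (simp, intro continuous_intros)
    from continuous_map_compose[OF inv this]
    show "continuous_map (subtopology Y (T i)) euclidean (F i)" for i
      by (cases i) (auto simp: o_def F_def[abs_def] T_def)
    show "F i x = F j x" if "x \<in> topspace Y \<inter> T i \<inter> T j" for i j x
      using r[of x i] r[of x j] that by auto
    show "\<exists>j. j \<in> UNIV \<and> x \<in> T j \<and> f x = F j x" if "x \<in> topspace Y" for x
    proof -
      have "x \<in> T True \<or> x \<in> T False" using that by (force simp: T_def)
      then show ?thesis using r by blast
    qed
  qed
  have fnz: "f v \<noteq> 0" for v by (simp add: f_def)
  have 1: "even (coeff_sum (wind f) (e + frag_cmul n arc))"
    by (rule wind_mod2_boundary[OF fc _ b]) (rule fnz)
  have "wind f \<sigma> = 0" if "\<sigma> \<in> Poly_Mapping.keys e" for \<sigma>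
  proof -
    have "singular_simplex 1 (subtopology Y rest) \<sigma>" using e that by (auto simp: singular_chain_def)
    then obtain g where g: "pathin (subtopology Y rest) g" "\<sigma> = path_simplex g" using pathin_simplex_path by metis
    show ?thesis unfolding g(2) by (rule wind_cut[OF fc]) (use g(1) f1 in \<open>auto simp: pathin_subtopology\<close>)
  qed
  then have 2: "coeff_sum (wind f) e = 0" by (simp add: coeff_sum_def)
  have fth: "(f \<circ> (\<lambda>t. \<theta> (2 * t - 1))) t = exp (of_real t * (2 * of_real pi * \<i>))" if "t \<in> {0..1}" for t
  proof -
    have "2 * t - 1 \<in> {-2<..<2}" "max (-1) (min 1 (2*t - 1)) = 2 * t - 1" using that by auto
    then show ?thesis by (auto simp: f_def inv_eq algebra_simps)
  qed
  have "Im (of_real 1 * (2 * of_real pi * \<i>) - of_real 0 * (2 * of_real pi * \<i>)) =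
      Arg ((f \<circ> (\<lambda>t. \<theta> (2 * t - 1))) 1) - Arg ((f \<circ> (\<lambda>t. \<theta> (2 * t - 1))) 0) + 2 * pi * of_int (turn (f \<circ> (\<lambda>t. \<theta> (2 * t - 1))))"
    by (rule turn_eq[where q = "\<lambda>t. of_real t * (2 * of_real pi * \<i>)"]) (use fth in \<open>auto intro!: continuous_intros\<close>)
  moreover have "(f \<circ> (\<lambda>t. \<theta> (2 * t - 1))) 1 = (f \<circ> (\<lambda>t. \<theta> (2 * t - 1))) 0"
    using fth[of 0] fth[of 1] exp_two_pi_i by simp
  ultimately have "turn (f \<circ> (\<lambda>t. \<theta> (2 * t - 1))) = 1" by (simp del: o_apply)
  then have "coeff_sum (wind f) arc = 1" unfolding arc_def coeff_sum_of wind_path .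
  then show ?thesis using 1 2 by (simp add: coeff_sum_add coeff_sum_cmul)
qed

end

section \<open>Dimensions over the field with two elements\<close>

context comm_group begin

abbreviation fprod :: "'a set \<Rightarrow> 'a" where "fprod T \<equiv> finprod G (\<lambda>x. x) T"

lemma fprod_closed: "T \<subseteq> carrier G \<Longrightarrow> fprod T \<in> carrier G"
  by (rule finprod_closed) auto

text \<open>Symmetric difference is the addition of coefficient vectors over the field with two
  elements: the factors in the intersection occur twice and cancel.\<close>

lemma fprod_sym_diff:
  assumes two: "\<And>x. x \<in> carrier G \<Longrightarrow> x \<otimes> x = \<one>"
    and S: "finite S" "S \<subseteq> carrier G" and T: "finite T" "T \<subseteq> carrier G"
  shows "fprod ((S - T) \<union> (T - S)) = fprod S \<otimes> fprod T"
proof -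
  have s: "fprod S = fprod (S - T) \<otimes> fprod (S \<inter> T)"
    using finprod_Un_disjoint[of "S - T" "S \<inter> T" "\<lambda>x. x"] S by (simp add: Un_Diff_Int) (auto simp: Pi_def)
  have t: "fprod T = fprod (T - S) \<otimes> fprod (S \<inter> T)"
    using finprod_Un_disjoint[of "T - S" "T \<inter> S" "\<lambda>x. x"] T by (simp add: Un_Diff_Int Int_commute[of S]) (auto simp: Pi_def)
  have st: "fprod ((S - T) \<union> (T - S)) = fprod (S - T) \<otimes> fprod (T - S)"
    by (rule finprod_Un_disjoint) (use S T in auto)
  have c: "fprod (S - T) \<in> carrier G" "fprod (T - S) \<in> carrier G" "fprod (S \<inter> T) \<in> carrier G"
    by (rule fprod_closed; use S T in auto)+
  have "fprod S \<otimes> fprod T = (fprod (S - T) \<otimes> fprod (T - S)) \<otimes> (fprod (S \<inter> T) \<otimes> fprod (S \<inter> T))"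
    unfolding s t using c by (simp add: m_ac)
  then show ?thesis using c two st by simp
qed

text \<open>Zorn's lemma gives a maximal family in which no nonempty finite product is one. Two
  representations of an element would yield such a product over their symmetric difference, and an
  element without representation could be added to the family.\<close>

lemma Z2_basis_exists:
  assumes two: "\<And>x. x \<in> carrier G \<Longrightarrow> x \<otimes> x = \<one>"
  obtains B where "Z2_basis G B"
proof -
  define ind where "ind = {B. B \<subseteq> carrier G \<and> (\<forall>T. finite T \<and> T \<subseteq> B \<and> T \<noteq> {} \<longrightarrow> fprod T \<noteq> \<one>)}"
  have "\<exists>M\<in>ind. \<forall>X\<in>ind. M \<subseteq> X \<longrightarrow> X = M"
  proof (rule subset_Zorn_nonempty)
    show "ind \<noteq> {}" by (auto simp: ind_def intro!: exI[of _ "{}"])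
    fix C assume C: "C \<noteq> {}" "subset.chain ind C"
    then have ch: "C \<subseteq> ind" "\<And>x y. x \<in> C \<Longrightarrow> y \<in> C \<Longrightarrow> x \<subseteq> y \<or> y \<subseteq> x"
      by (auto simp: subset_chain_def)
    show "\<Union>C \<in> ind" unfolding ind_def
    proof (intro CollectI conjI allI impI)
      show "\<Union>C \<subseteq> carrier G" using ch by (auto simp: ind_def)
      fix T assume T: "finite T \<and> T \<subseteq> \<Union>C \<and> T \<noteq> {}"
      then obtain Y where "Y \<in> C" "T \<subseteq> Y"
        using finite_subset_Union_chain[of T C ind] C by blast
      then show "fprod T \<noteq> \<one>" using T ch by (auto simp: ind_def)
    qed
  qed
  then obtain B where B: "B \<in> ind" "\<And>X. X \<in> ind \<Longrightarrow> B \<subseteq> X \<Longrightarrow> X = B" by blast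
  have Bc: "B \<subseteq> carrier G" and Bi: "\<And>T. finite T \<Longrightarrow> T \<subseteq> B \<Longrightarrow> T \<noteq> {} \<Longrightarrow> fprod T \<noteq> \<one>"
    using B(1) by (auto simp: ind_def)
  have "inj_on fprod {T. finite T \<and> T \<subseteq> B}"
  proof (rule inj_onI)
    fix S T assume ST: "S \<in> {T. finite T \<and> T \<subseteq> B}" "T \<in> {T. finite T \<and> T \<subseteq> B}" "fprod S = fprod T"
    then have c: "S \<subseteq> carrier G" "T \<subseteq> carrier G" using Bc by auto
    then have "fprod ((S - T) \<union> (T - S)) = fprod S \<otimes> fprod T"
      using ST by (intro fprod_sym_diff two) auto
    also have "\<dots> = \<one>" using ST(3) two fprod_closed[OF c(2)] by simp
    finally have "(S - T) \<union> (T - S) = {}" using Bi[of "(S - T) \<union> (T - S)"] ST by auto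
    then show "S = T" by auto
  qed
  moreover have "fprod ` {T. finite T \<and> T \<subseteq> B} = carrier G"
  proof (intro equalityI subsetI)
    fix x assume x: "x \<in> carrier G"
    show "x \<in> fprod ` {T. finite T \<and> T \<subseteq> B}"
    proof (rule ccontr)
      assume n: "x \<notin> fprod ` {T. finite T \<and> T \<subseteq> B}"
      have xB: "x \<notin> B"
      proof
        assume "x \<in> B"
        moreover have "fprod {x} = x" using x by simp
        ultimately show False using n by (metis (mono_tags, lifting) empty_subsetI finite.emptyI finite.insertI image_eqI insert_subset mem_Collect_eq)
      qed
      have "insert x B \<in> ind" unfolding ind_def
      proof (intro CollectI conjI allI impI)
        show "insert x B \<subseteq> carrier G" using x Bc by auto
        fix T assume T: "finite T \<and> T \<subseteq> insert x B \<and> T \<noteq> {}"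
        show "fprod T \<noteq> \<one>"
        proof (cases "x \<in> T")
          case True
          let ?T = "T - {x}"
          have T': "finite ?T" "?T \<subseteq> B" "x \<notin> ?T" using T by auto
          have "fprod (insert x ?T) = x \<otimes> fprod ?T"
            using T' Bc x by (intro finprod_insert) auto
          moreover have "insert x ?T = T" using True by auto
          moreover have "x \<otimes> fprod ?T \<noteq> \<one>"
          proof
            assume a: "x \<otimes> fprod ?T = \<one>"
            have c: "fprod ?T \<in> carrier G" using T' Bc by (intro fprod_closed) auto
            have "x \<otimes> (x \<otimes> fprod ?T) = fprod ?T" using two[OF x] c x by (simp flip: m_assoc)
            then have "x = fprod ?T" using a x by simp
            then show False using n T' by auto
          qed
          ultimately show ?thesis by simp
        next
          case False
          then show ?thesis using T Bi by blast
        qed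
      qed
      then show False using B(2)[of "insert x B"] xB by blast
    qed
  qed (use fprod_closed Bc in auto)
  ultimately have "Z2_basis G B" using Bc by (simp add: Z2_basis_def bij_betw_def)
  then show thesis by (rule that)
qed

text \<open>The elements correspond to the finite subsets of a basis. In the infinite case the basis
  is infinite as well, and its cardinality as a natural number is 0 by convention.\<close>

lemma Z2_dim_card:
  assumes two: "\<And>x. x \<in> carrier G \<Longrightarrow> x \<otimes> x = \<one>"
  shows "finite (carrier G) \<Longrightarrow> card (carrier G) = 2 ^ Z2_dim G" "infinite (carrier G) \<Longrightarrow> Z2_dim G = 0"
proof -
  define B where "B = (SOME B. Z2_basis G B)"
  have B: "Z2_basis G B" unfolding B_def using Z2_basis_exists[OF two] by (metis someI)
  then have bij: "bij_betw fprod {T. finite T \<and> T \<subseteq> B} (carrier G)" and Bc: "B \<subseteq> carrier G" by (auto simp: Z2_basis_def)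
  have d: "Z2_dim G = card B" by (simp add: Z2_dim_def B_def)
  have P: "{T. finite T \<and> T \<subseteq> B} = Pow B" if "finite B" using that finite_subset by auto
  show "card (carrier G) = 2 ^ Z2_dim G" if "finite (carrier G)"
  proof -
    have fB: "finite B" using Bc that finite_subset by auto
    then show ?thesis using bij_betw_same_card[OF bij] by (simp add: d P card_Pow)
  qed
  show "Z2_dim G = 0" if "infinite (carrier G)"
    using bij_betw_finite[OF bij] that P by (cases "finite B") (auto simp: d)
qed

end

text \<open>An infinite \<open>G\<close> has dimension 0, so only the finite case has content. There
  an infinite \<open>H\<close> has to be excluded, because its dimension would be 0, too.\<close>

lemma Z2_dim_le:
  assumes "comm_group G" "\<And>x. x \<in> carrier G \<Longrightarrow> x \<otimes>\<^bsub>G\<^esub> x = \<one>\<^bsub>G\<^esub>"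
    and "comm_group H" "\<And>x. x \<in> carrier H \<Longrightarrow> x \<otimes>\<^bsub>H\<^esub> x = \<one>\<^bsub>H\<^esub>"
    and "finite (carrier G) \<Longrightarrow> finite (carrier H) \<and> card (carrier G) \<le> card (carrier H)"
  shows "Z2_dim G \<le> Z2_dim H"
proof (cases "finite (carrier G)")
  case True
  then have "(2::nat) ^ Z2_dim G \<le> 2 ^ Z2_dim H"
    using comm_group.Z2_dim_card(1)[OF assms(1,2)] comm_group.Z2_dim_card(1)[OF assms(3,4)] assms(5) by simp
  then show ?thesis by (simp add: power_le_imp_le_exp)
next
  case False
  then show ?thesis using comm_group.Z2_dim_card(2)[OF assms(1,2)] by simp
qed

subsection \<open>Comparing homological defects\<close>

definition mod2_class :: "'a topology \<Rightarrow> 'a chain \<Rightarrow> 'a chain set" where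
  "mod2_class Y c = (\<lambda>b. b + c) ` mod2_boundaries 1 Y"

lemma mod2_class_eq: "mod2_class Y c = mod2_class Y d \<longleftrightarrow> c - d \<in> mod2_boundaries 1 Y"
proof
  assume "mod2_class Y c = mod2_class Y d"
  moreover have "c \<in> mod2_class Y c" unfolding mod2_class_def using mod2_zero by force
  ultimately obtain b where "b \<in> mod2_boundaries 1 Y" "c = b + d" by (auto simp: mod2_class_def)
  then show "c - d \<in> mod2_boundaries 1 Y" by simp
next
  assume cd: "c - d \<in> mod2_boundaries 1 Y"
  show "mod2_class Y c = mod2_class Y d" unfolding mod2_class_def
  proof (intro equalityI subsetI)
    fix x assume "x \<in> (\<lambda>b. b + c) ` mod2_boundaries 1 Y"
    then obtain b where "b \<in> mod2_boundaries 1 Y" "x = b + c" by auto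
    then show "x \<in> (\<lambda>b. b + d) ` mod2_boundaries 1 Y"
      using mod2_add[OF _ cd] by (intro image_eqI[of _ _ "b + (c - d)"]) auto
  next
    fix x assume "x \<in> (\<lambda>b. b + d) ` mod2_boundaries 1 Y"
    then obtain b where "b \<in> mod2_boundaries 1 Y" "x = b + d" by auto
    then show "x \<in> (\<lambda>b. b + c) ` mod2_boundaries 1 Y"
      using mod2_diff[OF _ cd] by (intro image_eqI[of _ _ "b - (c - d)"]) auto
  qed
qed

text \<open>The representatives of the kernel whose dimension is the homological defect; working
  with chains avoids maps between quotient groups.\<close>

definition null_cycles :: "'a topology \<Rightarrow> 'a set \<Rightarrow> 'a chain set" where
  "null_cycles X S = mod2_cycles 1 (subtopology X S) \<inter> mod2_boundaries 1 X"

lemma one_mod2: "\<one>\<^bsub>mod2_homology_group p X\<^esub> = mod2_boundaries p X"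
  by (simp add: mod2_homology_group_def FactGroup_def)

lemma mult_mod2_class: "mod2_class Y c \<otimes>\<^bsub>mod2_homology_group 1 Y\<^esub> mod2_class Y d = mod2_class Y (c + d)"
proof -
  have "mod2_class Y c \<otimes>\<^bsub>mod2_homology_group 1 Y\<^esub> mod2_class Y d = {a + b | a b. a \<in> mod2_class Y c \<and> b \<in> mod2_class Y d}"
    by (auto simp: mod2_homology_group_def FactGroup_def set_mult_def)
  also have "\<dots> = mod2_class Y (c + d)" unfolding mod2_class_def
  proof (intro equalityI subsetI)
    fix x assume "x \<in> {a + b |a b. a \<in> (\<lambda>b. b + c) ` mod2_boundaries 1 Y \<and> b \<in> (\<lambda>b. b + d) ` mod2_boundaries 1 Y}"
    then obtain a b where "a \<in> mod2_boundaries 1 Y" "b \<in> mod2_boundaries 1 Y" "x = (a + c) + (b + d)" by blast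
    then show "x \<in> (\<lambda>b. b + (c + d)) ` mod2_boundaries 1 Y"
      by (intro image_eqI[of _ _ "a + b"]) (auto simp: mod2_add algebra_simps)
  next
    fix x assume "x \<in> (\<lambda>b. b + (c + d)) ` mod2_boundaries 1 Y"
    then obtain a where "a \<in> mod2_boundaries 1 Y" "x = (a + c) + (0 + d)" by (auto simp: algebra_simps)
    then show "x \<in> {a + b |a b. a \<in> (\<lambda>b. b + c) ` mod2_boundaries 1 Y \<and> b \<in> (\<lambda>b. b + d) ` mod2_boundaries 1 Y}"
      using mod2_zero by blast
  qed
  finally show ?thesis .
qed

context
  fixes X :: "'a topology" and S :: "'a set"
begin

abbreviation (input) "HS \<equiv> mod2_homology_group 1 (subtopology X S)"
abbreviation (input) "ker \<equiv> kernel HS (mod2_homology_group 1 X) (mod2_hom_induced 1 X id)"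

lemma kernel_mod2: "ker = mod2_class (subtopology X S) ` null_cycles X S"
proof -
  have cm: "continuous_map (subtopology X S) X id" by (simp add: continuous_map_from_subtopology)
  have "mod2_hom_induced 1 X id (mod2_class (subtopology X S) c) = mod2_class X c"
    if "c \<in> mod2_cycles 1 (subtopology X S)" for c
  proof -
    have "chain_map 1 id c = c"
      by (rule chain_map_id_gen[of _ "subtopology X S"]) (use that in \<open>auto simp: mod2_cycles_def\<close>)
    then show ?thesis using mod2_hom_coset[OF cm, of 1 c] by (simp add: mod2_class_def)
  qed
  moreover have "mod2_class X c = mod2_boundaries 1 X \<longleftrightarrow> c \<in> mod2_boundaries 1 X" for c
    using mod2_class_eq[of X c 0] by (simp add: mod2_class_def)
  ultimately show ?thesis
    unfolding kernel_def carrier_mod2 one_mod2 null_cycles_def mod2_class_def[symmetric] by auto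
qed

lemma subgroup_kernel_mod2: "subgroup ker HS"
proof -
  interpret comm_group HS by (rule comm_group_mod2)
  show ?thesis
  proof (rule subgroupI)
    show "ker \<subseteq> carrier HS" by (auto simp: kernel_def)
    have "0 \<in> null_cycles X S" using mod2_zero subsetD[OF mod2_boundaries_cycles mod2_zero] by (auto simp: null_cycles_def)
    then show "ker \<noteq> {}" unfolding kernel_mod2 by auto
    fix a assume a: "a \<in> ker"
    then have ac: "a \<in> carrier HS" by (auto simp: kernel_def)
    have "inv\<^bsub>HS\<^esub> a = a" using mod2_order2[OF ac] ac by (simp add: inv_equality)
    then show "inv\<^bsub>HS\<^esub> a \<in> ker" using a by simp
    fix b assume b: "b \<in> ker"
    obtain c d where cd: "a = mod2_class (subtopology X S) c" "b = mod2_class (subtopology X S) d"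
      "c \<in> null_cycles X S" "d \<in> null_cycles X S" using a b unfolding kernel_mod2 by blast
    then have "c + d \<in> null_cycles X S" by (simp add: null_cycles_def mod2_cycles_add mod2_add)
    then show "a \<otimes>\<^bsub>HS\<^esub> b \<in> ker" unfolding cd mult_mod2_class kernel_mod2 by blast
  qed
qed

lemma defect_group:
  "comm_group (subgroup_generated HS ker)"
  "x \<in> carrier (subgroup_generated HS ker) \<Longrightarrow> x \<otimes>\<^bsub>subgroup_generated HS ker\<^esub> x = \<one>\<^bsub>subgroup_generated HS ker\<^esub>"
  "carrier (subgroup_generated HS ker) = mod2_class (subtopology X S) ` null_cycles X S"
proof -
  interpret comm_group HS by (rule comm_group_mod2)
  show "comm_group (subgroup_generated HS ker)" by (rule abelian_subgroup_generated) (rule comm_group_axioms)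
  have c: "carrier (subgroup_generated HS ker) = ker"
    by (rule subgroup.carrier_subgroup_generated_subgroup[OF subgroup_kernel_mod2])
  then show "carrier (subgroup_generated HS ker) = mod2_class (subtopology X S) ` null_cycles X S"
    using kernel_mod2 by simp
  show "x \<in> carrier (subgroup_generated HS ker) \<Longrightarrow> x \<otimes>\<^bsub>subgroup_generated HS ker\<^esub> x = \<one>\<^bsub>subgroup_generated HS ker\<^esub>"
    using mod2_order2[of x 1 "subtopology X S"] unfolding c by (simp add: subgroup_generated_def kernel_def)
qed

end

text \<open>Only cardinalities of kernels are compared. Hence \<open>f\<close> need not be additive,
  nor respect homology classes: it is applied to one chosen representative of each class, and has to
  separate the classes. The last assumption guards against the dimension 0 of infinite
  groups.\<close>

lemma homological_defect_le:
  assumes f: "\<And>c. c \<in> null_cycles X S \<Longrightarrow> f c \<in> null_cycles X T"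
    and inj: "\<And>c d. c \<in> null_cycles X S \<Longrightarrow> d \<in> null_cycles X S \<Longrightarrow>
       f c - f d \<in> mod2_boundaries 1 (subtopology X T) \<Longrightarrow> c - d \<in> mod2_boundaries 1 (subtopology X S)"
    and fin: "finite (mod2_class (subtopology X S) ` null_cycles X S) \<Longrightarrow>
       finite (mod2_class (subtopology X T) ` null_cycles X T)"
  shows "homological_defect X S \<le> homological_defect X T"
  unfolding homological_defect_def Let_def
proof (rule Z2_dim_le[OF defect_group(1,2) defect_group(1,2)], unfold defect_group(3))
  assume fi: "finite (mod2_class (subtopology X S) ` null_cycles X S)"
  let ?S = "mod2_class (subtopology X S)" and ?T = "mod2_class (subtopology X T)"
  define r where "r k = (SOME c. c \<in> null_cycles X S \<and> ?S c = k)" for k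
  have r: "r k \<in> null_cycles X S \<and> ?S (r k) = k" if "k \<in> ?S ` null_cycles X S" for k
  proof -
    have "\<exists>c. c \<in> null_cycles X S \<and> ?S c = k" using that by auto
    then show ?thesis unfolding r_def by (rule someI_ex)
  qed
  have "card (?S ` null_cycles X S) \<le> card (?T ` null_cycles X T)"
  proof (rule card_inj_on_le[where f = "\<lambda>k. ?T (f (r k))"])
    show "inj_on (\<lambda>k. ?T (f (r k))) (?S ` null_cycles X S)"
    proof (rule inj_onI)
      fix k l assume k: "k \<in> ?S ` null_cycles X S" and l: "l \<in> ?S ` null_cycles X S" and e: "?T (f (r k)) = ?T (f (r l))"
      then have "r k - r l \<in> mod2_boundaries 1 (subtopology X S)"
        using inj r[OF k] r[OF l] by (simp add: mod2_class_eq)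
      then show "k = l" using r[OF k] r[OF l] mod2_class_eq by metis
    qed
    show "(\<lambda>k. ?T (f (r k))) ` ?S ` null_cycles X S \<subseteq> ?T ` null_cycles X T" using r f by blast
  qed (rule fin[OF fi])
  then show "finite (?T ` null_cycles X T) \<and> card (?S ` null_cycles X S) \<le> card (?T ` null_cycles X T)" using fin[OF fi] by simp
qed

section \<open>Separation by null-homologous curves\<close>

subsection \<open>Charts\<close>

lemma chart_restrict:
  assumes ch: "chart X U \<phi>" and W: "openin X W" "W \<subseteq> U" shows "chart X W \<phi>"
proof -
  have "homeomorphic_map (subtopology (subtopology X U) W) (subtopology (top_of_set (\<phi> ` U)) (\<phi> ` W)) \<phi>"
  proof (rule homeomorphic_map_subtopologies)
    show "homeomorphic_map (subtopology X U) (top_of_set (\<phi> ` U)) \<phi>" using ch by (simp add: chart_def)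
    show "\<phi> ` (topspace (subtopology X U) \<inter> W) = topspace (top_of_set (\<phi> ` U)) \<inter> \<phi> ` W"
      using W chart_facts(2)[OF ch] by auto
  qed
  then have "homeomorphic_map (subtopology X W) (top_of_set (\<phi> ` W)) \<phi>"
    using W by (simp add: subtopology_subtopology Int_absorb1 Int_absorb2 image_mono)
  then show ?thesis using chart_facts(4)[OF ch W] W by (simp add: chart_def)
qed

lemma chart_inverse:
  assumes "chart X U \<phi>"
  shows "z \<in> \<phi> ` U \<Longrightarrow> inv_into U \<phi> z \<in> U" "z \<in> \<phi> ` U \<Longrightarrow> \<phi> (inv_into U \<phi> z) = z"
    "p \<in> U \<Longrightarrow> inv_into U \<phi> (\<phi> p) = p"
  using chart_facts(1)[OF assms] by (auto intro: inv_into_into f_inv_into_f)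

lemma continuous_map_chart_inverse:
  assumes "chart X U \<phi>" "Z \<subseteq> \<phi> ` U"
  shows "continuous_map (top_of_set Z) X (inv_into U \<phi>)"
  using chart_facts(5)[OF assms(1)] assms(2)
  by (metis continuous_map_from_subtopology_mono continuous_map_into_fulltopology)

lemma chart_preimage:
  assumes ch: "chart X U \<phi>" and "Z \<subseteq> \<phi> ` U"
  shows "{p \<in> U. \<phi> p \<in> Z} = inv_into U \<phi> ` Z"
proof (intro equalityI subsetI)
  fix p assume "p \<in> {p \<in> U. \<phi> p \<in> Z}"
  then show "p \<in> inv_into U \<phi> ` Z" using chart_inverse(3)[OF ch] by (metis (mono_tags, lifting) image_eqI mem_Collect_eq)
next
  fix p assume "p \<in> inv_into U \<phi> ` Z"
  then show "p \<in> {p \<in> U. \<phi> p \<in> Z}" using chart_inverse[OF ch] assms(2) by auto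
qed

lemma openin_chart_preimage:
  assumes ch: "chart X U \<phi>" and Z: "open Z" shows "openin X {p \<in> U. \<phi> p \<in> Z}"
proof -
  have "openin (subtopology X U) {p \<in> topspace (subtopology X U). \<phi> p \<in> Z}"
    by (rule openin_continuous_map_preimage[OF chart_facts(3)[OF ch]]) (use Z in simp)
  moreover have "{p \<in> topspace (subtopology X U). \<phi> p \<in> Z} = {p \<in> U. \<phi> p \<in> Z}" using chart_facts(2)[OF ch] by auto
  ultimately show ?thesis using ch openin_trans_full by (metis chart_def)
qed

lemma closedin_chart_preimage:
  assumes ch: "chart X U \<phi>" and "Hausdorff_space X" and Z: "compact Z" "Z \<subseteq> \<phi> ` U"
  shows "closedin X {p \<in> U. \<phi> p \<in> Z}"
proof -
  have "compactin (top_of_set Z) Z" using Z by (simp add: compactin_subtopology)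
  then have "compactin X (inv_into U \<phi> ` Z)"
    using image_compactin continuous_map_chart_inverse[OF ch Z(2)] by blast
  then show ?thesis using chart_preimage[OF ch Z(2)] assms(2) compactin_imp_closedin by metis
qed

lemma chart_disc_exists:
  assumes charts: "\<And>p. p \<in> topspace X \<Longrightarrow> \<exists>U \<phi>. chart X U \<phi> \<and> p \<in> U" and W: "openin X W" "p \<in> W"
  obtains U \<phi> r where "chart X U \<phi>" "p \<in> U" "U \<subseteq> W" "r > 0" "cball (\<phi> p :: complex) r \<subseteq> \<phi> ` U"
proof -
  obtain U \<phi> where U: "chart X U \<phi>" "p \<in> U" using charts W openin_subset by blast
  then have oUW: "openin X (U \<inter> W)" using W by (auto simp: chart_def)
  have ch: "chart X (U \<inter> W) \<phi>" using chart_restrict[OF U(1) oUW] by auto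
  then have "open (\<phi> ` (U \<inter> W))" by (simp add: chart_def)
  moreover have "\<phi> p \<in> \<phi> ` (U \<inter> W)" using U W by auto
  ultimately obtain r where "r > 0" "cball (\<phi> p) r \<subseteq> \<phi> ` (U \<inter> W)" using open_contains_cball by metis
  then show thesis using that[OF ch] U W by auto
qed

lemma subdivision_small:
  assumes "singular_chain p X c" "\<And>T. T \<in> \<C> \<Longrightarrow> openin X T" "topspace X \<subseteq> \<Union>\<C>"
  shows "\<exists>n. \<forall>k\<ge>n. \<forall>s \<in> Poly_Mapping.keys ((singular_subdivision p ^^ k) c). \<exists>T\<in>\<C>. s ` standard_simplex p \<subseteq> T"
proof (rule sufficient_iterated_singular_subdivision_exists[OF assms(2,3,1)])
  fix n assume "\<And>m f. n \<le> m \<Longrightarrow> f \<in> Poly_Mapping.keys ((singular_subdivision p ^^ m) c) \<Longrightarrow>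
      \<exists>V\<in>\<C>. f \<in> standard_simplex p \<rightarrow> V"
  then show ?thesis by (intro exI[of _ n]) (simp add: image_subset_iff_funcset)
qed

text \<open>The proof projects radially away from the centre \<open>p\<close> of the disc.\<close>

lemma mod2_boundary_avoid_disc:
  assumes ch: "chart X U \<phi>" and H: "Hausdorff_space X" and p: "p \<in> U" and r: "r > 0"
    and cb: "cball (\<phi> p) r \<subseteq> \<phi> ` U"
    and Q: "Q \<inter> {q \<in> U. \<phi> q \<in> cball (\<phi> p) r} = {}"
    and c: "singular_chain 1 (subtopology X S) c" "S \<inter> {q \<in> U. \<phi> q \<in> cball (\<phi> p) r} = {}" "S \<inter> Q = {}"
    and b: "c \<in> mod2_boundaries 1 (subtopology X (topspace X - insert p Q))"
  shows "c \<in> mod2_boundaries 1 (subtopology X (topspace X - ({q \<in> U. \<phi> q \<in> ball (\<phi> p) r} \<union> Q)))"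
proof -
  define C where "C = {q \<in> U. \<phi> q \<in> cball (\<phi> p) r}"
  define O' where "O' = {q \<in> U. \<phi> q \<in> ball (\<phi> p) r}"
  define f where "f i q = (if i then inv_into U \<phi> (\<phi> p + of_real r * sgn (\<phi> q - \<phi> p)) else q)" for i :: bool and q
  define \<rho> where "\<rho> q = f (q \<in> C) q" for q
  let ?P = "topspace X - insert p Q"
  have Cc: "closedin X C" unfolding C_def using closedin_chart_preimage[OF ch H _ cb] by simp
  have Oo: "openin X O'" unfolding O'_def by (rule openin_chart_preimage[OF ch open_ball])
  have OC: "O' \<subseteq> C" by (auto simp: C_def O'_def)
  have nz: "\<phi> q \<noteq> \<phi> p" if "q \<in> C" "q \<noteq> p" for q
    using that chart_inverse(3)[OF ch] p unfolding C_def by (metis (mono_tags, lifting) mem_Collect_eq)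
  have sph: "\<phi> p + of_real r * sgn (\<phi> q - \<phi> p) \<in> sphere (\<phi> p) r" if "q \<in> C" "q \<noteq> p" for q
    using nz[OF that] r by (simp add: dist_norm norm_mult norm_sgn)
  have cm: "continuous_map (subtopology X ?P) X \<rho>"
  proof (rule pasting_lemma_closed[where I = UNIV and T = "\<lambda>i. if i then ?P \<inter> C else ?P - O'" and f = f])
    show "closedin (subtopology X ?P) (if i then ?P \<inter> C else ?P - O')" for i :: bool
    proof (cases i)
      case True then show ?thesis using Cc by (simp add: closedin_subtopology_Int_closed)
    next
      case False
      have "?P - O' = ?P \<inter> (topspace X - O')" by auto
      moreover have "closedin X (topspace X - O')" using Oo openin_closedin_eq by blast
      ultimately show ?thesis using False by (simp add: closedin_subtopology_Int_closed)
    qed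
    show "continuous_map (subtopology (subtopology X ?P) (if i then ?P \<inter> C else ?P - O')) X (f i)" for i :: bool
    proof (cases i)
      case True
      have sub: "?P \<inter> C \<subseteq> U" by (auto simp: C_def)
      have "continuous_map (subtopology X (?P \<inter> C)) euclidean \<phi>"
        using continuous_map_from_subtopology_mono[OF chart_facts(3)[OF ch] sub] .
      moreover have "?P \<inter> C \<subseteq> topspace X" by auto
      moreover have "continuous_on (- {\<phi> p}) (\<lambda>z. \<phi> p + of_real r * sgn (z - \<phi> p))"
        by (intro continuous_intros) auto
      ultimately have "continuous_map (subtopology X (?P \<inter> C)) (top_of_set (-{\<phi> p})) \<phi>"
        "continuous_map (top_of_set (-{\<phi> p})) euclidean (\<lambda>z. \<phi> p + of_real r * sgn (z - \<phi> p))"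
        using nz by (auto simp: continuous_map_in_subtopology)
      from continuous_map_compose[OF this]
      have "continuous_map (subtopology X (?P \<inter> C)) (top_of_set (cball (\<phi> p) r)) (\<lambda>q. \<phi> p + of_real r * sgn (\<phi> q - \<phi> p))"
        using sph sphere_cball by (fastforce simp: continuous_map_in_subtopology o_def)
      from continuous_map_compose[OF this continuous_map_chart_inverse[OF ch cb]]
      show ?thesis using True by (simp add: f_def[abs_def] o_def subtopology_subtopology Int_absorb1)
    next
      case False
      then show ?thesis by (simp add: f_def[abs_def] subtopology_subtopology continuous_map_from_subtopology)
    qed
    have agree: "f True q = f False q" if "q \<in> C" "q \<notin> O'" for q
    proof -
      have "norm (\<phi> q - \<phi> p) = r" using that by (auto simp: C_def O'_def dist_norm norm_minus_commute)
      then have "of_real r * sgn (\<phi> q - \<phi> p) = \<phi> q - \<phi> p" using r by (auto simp: sgn_div_norm scaleR_conv_of_real field_simps)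
      then show ?thesis using chart_inverse(3)[OF ch] that by (simp add: f_def C_def)
    qed
    then show "f i x = f j x" if "x \<in> topspace (subtopology X ?P) \<inter> (if i then ?P \<inter> C else ?P - O') \<inter> (if j then ?P \<inter> C else ?P - O')" for i j x
      using that by (cases i; cases j) auto
    show "\<exists>j. j \<in> UNIV \<and> x \<in> (if j then ?P \<inter> C else ?P - O') \<and> \<rho> x = f j x" if "x \<in> topspace (subtopology X ?P)" for x
      using that OC by (intro exI[of _ "x \<in> C"]) (auto simp: \<rho>_def)
  qed simp
  have "\<rho> q \<notin> O' \<union> Q" if q: "q \<in> ?P" for q
  proof (cases "q \<in> C")
    case True
    then have s: "\<phi> p + of_real r * sgn (\<phi> q - \<phi> p) \<in> sphere (\<phi> p) r" using sph q by auto
    then have c: "\<phi> p + of_real r * sgn (\<phi> q - \<phi> p) \<in> \<phi> ` U" using cb sphere_cball by blast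
    have "\<phi> (\<rho> q) \<in> sphere (\<phi> p) r" "\<rho> q \<in> U"
      using True s chart_inverse[OF ch] c by (simp_all add: \<rho>_def f_def)
    then show ?thesis using Q by (auto simp: O'_def)
  next
    case False
    then show ?thesis using q OC by (auto simp: \<rho>_def f_def)
  qed
  moreover have "\<rho> q \<in> topspace X" if "q \<in> ?P" for q
    using cm that by (auto simp: continuous_map_def)
  ultimately have "continuous_map (subtopology X ?P) (subtopology X (topspace X - (O' \<union> Q))) \<rho>"
    using cm by (auto simp: continuous_map_in_subtopology)
  then have "chain_map 1 \<rho> c \<in> mod2_boundaries 1 (subtopology X (topspace X - (O' \<union> Q)))"
    using mod2_boundaries_image b by blast
  moreover have "chain_map 1 \<rho> c = c"
  proof (rule chain_map_id_gen[OF c(1)])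
    fix x assume "x \<in> topspace (subtopology X S)"
    then have "x \<notin> C" using c(2) by (auto simp: C_def)
    then show "\<rho> x = x" by (simp add: \<rho>_def f_def)
  qed
  ultimately show ?thesis by (simp add: O'_def)
qed

subsection \<open>Crossing parity in a chart\<close>

lemma wind_simplex_map:
  assumes "singular_simplex 1 Y \<sigma>" shows "wind id (simplex_map 1 f \<sigma>) = wind f \<sigma>"
proof -
  obtain g where "\<sigma> = path_simplex g" using pathin_simplex_path[OF assms] by metis
  then show ?thesis by (simp add: simplex_map_path_simplex wind_path)
qed

lemma coeff_sum_wind_chain_map:
  "singular_chain 1 Y c \<Longrightarrow> coeff_sum (wind id) (chain_map 1 f c) = coeff_sum (wind f) c"
  unfolding chain_map_def coeff_sum_extend singular_chain_def
  by (rule coeff_sum_cong) (use wind_simplex_map in fastforce)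

text \<open>Comparison of the angles around \<open>\<i>/2\<close> and \<open>-\<i>/2\<close>: with the principal cuts, their difference is a
  coboundary off the segment joining these points, and zero on the real axis.\<close>

definition pole :: complex where "pole = \<i>/2"

lemma pole [simp]: "pole \<noteq> 0" "Re pole = 0" "Im pole = 1/2" "norm pole = 1/2"
  by (simp_all add: pole_def norm_divide)

text \<open>The 0-cochain whose coboundary is the difference in question: the principal argument of
  the quotient and the difference of the principal arguments disagree by an integral multiple of 2
  pi. The floor merely turns this into an integer.\<close>

definition jump :: "complex \<Rightarrow> int" where
  "jump z = \<lfloor>(Arg ((z - pole) / (z + pole)) - Arg (z - pole) + Arg (z + pole)) / (2 * pi)\<rfloor>"

lemma jump:
  assumes "z \<noteq> pole" "z \<noteq> - pole"
  shows "2 * pi * of_int (jump z) = Arg ((z - pole) / (z + pole)) - Arg (z - pole) + Arg (z + pole)"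
proof -
  have nz: "z - pole \<noteq> 0" "z + pole \<noteq> 0" using assms by (auto simp: eq_neg_iff_add_eq_0)
  have "exp (Ln ((z - pole) / (z + pole)) - Ln (z - pole) + Ln (z + pole)) = 1"
    using nz by (simp add: exp_add exp_diff)
  then obtain k :: int where "Im (Ln ((z - pole) / (z + pole)) - Ln (z - pole) + Ln (z + pole)) = of_int (2 * k) * pi"
    by (auto simp: exp_eq_1)
  then have "Arg ((z - pole) / (z + pole)) - Arg (z - pole) + Arg (z + pole) = 2 * pi * of_int k"
    using nz by (simp add: Arg_eq_Im_Ln algebra_simps)
  then show ?thesis by (simp add: jump_def)
qed

lemma lift_exists:
  assumes "continuous_on {0..1::real} g" "\<And>t. t \<in> {0..1} \<Longrightarrow> g t \<noteq> (0::complex)"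
  obtains q where "continuous_on {0..1} q" "\<And>t. t \<in> {0..1} \<Longrightarrow> g t = exp (q t)"
  using continuous_logarithm_on_contractible[OF assms(1) convex_imp_contractible[OF convex_real_interval(5)] assms(2)] by metis

text \<open>The quotient of \<open>z - pole\<close> by \<open>z + pole\<close> is a nonpositive real
  only on the segment between the poles, which lies within distance 1/2 of 0. Outside the unit disc
  the quotient thus never meets its branch cut, and its logarithm is the difference of those of
  numerator and denominator.\<close>

lemma turn_difference_off_segment:
  assumes g: "continuous_on {0..1} g" "\<And>t. t \<in> {0..1} \<Longrightarrow> norm (g t) > 1"
  shows "turn (\<lambda>t. g t - pole) - turn (\<lambda>t. g t + pole) = jump (g 1) - jump (g 0)"
proof -
  have nz: "g t - pole \<noteq> 0" "g t + pole \<noteq> 0" if "t \<in> {0..1}" for t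
  proof -
    have "g t \<noteq> pole" "g t \<noteq> - pole" using g(2)[OF that] by auto
    then show "g t - pole \<noteq> 0" "g t + pole \<noteq> 0" by (auto simp: eq_neg_iff_add_eq_0)
  qed
  obtain q1 where q1: "continuous_on {0..1} q1" "\<And>t. t \<in> {0..1} \<Longrightarrow> g t - pole = exp (q1 t)"
    by (rule lift_exists[of "\<lambda>t. g t - pole"]) (use g nz in \<open>auto intro!: continuous_intros\<close>)
  obtain q2 where q2: "continuous_on {0..1} q2" "\<And>t. t \<in> {0..1} \<Longrightarrow> g t + pole = exp (q2 t)"
    by (rule lift_exists[of "\<lambda>t. g t + pole"]) (use g nz in \<open>auto intro!: continuous_intros\<close>)
  let ?h = "\<lambda>t. (g t - pole) / (g t + pole)"
  have h: "Im (q1 1 - q2 1 - (q1 0 - q2 0)) = Arg (?h 1) - Arg (?h 0) + 2 * pi * of_int (turn ?h)"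
    by (rule turn_eq[where q = "\<lambda>t. q1 t - q2 t"]) (use q1 q2 in \<open>auto intro!: continuous_intros simp: exp_diff\<close>)
  have "turn ?h = 0"
  proof (rule turn_cut)
    show "continuous_on {0..1} ?h" using g nz by (intro continuous_intros) auto
    fix t :: real assume t: "t \<in> {0..1}"
    show "?h t \<notin> \<real>\<^sub>\<le>\<^sub>0"
    proof
      assume "?h t \<in> \<real>\<^sub>\<le>\<^sub>0"
      then obtain s where s: "s \<le> 0" "?h t = of_real s" by (auto elim!: nonpos_Reals_cases)
      then have "g t - pole = of_real s * (g t + pole)" using nz(2)[OF t] by (metis nonzero_divide_eq_eq)
      moreover have "of_real (1 - s) * g t - of_real (1 + s) * pole = (g t - pole) - of_real s * (g t + pole)"
        by (simp add: algebra_simps)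
      ultimately have e: "of_real (1 - s) * g t = of_real (1 + s) * pole" by simp
      have "\<bar>1 - s\<bar> * norm (g t) = \<bar>1 + s\<bar> / 2"
        using arg_cong[OF e, of norm] unfolding norm_mult norm_of_real by (simp add: norm_divide)
      moreover have "\<bar>1 - s\<bar> * 1 < \<bar>1 - s\<bar> * norm (g t)" using g(2)[OF t] s by (intro mult_strict_left_mono) auto
      ultimately have "\<bar>1 - s\<bar> < \<bar>1 + s\<bar> / 2" by (metis mult_1_right)
      then show False using s by auto
    qed
  qed
  moreover have "Im (q1 1 - q1 0) = Arg (g 1 - pole) - Arg (g 0 - pole) + 2 * pi * of_int (turn (\<lambda>t. g t - pole))"
    by (rule turn_eq[OF q1])
  moreover have "Im (q2 1 - q2 0) = Arg (g 1 + pole) - Arg (g 0 + pole) + 2 * pi * of_int (turn (\<lambda>t. g t + pole))"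
    by (rule turn_eq[OF q2])
  moreover have "2 * pi * of_int (jump (g t)) = Arg (?h t) - Arg (g t - pole) + Arg (g t + pole)" if "t \<in> {0..1}" for t
    using nz[OF that] by (intro jump) auto
  from this[of 0] this[of 1]
  have "2 * pi * of_int (jump (g 1)) - 2 * pi * of_int (jump (g 0)) =
     Arg (?h 1) - Arg (g 1 - pole) + Arg (g 1 + pole) - (Arg (?h 0) - Arg (g 0 - pole) + Arg (g 0 + pole))" by simp
  ultimately have "2 * pi * of_int (turn (\<lambda>t. g t - pole) - turn (\<lambda>t. g t + pole)) = 2 * pi * of_int (jump (g 1) - jump (g 0))"
    using h by (simp add: algebra_simps)
  then show ?thesis by simp
qed

text \<open>On the real axis \<open>z - pole\<close> and \<open>z + pole\<close> have constant
  nonzero imaginary parts and avoid the branch cut.\<close>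

lemma turn_difference_real_axis:
  assumes g: "continuous_on {0..1} g" "\<And>t. t \<in> {0..1} \<Longrightarrow> Im (g t) = 0"
  shows "turn (\<lambda>t. g t - pole) = 0" "turn (\<lambda>t. g t + pole) = 0"
  by (rule turn_cut; use g in \<open>auto intro!: continuous_intros simp: complex_nonpos_Reals_iff\<close>)+

text \<open>With \<theta> the argument of \<open>z + pole\<close>, the quotient has angle -2
  \<theta>, which leaves the range of the principal argument exactly for \<theta> at least pi/2,
  that is on the left half axis. So \<open>jump\<close> changes by one at 0: it counts the passage
  between the poles.\<close>

lemma jump_real_axis:
  assumes "Im z = 0" shows "jump z = (if Re z \<le> 0 then 1 else 0)"
proof -
  obtain x where x: "z = of_real x" using assms by (metis complex_is_Real_iff Reals_cases)
  define \<theta> where "\<theta> = Arg (of_real x + pole)"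
  have "0 < Im (of_real x + pole)" by simp
  then have \<theta>: "0 < \<theta>" "\<theta> < pi" unfolding \<theta>_def using Arg_lt_pi[of "of_real x + pole"] by auto
  have c: "of_real x - pole = cnj (of_real x + pole)" by (simp add: complex_eq_iff)
  have nr: "of_real x + pole \<notin> \<real>" by (simp add: complex_is_Real_iff)
  have m: "Arg (of_real x - pole) = - \<theta>" unfolding c using Arg_cnj[of "of_real x + pole"] nr by (simp add: \<theta>_def)
  define r where "r = norm (of_real x + pole)"
  have r: "r > 0" unfolding r_def using \<open>0 < Im (of_real x + pole)\<close> by (metis less_irrefl zero_complex.simps(2) zero_less_norm_iff)
  have p: "of_real x + pole = of_real r * exp (\<i> * of_real \<theta>)"
    using Arg_eq[of "of_real x + pole"] r unfolding r_def \<theta>_def by fastforce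
  have q: "of_real x - pole = of_real r * exp (- \<i> * of_real \<theta>)"
    unfolding c p by (simp add: exp_cnj)
  have quo: "(of_real x - pole) / (of_real x + pole) = exp (\<i> * of_real (- 2 * \<theta>))"
    unfolding p q using r by (simp add: exp_minus field_simps flip: exp_add)
  have xre: "x = r * cos \<theta>" using arg_cong[OF p, of Re] by (simp add: Re_exp)
  have nz: "z \<noteq> pole" "z \<noteq> - pole" using assms by auto
  have j: "2 * pi * of_int (jump z) = Arg (exp (\<i> * of_real (- 2 * \<theta>))) + 2 * \<theta>"
    using jump[OF nz] m quo unfolding x \<theta>_def by simp
  show ?thesis
  proof (cases "x \<le> 0")
    case True
    then have "cos \<theta> \<le> 0" using xre r by (metis mult_pos_pos not_le)
    then have "\<theta> \<ge> pi/2" using cos_gt_zero[of \<theta>] \<theta> by (meson not_le)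
    then have "Arg (exp (\<i> * of_real (2 * pi - 2 * \<theta>))) = 2 * pi - 2 * \<theta>"
      using \<theta> Arg_exp[of "\<i> * of_real (2 * pi - 2 * \<theta>)"] by simp
    moreover have "exp (\<i> * of_real (2 * pi - 2 * \<theta>)) = exp (\<i> * of_real (- 2 * \<theta>))"
      using exp_plus_2pin[of "\<i> * of_real (- 2 * \<theta>)" 1] by (simp add: algebra_simps)
    ultimately have "2 * pi * of_int (jump z) = 2 * pi" using j by simp
    then show ?thesis using True x by simp
  next
    case False
    then have "r * cos \<theta> > 0" using xre by simp
    then have "cos \<theta> > 0" using r by (simp add: zero_less_mult_iff)
    then have "\<theta> < pi/2"
      using \<theta> cos_monotone_0_pi_le[of "pi/2" \<theta>] by (cases "\<theta> < pi/2") auto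
    then have "Arg (exp (\<i> * of_real (- 2 * \<theta>))) = - 2 * \<theta>"
      using \<theta> Arg_exp[of "\<i> * of_real (- 2 * \<theta>)"] by simp
    then have "2 * pi * of_int (jump z) = 0" using j by simp
    then show ?thesis using False x by simp
  qed
qed

lemma connected_real_sign:
  assumes g: "continuous_on {0..1} g" and nz: "\<And>t. t \<in> {0..1::real} \<Longrightarrow> g t \<noteq> (0::real)"
  shows "g 0 \<le> 0 \<longleftrightarrow> g 1 \<le> 0"
proof -
  have "connected (g ` {0..1})" by (rule connected_continuous_image[OF g]) simp
  moreover have "g 0 \<in> g ` {0..1}" "g 1 \<in> g ` {0..1}" by auto
  moreover have "0 \<notin> g ` {0..1}" using nz by force
  ultimately show ?thesis unfolding connected_iff_interval by (meson linear)
qed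

lemma even_sum_iff: "finite A \<Longrightarrow> (\<And>x. x \<in> A \<Longrightarrow> even (f x) \<longleftrightarrow> even (g x)) \<Longrightarrow> even (sum f A) \<longleftrightarrow> even (sum g A :: int)"
  by (induction A rule: finite_induct) auto

lemma coeff_sum_parity:
  assumes "\<And>\<sigma>. even (F \<sigma>) \<or> (even (Poly_Mapping.lookup a \<sigma>) \<longleftrightarrow> even (Poly_Mapping.lookup b \<sigma>))"
  shows "even (coeff_sum F a) \<longleftrightarrow> even (coeff_sum F b)"
proof -
  let ?A = "Poly_Mapping.keys a \<union> Poly_Mapping.keys b"
  have 1: "coeff_sum F a = (\<Sum>\<sigma>\<in>?A. Poly_Mapping.lookup a \<sigma> * F \<sigma>)" "coeff_sum F b = (\<Sum>\<sigma>\<in>?A. Poly_Mapping.lookup b \<sigma> * F \<sigma>)"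
    by (auto intro!: coeff_sum_superset)
  show ?thesis unfolding 1 by (rule even_sum_iff) (use assms in auto)
qed

lemma mod2_boundary_of_difference:
  assumes "c - a - b = frag_cmul 2 e" "singular_chain 1 Y c" "a \<in> mod2_boundaries 1 Y" "b \<in> mod2_boundaries 1 Y"
  shows "c \<in> mod2_boundaries 1 Y"
proof -
  have "singular_chain 1 Y a" "singular_chain 1 Y b"
    using assms(3,4) mod2_boundaries_cycles by (auto simp: mod2_cycles_def)
  then have "singular_chain 1 Y (frag_cmul 2 e)"
    unfolding assms(1)[symmetric] using assms(2) by (intro singular_chain_diff)
  then have "singular_chain 1 Y e" by (auto simp: singular_chain_def)
  then have "c - a - b \<in> mod2_boundaries 1 Y" unfolding assms(1) by (rule mod2_even)
  from mod2_add[OF mod2_add[OF this assms(4)] assms(3)] show ?thesis by simp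
qed

text \<open>The set \<open>K\<close> stands for a closed curve that is the real axis in a chart
  \<open>B\<close> onto the whole plane. The path \<open>g\<close> is the piece of it through
  \<open>m\<close>, the chain \<open>u\<close> is the rest and avoids \<open>m\<close>, and
  \<open>p1\<close>, \<open>p2\<close> are points just beside \<open>m\<close> on the two
  sides.\<close>

locale crossing_curve =
  fixes X :: "'a topology" and K :: "'a set" and B :: "'a set" and \<phi> :: "'a \<Rightarrow> complex"
    and g :: "real \<Rightarrow> 'a" and u :: "'a chain" and m p1 p2 :: 'a
  assumes H: "Hausdorff_space X"
    and charts: "\<And>p. p \<in> topspace X \<Longrightarrow> \<exists>U \<psi>. chart X U (\<psi> :: 'a \<Rightarrow> complex) \<and> p \<in> U"
    and K: "closedin X K"
    and B: "chart X B \<phi>" "\<phi> ` B = UNIV"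
    and KB: "\<And>p. p \<in> B \<Longrightarrow> p \<in> K \<longleftrightarrow> Im (\<phi> p) = 0"
    and g: "pathin (subtopology X (K \<inter> B)) g" "(Re (\<phi> (g 0)) \<le> 0) \<noteq> (Re (\<phi> (g 1)) \<le> 0)"
    and m: "m \<in> B" "\<phi> m = 0"
    and u: "singular_chain 1 (subtopology X (K - {m})) u"
    and p1: "p1 \<in> B" "\<phi> p1 = pole" and p2: "p2 \<in> B" "\<phi> p2 = - pole"
begin

definition z :: "'a chain" where "z = frag_of (path_simplex g) + u"

lemma K_top: "K \<subseteq> topspace X" using K closedin_subset by blast

lemma B_top: "B \<subseteq> topspace X" using chart_facts(2)[OF B(1)] .

lemma inj_phi: "p \<in> B \<Longrightarrow> q \<in> B \<Longrightarrow> \<phi> p = \<phi> q \<Longrightarrow> p = q"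
  using chart_facts(1)[OF B(1)] by (auto dest: inj_onD)

lemma p_notin: "p1 \<notin> K" "p2 \<notin> K" "p1 \<noteq> p2"
  using KB[OF p1(1)] KB[OF p2(1)] p1 p2 by auto

lemma z_chain: "singular_chain 1 (subtopology X K) z"
  unfolding z_def
proof (rule singular_chain_add)
  show "singular_chain 1 (subtopology X K) (frag_of (path_simplex g))"
    using g(1) by (auto simp: singular_chain_path pathin_subtopology)
  show "singular_chain 1 (subtopology X K) u" by (rule singular_chain_mono[OF u]) auto
qed

lemma z_chain': "K \<inter> Q = {} \<Longrightarrow> singular_chain 1 (subtopology X (topspace X - Q)) z"
  by (rule singular_chain_mono[OF z_chain]) (use K_top in auto)

lemma simplex_continuous:
  assumes "singular_simplex 1 X \<sigma>" "\<sigma> ` standard_simplex 1 \<subseteq> B"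
  shows "continuous_on {0..1} (\<phi> \<circ> simplex_path \<sigma>)"
proof -
  have "singular_simplex 1 (subtopology X B) \<sigma>" using assms by (simp add: singular_simplex_subtopology)
  then have "pathin (subtopology X B) (simplex_path \<sigma>)" by (rule pathin_simplex_path(1))
  from continuous_map_compose[OF this[unfolded pathin_def] chart_facts(3)[OF B(1)]]
  show ?thesis by simp
qed

text \<open>The cycle \<open>y\<close> is the boundary of the part of \<open>w\<close> near \<open>m\<close>.\<close>

lemma local_parity:
  assumes w: "singular_chain 2 X w" "z = chain_boundary 2 w + frag_cmul 2 f"
  obtains y where "y \<in> mod2_cycles 1 (subtopology X (B - {p1, p2}))"
    "odd (coeff_sum (wind (\<lambda>p. \<phi> p - \<phi> p1)) y + coeff_sum (wind (\<lambda>p. \<phi> p - \<phi> p2)) y)"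
    "\<And>p. p \<in> {p1, p2} \<Longrightarrow> y \<in> mod2_boundaries 1 (subtopology X (topspace X - {p})) \<Longrightarrow>
        z \<in> mod2_boundaries 1 (subtopology X (topspace X - {p}))"
    "\<And>p. p \<in> {p1, p2} \<Longrightarrow> singular_chain 2 (subtopology X (topspace X - {p})) w \<Longrightarrow> even (coeff_sum (wind (\<lambda>q. \<phi> q - \<phi> p)) y)"
proof -
  define V where "V = {p \<in> B. \<phi> p \<in> cball 0 1}"
  have Vc: "closedin X V" unfolding V_def by (rule closedin_chart_preimage[OF B(1) H]) (auto simp: B)
  have VB: "V \<subseteq> B" by (auto simp: V_def)
  have pV: "p1 \<in> V" "p2 \<in> V" "m \<in> V" using p1 p2 m by (auto simp: V_def norm_divide)
  let ?C = "{B, topspace X - V}"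
  have Cop: "openin X T" if "T \<in> ?C" for T using that Vc B(1) by (auto simp: chart_def)
  have Ccov: "topspace X \<subseteq> \<Union>?C" using VB by auto
  obtain n1 where n1: "\<forall>k\<ge>n1. \<forall>s \<in> Poly_Mapping.keys ((singular_subdivision 2 ^^ k) w). \<exists>T\<in>?C. s ` standard_simplex 2 \<subseteq> T"
    using subdivision_small[OF w(1) Cop Ccov] by blast
  have uX: "singular_chain 1 X u" using u by (auto simp: singular_chain_subtopology)
  obtain n2 where n2: "\<forall>k\<ge>n2. \<forall>s \<in> Poly_Mapping.keys ((singular_subdivision 1 ^^ k) u). \<exists>T\<in>?C. s ` standard_simplex 1 \<subseteq> T"
    using subdivision_small[OF uX Cop Ccov] by blast
  define n where "n = max n1 n2"
  let ?Sd = "\<lambda>p. singular_subdivision p ^^ n"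
  define w' where "w' = ?Sd 2 w"
  define z' where "z' = ?Sd 1 z"
  have w'c: "singular_chain 2 X w'" unfolding w'_def by (rule singular_chain_subdivision_power[OF w(1)])
  have z'c: "singular_chain 1 (subtopology X K) z'" unfolding z'_def by (rule singular_chain_subdivision_power[OF z_chain])
  have z'eq: "z' = chain_boundary 2 w' + frag_cmul 2 (?Sd 1 f)"
    unfolding z'_def w'_def w(2) subdivision_power_add subdivision_power_double
    using chain_boundary_subdivision_power[OF w(1), of n] by (simp add: One_nat_def)
  have kw: "Poly_Mapping.keys w' \<subseteq> singular_simplex_set 2 (subtopology X B) \<union> singular_simplex_set 2 (subtopology X (topspace X - V))"
  proof
    fix s assume s: "s \<in> Poly_Mapping.keys w'"
    then have "singular_simplex 2 X s" using w'c by (auto simp: singular_chain_def)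
    moreover have "\<exists>T\<in>?C. s ` standard_simplex 2 \<subseteq> T" using n1 s unfolding n_def w'_def by (meson max.cobounded1)
    ultimately show "s \<in> singular_simplex_set 2 (subtopology X B) \<union> singular_simplex_set 2 (subtopology X (topspace X - V))"
      by (auto simp: singular_simplex_subtopology)
  qed
  \<comment> \<open>The simplices of \<open>w'\<close> inside \<open>B\<close>; by smallness the
    remaining ones, which form \<open>wF\<close>, avoid the unit disc \<open>V\<close>. Being
    obtained by filtering, \<open>wB\<close> contains no simplex that is not in \<open>w'\<close>,
    and so avoids every point that \<open>w'\<close> avoids.\<close>
  define wB where "wB = frag_extend (\<lambda>s. if s \<in> singular_simplex_set 2 (subtopology X B) then frag_of s else 0) w'"
  define wF where "wF = w' - wB"
  have wFe: "wF = frag_extend (\<lambda>s. if s \<in> singular_simplex_set 2 (subtopology X B) then 0 else frag_of s) w'"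
  proof -
    have gen: "frag_extend frag_of c - frag_extend (\<lambda>s. if s \<in> A then frag_of s else 0) c = frag_extend (\<lambda>s. if s \<in> A then 0 else frag_of s) c"
      for A and c :: "'b \<Rightarrow>\<^sub>0 int"
      using subset_UNIV by (induction c rule: frag_induction) (auto simp: frag_extend_diff algebra_simps)
    show ?thesis unfolding wF_def wB_def
      using gen[of w' "singular_simplex_set 2 (subtopology X B)"] by (simp flip: frag_expansion[of w'])
  qed
  have wBc: "singular_chain 2 (subtopology X B) wB"
    unfolding wB_def by (rule singular_chain_extend) (auto simp: singular_chain_of)
  have wFc: "singular_chain 2 (subtopology X (topspace X - V)) wF"
    unfolding wFe by (rule singular_chain_extend) (use kw in \<open>auto simp: singular_chain_of\<close>)
  have wBw: "Poly_Mapping.keys wB \<subseteq> Poly_Mapping.keys w'"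
    unfolding wB_def by (rule order_trans[OF keys_frag_extend]) (auto split: if_splits)
  define yy where "yy = chain_boundary 2 wB"
  have yyc: "singular_chain 1 (subtopology X B) yy" unfolding yy_def using singular_chain_boundary[OF wBc] by (simp add: One_nat_def)
  have bFc: "singular_chain 1 (subtopology X (topspace X - V)) (chain_boundary 2 wF)"
    using singular_chain_boundary[OF wFc] by (simp add: One_nat_def)
  have yyeq: "yy = z' - chain_boundary 2 wF - frag_cmul 2 (?Sd 1 f)"
    unfolding z'eq yy_def wF_def by (simp add: chain_boundary_diff)
  obtain y e where ye: "yy = y + frag_cmul 2 e" "Poly_Mapping.keys y = {\<sigma>. odd (Poly_Mapping.lookup yy \<sigma>)}"
    "Poly_Mapping.keys e \<subseteq> Poly_Mapping.keys yy" by (rule odd_part)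
  have ykeys: "singular_simplex 1 X \<sigma> \<and> \<sigma> ` standard_simplex 1 \<subseteq> B \<and> (\<sigma> ` standard_simplex 1 \<subseteq> K \<or> \<sigma> ` standard_simplex 1 \<subseteq> topspace X - V)"
    if "\<sigma> \<in> Poly_Mapping.keys y" for \<sigma>
  proof -
    have odd: "odd (Poly_Mapping.lookup yy \<sigma>)" using that ye(2) by auto
    then have "\<sigma> \<in> Poly_Mapping.keys yy" by (auto simp: in_keys_iff)
    then have 1: "singular_simplex 1 (subtopology X B) \<sigma>" using yyc by (auto simp: singular_chain_def)
    have "\<sigma> \<in> Poly_Mapping.keys z' \<or> \<sigma> \<in> Poly_Mapping.keys (chain_boundary 2 wF)"
      using odd unfolding yyeq by (auto simp: lookup_minus in_keys_iff)
    then have "singular_simplex 1 (subtopology X K) \<sigma> \<or> singular_simplex 1 (subtopology X (topspace X - V)) \<sigma>"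
      using z'c bFc by (auto simp: singular_chain_def)
    then show ?thesis using 1 by (auto simp: singular_simplex_subtopology)
  qed
  show thesis
  proof (rule that)
    have yc: "singular_chain 1 (subtopology X (B - {p1, p2})) y"
      unfolding singular_chain_def
    proof
      fix \<sigma> assume "\<sigma> \<in> Poly_Mapping.keys y"
      from ykeys[OF this] show "\<sigma> \<in> singular_simplex_set 1 (subtopology X (B - {p1, p2}))"
        using p_notin pV by (auto simp: singular_simplex_subtopology)
    qed
    have "chain_boundary 1 yy = 0"
      using chain_boundary_boundary[OF wBc] by (simp add: yy_def One_nat_def numeral_2_eq_2)
    then have "chain_boundary 1 y = frag_cmul 2 (- chain_boundary 1 e)"
      unfolding ye(1) chain_boundary_add chain_boundary_cmul by (simp add: frag_cmul_2 eq_neg_iff_add_eq_0 algebra_simps)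
    then have by2: "chain_boundary 1 y = frag_cmul 2 (- chain_boundary 1 e)" .
    then show ycyc: "y \<in> mod2_cycles 1 (subtopology X (B - {p1, p2}))" using yc unfolding mod2_cycles_def by blast
    define h where "h p = jump (\<phi> p)" for p
    \<comment> \<open>Simplices of \<open>y\<close> outside \<open>V\<close> see \<open>J\<close> as
      the coboundary of \<open>h\<close>. Those meeting \<open>V\<close> lie on the real axis, where
      \<open>J\<close> is zero. So \<kappa> is exactly the error, and the coboundary itself is even
      on the cycle \<open>y\<close>.\<close>
    define meets where "meets \<sigma> \<longleftrightarrow> \<not> \<sigma> ` standard_simplex 1 \<subseteq> topspace X - V" for \<sigma> :: "(nat \<Rightarrow> real) \<Rightarrow> 'a"
    define \<kappa> where "\<kappa> \<sigma> = (if meets \<sigma> then path_diff h \<sigma> else 0)" for \<sigma>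
    define J where "J \<sigma> = wind (\<lambda>p. \<phi> p - \<phi> p1) \<sigma> - wind (\<lambda>p. \<phi> p - \<phi> p2) \<sigma>" for \<sigma>
    have J: "J \<sigma> = path_diff h \<sigma> - \<kappa> \<sigma>" if s: "\<sigma> \<in> Poly_Mapping.keys y" for \<sigma>
    proof -
      note yk = ykeys[OF s]
      have c: "continuous_on {0..1} (\<phi> \<circ> simplex_path \<sigma>)" using simplex_continuous yk by blast
      have im: "simplex_path \<sigma> t \<in> \<sigma> ` standard_simplex 1" if "t \<in> {0..1}" for t
        using simplex_path_image[of \<sigma>] that by blast
      have Je: "J \<sigma> = turn (\<lambda>t. (\<phi> \<circ> simplex_path \<sigma>) t - pole) - turn (\<lambda>t. (\<phi> \<circ> simplex_path \<sigma>) t + pole)"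
        by (simp add: J_def wind_def o_def p1 p2)
      show ?thesis
      proof (cases "meets \<sigma>")
        case True
        then have "\<sigma> ` standard_simplex 1 \<subseteq> K" using yk by (auto simp: meets_def)
        then have "Im ((\<phi> \<circ> simplex_path \<sigma>) t) = 0" if "t \<in> {0..1}" for t
          using im[OF that] yk KB by auto
        then show ?thesis using turn_difference_real_axis[OF c] True Je by (simp add: \<kappa>_def)
      next
        case False
        then have "norm ((\<phi> \<circ> simplex_path \<sigma>) t) > 1" if "t \<in> {0..1}" for t
          using im[OF that] yk unfolding meets_def V_def by fastforce
        then show ?thesis using turn_difference_off_segment[OF c] False Je by (simp add: \<kappa>_def path_diff_def h_def)
      qed
    qed
    have "coeff_sum J y = coeff_sum (\<lambda>\<sigma>. path_diff h \<sigma> - \<kappa> \<sigma>) y" by (rule coeff_sum_cong) (rule J)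
    also have "\<dots> = coeff_sum (point_fun h) (chain_boundary 1 y) - coeff_sum \<kappa> y"
      by (simp add: coeff_sum_diff_fun coeff_sum_path_diff)
    also have "coeff_sum (point_fun h) (chain_boundary 1 y) = 2 * coeff_sum (point_fun h) (- chain_boundary 1 e)"
      unfolding by2 coeff_sum_cmul ..
    finally have "even (coeff_sum J y) \<longleftrightarrow> even (coeff_sum \<kappa> y)" by simp
    also have "\<dots> \<longleftrightarrow> even (coeff_sum \<kappa> z')"
    proof (rule coeff_sum_parity)
      fix \<sigma>
      show "even (\<kappa> \<sigma>) \<or> even (Poly_Mapping.lookup y \<sigma>) = even (Poly_Mapping.lookup z' \<sigma>)"
      proof (cases "meets \<sigma>")
        case True
        \<comment> \<open>Near \<open>m\<close> the boundary of \<open>wB\<close> agrees modulo 2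
          with the curve; the artificial part of this boundary belongs to \<open>wF\<close>, away
          from \<open>V\<close>, where \<kappa> vanishes.\<close>
        have "\<sigma> \<notin> Poly_Mapping.keys (chain_boundary 2 wF)"
        proof
          assume "\<sigma> \<in> Poly_Mapping.keys (chain_boundary 2 wF)"
          then have "singular_simplex 1 (subtopology X (topspace X - V)) \<sigma>" using bFc by (auto simp: singular_chain_def)
          then show False using True by (simp add: singular_simplex_subtopology meets_def)
        qed
        then have "even (Poly_Mapping.lookup yy \<sigma>) = even (Poly_Mapping.lookup z' \<sigma>)"
          unfolding yyeq by (simp add: lookup_minus in_keys_iff)
        moreover have "even (Poly_Mapping.lookup yy \<sigma>) = even (Poly_Mapping.lookup y \<sigma>)"
          unfolding ye(1) by (simp add: lookup_add)
        ultimately show ?thesis by simp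
      qed (simp add: \<kappa>_def)
    qed
    also have "coeff_sum \<kappa> z' = coeff_sum \<kappa> (?Sd 1 (frag_of (path_simplex g))) + coeff_sum \<kappa> (?Sd 1 u)"
      unfolding z'_def z_def subdivision_power_add coeff_sum_add ..
    \<comment> \<open>A small simplex of \<open>u\<close> that meets \<open>V\<close> runs on the
      real axis and, missing \<open>m\<close>, stays on one side of 0, where \<open>jump\<close> is
      constant.\<close>
    also have "coeff_sum \<kappa> (?Sd 1 u) = 0"
    proof -
      have "\<kappa> \<sigma> = 0" if s: "\<sigma> \<in> Poly_Mapping.keys (?Sd 1 u)" for \<sigma>
      proof (cases "meets \<sigma>")
        case True
        have "singular_simplex 1 (subtopology X (K - {m})) \<sigma>"
          using s singular_chain_subdivision_power[OF u, of n] by (auto simp: singular_chain_def)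
        then have 1: "singular_simplex 1 X \<sigma>" "\<sigma> ` standard_simplex 1 \<subseteq> K - {m}" by (auto simp: singular_simplex_subtopology)
        have "\<exists>T\<in>?C. \<sigma> ` standard_simplex 1 \<subseteq> T" using n2 s unfolding n_def by (meson max.cobounded2)
        then have 2: "\<sigma> ` standard_simplex 1 \<subseteq> B" using True by (auto simp: meets_def)
        have im: "simplex_path \<sigma> t \<in> (K - {m}) \<inter> B" if "t \<in> {0..1}" for t
          using simplex_path_image[of \<sigma>] that 1 2 by blast
        have I0: "Im (\<phi> (simplex_path \<sigma> t)) = 0" if "t \<in> {0..1}" for t using im[OF that] KB by auto
        have R0: "Re (\<phi> (simplex_path \<sigma> t)) \<noteq> 0" if "t \<in> {0..1}" for t
        proof
          assume "Re (\<phi> (simplex_path \<sigma> t)) = 0"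
          then have "\<phi> (simplex_path \<sigma> t) = \<phi> m" using I0[OF that] m by (simp add: complex_eq_iff)
          then show False using inj_phi[OF _ m(1)] im[OF that] by auto
        qed
        have "Re (\<phi> (simplex_path \<sigma> 0)) \<le> 0 \<longleftrightarrow> Re (\<phi> (simplex_path \<sigma> 1)) \<le> 0"
          by (rule connected_real_sign[of "\<lambda>t. Re (\<phi> (simplex_path \<sigma> t))"])
             (use simplex_continuous[OF 1(1) 2] R0 in \<open>auto simp: o_def intro!: continuous_intros\<close>)
        then show ?thesis by (simp add: \<kappa>_def path_diff_def h_def jump_real_axis I0)
      qed (simp add: \<kappa>_def)
      then show ?thesis by (simp add: coeff_sum_def)
    qed
    also have "coeff_sum \<kappa> (?Sd 1 (frag_of (path_simplex g))) = coeff_sum (path_diff h) (?Sd 1 (frag_of (path_simplex g)))"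
    proof (rule coeff_sum_cong)
      fix \<sigma> assume s: "\<sigma> \<in> Poly_Mapping.keys (?Sd 1 (frag_of (path_simplex g)))"
      have gc: "singular_chain 1 (subtopology X (K \<inter> B)) (frag_of (path_simplex g))" using g(1) by (simp add: singular_chain_path)
      have "singular_simplex 1 (subtopology X (K \<inter> B)) \<sigma>"
        using s singular_chain_subdivision_power[OF gc, of n] by (auto simp: singular_chain_def)
      then have 1: "singular_simplex 1 X \<sigma>" "\<sigma> ` standard_simplex 1 \<subseteq> K \<inter> B" by (auto simp: singular_simplex_subtopology)
      have im: "simplex_path \<sigma> t \<in> K \<inter> B" if "t \<in> {0..1}" for t
        using simplex_path_image[of \<sigma>] that 1 by blast
      have I0: "Im (\<phi> (simplex_path \<sigma> t)) = 0" if "t \<in> {0..1}" for t using im[OF that] KB by auto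
      show "\<kappa> \<sigma> = path_diff h \<sigma>"
      proof (cases "meets \<sigma>")
        case False
        have R0: "Re (\<phi> (simplex_path \<sigma> t)) \<noteq> 0" if "t \<in> {0..1}" for t
        proof
          assume "Re (\<phi> (simplex_path \<sigma> t)) = 0"
          then have "\<phi> (simplex_path \<sigma> t) = 0" using I0[OF that] by (simp add: complex_eq_iff)
          then have "simplex_path \<sigma> t \<in> V" using im[OF that] by (simp add: V_def)
          moreover have "simplex_path \<sigma> t \<in> \<sigma> ` standard_simplex 1" using simplex_path_image[of \<sigma>] that by blast
          ultimately show False using False unfolding meets_def by blast
        qed
        have "Re (\<phi> (simplex_path \<sigma> 0)) \<le> 0 \<longleftrightarrow> Re (\<phi> (simplex_path \<sigma> 1)) \<le> 0"
          by (rule connected_real_sign[of "\<lambda>t. Re (\<phi> (simplex_path \<sigma> t))"])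
             (use simplex_continuous[OF 1(1)] 1(2) R0 in \<open>auto simp: o_def intro!: continuous_intros\<close>)
        then show ?thesis using False by (simp add: \<kappa>_def path_diff_def h_def jump_real_axis I0)
      qed (simp add: \<kappa>_def)
    qed
    \<comment> \<open>Subdivision does not change the boundary of \<open>g\<close>, so only its two
      ends count. They lie on different sides of 0, and \<open>jump\<close> differs by one between
      them.\<close>
    also have "coeff_sum (path_diff h) (?Sd 1 (frag_of (path_simplex g))) = h (g 1) - h (g 0)"
    proof -
      have gX: "singular_chain 1 X (frag_of (path_simplex g))" using g(1) by (auto simp: singular_chain_path pathin_subtopology)
      have "chain_boundary 1 (?Sd 1 (frag_of (path_simplex g))) = chain_boundary 1 (frag_of (path_simplex g))"
        using chain_boundary_subdivision_power[OF gX] subdivision_power_0[OF singular_chain_boundary[OF gX, unfolded One_nat_def, simplified]]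
        by (simp add: One_nat_def)
      then show ?thesis by (simp add: coeff_sum_path_diff chain_boundary_path coeff_sum_diff)
    qed
    also have "even (h (g 1) - h (g 0) + 0) \<longleftrightarrow> False"
    proof -
      have "Im (\<phi> (g t)) = 0" if "t \<in> {0..1}" for t using g(1) that KB[of "g t"] by (auto simp: pathin_subtopology)
      then show ?thesis using g(2) by (auto simp: h_def jump_real_axis)
    qed
    finally have "odd (coeff_sum J y)" by simp
    then show "odd (coeff_sum (wind (\<lambda>p. \<phi> p - \<phi> p1)) y + coeff_sum (wind (\<lambda>p. \<phi> p - \<phi> p2)) y)"
      unfolding J_def coeff_sum_diff_fun by simp
    show "z \<in> mod2_boundaries 1 (subtopology X (topspace X - {p}))"
      if p: "p \<in> {p1, p2}" and yb: "y \<in> mod2_boundaries 1 (subtopology X (topspace X - {p}))" for p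
    proof -
      let ?Y = "subtopology X (topspace X - {p})"
      have pK: "K \<inter> {p} = {}" using p p_notin by auto
      have "singular_chain 2 ?Y wF" by (rule singular_chain_mono[OF wFc]) (use p pV in auto)
      then have "chain_boundary 2 wF \<in> mod2_boundaries 1 ?Y"
        by (intro int_boundary_mod2) (auto simp: singular_boundary numeral_2_eq_2 One_nat_def)
      moreover have "z' - y - chain_boundary 2 wF = frag_cmul 2 (e + ?Sd 1 f)"
        using yyeq ye(1) by (simp add: frag_cmul_distrib2 algebra_simps)
      moreover have "singular_chain 1 ?Y z'" unfolding z'_def by (rule singular_chain_subdivision_power[OF z_chain'[OF pK]])
      ultimately have "z' \<in> mod2_boundaries 1 ?Y" using mod2_boundary_of_difference yb by blast
      then show ?thesis unfolding z'_def using mod2_boundary_subdivision_iff[OF z_chain'[OF pK]] by simp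
    qed
    show "even (coeff_sum (wind (\<lambda>q. \<phi> q - \<phi> p)) y)"
      if p: "p \<in> {p1, p2}" and wp: "singular_chain 2 (subtopology X (topspace X - {p})) w" for p
    proof -
      have "singular_chain 2 (subtopology X (topspace X - {p})) w'" unfolding w'_def by (rule singular_chain_subdivision_power[OF wp])
      then have wBp: "singular_chain 2 (subtopology X (B - {p})) wB"
        using wBc wBw by (fastforce simp: singular_chain_subtopology)
      have pB: "p \<in> B" using p p1 p2 by auto
      have "coeff_sum (wind (\<lambda>q. \<phi> q - \<phi> p)) yy = 0" unfolding yy_def
      proof (rule wind_boundary[OF _ _ wBp])
        have "continuous_map (subtopology X (B - {p})) euclidean \<phi>"
          by (rule continuous_map_from_subtopology_mono[OF chart_facts(3)[OF B(1)]]) auto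
        then show "continuous_map (subtopology X (B - {p})) euclidean (\<lambda>q. \<phi> q - \<phi> p)" by (intro continuous_intros)
        show "\<phi> q - \<phi> p \<noteq> 0" if "q \<in> topspace (subtopology X (B - {p}))" for q
          using inj_phi[OF _ pB] that by auto
      qed
      then have "coeff_sum (wind (\<lambda>q. \<phi> q - \<phi> p)) y + 2 * coeff_sum (wind (\<lambda>q. \<phi> q - \<phi> p)) e = 0"
        unfolding ye(1) coeff_sum_add coeff_sum_cmul .
      then show ?thesis by presburger
    qed
  qed
qed

text \<open>The chart identifies \<open>B\<close> without \<open>p\<close> with the punctured plane,
  where the winding parity decides; its inverse carries the bounding chain back.\<close>

lemma even_wind_bounds:
  assumes y: "y \<in> mod2_cycles 1 (subtopology X (B - {p}))" and p: "p \<in> B"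
    and ev: "even (coeff_sum (wind (\<lambda>q. \<phi> q - \<phi> p)) y)"
  shows "y \<in> mod2_boundaries 1 (subtopology X (topspace X - {p}))"
proof -
  let ?f = "\<lambda>q. \<phi> q - \<phi> p" and ?i = "\<lambda>\<zeta>. inv_into B \<phi> (\<zeta> + \<phi> p)"
  let ?Y = "subtopology X (B - {p})" and ?Z = "top_of_set (- {0::complex})"
  have "continuous_map ?Y euclidean \<phi>"
    by (rule continuous_map_from_subtopology_mono[OF chart_facts(3)[OF B(1)]]) auto
  then have "continuous_map ?Y euclidean ?f" by (intro continuous_intros)
  then have fc: "continuous_map ?Y ?Z ?f"
    using inj_phi[OF _ p] by (auto simp: continuous_map_in_subtopology)
  have "continuous_map ?Z (top_of_set UNIV) (\<lambda>\<zeta>. \<zeta> + \<phi> p)" by (simp, intro continuous_intros)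
  from continuous_map_compose[OF this continuous_map_chart_inverse[OF B(1), unfolded B(2), OF order_refl]]
  have "continuous_map ?Z X ?i" by (simp add: o_def)
  moreover have "?i \<zeta> \<in> topspace X - {p}" if "\<zeta> \<in> - {0}" for \<zeta>
    using chart_inverse(1,2)[OF B(1), unfolded B(2), of "\<zeta> + \<phi> p"] B_top that by auto
  ultimately have ic: "continuous_map ?Z (subtopology X (topspace X - {p})) ?i"
    by (auto simp: continuous_map_in_subtopology)
  have yc: "singular_chain 1 ?Y y" using y by (simp add: mod2_cycles_def)
  obtain b where b: "chain_boundary 1 y = frag_cmul 2 b" using y by (auto simp: mod2_cycles_def)
  have "chain_map 1 ?f y \<in> mod2_cycles 1 ?Z"
    unfolding mod2_cycles_def
    using singular_chain_chain_map[OF yc fc] chain_boundary_chain_map[OF yc, of ?f]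
    by (auto simp: b intro!: exI[of _ "chain_map 0 ?f b"])
  then have "chain_map 1 ?f y \<in> mod2_boundaries 1 ?Z"
    using punctured_plane_mod2 coeff_sum_wind_chain_map[OF yc] ev by simp
  then have "chain_map 1 ?i (chain_map 1 ?f y) \<in> mod2_boundaries 1 (subtopology X (topspace X - {p}))"
    using mod2_boundaries_image[OF ic] by blast
  moreover have "chain_map 1 ?i (chain_map 1 ?f y) = chain_map 1 (?i \<circ> ?f) y" by (simp add: chain_map_compose)
  moreover have "chain_map 1 (?i \<circ> ?f) y = y"
    by (rule chain_map_id_gen[OF yc]) (use chart_inverse(3)[OF B(1)] in auto)
  ultimately show ?thesis by simp
qed

lemma separated_aux:
  assumes zb: "z \<in> mod2_boundaries 1 (subtopology X (topspace X - {a}))" and ab: "{a, b} = {p1, p2}"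
  shows "\<not> connectedin X (topspace X - K)"
proof
  assume conn: "connectedin X (topspace X - K)"
  let ?N = "\<lambda>Q. z \<in> mod2_boundaries 1 (subtopology X (topspace X - Q))"
  define G where "G = {p \<in> topspace X - K. p = a \<or> ?N {p, a}}"
  have aK: "a \<in> topspace X - K" "b \<in> topspace X - K" "a \<noteq> b" using ab p_notin p1(1) p2(1) B_top
    by (auto simp: doubleton_eq_iff)
  have mono: "?N Q' \<Longrightarrow> Q \<subseteq> Q' \<Longrightarrow> ?N Q" for Q Q' by (erule mod2_boundaries_mono[rotated]) auto
  \<comment> \<open>If \<open>z\<close> bounded in the complement of both poles, the windings of the
    local cycle around both would be even, whereas their sum is odd.\<close>
  have b: "b \<notin> G"
  proof
    assume "b \<in> G"
    then have "?N {b, a}" using aK by (auto simp: G_def)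
    then have n: "?N {p1, p2}" using ab by (simp add: insert_commute)
    then obtain w f where w: "singular_chain 2 (subtopology X (topspace X - {p1, p2})) w" "z = chain_boundary 2 w + frag_cmul 2 f"
      by (auto simp: mod2_boundaries_def numeral_2_eq_2 One_nat_def)
    have wX: "singular_chain 2 X w" using w(1) by (auto simp: singular_chain_subtopology)
    have w1: "singular_chain 2 (subtopology X (topspace X - {p})) w" if "p \<in> {p1,p2}" for p
      by (rule singular_chain_mono[OF w(1)]) (use that in auto)
    from local_parity[OF wX w(2)] w1 show False by (metis even_add insertCI)
  qed
  have oK: "openin X (topspace X - K)" using K by auto
  have nbhd: "\<exists>T. openin X T \<and> p \<in> T \<and> T \<subseteq> topspace X - K \<and> (\<forall>q\<in>T. (p \<in> G) = (q \<in> G))" if p: "p \<in> topspace X - K" for p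
  proof (cases "p = a")
    case True
    obtain U \<psi> r where U: "chart X U \<psi>" "p \<in> U" "U \<subseteq> topspace X - K" "r > 0" "cball (\<psi> p :: complex) r \<subseteq> \<psi> ` U"
      by (rule chart_disc_exists[OF charts oK p])
    let ?T = "{q \<in> U. \<psi> q \<in> ball (\<psi> p) r}"
    have N: "?N (?T \<union> {})"
      by (rule mod2_boundary_avoid_disc[OF U(1) H U(2,4,5) _ z_chain]) (use U(3) zb True in auto)
    have pT: "p \<in> ?T" using U by auto
    have "q \<in> G" if "q \<in> ?T" for q
      using mono[OF N, of "{q, a}"] that pT True U(3) by (auto simp: G_def)
    then show ?thesis using openin_chart_preimage[OF U(1), of "ball (\<psi> p) r"] pT U(3)
      by (intro exI[of _ ?T]) auto
  next
    case False
    have "closedin X {a}" using closedin_Hausdorff_singleton[OF H] aK by auto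
    then have oW: "openin X ((topspace X - K) - {a})" using oK by blast
    have pW: "p \<in> (topspace X - K) - {a}" using p False by auto
    obtain U \<psi> r where U: "chart X U \<psi>" "p \<in> U" "U \<subseteq> (topspace X - K) - {a}" "r > 0" "cball (\<psi> p :: complex) r \<subseteq> \<psi> ` U"
      by (rule chart_disc_exists[OF charts oW pW])
    \<comment> \<open>Half the radius makes this symmetric: for points at distance less than
      \<open>r/2\<close>, the disc of that radius about either of them contains the other and stays
      in the chart.\<close>
    have move: "?N {q', a}" if q: "q \<in> U" "q' \<in> U" "?N {q, a}" "\<psi> q' \<in> ball (\<psi> q) (r/2)" "cball (\<psi> q) (r/2) \<subseteq> \<psi> ` U" for q q'
    proof -
      have "?N ({x \<in> U. \<psi> x \<in> ball (\<psi> q) (r/2)} \<union> {a})"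
        by (rule mod2_boundary_avoid_disc[OF U(1) H q(1) _ q(5) _ z_chain]) (use U(3,4) aK q(3) in auto)
      then show ?thesis by (rule mono) (use q in auto)
    qed
    let ?T = "{q \<in> U. \<psi> q \<in> ball (\<psi> p) (r/2)}"
    have pT: "p \<in> ?T" using U by auto
    have "p \<in> G \<longleftrightarrow> q \<in> G" if q: "q \<in> ?T" for q
    proof -
      have 1: "cball (\<psi> p) (r/2) \<subseteq> \<psi> ` U" by (rule order_trans[OF subset_cball U(5)]) (use U(4) in auto)
      have "cball (\<psi> q) (r/2) \<subseteq> cball (\<psi> p) r"
      proof
        fix x assume "x \<in> cball (\<psi> q) (r/2)"
        then show "x \<in> cball (\<psi> p) r" using q dist_triangle[of "\<psi> p" x "\<psi> q"] by auto
      qed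
      then have 2: "cball (\<psi> q) (r/2) \<subseteq> \<psi> ` U" using U(5) by blast
      have "?N {p, a} \<longleftrightarrow> ?N {q, a}"
        using move[of p q] move[of q p] 1 2 q U(2) by (auto simp: dist_commute)
      then show ?thesis using q U(3) p False by (auto simp: G_def)
    qed
    then show ?thesis using openin_chart_preimage[OF U(1), of "ball (\<psi> p) (r/2)"] pT U(3)
      by (intro exI[of _ ?T]) auto
  qed
  have oG: "openin X G"
    unfolding openin_subopen[of X G]
  proof
    fix p assume "p \<in> G"
    then have "p \<in> topspace X - K" by (simp add: G_def)
    from nbhd[OF this] \<open>p \<in> G\<close> show "\<exists>T. openin X T \<and> p \<in> T \<and> T \<subseteq> G" by blast
  qed
  have oG': "openin X ((topspace X - K) - G)"
    unfolding openin_subopen[of X "(topspace X - K) - G"]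
  proof
    fix p assume p: "p \<in> (topspace X - K) - G"
    then have "p \<in> topspace X - K" by simp
    from nbhd[OF this] p show "\<exists>T. openin X T \<and> p \<in> T \<and> T \<subseteq> (topspace X - K) - G" by blast
  qed
  have "a \<in> G" using aK by (auto simp: G_def)
  then have "G \<inter> (topspace X - K) \<noteq> {}" "((topspace X - K) - G) \<inter> (topspace X - K) \<noteq> {}" using aK b by blast+
  moreover have "topspace X - K \<subseteq> G \<union> ((topspace X - K) - G)" "G \<inter> ((topspace X - K) - G) \<inter> (topspace X - K) = {}" by blast+
  ultimately show False using conn oG oG' unfolding connectedin by blast
qed

text \<open>Of the two windings of the local cycle, whose sum is odd, exactly one is even. Around
  that pole the local cycle bounds in the punctured chart, so \<open>z\<close> bounds off this pole,
  and the pole can serve as the point from which the sides are compared.\<close>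

lemma separated:
  assumes zb: "z \<in> mod2_boundaries 1 X"
  shows "\<not> connectedin X (topspace X - K)"
proof -
  obtain w f where w: "singular_chain 2 X w" "z = chain_boundary 2 w + frag_cmul 2 f"
    using zb by (auto simp: mod2_boundaries_def numeral_2_eq_2 One_nat_def)
  obtain y where y: "y \<in> mod2_cycles 1 (subtopology X (B - {p1, p2}))"
    "odd (coeff_sum (wind (\<lambda>p. \<phi> p - \<phi> p1)) y + coeff_sum (wind (\<lambda>p. \<phi> p - \<phi> p2)) y)"
    "\<And>p. p \<in> {p1, p2} \<Longrightarrow> y \<in> mod2_boundaries 1 (subtopology X (topspace X - {p})) \<Longrightarrow>
        z \<in> mod2_boundaries 1 (subtopology X (topspace X - {p}))"
    by (rule local_parity[OF w]) blast
  have yp: "y \<in> mod2_cycles 1 (subtopology X (B - {p}))" if "p \<in> {p1, p2}" for p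
    by (rule mod2_cycles_mono[OF _ y(1)]) (use that in auto)
  from y(2) consider "even (coeff_sum (wind (\<lambda>p. \<phi> p - \<phi> p1)) y)" | "even (coeff_sum (wind (\<lambda>p. \<phi> p - \<phi> p2)) y)" by fastforce
  then show ?thesis
  proof cases
    case 1
    then show ?thesis using separated_aux[of p1 p2] y(3)[of p1] even_wind_bounds[OF yp p1(1)] by simp
  next
    case 2
    then show ?thesis using separated_aux[of p2 p1] y(3)[of p2] even_wind_bounds[OF yp p2(1)] by (simp add: insert_commute)
  qed
qed

end

section \<open>The black side of an alternating diagram\<close>

lemma strict_mono_dichotomy:
  fixes f :: "real \<Rightarrow> real"
  assumes "continuous_on {a..b} f" "inj_on f {a..b}" "a < b"
  obtains "\<And>x y. a \<le> x \<Longrightarrow> x < y \<Longrightarrow> y \<le> b \<Longrightarrow> f x < f y" | "\<And>x y. a \<le> x \<Longrightarrow> x < y \<Longrightarrow> y \<le> b \<Longrightarrow> f x > f y"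
proof -
  have sub: "f u < f v \<and> f v < f w \<or> f w < f v \<and> f v < f u" if "a \<le> u" "u < v" "v < w" "w \<le> b" for u v w
    using that by (intro continuous_inj_imp_mono continuous_on_subset[OF assms(1)] inj_on_subset[OF assms(2)]) auto
  have ne: "f a \<noteq> f b" using assms(2,3) by (auto dest: inj_onD)
  show thesis
  proof (cases "f a < f b")
    case True
    have "f x < f y" if "a \<le> x" "x < y" "y \<le> b" for x y
      using sub[of a x y] sub[of x y b] sub[of a x b] True that by (cases "x = a"; cases "y = b") force+
    then show thesis by (rule that(1))
  next
    case False
    have "f x > f y" if "a \<le> x" "x < y" "y \<le> b" for x y
      using sub[of a x y] sub[of x y b] sub[of a x b] False ne that by (cases "x = a"; cases "y = b") force+
    then show thesis by (rule that(2))
  qed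
qed

lemma zero_not_in_segment:
  assumes "Im a > 0 \<and> Im b > 0 \<or> Im a < 0 \<and> Im b < 0 \<or> Im a = 0 \<and> Im b = 0 \<and> Re a * Re b > 0"
  shows "0 \<notin> closed_segment a b"
proof
  assume "0 \<in> closed_segment a b"
  then obtain u where u: "0 \<le> u" "u \<le> 1" "0 = (1 - u) *\<^sub>R a + u *\<^sub>R b" by (auto simp: closed_segment_def)
  have pos: False if "(1 - u) * x + u * y = 0" "x * y > 0" for x y :: real
  proof (cases "x > 0")
    case True
    then have "y > 0" using that(2) by (simp add: zero_less_mult_iff)
    then show False using that(1) True u(1,2) by (smt (verit) mult_nonneg_nonneg mult_pos_pos)
  next
    case False
    then have "x < 0" "y < 0" using that(2) by (auto simp: zero_less_mult_iff)
    then show False using that(1) u(1,2) by (smt (verit) mult_nonneg_nonpos mult_pos_neg)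
  qed
  have "(1 - u) * Re a + u * Re b = 0" "(1 - u) * Im a + u * Im b = 0"
    using arg_cong[OF u(3), of Re] arg_cong[OF u(3), of Im] by auto
  then show False using assms pos[of "Re a" "Re b"] pos[of "Im a" "Im b"]
    by (auto simp: mult_pos_pos mult_neg_neg)
qed

text \<open>For nonzero w the segment from w to \<i> w misses 0, so the winding number survives a
  quarter turn. Iteration yields the turns by -1 and - \<i>, by which every half strand at a
  crossing is brought to the positive real axis.\<close>

lemma oriented_chart_mult_i:
  assumes surf: "\<And>V \<psi>. (V,\<psi>) \<in> \<A> \<Longrightarrow> chart X V \<psi>" and oc: "oriented_chart X \<A> U \<phi>"
  shows "oriented_chart X \<A> U (\<lambda>p. \<i> * \<phi> p)"
proof -
  have ch: "chart X U \<phi>" using oc by (simp add: oriented_chart_def)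
  let ?f = "\<lambda>p. \<i> * \<phi> p"
  have im: "?f ` U = (\<lambda>z. \<i> * z) ` (\<phi> ` U)" by (simp add: image_image)
  have "bij (\<lambda>z. \<i> * z :: complex)" by (rule bij_betw_byWitness[of _ "\<lambda>z. - \<i> * z"]) auto
  have hm: "homeomorphic_map (top_of_set (\<phi> ` U)) (top_of_set (?f ` U)) (\<lambda>z. \<i> * z)"
    unfolding homeomorphic_map_maps homeomorphic_maps_def
    by (intro exI[of _ "\<lambda>z. - \<i> * z"]) (auto intro!: continuous_intros)
  have "(\<lambda>z. \<i> * z) ` (\<phi> ` U) = (\<lambda>z. - \<i> * z) -` (\<phi> ` U)" by (force intro: image_eqI[of _ _ "- \<i> * _"])
  moreover have "open ((\<lambda>z. - \<i> * z) -` (\<phi> ` U))"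
    using ch by (intro open_vimage continuous_intros) (simp add: chart_def)
  ultimately have "open (?f ` U)" using im by simp
  then have "chart X U ?f"
    using ch homeomorphic_map_compose[OF _ hm, of "subtopology X U" \<phi>] by (simp add: chart_def o_def)
  moreover have "orientation_compatible V \<psi> U ?f" if "(V,\<psi>) \<in> \<A>" for V \<psi>
    unfolding orientation_compatible_def
  proof (intro ballI allI impI)
    fix p r assume p: "p \<in> V \<inter> U" and r: "(0::real) < r" and cb: "cball (\<psi> p) r \<subseteq> \<psi> ` (V \<inter> U)"
    have cV: "chart X V \<psi>" using surf that by blast
    let ?g = "\<phi> \<circ> inv_into V \<psi> \<circ> circlepath (\<psi> p) r"
    have w1: "winding_number ?g (\<phi> p) = 1"
      using oc that p r cb unfolding oriented_chart_def orientation_compatible_def by blast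
    have pic: "path_image (circlepath (\<psi> p) r) \<subseteq> \<psi> ` (V \<inter> U)"
      using cb r sphere_cball by (auto simp: path_image_circlepath)
    have VU: "inv_into V \<psi> z \<in> V \<inter> U" if "z \<in> \<psi> ` (V \<inter> U)" for z using that chart_inverse(3)[OF cV] by auto
    have "continuous_map (top_of_set (\<psi> ` (V \<inter> U))) (subtopology X U) (inv_into V \<psi>)"
      using continuous_map_chart_inverse[OF cV, of "\<psi> ` (V \<inter> U)"] VU by (auto simp: continuous_map_in_subtopology)
    from continuous_map_compose[OF this chart_facts(3)[OF ch]]
    have co: "continuous_on (\<psi> ` (V \<inter> U)) (\<phi> \<circ> inv_into V \<psi>)" by simp
    have pg: "path ?g" by (metis co continuous_on_subset path_circlepath path_continuous_image pic)
    have off: "\<phi> p \<notin> path_image ?g"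
    proof
      assume "\<phi> p \<in> path_image ?g"
      then obtain z where z: "z \<in> sphere (\<psi> p) r" "\<phi> p = \<phi> (inv_into V \<psi> z)"
        using r by (auto simp: path_image_compose path_image_circlepath)
      then have "z \<in> \<psi> ` (V \<inter> U)" using cb by auto
      then obtain q where q: "q \<in> V \<inter> U" "z = \<psi> q" by auto
      then have "\<phi> p = \<phi> q" using z chart_inverse(3)[OF cV] by auto
      then have "p = q" using chart_facts(1)[OF ch] q p by (auto dest: inj_onD)
      then show False using z q r by auto
    qed
    have "winding_number (\<lambda>t. \<i> * (?g t - \<phi> p)) 0 = winding_number (\<lambda>t. ?g t - \<phi> p) 0"
    proof (rule winding_number_loops_linear_eq)
      show "path (\<lambda>t. ?g t - \<phi> p)" "path (\<lambda>t. \<i> * (?g t - \<phi> p))"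
        using pg by (auto simp: path_def intro!: continuous_intros)
      show "pathfinish (\<lambda>t. ?g t - \<phi> p) = pathstart (\<lambda>t. ?g t - \<phi> p)"
        "pathfinish (\<lambda>t. \<i> * (?g t - \<phi> p)) = pathstart (\<lambda>t. \<i> * (?g t - \<phi> p))"
        by (simp_all add: pathfinish_def pathstart_def circlepath)
      fix t :: real assume t: "t \<in> {0..1}"
      show "0 \<notin> closed_segment (?g t - \<phi> p) (\<i> * (?g t - \<phi> p))"
      proof
        assume "0 \<in> closed_segment (?g t - \<phi> p) (\<i> * (?g t - \<phi> p))"
        then obtain s where s: "0 = (1-s) *\<^sub>R (?g t - \<phi> p) + s *\<^sub>R (\<i> * (?g t - \<phi> p))"
          by (auto simp: closed_segment_def)
        then have "0 = Complex (1 - s) s * (?g t - \<phi> p)" by (simp add: scaleR_conv_of_real Complex_eq algebra_simps)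
        moreover have "?g t \<noteq> \<phi> p" using off t unfolding path_image_def by (metis imageI)
        ultimately have "Complex (1 - s) s = 0" by simp
        then show False by (auto simp: complex_eq_iff)
      qed
    qed
    then have "winding_number (\<lambda>t. \<i> * ?g t) (\<i> * \<phi> p) = winding_number ?g (\<phi> p)"
      by (subst winding_number_offset, subst (2) winding_number_offset) (simp add: right_diff_distrib)
    then show "winding_number ((\<lambda>p. \<i> * \<phi> p) \<circ> inv_into V \<psi> \<circ> circlepath (\<psi> p) r) (\<i> * \<phi> p) = 1"
      using w1 by (simp add: o_def)
  qed
  ultimately show ?thesis by (auto simp: oriented_chart_def)
qed

section \<open>Strands of an alternating diagram and their direction\<close>

locale diagram =
  fixes X :: "'a topology" and \<A> :: "('a set \<times> ('a \<Rightarrow> complex)) set" and n :: nat and L :: "nat \<Rightarrow> real \<Rightarrow> 'a \<times> real"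
  assumes surface: "closed_connected_oriented_surface X \<A>" and diagram: "link_diagram X \<A> n L"
    and alt: "alternating n L"
begin

abbreviation D :: "'a set" where "D \<equiv> projection n L"
abbreviation C :: "'a set" where "C \<equiv> crossings n L"
abbreviation \<pi> :: "nat \<Rightarrow> real \<Rightarrow> 'a" where "\<pi> i t \<equiv> fst (L i t)"

lemma Hd: "Hausdorff_space X" and atlas: "(V,\<psi>) \<in> \<A> \<Longrightarrow> chart X V \<psi>"
  using surface by (auto simp: closed_connected_oriented_surface_def)

lemma charts: "p \<in> topspace X \<Longrightarrow> \<exists>U \<psi>. (U, \<psi>) \<in> \<A> \<and> p \<in> U"
proof -
  assume "p \<in> topspace X"
  then have "p \<in> (\<Union>(U, \<phi>) \<in> \<A>. U)" using surface unfolding closed_connected_oriented_surface_def by metis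
  then show ?thesis by blast
qed

lemma finite_C: "finite C" using diagram by (simp add: link_diagram_def)

lemma L_eq: "i < n \<Longrightarrow> j < n \<Longrightarrow> L i s = L j t \<longleftrightarrow> i = j \<and> s - t \<in> \<int>"
  using diagram by (simp add: link_diagram_def link_in_thickening_def)

lemma cont_pi: "i < n \<Longrightarrow> continuous_map euclideanreal X (\<pi> i)"
proof -
  assume "i < n"
  then have "continuous_map euclideanreal (prod_topology X (top_of_set {0..1})) (L i)"
    using diagram by (simp add: link_diagram_def link_in_thickening_def)
  from continuous_map_compose[OF this continuous_map_fst] show ?thesis by (simp add: o_def)
qed

lemma pi_top: "i < n \<Longrightarrow> \<pi> i t \<in> topspace X"
  using cont_pi by (auto simp: continuous_map_def)

lemma D_iff: "x \<in> D \<longleftrightarrow> (\<exists>i t. i < n \<and> x = \<pi> i t)"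
  by (auto simp: projection_def)

lemma D_top: "D \<subseteq> topspace X" using pi_top by (auto simp: D_iff)

lemma L_periodic: "i < n \<Longrightarrow> s - t \<in> \<int> \<Longrightarrow> L i s = L i t" using L_eq by auto

lemma frac_Ints: "frac s - s \<in> (\<int> :: real set)" by (simp add: frac_def)

lemma strands_iff: "(i, t) \<in> strands_at n L x \<longleftrightarrow> i < n \<and> t \<in> {0..<1} \<and> \<pi> i t = x"
  by (auto simp: strands_at_def)

lemma strand_frac: "i < n \<Longrightarrow> \<pi> i t = x \<Longrightarrow> (i, frac t) \<in> strands_at n L x"
  using L_periodic[OF _ frac_Ints, of i t] by (auto simp: strands_iff frac_lt_1)

lemma C_sub_D: "C \<subseteq> D"
proof
  fix c assume "c \<in> C"
  then have "card (strands_at n L c) = 2" by (simp add: crossings_def)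
  then have "strands_at n L c \<noteq> {}" by auto
  then show "c \<in> D" by (auto simp: strands_at_def D_iff)
qed

lemma simple_unique:
  assumes "i < n" "j < n" "\<pi> i t = x" "\<pi> j s = x" "x \<notin> C"
  shows "j = i \<and> s - t \<in> \<int>"
proof -
  have "x \<in> D" using assms by (auto simp: D_iff)
  then have "card (strands_at n L x) = 1" using diagram assms(5) unfolding link_diagram_def by (auto simp: crossings_def)
  then obtain q where "strands_at n L x = {q}" by (rule card_1_singletonE)
  then have "(i, frac t) = (j, frac s)" using strand_frac assms by (metis singletonD)
  then have "L i (frac t) = L j (frac s)" by simp
  moreover have "L i t = L i (frac t)" "L j s = L j (frac s)" using L_periodic frac_Ints assms by metis+
  ultimately show ?thesis using L_eq[OF assms(2,1)] by metis
qed

text \<open>The link is embedded, so the two strands over a crossing have different heights. Hence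
  each parameter value over \<open>c\<close> belongs to exactly one of over- and understrand, up to
  the period.\<close>

lemma crossing_strands:
  assumes "c \<in> C"
  obtains i t j s where "i < n" "j < n" "\<pi> i t = c" "\<pi> j s = c" "passes_over n L i t" "passes_under n L j s"
    "\<And>k r. k < n \<Longrightarrow> \<pi> k r = c \<Longrightarrow> (k = i \<and> r - t \<in> \<int> \<and> passes_over n L k r \<and> \<not> passes_under n L k r)
        \<or> (k = j \<and> r - s \<in> \<int> \<and> passes_under n L k r \<and> \<not> passes_over n L k r)"
proof -
  have "card (strands_at n L c) = 2" using assms by (simp add: crossings_def)
  then obtain a b where ab: "strands_at n L c = {a, b}" "a \<noteq> b" by (auto simp: card_2_iff)
  note result = that
  have main: thesis if ab: "strands_at n L c = {(i,t), (j,s)}" "(i,t) \<noteq> (j,s)" and lt: "snd (L i t) > snd (L j s)" for i j t s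
  proof -
    have i: "i < n" "\<pi> i t = c" and j: "j < n" "\<pi> j s = c" using ab strands_iff by blast+
    have all: "L k r = L i t \<or> L k r = L j s" "L k r = L i t \<Longrightarrow> k = i \<and> r - t \<in> \<int>" "L k r = L j s \<Longrightarrow> k = j \<and> r - s \<in> \<int>"
      if "k < n" "\<pi> k r = c" for k r
    proof -
      have "(k, frac r) \<in> {(i,t), (j,s)}" using strand_frac[OF that] ab by simp
      moreover have "L k r = L k (frac r)" using L_periodic[OF that(1)] frac_Ints by metis
      ultimately show "L k r = L i t \<or> L k r = L j s" by auto
      show "L k r = L i t \<Longrightarrow> k = i \<and> r - t \<in> \<int>" "L k r = L j s \<Longrightarrow> k = j \<and> r - s \<in> \<int>" using L_eq i j that by auto
    qed
    have over: "passes_over n L k r \<and> \<not> passes_under n L k r" if "k < n" "L k r = L i t" for k r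
      unfolding passes_over_def passes_under_def using that i j lt all by (metis less_asym less_irrefl)
    have under: "passes_under n L k r \<and> \<not> passes_over n L k r" if "k < n" "L k r = L j s" for k r
      unfolding passes_over_def passes_under_def using that i j lt all by (metis less_asym less_irrefl)
    show thesis
    proof (rule result[OF i(1) j(1) i(2) j(2)])
      show "passes_over n L i t" using over[OF i(1) refl] by blast
      show "passes_under n L j s" using under[OF j(1) refl] by blast
      fix k r assume k: "k < n" "\<pi> k r = c"
      from all(1)[OF k] show "(k = i \<and> r - t \<in> \<int> \<and> passes_over n L k r \<and> \<not> passes_under n L k r)
        \<or> (k = j \<and> r - s \<in> \<int> \<and> passes_under n L k r \<and> \<not> passes_over n L k r)"
      proof
        assume e: "L k r = L i t"
        show ?thesis using all(2)[OF k e] over[OF k(1) e] by simp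
      next
        assume e: "L k r = L j s"
        show ?thesis using all(3)[OF k e] under[OF k(1) e] by simp
      qed
    qed
  qed
  obtain i t j s where ij: "a = (i,t)" "b = (j,s)" by (metis surj_pair)
  have i: "i < n" "\<pi> i t = c" "t \<in> {0..<1}" and j: "j < n" "\<pi> j s = c" "s \<in> {0..<1}" using ab ij strands_iff by blast+
  have "L i t \<noteq> L j s"
  proof
    assume "L i t = L j s"
    then have "i = j" "t - s \<in> \<int>" using L_eq i j by auto
    moreover have "frac t = frac s" using \<open>t - s \<in> \<int>\<close> by (metis diff_add_cancel frac_add_int_left)
    ultimately show False using ab ij i(3) j(3) by simp
  qed
  then have "snd (L i t) \<noteq> snd (L j s)" using i j by (auto simp: prod_eq_iff)
  then show thesis using main[of i t j s] main[of j s i t] ab ij by (cases "snd (L i t) > snd (L j s)") (auto simp: insert_commute)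
qed

lemma finite_Ints_shift: "finite {u \<in> {a..b}. u - t \<in> (\<int>::real set)}"
proof -
  have "finite ((\<lambda>x. x + t) ` {x \<in> \<int>. a - t \<le> x \<and> x \<le> b - t})" by (intro finite_imageI finite_int_segment)
  moreover have "{u \<in> {a..b}. u - t \<in> \<int>} \<subseteq> (\<lambda>x. x + t) ` {x \<in> \<int>. a - t \<le> x \<and> x \<le> b - t}"
  proof
    fix u assume "u \<in> {u \<in> {a..b}. u - t \<in> \<int>}"
    then show "u \<in> (\<lambda>x. x + t) ` {x \<in> \<int>. a - t \<le> x \<and> x \<le> b - t}" by (intro image_eqI[of _ _ "u - t"]) auto
  qed
  ultimately show ?thesis using finite_subset by blast
qed

lemma finite_crossing_times: "i < n \<Longrightarrow> finite {u \<in> {a..b}. \<pi> i u \<in> C}"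
proof -
  assume i: "i < n"
  have "finite {u \<in> {a..b}. \<pi> i u = c}" if c: "c \<in> C" for c
  proof -
    show ?thesis
    proof (rule crossing_strands[OF c])
      fix k t j s assume H: "\<And>k' r. k' < n \<Longrightarrow> \<pi> k' r = c \<Longrightarrow>
        (k' = k \<and> r - t \<in> \<int> \<and> passes_over n L k' r \<and> \<not> passes_under n L k' r) \<or>
        (k' = j \<and> r - s \<in> \<int> \<and> passes_under n L k' r \<and> \<not> passes_over n L k' r)"
      have "{u \<in> {a..b}. \<pi> i u = c} \<subseteq> {u \<in> {a..b}. u - t \<in> \<int>} \<union> {u \<in> {a..b}. u - s \<in> \<int>}"
        using H[OF i] by fast
      then show ?thesis by (rule finite_subset) (intro finite_UnI finite_Ints_shift)
    qed
  qed
  then have "finite (\<Union>c\<in>C. {u \<in> {a..b}. \<pi> i u = c})" using finite_C by blast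
  moreover have "{u \<in> {a..b}. \<pi> i u \<in> C} = (\<Union>c\<in>C. {u \<in> {a..b}. \<pi> i u = c})" by auto
  ultimately show ?thesis by simp
qed

lemma no_crossing_near:
  assumes "i < n" obtains \<eta> where "\<eta> > 0" "\<eta> < 1/2" "\<And>s. s \<noteq> t \<Longrightarrow> \<bar>s - t\<bar> < \<eta> \<Longrightarrow> \<pi> i s \<notin> C"
proof -
  have "\<not> t islimpt {u \<in> {t-1..t+1}. \<pi> i u \<in> C}" using finite_crossing_times[OF assms] by (rule islimpt_finite)
  then have "\<forall>\<^sub>F s in at t. s \<notin> {u \<in> {t-1..t+1}. \<pi> i u \<in> C}" by (simp add: islimpt_iff_eventually)
  then obtain d where d: "d > 0" "\<And>s. s \<noteq> t \<Longrightarrow> dist s t < d \<Longrightarrow> s \<notin> {u \<in> {t-1..t+1}. \<pi> i u \<in> C}"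
    unfolding eventually_at by auto
  show thesis
  proof (rule that[of "min (d/2) (1/4)"])
    show "\<pi> i s \<notin> C" if "s \<noteq> t" "\<bar>s - t\<bar> < min (d/2) (1/4)" for s
      using d(2)[OF that(1)] that(2) d(1) by (auto simp: dist_real_def)
  qed (use d in auto)
qed

text \<open>Whether the parameter runs in the direction from over- to undercrossing: the first
  crossing from \<open>t\<close> on is passed under. On a component without crossings this is
  constantly false, which still selects a direction consistently.\<close>

definition fwd :: "nat \<Rightarrow> real \<Rightarrow> bool" where
  "fwd i t \<longleftrightarrow> (\<exists>u\<ge>t. \<pi> i u \<in> C \<and> (\<forall>s. t \<le> s \<and> s < u \<longrightarrow> \<pi> i s \<notin> C) \<and> passes_under n L i u)"

lemma fwd_eq:
  assumes "s \<le> u" "\<pi> i u \<in> C" "\<And>r. s \<le> r \<Longrightarrow> r < u \<Longrightarrow> \<pi> i r \<notin> C"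
  shows "fwd i s \<longleftrightarrow> passes_under n L i u"
proof
  assume "fwd i s"
  then obtain v where "v \<ge> s" "\<pi> i v \<in> C" "\<forall>r. s \<le> r \<and> r < v \<longrightarrow> \<pi> i r \<notin> C" "passes_under n L i v" by (auto simp: fwd_def)
  then show "passes_under n L i u" using assms by (metis linorder_neqE_linordered_idom)
qed (use assms in \<open>auto simp: fwd_def\<close>)

lemma fwd_const:
  assumes "s \<le> t" "\<And>r. s \<le> r \<Longrightarrow> r \<le> t \<Longrightarrow> \<pi> i r \<notin> C"
  shows "fwd i s \<longleftrightarrow> fwd i t"
proof
  assume "fwd i s"
  then obtain v where v: "v \<ge> s" "\<pi> i v \<in> C" "\<forall>r. s \<le> r \<and> r < v \<longrightarrow> \<pi> i r \<notin> C" "passes_under n L i v" by (auto simp: fwd_def)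
  then have "v > t" using assms(2)[of v] by force
  then show "fwd i t" unfolding fwd_def using v assms(1) by (intro exI[of _ v]) auto
next
  assume "fwd i t"
  then obtain v where v: "v \<ge> t" "\<pi> i v \<in> C" "\<forall>r. t \<le> r \<and> r < v \<longrightarrow> \<pi> i r \<notin> C" "passes_under n L i v" by (auto simp: fwd_def)
  have "\<pi> i r \<notin> C" if "s \<le> r" "r < v" for r using that v assms(2)[of r] by (cases "r \<le> t") auto
  then show "fwd i s" unfolding fwd_def using v assms(1) by (intro exI[of _ v]) auto
qed

text \<open>This is where alternation enters. Just before \<open>t\<close> the next crossing is the
  one at \<open>t\<close>; just after it, it is the following one, which exists by periodicity and
  is passed under iff the one at \<open>t\<close> is passed over.\<close>

lemma fwd_near_crossing:
  assumes i: "i < n" and c: "\<pi> i t \<in> C"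
  obtains \<eta> where "\<eta> > 0" "\<And>s. t - \<eta> < s \<Longrightarrow> s < t \<Longrightarrow> fwd i s \<longleftrightarrow> passes_under n L i t"
    "\<And>s. t < s \<Longrightarrow> s < t + \<eta> \<Longrightarrow> fwd i s \<longleftrightarrow> passes_over n L i t"
proof -
  let ?T = "{u \<in> {t..t+1}. \<pi> i u \<in> C} - {t}"
  have fin: "finite ?T" using finite_crossing_times[OF i] by blast
  have "\<pi> i (t+1) = \<pi> i t" using L_periodic[OF i, of "t+1" t] by simp
  then have "t + 1 \<in> ?T" using c by auto
  then have ne: "?T \<noteq> {}" by blast
  define u where "u = Min ?T"
  have uT: "u \<in> ?T" unfolding u_def using Min_in[OF fin ne] .
  then have u: "u > t" "\<pi> i u \<in> C" by auto
  have um: "\<pi> i r \<notin> C" if "t < r" "r < u" for r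
  proof
    assume "\<pi> i r \<in> C"
    then have "r \<in> ?T" using that uT by auto
    then have "u \<le> r" unfolding u_def using Min_le[OF fin] by blast
    then show False using that by simp
  qed
  have ou: "passes_over n L i t \<longleftrightarrow> passes_under n L i u"
    using alt i u c um unfolding alternating_def by blast
  obtain \<eta> where \<eta>: "\<eta> > 0" "\<And>s. s \<noteq> t \<Longrightarrow> \<bar>s - t\<bar> < \<eta> \<Longrightarrow> \<pi> i s \<notin> C"
    by (rule no_crossing_near[OF i, of t]) blast
  show thesis
  proof (rule that[of "min \<eta> (u - t)"])
    show "min \<eta> (u - t) > 0" using \<eta> u by auto
    show "fwd i s \<longleftrightarrow> passes_under n L i t" if "t - min \<eta> (u - t) < s" "s < t" for s
      by (rule fwd_eq) (use that \<eta> c in auto)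
    show "fwd i s \<longleftrightarrow> passes_over n L i t" if "t < s" "s < t + min \<eta> (u - t)" for s
      unfolding ou by (rule fwd_eq) (use that u um in auto)
  qed
qed

text \<open>Everything of the diagram except a short piece of strand around \<open>t\<close> is a
  finite union of compact images and misses the point, which is passed only once per period. Its
  complement is the neighbourhood.\<close>

lemma local_strand:
  assumes i: "i < n" and s: "\<pi> i t \<notin> C" and \<eta>: "\<eta> > 0"
  obtains W where "openin X W" "\<pi> i t \<in> W" "D \<inter> W \<subseteq> \<pi> i ` {t-\<eta><..<t+\<eta>}"
proof -
  \<comment> \<open>The interval of length 2 contains translates of the short piece by one period at
    both ends; these are cut out as well, since they have the same image.\<close>
  define K where "K j = (if j = i then {t-1..t+1} - ({t-\<eta><..<t+\<eta>} \<union> {t-1-\<eta><..<t-1+\<eta>} \<union> {t+1-\<eta><..<t+1+\<eta>}) else {0..1})" for j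
  have "compactin X (\<pi> j ` K j)" if "j < n" for j
  proof (rule image_compactin[OF _ cont_pi[OF that]])
    have "closed (K j)" unfolding K_def by (auto intro!: closed_Diff open_Un)
    moreover have "bounded (K j)" unfolding K_def using bounded_closed_interval[of "t-1" "t+1"] bounded_closed_interval[of 0 "1::real"]
      by (auto intro: bounded_subset)
    ultimately show "compactin euclideanreal (K j)" by (simp add: compact_eq_bounded_closed)
  qed
  then have cl: "closedin X (\<Union>j<n. \<pi> j ` K j)"
    by (intro closedin_Union) (auto intro: compactin_imp_closedin[OF Hd])
  have nin: "\<pi> i t \<notin> (\<Union>j<n. \<pi> j ` K j)"
  proof
    assume "\<pi> i t \<in> (\<Union>j<n. \<pi> j ` K j)"
    then obtain j r where j: "j < n" "r \<in> K j" "\<pi> j r = \<pi> i t" by auto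
    then have "j = i" "r - t \<in> \<int>" using simple_unique[OF i j(1) refl j(3) s] by auto
    then obtain m :: int where m: "r = t + of_int m" by (metis Ints_cases diff_add_cancel add.commute)
    have "\<bar>of_int m\<bar> \<le> (1::real)" using j(2) \<open>j = i\<close> m by (auto simp: K_def)
    then have "m = 0 \<or> m = 1 \<or> m = -1" by linarith
    then show False using j(2) \<open>j = i\<close> m \<eta> by (auto simp: K_def)
  qed
  show thesis
  proof (rule that)
    show "openin X (topspace X - (\<Union>j<n. \<pi> j ` K j))" using cl by blast
    show "\<pi> i t \<in> topspace X - (\<Union>j<n. \<pi> j ` K j)" using nin pi_top[OF i] by blast
    show "D \<inter> (topspace X - (\<Union>j<n. \<pi> j ` K j)) \<subseteq> \<pi> i ` {t-\<eta><..<t+\<eta>}"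
    proof
      fix x assume x: "x \<in> D \<inter> (topspace X - (\<Union>j<n. \<pi> j ` K j))"
      then obtain j r where j: "j < n" "x = \<pi> j r" by (auto simp: D_iff)
      show "x \<in> \<pi> i ` {t-\<eta><..<t+\<eta>}"
      proof (cases "j = i")
        case False
        have "frac r \<in> K j" using False by (auto simp: K_def less_imp_le[OF frac_lt_1])
        moreover have "x = \<pi> j (frac r)" using L_periodic[OF j(1) frac_Ints] j(2) by metis
        ultimately show ?thesis using x j(1) by blast
      next
        case True
        define r' where "r' = t + frac (r - t)"
        have "r' - r \<in> \<int>" using frac_Ints[of "r - t"] by (simp add: r'_def algebra_simps)
        then have xr: "x = \<pi> i r'" using L_periodic[OF i] j True by metis
        have r': "t \<le> r'" "r' < t + 1" by (simp_all add: r'_def frac_lt_1)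
        then have "r' \<notin> K i" using x i xr by blast
        then have "r' \<in> {t-\<eta><..<t+\<eta>} \<union> {t-1-\<eta><..<t-1+\<eta>} \<union> {t+1-\<eta><..<t+1+\<eta>}" using r' by (auto simp: K_def)
        then consider "r' \<in> {t-\<eta><..<t+\<eta>}" | "r' + 1 \<in> {t-\<eta><..<t+\<eta>}" | "r' - 1 \<in> {t-\<eta><..<t+\<eta>}" by auto
        then show ?thesis
        proof cases
          case 2
          have "x = \<pi> i (r' + 1)" using L_periodic[OF i, of "r' + 1" r'] xr by simp
          then show ?thesis using 2 by blast
        next
          case 3
          have "x = \<pi> i (r' - 1)" using L_periodic[OF i, of "r' - 1" r'] xr by simp
          then show ?thesis using 3 by blast
        qed (use xr in blast)
      qed
    qed
  qed
qed

text \<open>A positively oriented chart of any shape, free of crossings, that straightens the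
  diagram to the real axis. Leaving the shape open makes the notion stable under restriction to open
  subsets.\<close>

definition axis_chart :: "'a set \<Rightarrow> ('a \<Rightarrow> complex) \<Rightarrow> bool" where
  "axis_chart \<Omega> \<phi> \<longleftrightarrow> oriented_chart X \<A> \<Omega> \<phi> \<and> \<Omega> \<inter> C = {} \<and> (\<forall>p\<in>\<Omega>. p \<in> D \<longleftrightarrow> Im (\<phi> p) = 0)"

lemma axis_chartD:
  assumes "axis_chart \<Omega> \<phi>"
  shows "chart X \<Omega> \<phi>" "oriented_chart X \<A> \<Omega> \<phi>" "\<Omega> \<inter> C = {}" "\<And>p. p \<in> \<Omega> \<Longrightarrow> p \<in> D \<longleftrightarrow> Im (\<phi> p) = 0" "openin X \<Omega>" "\<Omega> \<subseteq> topspace X"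
  using assms chart_facts(2) by (auto simp: axis_chart_def oriented_chart_def chart_def)

lemma axis_chart_restrict:
  assumes "axis_chart \<Omega> \<phi>" "openin X W" "W \<subseteq> \<Omega>" shows "axis_chart W \<phi>"
  using shrink_oriented_chart[OF atlas axis_chartD(2)[OF assms(1)] assms(2,3), of 1] assms by (auto simp: axis_chart_def)

lemma axis_chart_minus: "axis_chart \<Omega> \<phi> \<Longrightarrow> axis_chart \<Omega> (\<lambda>p. - \<phi> p)"
  using oriented_chart_mult_i[OF atlas oriented_chart_mult_i[OF atlas, where U = \<Omega> and \<phi> = \<phi>]]
  by (auto simp: axis_chart_def simp flip: mult.assoc)

text \<open>The strand runs to the right in the chart at time \<open>t\<close>. In the absence of
  derivatives this is the agreement of signs of differences near \<open>t\<close>.\<close>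

definition incr :: "('a \<Rightarrow> complex) \<Rightarrow> nat \<Rightarrow> real \<Rightarrow> bool" where
  "incr \<phi> i t \<longleftrightarrow> (\<exists>\<eta>>0. \<forall>s. \<bar>s - t\<bar> < \<eta> \<longrightarrow> sgn (Re (\<phi> (\<pi> i s)) - Re (\<phi> (\<pi> i t))) = sgn (s - t))"

lemma monotone_near:
  assumes ch: "chart X \<Omega> \<phi>" and i: "i < n" and t: "\<pi> i t \<in> \<Omega>"
    and real: "\<forall>\<^sub>F s in nhds t. Im (\<phi> (\<pi> i s)) = 0"
  obtains \<eta> where "\<eta> > 0" "\<And>s. \<bar>s - t\<bar> \<le> \<eta> \<Longrightarrow> \<pi> i s \<in> \<Omega>"
      "\<And>s. \<bar>s - t\<bar> \<le> \<eta> \<Longrightarrow> Im (\<phi> (\<pi> i s)) = 0"  "\<And>s. \<bar>s - t\<bar> \<le> \<eta> \<Longrightarrow> s \<noteq> t \<Longrightarrow> \<pi> i s \<notin> C"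
      "(\<forall>r s. \<bar>r - t\<bar> \<le> \<eta> \<and> \<bar>s - t\<bar> \<le> \<eta> \<and> r < s \<longrightarrow> Re (\<phi> (\<pi> i r)) < Re (\<phi> (\<pi> i s))) \<or>
       (\<forall>r s. \<bar>r - t\<bar> \<le> \<eta> \<and> \<bar>s - t\<bar> \<le> \<eta> \<and> r < s \<longrightarrow> Re (\<phi> (\<pi> i r)) > Re (\<phi> (\<pi> i s)))"
proof -
  have oO: "openin X \<Omega>" using ch by (simp add: chart_def)
  have "openin euclideanreal {s \<in> topspace euclideanreal. \<pi> i s \<in> \<Omega>}"
    by (rule openin_continuous_map_preimage[OF cont_pi[OF i] oO])
  then have "open {s. \<pi> i s \<in> \<Omega>}" by simp
  then have "\<forall>\<^sub>F s in nhds t. \<pi> i s \<in> \<Omega>" using t eventually_nhds by blast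
  with real have "\<forall>\<^sub>F s in nhds t. \<pi> i s \<in> \<Omega> \<and> Im (\<phi> (\<pi> i s)) = 0" by eventually_elim auto
  then obtain d where d: "d > 0" "\<And>s. dist s t < d \<Longrightarrow> \<pi> i s \<in> \<Omega> \<and> Im (\<phi> (\<pi> i s)) = 0"
    unfolding eventually_nhds_metric by blast
  obtain \<eta>0 where \<eta>0: "\<eta>0 > 0" "\<eta>0 < 1/2" "\<And>s. s \<noteq> t \<Longrightarrow> \<bar>s - t\<bar> < \<eta>0 \<Longrightarrow> \<pi> i s \<notin> C"
    by (rule no_crossing_near[OF i, of t]) blast
  define \<eta> where "\<eta> = min d \<eta>0 / 2"
  have \<eta>: "\<eta> > 0" "\<eta> < d" "\<eta> < \<eta>0" using d \<eta>0 by (auto simp: \<eta>_def)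
  have in\<Omega>: "\<pi> i s \<in> \<Omega>" "Im (\<phi> (\<pi> i s)) = 0" if "\<bar>s - t\<bar> \<le> \<eta>" for s
    using d(2)[of s] that \<eta> by (auto simp: dist_real_def)
  have noC: "\<pi> i s \<notin> C" if "\<bar>s - t\<bar> \<le> \<eta>" "s \<noteq> t" for s using \<eta>0(3)[OF that(2)] that \<eta> by auto
  let ?f = "\<lambda>s. Re (\<phi> (\<pi> i s))"
  have "continuous_map (top_of_set {t-\<eta>..t+\<eta>}) (subtopology X \<Omega>) (\<pi> i)"
    using continuous_map_from_subtopology[OF cont_pi[OF i], of "{t-\<eta>..t+\<eta>}"] in\<Omega>(1)
    by (auto simp: continuous_map_in_subtopology abs_le_iff)
  from continuous_map_compose[OF this chart_facts(3)[OF ch]]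
  have cont: "continuous_on {t-\<eta>..t+\<eta>} ?f" by (simp add: o_def) (intro continuous_intros)
  have inj: "inj_on ?f {t-\<eta>..t+\<eta>}"
  proof (rule inj_onI)
    fix r s assume rs: "r \<in> {t-\<eta>..t+\<eta>}" "s \<in> {t-\<eta>..t+\<eta>}" "?f r = ?f s"
    then have a: "\<bar>r - t\<bar> \<le> \<eta>" "\<bar>s - t\<bar> \<le> \<eta>" by auto
    have "\<phi> (\<pi> i r) = \<phi> (\<pi> i s)" using rs(3) in\<Omega>(2)[OF a(1)] in\<Omega>(2)[OF a(2)] by (simp add: complex_eq_iff)
    then have e: "\<pi> i r = \<pi> i s" using chart_facts(1)[OF ch] in\<Omega>(1) a by (meson inj_onD)
    have z: "x = 0" if "x \<in> \<int>" "\<bar>x\<bar> < 1" for x :: real using that by (auto elim!: Ints_cases)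
    have lt: "\<bar>r - s\<bar> < 1" using a \<eta> \<eta>0 by linarith
    show "r = s"
    proof (cases "\<pi> i r \<in> C")
      case True
      then have "r = t" "s = t" using noC a e by metis+
      then show ?thesis by simp
    next
      case False
      then have "r - s \<in> \<int>" using simple_unique[OF i i e[symmetric] refl False] by auto
      then show ?thesis using z[of "r - s"] lt by simp
    qed
  qed
  show thesis
  proof (rule that[OF \<eta>(1) in\<Omega> noC])
    have "t - \<eta> < t + \<eta>" using \<eta> by simp
    then show "(\<forall>r s. \<bar>r - t\<bar> \<le> \<eta> \<and> \<bar>s - t\<bar> \<le> \<eta> \<and> r < s \<longrightarrow> ?f r < ?f s) \<or>
       (\<forall>r s. \<bar>r - t\<bar> \<le> \<eta> \<and> \<bar>s - t\<bar> \<le> \<eta> \<and> r < s \<longrightarrow> ?f r > ?f s)"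
      by (rule strict_mono_dichotomy[OF cont inj]) (auto simp: abs_le_iff)
  qed
qed

lemma incr_iff:
  assumes \<eta>: "\<eta> > 0" and s: "\<bar>s - t\<bar> < \<eta>"
  shows "(\<forall>r s. \<bar>r - t\<bar> \<le> \<eta> \<and> \<bar>s - t\<bar> \<le> \<eta> \<and> r < s \<longrightarrow> Re (\<phi> (\<pi> i r)) < Re (\<phi> (\<pi> i s))) \<Longrightarrow> incr \<phi> i s"
    "(\<forall>r s. \<bar>r - t\<bar> \<le> \<eta> \<and> \<bar>s - t\<bar> \<le> \<eta> \<and> r < s \<longrightarrow> Re (\<phi> (\<pi> i r)) > Re (\<phi> (\<pi> i s))) \<Longrightarrow> \<not> incr \<phi> i s"
    "(\<forall>r s. \<bar>r - t\<bar> \<le> \<eta> \<and> \<bar>s - t\<bar> \<le> \<eta> \<and> r < s \<longrightarrow> Re (\<phi> (\<pi> i r)) > Re (\<phi> (\<pi> i s))) \<Longrightarrow> incr (\<lambda>p. - \<phi> p) i s"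
proof -
  let ?e = "\<eta> - \<bar>s - t\<bar>"
  have e: "?e > 0" using s by simp
  have near: "\<bar>r - t\<bar> \<le> \<eta>" "\<bar>s - t\<bar> \<le> \<eta>" if "\<bar>r - s\<bar> < ?e" for r using that s by linarith+
  {
    assume m: "\<forall>r s. \<bar>r - t\<bar> \<le> \<eta> \<and> \<bar>s - t\<bar> \<le> \<eta> \<and> r < s \<longrightarrow> Re (\<phi> (\<pi> i r)) < Re (\<phi> (\<pi> i s))"
    show "incr \<phi> i s" unfolding incr_def
    proof (intro exI[of _ ?e] conjI e allI impI)
      fix r assume "\<bar>r - s\<bar> < ?e"
      from near[OF this] show "sgn (Re (\<phi> (\<pi> i r)) - Re (\<phi> (\<pi> i s))) = sgn (r - s)"
        using m[rule_format, of r s] m[rule_format, of s r] by (cases r s rule: linorder_cases) (auto simp: sgn_if)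
    qed
  }
  assume m: "\<forall>r s. \<bar>r - t\<bar> \<le> \<eta> \<and> \<bar>s - t\<bar> \<le> \<eta> \<and> r < s \<longrightarrow> Re (\<phi> (\<pi> i r)) > Re (\<phi> (\<pi> i s))"
  show "incr (\<lambda>p. - \<phi> p) i s" unfolding incr_def
  proof (intro exI[of _ ?e] conjI e allI impI)
    fix r assume "\<bar>r - s\<bar> < ?e"
    from near[OF this] show "sgn (Re (- \<phi> (\<pi> i r)) - Re (- \<phi> (\<pi> i s))) = sgn (r - s)"
      using m[rule_format, of r s] m[rule_format, of s r] by (cases r s rule: linorder_cases) (auto simp: sgn_if)
  qed
  show "\<not> incr \<phi> i s"
  proof
    assume "incr \<phi> i s"
    then obtain d where d: "d > 0" "\<And>r. \<bar>r - s\<bar> < d \<Longrightarrow> sgn (Re (\<phi> (\<pi> i r)) - Re (\<phi> (\<pi> i s))) = sgn (r - s)"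
      by (auto simp: incr_def)
    obtain w where "0 < w" "w < d" "w < ?e" using field_lbound_gt_zero[OF d(1) e] by blast
    moreover define r where "r = s + w"
    ultimately have r: "\<bar>r - s\<bar> < d" "\<bar>r - s\<bar> < ?e" "r > s" by auto
    then have "Re (\<phi> (\<pi> i r)) < Re (\<phi> (\<pi> i s))" using m near[OF r(2)] by blast
    moreover have "sgn (Re (\<phi> (\<pi> i r)) - Re (\<phi> (\<pi> i s))) = 1" using d(2)[OF r(1)] r(3) by simp
    ultimately show False by (simp add: sgn_if split: if_splits)
  qed
qed

lemma axis_real_near:
  assumes "axis_chart \<Omega> \<phi>" "i < n" "\<pi> i t \<in> \<Omega>"
  shows "\<forall>\<^sub>F s in nhds t. Im (\<phi> (\<pi> i s)) = 0"
proof -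
  have "openin euclideanreal {s \<in> topspace euclideanreal. \<pi> i s \<in> \<Omega>}"
    by (rule openin_continuous_map_preimage[OF cont_pi[OF assms(2)] axis_chartD(5)[OF assms(1)]])
  then have "open {s. \<pi> i s \<in> \<Omega>}" by simp
  then have "\<forall>\<^sub>F s in nhds t. \<pi> i s \<in> \<Omega>" using assms(3) eventually_nhds by blast
  then show ?thesis
  proof eventually_elim
    case (elim s)
    have "\<pi> i s \<in> D" using assms(2) by (auto simp: D_iff)
    then show ?case using axis_chartD(4)[OF assms(1) elim] by simp
  qed
qed

lemma incr_cases:
  assumes "axis_chart \<Omega> \<phi>" "i < n" "\<pi> i t \<in> \<Omega>"
  shows "incr (\<lambda>p. - \<phi> p) i t \<longleftrightarrow> \<not> incr \<phi> i t"
proof -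
  obtain \<eta> where \<eta>: "\<eta> > 0" "(\<forall>r s. \<bar>r - t\<bar> \<le> \<eta> \<and> \<bar>s - t\<bar> \<le> \<eta> \<and> r < s \<longrightarrow> Re (\<phi> (\<pi> i r)) < Re (\<phi> (\<pi> i s))) \<or>
       (\<forall>r s. \<bar>r - t\<bar> \<le> \<eta> \<and> \<bar>s - t\<bar> \<le> \<eta> \<and> r < s \<longrightarrow> Re (\<phi> (\<pi> i r)) > Re (\<phi> (\<pi> i s)))"
    by (rule monotone_near[OF axis_chartD(1)[OF assms(1)] assms(2,3) axis_real_near[OF assms]]) blast
  have t: "\<bar>t - t\<bar> < \<eta>" using \<eta> by simp
  from \<eta>(2) show ?thesis
  proof
    assume m: "\<forall>r s. \<bar>r - t\<bar> \<le> \<eta> \<and> \<bar>s - t\<bar> \<le> \<eta> \<and> r < s \<longrightarrow> Re (\<phi> (\<pi> i r)) < Re (\<phi> (\<pi> i s))"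
    then have "\<forall>r s. \<bar>r - t\<bar> \<le> \<eta> \<and> \<bar>s - t\<bar> \<le> \<eta> \<and> r < s \<longrightarrow> Re (- \<phi> (\<pi> i r)) > Re (- \<phi> (\<pi> i s))" by simp
    from incr_iff(2)[OF \<eta>(1) t this] incr_iff(1)[OF \<eta>(1) t m] show ?thesis by blast
  next
    assume m: "\<forall>r s. \<bar>r - t\<bar> \<le> \<eta> \<and> \<bar>s - t\<bar> \<le> \<eta> \<and> r < s \<longrightarrow> Re (\<phi> (\<pi> i r)) > Re (\<phi> (\<pi> i s))"
    from incr_iff(2,3)[OF \<eta>(1) t this] show ?thesis by blast
  qed
qed

text \<open>If two charts traverse the strand in the same direction but exchanged its sides, then one chart
  would be homotopic to the complex conjugate of the other on a small circle, and have winding number \<open>-1\<close>.\<close>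

lemma same_side:
  assumes \<phi>: "axis_chart \<Omega> \<phi>" and \<psi>: "axis_chart \<Omega>' \<psi>" and i: "i < n" and x: "\<pi> i t \<in> \<Omega>" "\<pi> i t \<in> \<Omega>'"
    and inc: "incr \<phi> i t" "incr \<psi> i t"
  obtains W where "openin X W" "\<pi> i t \<in> W" "W \<subseteq> \<Omega> \<inter> \<Omega>'" "\<And>p. p \<in> W \<Longrightarrow> sgn (Im (\<phi> p)) = sgn (Im (\<psi> p))"
proof -
  let ?x = "\<pi> i t"
  note c\<phi> = axis_chartD[OF \<phi>] and c\<psi> = axis_chartD[OF \<psi>]
  have xD: "?x \<in> D" using i by (auto simp: D_iff)
  have xC: "?x \<notin> C" using c\<phi>(3) x by blast
  have ImX: "Im (\<phi> ?x) = 0" "Im (\<psi> ?x) = 0" using c\<phi>(4) c\<psi>(4) x xD by auto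
  have oI: "openin X (\<Omega> \<inter> \<Omega>')" using c\<phi>(5) c\<psi>(5) by blast
  have chI: "chart X (\<Omega> \<inter> \<Omega>') \<phi>" by (rule chart_restrict[OF c\<phi>(1) oI]) auto
  have chJ: "chart X (\<Omega> \<inter> \<Omega>') \<psi>" by (rule chart_restrict[OF c\<psi>(1) oI]) auto
  have "open (\<phi> ` (\<Omega> \<inter> \<Omega>'))" using chI by (simp add: chart_def)
  moreover have "\<phi> ?x \<in> \<phi> ` (\<Omega> \<inter> \<Omega>')" using x by auto
  ultimately obtain r where r: "r > 0" "ball (\<phi> ?x) r \<subseteq> \<phi> ` (\<Omega> \<inter> \<Omega>')" using open_contains_ball by metis
  define W where "W = {p \<in> \<Omega> \<inter> \<Omega>'. \<phi> p \<in> ball (\<phi> ?x) r}"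
  have W: "openin X W" "?x \<in> W" "W \<subseteq> \<Omega> \<inter> \<Omega>'" unfolding W_def using openin_chart_preimage[OF chI open_ball] x r by auto
  have conn: "connected ((\<lambda>z. Im (\<psi> (inv_into (\<Omega> \<inter> \<Omega>') \<phi> z))) ` (ball (\<phi> ?x) r \<inter> H))" if "convex H" for H
  proof (rule connected_continuous_image)
    have "continuous_map (top_of_set (ball (\<phi> ?x) r \<inter> H)) X (inv_into (\<Omega> \<inter> \<Omega>') \<phi>)"
      by (rule continuous_map_chart_inverse[OF chI]) (use r in auto)
    moreover have "inv_into (\<Omega> \<inter> \<Omega>') \<phi> z \<in> \<Omega> \<inter> \<Omega>'" if "z \<in> ball (\<phi> ?x) r" for z
      using chart_inverse(1)[OF chI] r that by blast
    ultimately have "continuous_map (top_of_set (ball (\<phi> ?x) r \<inter> H)) (subtopology X (\<Omega> \<inter> \<Omega>')) (inv_into (\<Omega> \<inter> \<Omega>') \<phi>)"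
      by (auto simp: continuous_map_in_subtopology)
    from continuous_map_compose[OF this chart_facts(3)[OF chJ]]
    have "continuous_on (ball (\<phi> ?x) r \<inter> H) (\<lambda>z. \<psi> (inv_into (\<Omega> \<inter> \<Omega>') \<phi> z))" by (simp add: o_def)
    then show "continuous_on (ball (\<phi> ?x) r \<inter> H) (\<lambda>z. Im (\<psi> (inv_into (\<Omega> \<inter> \<Omega>') \<phi> z)))" by (intro continuous_intros)
    show "connected (ball (\<phi> ?x) r \<inter> H)" using that by (intro convex_connected convex_Int) auto
  qed
  have im: "Im (\<phi> p) = 0 \<longleftrightarrow> Im (\<psi> p) = 0" if "p \<in> \<Omega> \<inter> \<Omega>'" for p using c\<phi>(4) c\<psi>(4) that by blast
  have const: "sgn (Im (\<psi> p)) = sgn (Im (\<psi> q))"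
    if pq: "p \<in> W" "q \<in> W" "\<phi> p \<in> H" "\<phi> q \<in> H" and H: "convex H" "\<And>z. z \<in> H \<Longrightarrow> Im z \<noteq> 0" for p q H
  proof -
    let ?h = "\<lambda>z. Im (\<psi> (inv_into (\<Omega> \<inter> \<Omega>') \<phi> z))"
    have h: "?h (\<phi> p) = Im (\<psi> p)" if "p \<in> W" for p using chart_inverse(3)[OF chI, of p] that W(3) by (simp add: subset_iff)
    have "Im (\<psi> p) \<in> ?h ` (ball (\<phi> ?x) r \<inter> H)" "Im (\<psi> q) \<in> ?h ` (ball (\<phi> ?x) r \<inter> H)"
      using pq imageI[of "\<phi> p" "ball (\<phi> ?x) r \<inter> H" ?h] imageI[of "\<phi> q" "ball (\<phi> ?x) r \<inter> H" ?h]
      unfolding h[OF pq(1)] h[OF pq(2)] by (auto simp: W_def)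
    moreover have "0 \<notin> ?h ` (ball (\<phi> ?x) r \<inter> H)"
    proof
      assume "0 \<in> ?h ` (ball (\<phi> ?x) r \<inter> H)"
      then obtain z where z: "z \<in> ball (\<phi> ?x) r" "z \<in> H" "?h z = 0" by auto
      then have zi: "z \<in> \<phi> ` (\<Omega> \<inter> \<Omega>')" using r by blast
      then have "Im z = 0" using im[OF chart_inverse(1)[OF chI zi]] chart_inverse(2)[OF chI zi] z(3) by simp
      then show False using H(2) z by blast
    qed
    ultimately have "Im (\<psi> p) \<noteq> 0" "Im (\<psi> q) \<noteq> 0"
      "\<not> (Im (\<psi> p) \<le> 0 \<and> 0 \<le> Im (\<psi> q))" "\<not> (Im (\<psi> q) \<le> 0 \<and> 0 \<le> Im (\<psi> p))"
      using conn[OF H(1)] unfolding connected_iff_interval by metis+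
    then show ?thesis by (auto simp: sgn_if)
  qed
  have pt: "\<exists>p\<in>W. \<phi> p = \<phi> ?x + w" if "norm w < r" for w
  proof -
    have z: "\<phi> ?x + w \<in> ball (\<phi> ?x) r" using that by (simp add: dist_norm)
    then have "\<phi> ?x + w \<in> \<phi> ` (\<Omega> \<inter> \<Omega>')" using r by blast
    then show ?thesis using z by (auto simp: W_def)
  qed
  obtain p0 where p0: "p0 \<in> W" "\<phi> p0 = \<phi> ?x + \<i> * of_real (r/2)" using pt[of "\<i> * of_real (r/2)"] r by (auto simp: norm_mult)
  obtain q0 where q0: "q0 \<in> W" "\<phi> q0 = \<phi> ?x - \<i> * of_real (r/2)" using pt[of "- \<i> * of_real (r/2)"] r by (auto simp: norm_mult)
  define a where "a = sgn (Im (\<psi> p0))"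
  define b where "b = sgn (Im (\<psi> q0))"
  have up: "sgn (Im (\<psi> p)) = a" if "p \<in> W" "Im (\<phi> p) > 0" for p
    unfolding a_def by (rule const[of p p0 "{z. Im z > 0}"]) (use that p0 ImX r convex_halfspace_Im_gt in auto)
  have dn: "sgn (Im (\<psi> p)) = b" if "p \<in> W" "Im (\<phi> p) < 0" for p
    unfolding b_def by (rule const[of p q0 "{z. Im z < 0}"]) (use that q0 ImX r convex_halfspace_Im_lt in auto)
  have ab: "a = 1 \<or> a = -1" "b = 1 \<or> b = -1"
  proof -
    have "Im (\<psi> p0) \<noteq> 0" "Im (\<psi> q0) \<noteq> 0" using im[of p0] im[of q0] p0 q0 W(3) ImX r by auto
    then show "a = 1 \<or> a = -1" "b = 1 \<or> b = -1" by (auto simp: a_def b_def sgn_if)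
  qed
  \<comment> \<open>With equal signs the image of \<open>W\<close> under \<open>\<psi>\<close> would
    lie on one side of the axis only, although it is a neighbourhood of a point of the axis.\<close>
  have "a \<noteq> b"
  proof
    assume e: "a = b"
    have "open (\<psi> ` W)" by (rule chart_facts(4)[OF chJ W(1,3)])
    moreover have "\<psi> ?x \<in> \<psi> ` W" using W by auto
    ultimately obtain d where d: "d > 0" "ball (\<psi> ?x) d \<subseteq> \<psi> ` W" using open_contains_ball by metis
    have "\<psi> ?x - of_real a * \<i> * of_real (d/2) \<in> ball (\<psi> ?x) d" using d ab by (auto simp: dist_norm norm_mult)
    then obtain p where p: "p \<in> W" "\<psi> p = \<psi> ?x - of_real a * \<i> * of_real (d/2)" using d by (metis imageE subsetD)
    have "Im (\<psi> p) = - a * (d/2)" using p ImX by simp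
    then have "Im (\<psi> p) \<noteq> 0" "sgn (Im (\<psi> p)) = - a" using ab(1) d by (auto simp: sgn_if)
    then show False using up[OF p(1)] dn[OF p(1)] e im[of p] p W(3) ab by (cases "Im (\<phi> p)" "0::real" rule: linorder_cases) auto
  qed
  moreover have "a \<noteq> -1"
  proof
    assume am: "a = -1"
    then have bp: "b = 1" using ab \<open>a \<noteq> b\<close> by auto
    obtain \<eta>1 where \<eta>1: "\<eta>1 > 0" "\<And>s. \<bar>s - t\<bar> < \<eta>1 \<Longrightarrow> sgn (Re (\<phi> (\<pi> i s)) - Re (\<phi> ?x)) = sgn (s - t)" using inc(1) by (auto simp: incr_def)
    obtain \<eta>2 where \<eta>2: "\<eta>2 > 0" "\<And>s. \<bar>s - t\<bar> < \<eta>2 \<Longrightarrow> sgn (Re (\<psi> (\<pi> i s)) - Re (\<psi> ?x)) = sgn (s - t)" using inc(2) by (auto simp: incr_def)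
    \<comment> \<open>Inside \<open>O'\<close> the diagram is a single short piece of strand, on
      which both charts are known to run in the direction of the parameter.\<close>
    have "min \<eta>1 \<eta>2 > 0" using \<eta>1 \<eta>2 by simp
    then obtain O' where O': "openin X O'" "?x \<in> O'" "D \<inter> O' \<subseteq> \<pi> i ` {t - min \<eta>1 \<eta>2<..<t + min \<eta>1 \<eta>2}"
      by (rule local_strand[OF i xC])
    obtain V \<xi> where V: "(V, \<xi>) \<in> \<A>" "?x \<in> V" using charts pi_top[OF i] by blast
    have chV: "chart X V \<xi>" using atlas V by blast
    let ?N = "V \<inter> (W \<inter> O')"
    have oN: "openin X ?N" using chV W O' by (auto simp: chart_def)
    have "open (\<xi> ` ?N)" by (rule chart_facts(4)[OF chV oN]) auto
    moreover have "\<xi> ?x \<in> \<xi> ` ?N" using V W O' by auto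
    ultimately obtain \<epsilon> where \<epsilon>: "\<epsilon> > 0" "cball (\<xi> ?x) \<epsilon> \<subseteq> \<xi> ` ?N" using open_contains_cball by metis
    \<comment> \<open>A small circle in a chart of the atlas; orientation compatibility gives its
      images under both charts winding number 1.\<close>
    let ?\<gamma> = "circlepath (\<xi> ?x) \<epsilon>"
    define y where "y s = inv_into V \<xi> (?\<gamma> s)" for s
    have y: "y s \<in> ?N" "y s \<noteq> ?x" if "s \<in> {0..1}" for s
    proof -
      have sp: "?\<gamma> s \<in> sphere (\<xi> ?x) \<epsilon>" using that \<epsilon> path_image_circlepath_nonneg[of \<epsilon> "\<xi> ?x"] by (auto simp: path_image_def)
      then have "?\<gamma> s \<in> \<xi> ` ?N" using \<epsilon> sphere_cball by blast
      then obtain p where p: "p \<in> ?N" "?\<gamma> s = \<xi> p" by auto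
      then have "y s = p" using chart_inverse(3)[OF chV] by (simp add: y_def)
      then show "y s \<in> ?N" "y s \<noteq> ?x" using p sp \<epsilon> by auto
    qed
    have wn: "winding_number (f \<circ> inv_into V \<xi> \<circ> ?\<gamma>) (f ?x) = 1" "path (f \<circ> inv_into V \<xi> \<circ> ?\<gamma>)"
      if f: "axis_chart Z f" "W \<subseteq> Z" for f Z
    proof -
      have "cball (\<xi> ?x) \<epsilon> \<subseteq> \<xi> ` (V \<inter> Z)" using \<epsilon>(2) f(2) by blast
      moreover have "orientation_compatible V \<xi> Z f" using axis_chartD(2)[OF f(1)] V(1) by (auto simp: oriented_chart_def)
      moreover have "?x \<in> V \<inter> Z" using V W f by blast
      ultimately show "winding_number (f \<circ> inv_into V \<xi> \<circ> ?\<gamma>) (f ?x) = 1" using \<epsilon>(1) unfolding orientation_compatible_def by blast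
      have "continuous_map (top_of_set (\<xi> ` ?N)) X (inv_into V \<xi>)" by (rule continuous_map_chart_inverse[OF chV]) auto
      moreover have "inv_into V \<xi> z \<in> Z" if "z \<in> \<xi> ` ?N" for z using that chart_inverse(3)[OF chV] f(2) by auto
      ultimately have "continuous_map (top_of_set (\<xi> ` ?N)) (subtopology X Z) (inv_into V \<xi>)" by (auto simp: continuous_map_in_subtopology)
      from continuous_map_compose[OF this chart_facts(3)[OF axis_chartD(1)[OF f(1)]]]
      have "continuous_on (\<xi> ` ?N) (f \<circ> inv_into V \<xi>)" by simp
      moreover have "path_image ?\<gamma> \<subseteq> \<xi> ` ?N" using \<epsilon> sphere_cball by (auto simp: path_image_circlepath)
      ultimately show "path (f \<circ> inv_into V \<xi> \<circ> ?\<gamma>)" by (metis continuous_on_subset path_circlepath path_continuous_image)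
    qed
    have W\<Omega>: "W \<subseteq> \<Omega>" "W \<subseteq> \<Omega>'" using W(3) by auto
    let ?p = "\<lambda>s. \<phi> (y s) - \<phi> ?x" and ?q = "\<lambda>s. \<psi> (y s) - \<psi> ?x"
    have e: "(\<lambda>s. f (y s)) = f \<circ> inv_into V \<xi> \<circ> ?\<gamma>" for f :: "'a \<Rightarrow> complex" by (auto simp: y_def)
    have wp: "winding_number ?p 0 = 1" and wq: "winding_number ?q 0 = 1"
      using wn(1)[OF \<phi> W\<Omega>(1)] wn(1)[OF \<psi> W\<Omega>(2)] unfolding e[symmetric] by (metis winding_number_offset)+
    have pp: "path ?p" "path ?q"
      using wn(2)[OF \<phi> W\<Omega>(1)] wn(2)[OF \<psi> W\<Omega>(2)] unfolding e[symmetric] path_def by (auto intro!: continuous_intros)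
    have nz: "?q s \<noteq> 0" if "s \<in> {0..1}" for s
      using y[OF that] W(3) x(2) chart_facts(1)[OF c\<psi>(1)] by (auto dest: inj_onD)
    \<comment> \<open>Off the axis the exchange of sides, undone by conjugation, puts both points
      into the same open half plane; on the axis both lie in the same direction from the centre by
      monotonicity. So the straight homotopy avoids 0.\<close>
    have seg: "0 \<notin> closed_segment (?p s) (cnj (?q s))" if s: "s \<in> {0..1}" for s
    proof (rule zero_not_in_segment)
      have yW: "y s \<in> W" using y[OF s] by auto
      consider "Im (\<phi> (y s)) > 0" | "Im (\<phi> (y s)) < 0" | "Im (\<phi> (y s)) = 0" by linarith
      then show "0 < Im (?p s) \<and> 0 < Im (cnj (?q s)) \<or> Im (?p s) < 0 \<and> Im (cnj (?q s)) < 0 \<or>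
            Im (?p s) = 0 \<and> Im (cnj (?q s)) = 0 \<and> 0 < Re (?p s) * Re (cnj (?q s))"
      proof cases
        case 1
        then have "Im (\<psi> (y s)) < 0" using up[OF yW] am by (auto simp: sgn_if split: if_splits)
        then show ?thesis using 1 ImX by auto
      next
        case 2
        then have "Im (\<psi> (y s)) > 0" using dn[OF yW] bp by (auto simp: sgn_if split: if_splits)
        then show ?thesis using 2 ImX by auto
      next
        case 3
        then have I: "Im (\<psi> (y s)) = 0" "y s \<in> D" using im[of "y s"] c\<phi>(4)[of "y s"] yW W(3) by auto
        then obtain r where r: "r \<in> {t - min \<eta>1 \<eta>2<..<t + min \<eta>1 \<eta>2}" "y s = \<pi> i r" using O'(3) y[OF s] by auto
        then have "r \<noteq> t" "\<bar>r - t\<bar> < \<eta>1" "\<bar>r - t\<bar> < \<eta>2" using y(2)[OF s] by auto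
        then have "sgn (Re (?p s)) = sgn (r - t)" "sgn (Re (?q s)) = sgn (r - t)" "sgn (r - t) \<noteq> 0"
          using \<eta>1(2) \<eta>2(2) r(2) by (auto simp: sgn_eq_0_iff)
        then have "Re (?p s) * Re (?q s) > 0" by (auto simp: sgn_if zero_less_mult_iff split: if_splits)
        then show ?thesis using 3 I ImX by simp
      qed
    qed
    have "winding_number (cnj \<circ> ?q) 0 = winding_number ?p 0"
    proof (rule winding_number_loops_linear_eq)
      show "path ?p" by (rule pp)
      show "path (cnj \<circ> ?q)" using continuous_on_cnj[OF pp(2)[unfolded path_def]] by (simp add: path_def o_def)
      show "pathfinish ?p = pathstart ?p" "pathfinish (cnj \<circ> ?q) = pathstart (cnj \<circ> ?q)"
        by (simp_all add: pathfinish_def pathstart_def y_def circlepath)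
    qed (use seg in simp)
    moreover have "winding_number (cnj \<circ> ?q) (cnj 0) = - cnj (winding_number ?q 0)"
      by (rule winding_number_cnj[OF pp(2)]) (use nz in \<open>force simp: path_image_def\<close>)
    ultimately show False using wp wq by simp
  qed
  ultimately have a1: "a = 1" and b1: "b = -1" using ab by auto
  show thesis
  proof (rule that[OF W])
    fix p assume p: "p \<in> W"
    show "sgn (Im (\<phi> p)) = sgn (Im (\<psi> p))"
      using up[OF p] dn[OF p] im[OF subsetD[OF W(3) p]] a1 b1 by (cases "Im (\<phi> p)" "0::real" rule: linorder_cases) auto
  qed
qed

end

context diagram begin

text \<open>The strands are directed from over- to undercrossings; the sign \<open>\<kappa>\<close> selects the right
  (\<open>\<kappa> = 1\<close>, for the \<open>A\<close>-smoothing) or the left (\<open>\<kappa> = -1\<close>) side of them.\<close>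

definition side :: "real \<Rightarrow> ('a \<Rightarrow> complex) \<Rightarrow> nat \<Rightarrow> real \<Rightarrow> real" where
  "side \<kappa> \<phi> i t = - (if incr \<phi> i t then 1 else -1) * (if fwd i t then 1 else -1) * \<kappa>"

text \<open>A value attached to the point instead of the parameter. Away from crossings the possible
  parameters differ by a period, so any choice gives the same result.\<close>

definition point_side :: "real \<Rightarrow> ('a \<Rightarrow> complex) \<Rightarrow> 'a \<Rightarrow> real" where
  "point_side \<kappa> \<phi> x = (SOME v. \<exists>i t. i < n \<and> \<pi> i t = x \<and> v = side \<kappa> \<phi> i t)"

lemma incr_shift: "i < n \<Longrightarrow> s - t \<in> \<int> \<Longrightarrow> incr \<phi> i t \<Longrightarrow> incr \<phi> i s"
proof -
  assume i: "i < n" and st: "s - t \<in> \<int>" and inc: "incr \<phi> i t"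
  obtain \<eta> where \<eta>: "\<eta> > 0" "\<And>r. \<bar>r - t\<bar> < \<eta> \<Longrightarrow> sgn (Re (\<phi> (\<pi> i r)) - Re (\<phi> (\<pi> i t))) = sgn (r - t)"
    using inc by (auto simp: incr_def)
  have e: "\<pi> i r = \<pi> i (r - (s - t))" for r using L_periodic[OF i, of r "r - (s - t)"] st by simp
  show ?thesis unfolding incr_def
  proof (intro exI[of _ \<eta>] conjI allI impI \<eta>(1))
    fix r assume "\<bar>r - s\<bar> < \<eta>"
    then have "\<bar>(r - (s - t)) - t\<bar> < \<eta>" by simp
    from \<eta>(2)[OF this] show "sgn (Re (\<phi> (\<pi> i r)) - Re (\<phi> (\<pi> i s))) = sgn (r - s)"
      using e[of r] e[of s] by simp
  qed
qed

lemma fwd_shift: "i < n \<Longrightarrow> s - t \<in> \<int> \<Longrightarrow> fwd i t \<Longrightarrow> fwd i s"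
proof -
  assume i: "i < n" and st: "s - t \<in> \<int>" and f: "fwd i t"
  have e: "L i r = L i (r - (s - t))" for r using L_periodic[OF i, of r "r - (s - t)"] st by simp
  obtain u where u: "u \<ge> t" "\<pi> i u \<in> C" "\<And>r. t \<le> r \<Longrightarrow> r < u \<Longrightarrow> \<pi> i r \<notin> C" "passes_under n L i u"
    using f by (auto simp: fwd_def)
  have eu: "L i (u + (s - t)) = L i u" using e[of "u + (s - t)"] by simp
  show ?thesis unfolding fwd_def
  proof (intro exI[of _ "u + (s - t)"] conjI allI impI)
    show "s \<le> u + (s - t)" using u by simp
    show "\<pi> i (u + (s - t)) \<in> C" using u eu by simp
    show "passes_under n L i (u + (s - t))" using u(4) eu by (simp add: passes_under_def)
    fix r assume "s \<le> r \<and> r < u + (s - t)"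
    then show "\<pi> i r \<notin> C" using u(3)[of "r - (s - t)"] e[of r] by simp
  qed
qed

lemma point_side_eq:
  assumes i: "i < n" and c: "\<pi> i t \<notin> C"
  shows "point_side \<kappa> \<phi> (\<pi> i t) = side \<kappa> \<phi> i t"
  unfolding point_side_def
proof (rule some_equality)
  show "\<exists>j s. j < n \<and> \<pi> j s = \<pi> i t \<and> side \<kappa> \<phi> i t = side \<kappa> \<phi> j s" using i by blast
  fix v assume "\<exists>j s. j < n \<and> \<pi> j s = \<pi> i t \<and> v = side \<kappa> \<phi> j s"
  then obtain j s where js: "j < n" "\<pi> j s = \<pi> i t" "v = side \<kappa> \<phi> j s" by blast
  have d: "j = i" "s - t \<in> \<int>" using simple_unique[OF i js(1) refl js(2) c] by auto
  then have d': "t - s \<in> \<int>" by (metis Ints_minus minus_diff_eq)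
  have "incr \<phi> i s = incr \<phi> i t" "fwd i s = fwd i t"
    using incr_shift[OF i d(2)] incr_shift[OF i d'] fwd_shift[OF i d(2)] fwd_shift[OF i d'] by blast+
  then show "v = side \<kappa> \<phi> i t" using js(3) d by (simp add: side_def)
qed

text \<open>Replacing a chart by its negative changes the sign both of \<open>side\<close> and of
  the imaginary part. So both charts may be assumed to follow the parameter, and then they agree on
  the sides.\<close>

lemma black_agree:
  assumes \<phi>: "axis_chart \<Omega> \<phi>" and \<psi>: "axis_chart \<Omega>' \<psi>" and x: "x \<in> \<Omega>" "x \<in> \<Omega>'" "x \<in> D"
  obtains W where "openin X W" "x \<in> W" "W \<subseteq> \<Omega> \<inter> \<Omega>'"
    "\<And>p. p \<in> W \<Longrightarrow> point_side \<kappa> \<phi> x * sgn (Im (\<phi> p)) = point_side \<kappa> \<psi> x * sgn (Im (\<psi> p))"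
proof -
  obtain i t where i: "i < n" "x = \<pi> i t" using x(3) by (auto simp: D_iff)
  have c: "\<pi> i t \<notin> C" using axis_chartD(3)[OF \<phi>] x i by blast
  define f where "f = (if incr \<phi> i t then \<phi> else (\<lambda>p. - \<phi> p))"
  define g where "g = (if incr \<psi> i t then \<psi> else (\<lambda>p. - \<psi> p))"
  have f: "axis_chart \<Omega> f" "incr f i t" using \<phi> axis_chart_minus[OF \<phi>] incr_cases[OF \<phi> i(1)] x i by (auto simp: f_def)
  have g: "axis_chart \<Omega>' g" "incr g i t" using \<psi> axis_chart_minus[OF \<psi>] incr_cases[OF \<psi> i(1)] x i by (auto simp: g_def)
  obtain W where W: "openin X W" "\<pi> i t \<in> W" "W \<subseteq> \<Omega> \<inter> \<Omega>'" "\<And>p. p \<in> W \<Longrightarrow> sgn (Im (f p)) = sgn (Im (g p))"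
    by (rule same_side[OF f(1) g(1) i(1) _ _ f(2) g(2)]) (use x i in auto)
  have "point_side \<kappa> \<phi> x * sgn (Im (\<phi> p)) = - (if fwd i t then 1 else -1) * \<kappa> * sgn (Im (f p))" for p
    unfolding i(2) point_side_eq[OF i(1) c] side_def f_def by (simp add: sgn_minus)
  moreover have "point_side \<kappa> \<psi> x * sgn (Im (\<psi> p)) = - (if fwd i t then 1 else -1) * \<kappa> * sgn (Im (g p))" for p
    unfolding i(2) point_side_eq[OF i(1) c] side_def g_def by (simp add: sgn_minus)
  ultimately show thesis using that[OF W(1) _ W(3)] W i by simp
qed

lemma side_locally_constant:
  assumes \<phi>: "axis_chart \<Omega> \<phi>" and x: "x \<in> \<Omega>" "x \<in> D"
  obtains W where "openin X W" "x \<in> W" "\<And>y. y \<in> W \<Longrightarrow> y \<in> D \<Longrightarrow> point_side \<kappa> \<phi> y = point_side \<kappa> \<phi> x"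
proof -
  obtain i t where i: "i < n" "x = \<pi> i t" using x(2) by (auto simp: D_iff)
  have x': "\<pi> i t \<in> \<Omega>" using x i by simp
  have c: "\<pi> i t \<notin> C" using axis_chartD(3)[OF \<phi>] x' by blast
  obtain \<eta> where \<eta>: "\<eta> > 0" "\<And>s. \<bar>s - t\<bar> \<le> \<eta> \<Longrightarrow> s \<noteq> t \<Longrightarrow> \<pi> i s \<notin> C"
    "(\<forall>r s. \<bar>r - t\<bar> \<le> \<eta> \<and> \<bar>s - t\<bar> \<le> \<eta> \<and> r < s \<longrightarrow> Re (\<phi> (\<pi> i r)) < Re (\<phi> (\<pi> i s))) \<or>
       (\<forall>r s. \<bar>r - t\<bar> \<le> \<eta> \<and> \<bar>s - t\<bar> \<le> \<eta> \<and> r < s \<longrightarrow> Re (\<phi> (\<pi> i r)) > Re (\<phi> (\<pi> i s)))"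
    by (rule monotone_near[OF axis_chartD(1)[OF \<phi>] i(1) x' axis_real_near[OF \<phi> i(1) x']]) blast
  have nc: "\<pi> i s \<notin> C" if "\<bar>s - t\<bar> \<le> \<eta>" for s using \<eta>(2) c that by (cases "s = t") auto
  obtain W where W: "openin X W" "\<pi> i t \<in> W" "D \<inter> W \<subseteq> \<pi> i ` {t-\<eta><..<t+\<eta>}"
    by (rule local_strand[OF i(1) c \<eta>(1)])
  show thesis
  proof (rule that[OF W(1)])
    show "x \<in> W" using W i by simp
    fix y assume "y \<in> W" "y \<in> D"
    then obtain s where s: "s \<in> {t-\<eta><..<t+\<eta>}" "y = \<pi> i s" using W by blast
    then have st: "\<bar>s - t\<bar> < \<eta>" "\<bar>t - t\<bar> < \<eta>" using \<eta> by auto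
    have "incr \<phi> i s = incr \<phi> i t"
      using \<eta>(3) incr_iff(1,2)[OF \<eta>(1) st(1), of \<phi> i] incr_iff(1,2)[OF \<eta>(1) st(2), of \<phi> i] by blast
    moreover have "fwd i s = fwd i t"
    proof (cases "s \<le> t")
      case True then show ?thesis by (intro fwd_const nc) (use st in auto)
    next
      case False then show ?thesis by (intro fwd_const[symmetric] nc) (use st in auto)
    qed
    ultimately show "point_side \<kappa> \<phi> y = point_side \<kappa> \<phi> x"
      unfolding s(2) i(2) using point_side_eq[OF i(1) c] point_side_eq[OF i(1) nc[of s]] st by (simp add: side_def)
  qed
qed

lemma side_constant:
  assumes \<phi>: "axis_chart \<Omega> \<phi>" and conn: "connected {z \<in> \<phi> ` \<Omega>. Im z = 0}"
    and x: "x \<in> \<Omega>" "x \<in> D" and y: "y \<in> \<Omega>" "y \<in> D"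
  shows "point_side \<kappa> \<phi> x = point_side \<kappa> \<phi> y"
proof -
  note c = axis_chartD[OF \<phi>]
  let ?A = "{z \<in> \<phi> ` \<Omega>. Im z = 0}" and ?f = "\<lambda>z. point_side \<kappa> \<phi> (inv_into \<Omega> \<phi> z)"
  have "?f (\<phi> x) = ?f (\<phi> y)"
  proof (rule connected_local_const[OF conn])
    show "\<phi> x \<in> ?A" "\<phi> y \<in> ?A" using x y c(4) by auto
    show "\<forall>z\<in>?A. \<forall>\<^sub>F w in at z within ?A. ?f z = ?f w"
    proof
      fix z assume z: "z \<in> ?A"
      then obtain p where p: "p \<in> \<Omega>" "z = \<phi> p" by auto
      then have pD: "p \<in> D" using z c(4) by auto
      obtain W where W: "openin X W" "p \<in> W" "\<And>y. y \<in> W \<Longrightarrow> y \<in> D \<Longrightarrow> point_side \<kappa> \<phi> y = point_side \<kappa> \<phi> p"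
        by (rule side_locally_constant[OF \<phi> p(1) pD]) blast
      have "openin X (W \<inter> \<Omega>)" using W c(5) by blast
      then have "open (\<phi> ` (W \<inter> \<Omega>))" by (rule chart_facts(4)[OF c(1)]) auto
      moreover have "z \<in> \<phi> ` (W \<inter> \<Omega>)" using p W by auto
      moreover have "?f z = ?f w" if w: "w \<in> \<phi> ` (W \<inter> \<Omega>)" "w \<in> ?A" for w
      proof -
        obtain q where q: "q \<in> W \<inter> \<Omega>" "w = \<phi> q" using w by auto
        then have "q \<in> D" using w c(4) by auto
        then show ?thesis using W(3)[of q] q p chart_inverse(3)[OF c(1)] by auto
      qed
      ultimately show "\<forall>\<^sub>F w in at z within ?A. ?f z = ?f w"
        unfolding eventually_at_topological by blast
    qed
  qed
  then show ?thesis using chart_inverse(3)[OF c(1)] x y by simp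
qed

subsection \<open>The black corners at a crossing\<close>

lemma crossing_chartD:
  assumes "crossing_chart X \<A> n L c U \<phi>"
  shows "oriented_chart X \<A> U \<phi>" "chart X U \<phi>" "c \<in> U" "\<phi> c = 0" "\<phi> ` U = ball 0 2" "openin X U"
    "\<And>p. p \<in> U \<Longrightarrow> p \<in> D \<longleftrightarrow> Im (\<phi> p) = 0 \<or> Re (\<phi> p) = 0"
    "\<And>p. p \<in> U \<Longrightarrow> norm (\<phi> p) < 2"
proof -
  have *: "oriented_chart X \<A> U \<phi>" "c \<in> U" "\<phi> c = 0" "\<phi> ` U = ball 0 2"
    "\<phi> ` (D \<inter> U) = {z \<in> ball 0 2. Im z = 0 \<or> Re z = 0}" using assms by (auto simp: crossing_chart_def)
  then show "oriented_chart X \<A> U \<phi>" "c \<in> U" "\<phi> c = 0" "\<phi> ` U = ball 0 2" by auto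
  show ch: "chart X U \<phi>" using * by (simp add: oriented_chart_def)
  then show "openin X U" by (simp add: chart_def)
  show "norm (\<phi> p) < 2" if "p \<in> U" for p using imageI[OF that, of \<phi>] *(4) by simp
  show "p \<in> D \<longleftrightarrow> Im (\<phi> p) = 0 \<or> Re (\<phi> p) = 0" if p: "p \<in> U" for p
  proof -
    have "p \<in> D \<longleftrightarrow> \<phi> p \<in> \<phi> ` (D \<inter> U)"
      using p chart_facts(1)[OF ch] by (auto dest: inj_onD)
    then show ?thesis using *(4,5) p by auto
  qed
qed

text \<open>The half disc around the ray in direction \<open>a\<close>, which contains just this one
  of the four half strands; multiplication by \<open>cnj a\<close> turns the ray to the positive
  real axis.\<close>

definition half :: "'a set \<Rightarrow> ('a \<Rightarrow> complex) \<Rightarrow> complex \<Rightarrow> 'a set" where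
  "half U \<phi> a = {p \<in> U. Re (cnj a * \<phi> p) > 0}"

lemma axis_chart_half:
  assumes cc: "crossing_chart X \<A> n L c U \<phi>" and UC: "U \<inter> C = {c}" and a: "a \<in> {1, -1, \<i>, -\<i>}"
  shows "axis_chart (half U \<phi> a) (\<lambda>p. cnj a * \<phi> p)" "oriented_chart X \<A> U (\<lambda>p. cnj a * \<phi> p)"
    "{z \<in> (\<lambda>p. cnj a * \<phi> p) ` half U \<phi> a. Im z = 0} = {z \<in> ball 0 2. Re z > 0 \<and> Im z = 0}"
proof -
  note c = crossing_chartD[OF cc]
  have 1: "oriented_chart X \<A> U (\<lambda>p. \<i> * \<phi> p)" by (rule oriented_chart_mult_i[OF atlas c(1)])
  have 2: "oriented_chart X \<A> U (\<lambda>p. - \<phi> p)" using oriented_chart_mult_i[OF atlas 1] by (simp flip: mult.assoc)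
  have 3: "oriented_chart X \<A> U (\<lambda>p. - \<i> * \<phi> p)" using oriented_chart_mult_i[OF atlas 2] by simp
  show oc: "oriented_chart X \<A> U (\<lambda>p. cnj a * \<phi> p)" using a c(1) 1 2 3 by auto
  have ch: "chart X U (\<lambda>p. cnj a * \<phi> p)" using oc by (simp add: oriented_chart_def)
  have oh: "openin X (half U \<phi> a)"
    using openin_chart_preimage[OF ch, of "{z. Re z > 0}"] by (simp add: half_def open_halfspace_Re_gt)
  have "oriented_chart X \<A> (half U \<phi> a) (\<lambda>p. cnj a * \<phi> p)"
    using shrink_oriented_chart[OF atlas oc oh, of 1] by (auto simp: half_def)
  moreover have "half U \<phi> a \<inter> C = {}"
  proof -
    have "c \<notin> half U \<phi> a" using c(4) by (simp add: half_def)
    then show ?thesis using UC by (auto simp: half_def)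
  qed
  moreover have "p \<in> D \<longleftrightarrow> Im (cnj a * \<phi> p) = 0" if "p \<in> half U \<phi> a" for p
    using c(7)[of p] that a by (auto simp: half_def)
  ultimately show "axis_chart (half U \<phi> a) (\<lambda>p. cnj a * \<phi> p)" by (simp add: axis_chart_def)
  have aa: "cnj a * a = 1" "norm a = 1" using a by auto
  show "{z \<in> (\<lambda>p. cnj a * \<phi> p) ` half U \<phi> a. Im z = 0} = {z \<in> ball 0 2. Re z > 0 \<and> Im z = 0}"
  proof (intro equalityI subsetI)
    fix z assume "z \<in> {z \<in> (\<lambda>p. cnj a * \<phi> p) ` half U \<phi> a. Im z = 0}"
    then show "z \<in> {z \<in> ball 0 2. Re z > 0 \<and> Im z = 0}" using c(8) aa by (auto simp: half_def norm_mult)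
  next
    fix z assume z: "z \<in> {z \<in> ball 0 2. Re z > 0 \<and> Im z = 0}"
    then have "a * z \<in> \<phi> ` U" using c(5) aa by (simp add: norm_mult)
    then obtain p where p: "p \<in> U" "a * z = \<phi> p" by auto
    then have "z = cnj a * \<phi> p" using aa(1) by (metis mult.assoc mult_1)
    then show "z \<in> {z \<in> (\<lambda>p. cnj a * \<phi> p) ` half U \<phi> a. Im z = 0}" using p z by (auto simp: half_def)
  qed
qed

text \<open>Leaving the crossing along the overstrand means following the direction from over to
  under, leaving it along the understrand means going against it. So, for \<kappa> = 1, black lies
  to the right of the two over-rays and to the left of the two under-rays as seen from the crossing:
  the second and the fourth quadrant are black. The value is computed near the crossing and carried
  along the ray by \<open>side_constant\<close>.\<close>

lemma crossing_side:
  assumes cc: "crossing_chart X \<A> n L c U \<phi>" and cC: "c \<in> C" and UC: "U \<inter> C = {c}" and a: "a \<in> {1, -1, \<i>, -\<i>}"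
    and x: "x \<in> D" "x \<in> half U \<phi> a"
  shows "point_side \<kappa> (\<lambda>p. cnj a * \<phi> p) x = (if a = 1 \<or> a = -1 then -\<kappa> else \<kappa>)"
proof -
  note c = crossing_chartD[OF cc]
  let ?f = "\<lambda>p. cnj a * \<phi> p"
  note ah = axis_chart_half[OF cc UC a]
  have chf: "chart X U ?f" using ah(2) by (simp add: oriented_chart_def)
  obtain i0 t0 j0 s0 where st: "i0 < n" "j0 < n" "\<pi> i0 t0 = c" "\<pi> j0 s0 = c" "passes_over n L i0 t0" "passes_under n L j0 s0"
      "\<And>k r. k < n \<Longrightarrow> \<pi> k r = c \<Longrightarrow> (k = i0 \<and> r - t0 \<in> \<int> \<and> passes_over n L k r \<and> \<not> passes_under n L k r)
        \<or> (k = j0 \<and> r - s0 \<in> \<int> \<and> passes_under n L k r \<and> \<not> passes_over n L k r)"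
    by (rule crossing_strands[OF cC]) (rule that)
  have "\<exists>i t. i < n \<and> \<pi> i t = c \<and> (if a = 1 \<or> a = -1 then passes_over n L i t \<and> \<not> passes_under n L i t
      else passes_under n L i t \<and> \<not> passes_over n L i t)"
    using st(1-6) st(7)[OF st(1,3)] st(7)[OF st(2,4)] by auto
  then obtain i t where i: "i < n" "\<pi> i t = c" and ou: "if a = 1 \<or> a = -1 then passes_over n L i t \<and> \<not> passes_under n L i t
      else passes_under n L i t \<and> \<not> passes_over n L i t" by blast
  have near: "(passes_over n L i t \<longrightarrow> (\<forall>\<^sub>F s in nhds t. Im (\<phi> (\<pi> i s)) = 0)) \<and>
        (passes_under n L i t \<longrightarrow> (\<forall>\<^sub>F s in nhds t. Re (\<phi> (\<pi> i s)) = 0))"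
    using cc i unfolding crossing_chart_def by blast
  then have real: "\<forall>\<^sub>F s in nhds t. Im (?f (\<pi> i s)) = 0"
  proof (cases "a = 1 \<or> a = -1")
    case True
    then show ?thesis using ou near by (elim disjE) (simp_all add: eventually_mono)
  next
    case False
    then have "a = \<i> \<or> a = -\<i>" "passes_under n L i t" using a ou by auto
    then show ?thesis using near by (elim disjE) (simp_all add: eventually_mono)
  qed
  have tU: "\<pi> i t \<in> U" using c(3) i by simp
  obtain \<eta>1 where \<eta>1: "\<eta>1 > 0" "\<And>s. \<bar>s - t\<bar> \<le> \<eta>1 \<Longrightarrow> \<pi> i s \<in> U" "\<And>s. \<bar>s - t\<bar> \<le> \<eta>1 \<Longrightarrow> s \<noteq> t \<Longrightarrow> \<pi> i s \<notin> C"
     "(\<forall>r s. \<bar>r - t\<bar> \<le> \<eta>1 \<and> \<bar>s - t\<bar> \<le> \<eta>1 \<and> r < s \<longrightarrow> Re (?f (\<pi> i r)) < Re (?f (\<pi> i s))) \<or>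
       (\<forall>r s. \<bar>r - t\<bar> \<le> \<eta>1 \<and> \<bar>s - t\<bar> \<le> \<eta>1 \<and> r < s \<longrightarrow> Re (?f (\<pi> i r)) > Re (?f (\<pi> i s)))"
    by (rule monotone_near[OF chf i(1) tU real]) blast
  have tC: "\<pi> i t \<in> C" using i cC by simp
  obtain \<eta>2 where \<eta>2: "\<eta>2 > 0" "\<And>s. t - \<eta>2 < s \<Longrightarrow> s < t \<Longrightarrow> fwd i s \<longleftrightarrow> passes_under n L i t"
    "\<And>s. t < s \<Longrightarrow> s < t + \<eta>2 \<Longrightarrow> fwd i s \<longleftrightarrow> passes_over n L i t"
    by (rule fwd_near_crossing[OF i(1) tC]) (rule that)
  obtain w where w: "0 < w" "w < \<eta>1" "w < \<eta>2" using field_lbound_gt_zero[OF \<eta>1(1) \<eta>2(1)] by blast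
  have f0: "?f (\<pi> i t) = 0" using i c(4) by simp
  \<comment> \<open>A time just after or just before the crossing is taken, whichever lies on the
    ray \<open>a\<close>. In passing from one case to the other both signs in \<open>side\<close>
    change, so the value is the same.\<close>
  have "\<exists>s. \<pi> i s \<in> half U \<phi> a \<and> \<pi> i s \<notin> C \<and> side \<kappa> ?f i s = (if a = 1 \<or> a = -1 then -\<kappa> else \<kappa>)"
    using \<eta>1(4)
  proof
    assume m: "\<forall>r s. \<bar>r - t\<bar> \<le> \<eta>1 \<and> \<bar>s - t\<bar> \<le> \<eta>1 \<and> r < s \<longrightarrow> Re (?f (\<pi> i r)) < Re (?f (\<pi> i s))"
    have s: "\<bar>(t + w) - t\<bar> < \<eta>1" using w by simp
    have "incr ?f i (t + w)" by (rule incr_iff(1)[OF \<eta>1(1) s m])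
    moreover have "fwd i (t + w) \<longleftrightarrow> passes_over n L i t" using \<eta>2(3)[of "t + w"] w by simp
    moreover have "Re (?f (\<pi> i t)) < Re (?f (\<pi> i (t + w)))" using m[rule_format, of t "t + w"] w \<eta>1(1) by simp
    then have "\<pi> i (t + w) \<in> half U \<phi> a" using \<eta>1(2)[of "t + w"] w f0 by (simp add: half_def)
    ultimately show ?thesis using \<eta>1(3)[of "t + w"] w ou by (intro exI[of _ "t + w"]) (auto simp: side_def)
  next
    assume m: "\<forall>r s. \<bar>r - t\<bar> \<le> \<eta>1 \<and> \<bar>s - t\<bar> \<le> \<eta>1 \<and> r < s \<longrightarrow> Re (?f (\<pi> i r)) > Re (?f (\<pi> i s))"
    have s: "\<bar>(t - w) - t\<bar> < \<eta>1" using w by simp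
    have "\<not> incr ?f i (t - w)" by (rule incr_iff(2)[OF \<eta>1(1) s m])
    moreover have "fwd i (t - w) \<longleftrightarrow> passes_under n L i t" using \<eta>2(2)[of "t - w"] w by simp
    moreover have "Re (?f (\<pi> i (t - w))) > Re (?f (\<pi> i t))" using m[rule_format, of "t - w" t] w \<eta>1(1) by simp
    then have "\<pi> i (t - w) \<in> half U \<phi> a" using \<eta>1(2)[of "t - w"] w f0 by (simp add: half_def)
    ultimately show ?thesis using \<eta>1(3)[of "t - w"] w ou by (intro exI[of _ "t - w"]) (auto simp: side_def)
  qed
  then obtain s where s: "\<pi> i s \<in> half U \<phi> a" "\<pi> i s \<notin> C" "side \<kappa> ?f i s = (if a = 1 \<or> a = -1 then -\<kappa> else \<kappa>)" by blast
  have "connected {z \<in> ?f ` half U \<phi> a. Im z = 0}" unfolding ah(3)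
  proof (rule convex_connected)
    have "{z \<in> ball 0 2. Re z > 0 \<and> Im z = 0} = ball 0 2 \<inter> ({z::complex. Re z > 0} \<inter> {z. Im z = 0})" by auto
    moreover have "convex {z::complex. Im z = 0}" using convex_hyperplane[of \<i> 0] by (simp add: inner_complex_def)
    ultimately show "convex {z \<in> ball 0 2. Re z > 0 \<and> Im z = (0::real)}"
      by (simp add: convex_Int convex_halfspace_Re_gt)
  qed
  then have "point_side \<kappa> ?f x = point_side \<kappa> ?f (\<pi> i s)"
    by (rule side_constant[OF ah(1)]) (use x s i in \<open>auto simp: D_iff\<close>)
  then show ?thesis using point_side_eq[OF i(1) s(2)] s(3) by simp
qed

subsection \<open>Germs of paths towards the black side\<close>

lemma closed_C: "closedin X C"
proof -
  have "closedin X {c}" if "c \<in> C" for c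
    using closedin_Hausdorff_singleton[OF Hd] that C_sub_D D_top by blast
  then have "closedin X (\<Union>c\<in>C. {c})" using finite_C by (intro closedin_Union) auto
  then show ?thesis by simp
qed

lemma axis_chart_exists:
  assumes "x \<in> D" "x \<notin> C" obtains \<Omega> \<phi> where "axis_chart \<Omega> \<phi>" "x \<in> \<Omega>"
proof -
  have "card (strands_at n L x) \<noteq> 2" using assms(2) by (simp add: crossings_def)
  then obtain U \<phi> where fc: "flat_chart X \<A> n L x U \<phi>" using diagram assms(1) unfolding link_diagram_def by blast
  then have f: "oriented_chart X \<A> U \<phi>" "x \<in> U" "\<phi> ` (D \<inter> U) = {z \<in> ball 0 2. Im z = 0}" "\<phi> ` U = ball 0 2"
    by (auto simp: flat_chart_def)
  have ch: "chart X U \<phi>" using f by (simp add: oriented_chart_def)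
  have oW: "openin X (U - C)" using ch closed_C by (auto simp: chart_def intro: openin_diff)
  have "p \<in> D \<longleftrightarrow> Im (\<phi> p) = 0" if p: "p \<in> U" for p
  proof -
    have "p \<in> D \<longleftrightarrow> \<phi> p \<in> \<phi> ` (D \<inter> U)" using p chart_facts(1)[OF ch] by (auto dest: inj_onD)
    then show ?thesis using f(3,4) p by auto
  qed
  moreover have "oriented_chart X \<A> (U - C) \<phi>" using shrink_oriented_chart[OF atlas f(1) oW, of 1] by auto
  ultimately have "axis_chart (U - C) \<phi>" by (auto simp: axis_chart_def)
  then show thesis using that f(2) assms(2) by blast
qed

lemma point_side_values: "\<kappa> \<in> {1, -1} \<Longrightarrow> x \<in> D \<Longrightarrow> x \<notin> C \<Longrightarrow> point_side \<kappa> \<phi> x \<in> {1, -1}"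
proof -
  assume \<kappa>: "\<kappa> \<in> {1, -1}" and x: "x \<in> D" "x \<notin> C"
  obtain i t where i: "i < n" "x = \<pi> i t" using x by (auto simp: D_iff)
  have "point_side \<kappa> \<phi> x = side \<kappa> \<phi> i t" unfolding i(2) by (rule point_side_eq) (use i x in auto)
  then show ?thesis using \<kappa> unfolding side_def by (cases "incr \<phi> i t"; cases "fwd i t") auto
qed

text \<open>In one axis chart the path leaves the diagram vertically towards the black side; by
  \<open>black_agree\<close> it then starts on the black side in every other axis chart.\<close>

lemma black_germ:
  assumes \<kappa>: "\<kappa> \<in> {1, -1}" and x: "x \<in> D" "x \<notin> C"
  shows "\<exists>\<delta>. pathin X \<delta> \<and> \<delta> 0 = x \<and> (\<forall>\<Omega> \<psi>. axis_chart \<Omega> \<psi> \<longrightarrow> x \<in> \<Omega> \<longrightarrow>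
      (\<forall>\<^sub>F s in at_right 0. \<delta> s \<in> \<Omega> \<and> point_side \<kappa> \<psi> x * Im (\<psi> (\<delta> s)) > 0))"
proof -
  obtain \<Omega> \<phi> where \<phi>: "axis_chart \<Omega> \<phi>" "x \<in> \<Omega>" by (rule axis_chart_exists[OF x])
  note c = axis_chartD[OF \<phi>(1)]
  have "open (\<phi> ` \<Omega>)" using c(1) by (simp add: chart_def)
  then obtain \<rho> where \<rho>: "\<rho> > 0" "cball (\<phi> x) \<rho> \<subseteq> \<phi> ` \<Omega>" using \<phi>(2) open_contains_cball by (metis image_eqI)
  define \<sigma> where "\<sigma> = point_side \<kappa> \<phi> x"
  have \<sigma>: "\<sigma> = 1 \<or> \<sigma> = -1" using point_side_values[OF \<kappa> x] by (auto simp: \<sigma>_def)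
  define h where "h s = \<phi> x + \<i> * of_real (\<sigma> * \<rho> * s)" for s
  define \<delta> where "\<delta> s = inv_into \<Omega> \<phi> (h s)" for s
  have hin: "h s \<in> \<phi> ` \<Omega>" if "s \<in> {0..1}" for s
  proof -
    have "\<bar>\<sigma>\<bar> = 1" using \<sigma> by auto
    then have "norm (h s - \<phi> x) = \<rho> * s" using that \<rho> by (simp add: h_def norm_mult abs_mult)
    moreover have "\<rho> * s \<le> \<rho>" using that \<rho> by (simp add: mult_left_le)
    ultimately have "h s \<in> cball (\<phi> x) \<rho>" by (simp add: dist_norm norm_minus_commute)
    then show ?thesis using \<rho> by blast
  qed
  have p\<delta>: "pathin X \<delta>"
    unfolding \<delta>_def
  proof (rule continuous_map_real_affine[OF continuous_map_chart_inverse[OF c(1) order_refl]])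
    show "continuous_on {0..1} h" unfolding h_def by (intro continuous_intros)
    show "h ` {0..1} \<subseteq> \<phi> ` \<Omega>" using hin by blast
  qed
  have \<delta>0: "\<delta> 0 = x" using chart_inverse(3)[OF c(1) \<phi>(2)] by (simp add: \<delta>_def h_def)
  have Im0: "Im (\<phi> x) = 0" using c(4)[OF \<phi>(2)] x by simp
  have "\<forall>\<^sub>F s in at_right 0. \<delta> s \<in> \<Omega>' \<and> point_side \<kappa> \<psi> x * Im (\<psi> (\<delta> s)) > 0" if \<psi>: "axis_chart \<Omega>' \<psi>" "x \<in> \<Omega>'" for \<Omega>' \<psi>
  proof -
    obtain W where W: "openin X W" "x \<in> W" "W \<subseteq> \<Omega> \<inter> \<Omega>'"
      "\<And>p. p \<in> W \<Longrightarrow> point_side \<kappa> \<phi> x * sgn (Im (\<phi> p)) = point_side \<kappa> \<psi> x * sgn (Im (\<psi> p))"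
      by (rule black_agree[OF \<phi>(1) \<psi>(1) \<phi>(2) \<psi>(2) x(1)]) blast
    have "openin (top_of_set {0..1}) {s \<in> topspace (top_of_set {0..1}). \<delta> s \<in> W}"
      using p\<delta> W(1) unfolding pathin_def by (rule openin_continuous_map_preimage)
    then obtain T where T: "open T" "{s \<in> {0..1}. \<delta> s \<in> W} = {0..1} \<inter> T"
      unfolding openin_open topspace_euclidean_subtopology by blast
    have "(0::real) \<in> {s \<in> {0..1}. \<delta> s \<in> W}" using \<delta>0 W(2) by simp
    then have z: "0 \<in> T" unfolding T(2) by blast
    obtain e where e: "e > 0" "ball 0 e \<subseteq> T" by (rule openE[OF T(1) z]) (rule that)
    have "\<delta> s \<in> W" if "0 < s" "s < min e 1" for s
    proof -
      have "s \<in> {0..1} \<inter> T" using that e by (auto simp: dist_real_def)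
      then show ?thesis using T(2) by blast
    qed
    then have "\<forall>\<^sub>F s in at_right 0. \<delta> s \<in> W \<and> 0 < s \<and> s < 1"
      unfolding eventually_at_right_field using e(1) by (intro exI[of _ "min e 1"]) auto
    then show ?thesis
    proof eventually_elim
      case (elim s)
      then have s01: "s \<in> {0..1}" by auto
      have "\<phi> (\<delta> s) = h s" unfolding \<delta>_def by (rule chart_inverse(2)[OF c(1) hin[OF s01]])
      then have "Im (\<phi> (\<delta> s)) = \<sigma> * \<rho> * s" using Im0 by (simp add: h_def)
      then have "\<sigma> * sgn (Im (\<phi> (\<delta> s))) = 1" using \<sigma> \<rho> elim by (auto simp: sgn_mult)
      then have "point_side \<kappa> \<psi> x * sgn (Im (\<psi> (\<delta> s))) = 1" using W(4)[of "\<delta> s"] elim by (simp add: \<sigma>_def)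
      moreover have "point_side \<kappa> \<psi> x \<in> {1, -1}" by (rule point_side_values[OF \<kappa> x])
      ultimately show ?case using W(3) elim by (auto simp: sgn_if split: if_splits)
    qed
  qed
  then show ?thesis using p\<delta> \<delta>0 by blast
qed

end

section \<open>Smoothing arcs\<close>

text \<open>The path \<open>corner\<close> runs down the real axis to \<open>1\<close>, along the segment to \<open>\<i>\<close>, and up the
  imaginary axis.\<close>

definition corner :: "real \<Rightarrow> complex" where
  "corner t = Complex (max 0 (max ((1 - t) / 2) (- t))) (max 0 (max ((1 + t) / 2) t))"

definition corner_curve :: "complex set" where
  "corner_curve = {z. Re z \<ge> 0 \<and> Im z \<ge> 0 \<and> (Re z + Im z = 1 \<or> Re z * Im z = 0 \<and> Re z + Im z \<ge> 1)}"

text \<open>The linear function \<open>Im z - Re z\<close> recovers the parameter, in spite of the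
  case distinctions in \<open>corner\<close>; it provides the continuous inverse that
  \<open>open_arc\<close> requires.\<close>

lemma corner_in: "corner t \<in> corner_curve" and corner_param: "Im (corner t) - Re (corner t) = t"
  and corner_pos: "Re (corner t) + Im (corner t) > 0"
  and corner_interior: "Re (corner t) > 0 \<and> Im (corner t) > 0 \<longleftrightarrow> \<bar>t\<bar> < 1"
  and corner_sum: "Re (corner t) + Im (corner t) = max 1 \<bar>t\<bar>"
  by (auto simp: corner_def corner_curve_def max_def abs_if field_simps)

lemma corner_norm: "\<bar>t\<bar> < 2 \<Longrightarrow> norm (corner t) < 2"
  using cmod_le[of "corner t"] corner_in[of t] corner_sum[of t] by (simp add: corner_curve_def)

lemma corner_of_param: "z \<in> corner_curve \<Longrightarrow> corner (Im z - Re z) = z"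
  unfolding corner_curve_def corner_def by (auto simp: complex_eq_iff max_def)

lemma corner_curve_param: "z \<in> corner_curve \<Longrightarrow> norm z < 2 \<Longrightarrow> Im z - Re z \<in> {-2<..<2}"
  using abs_Re_le_cmod[of z] abs_Im_le_cmod[of z] by (auto simp: corner_curve_def)

lemma continuous_on_corner: "continuous_on A corner"
proof -
  have "continuous_on A (\<lambda>t. of_real (max 0 (max ((1 - t) / 2) (- t))) + \<i> * of_real (max 0 (max ((1 + t) / 2) t)))"
    by (intro continuous_intros) auto
  then show ?thesis by (simp add: corner_def[abs_def] Complex_eq)
qed

context
  fixes X :: "'a topology" and V :: "'a set" and \<xi> :: "'a \<Rightarrow> complex"
  assumes Hd: "Hausdorff_space X" and ch: "chart X V \<xi>" and im: "\<xi> ` V = ball 0 2"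
begin

definition corner_path :: "real \<Rightarrow> 'a" where "corner_path t = inv_into V \<xi> (corner t)"

lemma corner_path:
  assumes "t \<in> {-2<..<2}" shows "corner_path t \<in> V" "\<xi> (corner_path t) = corner t"
proof -
  have "corner t \<in> \<xi> ` V" using corner_norm[of t] assms im by (simp add: abs_less_iff)
  then show "corner_path t \<in> V" "\<xi> (corner_path t) = corner t"
    unfolding corner_path_def using chart_inverse(1,2)[OF ch] by auto
qed

lemma corner_path_image:
  assumes S: "\<And>p. p \<in> V \<Longrightarrow> Re (\<xi> p) + Im (\<xi> p) > 0 \<Longrightarrow> p \<in> S \<longleftrightarrow> \<xi> p \<in> corner_curve" and K: "K \<subseteq> {-2<..<2}"
  shows "corner_path ` K = {p \<in> V \<inter> S. Re (\<xi> p) + Im (\<xi> p) > 0 \<and> Im (\<xi> p) - Re (\<xi> p) \<in> K}"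
proof (intro Set.set_eqI iffI)
  fix p assume "p \<in> corner_path ` K"
  then obtain t where t: "t \<in> K" "p = corner_path t" by blast
  then have "p \<in> V" "\<xi> p = corner t" using corner_path[of t] K by blast+
  then show "p \<in> {p \<in> V \<inter> S. Re (\<xi> p) + Im (\<xi> p) > 0 \<and> Im (\<xi> p) - Re (\<xi> p) \<in> K}"
    using S[of p] t(1) corner_in corner_param[of t] corner_pos[of t] by simp
next
  fix p assume p: "p \<in> {p \<in> V \<inter> S. Re (\<xi> p) + Im (\<xi> p) > 0 \<and> Im (\<xi> p) - Re (\<xi> p) \<in> K}"
  then have "\<xi> p \<in> corner_curve" using S by blast
  then have "corner (Im (\<xi> p) - Re (\<xi> p)) = \<xi> p" by (rule corner_of_param)
  then have "corner_path (Im (\<xi> p) - Re (\<xi> p)) = p"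
    unfolding corner_path_def using chart_inverse(3)[OF ch, of p] p by simp
  then show "p \<in> corner_path ` K" using p by (metis (no_types, lifting) imageI mem_Collect_eq)
qed

text \<open>Only one of the two corners of a state meets the half plane \<open>Re + Im > 0\<close>,
  so the shape of \<open>S\<close> is prescribed just there. The open smoothing segment is the part
  in the open quadrant, and the collars run along the axes.\<close>

lemma corner_open_arc:
  assumes S: "\<And>p. p \<in> V \<Longrightarrow> Re (\<xi> p) + Im (\<xi> p) > 0 \<Longrightarrow> p \<in> S \<longleftrightarrow> \<xi> p \<in> corner_curve" and ST: "S \<subseteq> topspace X"
  shows "open_arc (subtopology X S) corner_path (\<lambda>p. Im (\<xi> p) - Re (\<xi> p))"
    "open_arc.rest (subtopology X S) corner_path = S - {p \<in> V. Re (\<xi> p) > 0 \<and> Im (\<xi> p) > 0}"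
proof -
  let ?\<theta> = corner_path
  have img: "?\<theta> ` K = {p \<in> V \<inter> S. Re (\<xi> p) + Im (\<xi> p) > 0 \<and> Im (\<xi> p) - Re (\<xi> p) \<in> K}" if "K \<subseteq> {-2<..<2}" for K
    by (rule corner_path_image[OF S that])
  have imS: "?\<theta> ` {-2<..<2} = {p \<in> V \<inter> S. Re (\<xi> p) + Im (\<xi> p) > 0}"
    unfolding img[OF order_refl]
  proof (intro Set.set_eqI iffI)
    fix p assume p: "p \<in> {p \<in> V \<inter> S. 0 < Re (\<xi> p) + Im (\<xi> p)}"
    then have "\<xi> p \<in> corner_curve" "norm (\<xi> p) < 2" using S[of p] im by (auto simp: set_eq_iff image_iff)
    then show "p \<in> {p \<in> V \<inter> S. 0 < Re (\<xi> p) + Im (\<xi> p) \<and> Im (\<xi> p) - Re (\<xi> p) \<in> {- 2<..<2}}"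
      using corner_curve_param p by blast
  qed auto
  have c0: "continuous_map (top_of_set {-2<..<2}) X ?\<theta>"
  proof -
    have "corner ` {-2<..<2} \<subseteq> \<xi> ` V" using corner_norm im by (auto simp: abs_less_iff)
    then have "continuous_map (top_of_set {-2<..<2}) (top_of_set (\<xi> ` V)) corner"
      using continuous_on_corner by (auto simp: image_subset_iff)
    from continuous_map_compose[OF this continuous_map_chart_inverse[OF ch order_refl]]
    show ?thesis by (simp add: corner_path_def[abs_def] o_def)
  qed
  show arc: "open_arc (subtopology X S) ?\<theta> (\<lambda>p. Im (\<xi> p) - Re (\<xi> p))"
  proof
    show "continuous_map (top_of_set {-2<..<2}) (subtopology X S) ?\<theta>"
      using c0 imS by (auto simp: continuous_map_in_subtopology)
    have "openin X {p \<in> V. \<xi> p \<in> {z. Re z + Im z > 0}}"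
      by (rule openin_chart_preimage[OF ch]) (intro open_Collect_less continuous_intros)
    then show "openin (subtopology X S) (?\<theta> ` {-2<..<2})"
      unfolding imS openin_subtopology by (intro exI[of _ "{p \<in> V. \<xi> p \<in> {z. Re z + Im z > 0}}"]) auto
    have "continuous_map (subtopology X V) euclideanreal (\<lambda>p. Im (\<xi> p) - Re (\<xi> p))"
    proof -
      have "continuous_map euclidean euclideanreal (\<lambda>z. Im z - Re z)" by (simp add: continuous_intros)
      from continuous_map_compose[OF chart_facts(3)[OF ch] this] show ?thesis by (simp add: o_def)
    qed
    moreover have "subtopology (subtopology X S) (?\<theta> ` {-2<..<2}) = subtopology X (?\<theta> ` {-2<..<2})"
    proof -
      have "S \<inter> ?\<theta> ` {-2<..<2} = ?\<theta> ` {-2<..<2}" using imS by auto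
      then show ?thesis by (simp add: subtopology_subtopology)
    qed
    moreover have "?\<theta> ` {-2<..<2} \<subseteq> V" using imS by auto
    ultimately show "continuous_map (subtopology (subtopology X S) (?\<theta> ` {-2<..<2})) euclideanreal (\<lambda>p. Im (\<xi> p) - Re (\<xi> p))"
      using continuous_map_from_subtopology_mono by metis
    show "Im (\<xi> (?\<theta> t)) - Re (\<xi> (?\<theta> t)) = t" if "t \<in> {-2<..<2}" for t
      using corner_path(2)[OF that] corner_param by simp
    have "compactin (top_of_set {-2<..<2}) {-1..1::real}" by (auto simp: compactin_subtopology)
    then have "compactin X (?\<theta> ` {-1..1})" using c0 by (rule image_compactin)
    then have "closedin X (?\<theta> ` {-1..1})" using Hd compactin_imp_closedin by blast
    moreover have "?\<theta> ` {-1..1} \<subseteq> S" using imS by auto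
    ultimately show "closedin (subtopology X S) (?\<theta> ` {-1..1})"
      unfolding closedin_subtopology by (intro exI[of _ "?\<theta> ` {-1..1}"]) auto
  qed
  have sub: "{-1<..<1} \<subseteq> {-2<..<(2::real)}" by auto
  have "?\<theta> ` {-1<..<1} = {p \<in> V \<inter> S. Re (\<xi> p) > 0 \<and> Im (\<xi> p) > 0}"
    unfolding img[OF sub]
  proof (intro Set.set_eqI iffI; clarify; intro CollectI conjI IntI)
    fix p assume p: "p \<in> V" "p \<in> S"
    assume s: "0 < Re (\<xi> p) + Im (\<xi> p)" "Im (\<xi> p) - Re (\<xi> p) \<in> {-1<..<1}"
    then have "\<xi> p = corner (Im (\<xi> p) - Re (\<xi> p))" using S p corner_of_param by metis
    moreover have "\<bar>Im (\<xi> p) - Re (\<xi> p)\<bar> < 1" using s by (simp add: abs_less_iff)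
    ultimately show "0 < Re (\<xi> p)" "0 < Im (\<xi> p)" using corner_interior by metis+
  next
    fix p assume p: "p \<in> V" "p \<in> S" and s: "0 < Re (\<xi> p)" "0 < Im (\<xi> p)"
    then show "0 < Re (\<xi> p) + Im (\<xi> p)" by simp
    then have "\<xi> p = corner (Im (\<xi> p) - Re (\<xi> p))" using S p corner_of_param by metis
    then have "\<bar>Im (\<xi> p) - Re (\<xi> p)\<bar> < 1" using s corner_interior by metis
    then show "Im (\<xi> p) - Re (\<xi> p) \<in> {-1<..<1}" by auto
  qed auto
  then show "open_arc.rest (subtopology X S) ?\<theta> = S - {p \<in> V. Re (\<xi> p) > 0 \<and> Im (\<xi> p) > 0}"
    unfolding open_arc.rest_def[OF arc] using ST by auto
qed

end

definition corner_arc :: "'a set \<Rightarrow> ('a \<Rightarrow> complex) \<Rightarrow> 'a chain" where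
  "corner_arc V \<xi> = frag_of (path_simplex (\<lambda>t. corner_path V \<xi> (2 * t - 1)))"

lemma singular_chain_half:
  "singular_chain p X (frag_cmul 2 b) \<longleftrightarrow> singular_chain p X b"
proof -
  have "Poly_Mapping.keys (frag_cmul 2 b) = Poly_Mapping.keys b" by (auto simp: in_keys_iff)
  then show ?thesis by (simp add: singular_chain_def)
qed

text \<open>Model of a state at a crossing. The arcs are taken away one after the other, from
  \<open>S\<close> to \<open>mid\<close> to \<open>core\<close>, the second as a corner in the chart
  \<open>- \<xi>\<close>. Both states to be compared are of this form, in coordinates that differ by
  a quarter turn.\<close>

locale two_corners =
  fixes X :: "'a topology" and V :: "'a set" and \<xi> :: "'a \<Rightarrow> complex" and S :: "'a set"
  assumes Hd: "Hausdorff_space X" and ch: "chart X V \<xi>" and im: "\<xi> ` V = ball 0 2"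
    and S: "S \<subseteq> topspace X" and SV: "\<And>p. p \<in> V \<Longrightarrow> p \<in> S \<longleftrightarrow> \<xi> p \<in> corner_curve \<or> - \<xi> p \<in> corner_curve"
begin

abbreviation \<gamma>1 where "\<gamma>1 \<equiv> corner_arc V \<xi>"
abbreviation \<gamma>2 where "\<gamma>2 \<equiv> corner_arc V (\<lambda>p. - \<xi> p)"

definition core :: "'a set" where "core = S - {p \<in> V. Re (\<xi> p) * Im (\<xi> p) > 0}"
definition mid :: "'a set" where "mid = S - {p \<in> V. Re (\<xi> p) > 0 \<and> Im (\<xi> p) > 0}"

lemma ch': "chart X V (\<lambda>p. - \<xi> p)" and im': "(\<lambda>p. - \<xi> p) ` V = ball 0 2"
proof -
  show "(\<lambda>p. - \<xi> p) ` V = ball 0 2"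
  proof -
    have "(\<lambda>p. - \<xi> p) ` V = uminus ` ball 0 2" unfolding im[symmetric] by (simp add: image_image)
    then show ?thesis by (auto simp: image_iff intro!: bexI[of _ "- _"])
  qed
  then have o: "open ((\<lambda>p. - \<xi> p) ` V)" by simp
  have h: "homeomorphic_map (top_of_set (\<xi> ` V)) (top_of_set ((\<lambda>p. - \<xi> p) ` V)) uminus"
    unfolding homeomorphic_map_maps homeomorphic_maps_def
    by (intro exI[of _ uminus]) (auto intro!: continuous_intros)
  show "chart X V (\<lambda>p. - \<xi> p)"
    using ch homeomorphic_map_compose[OF _ h, of "subtopology X V" \<xi>] o by (simp add: chart_def o_def)
qed

lemma arc1: "open_arc (subtopology X S) (corner_path V \<xi>) (\<lambda>p. Im (\<xi> p) - Re (\<xi> p))"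
  and rest1: "open_arc.rest (subtopology X S) (corner_path V \<xi>) = mid"
proof -
  have "p \<in> S \<longleftrightarrow> \<xi> p \<in> corner_curve" if "p \<in> V" "Re (\<xi> p) + Im (\<xi> p) > 0" for p
    using SV[OF that(1)] that(2) by (auto simp: corner_curve_def)
  from corner_open_arc[OF Hd ch im this S] show "open_arc (subtopology X S) (corner_path V \<xi>) (\<lambda>p. Im (\<xi> p) - Re (\<xi> p))"
    "open_arc.rest (subtopology X S) (corner_path V \<xi>) = mid" by (simp_all add: mid_def)
qed

lemma arc2: "open_arc (subtopology X mid) (corner_path V (\<lambda>p. - \<xi> p)) (\<lambda>p. Im (- \<xi> p) - Re (- \<xi> p))"
  and rest2: "open_arc.rest (subtopology X mid) (corner_path V (\<lambda>p. - \<xi> p)) = core"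
proof -
  have 1: "p \<in> mid \<longleftrightarrow> - \<xi> p \<in> corner_curve" if "p \<in> V" "Re (- \<xi> p) + Im (- \<xi> p) > 0" for p
    using SV[OF that(1)] that(2) by (auto simp: corner_curve_def mid_def)
  have 2: "mid \<subseteq> topspace X" using S by (auto simp: mid_def)
  show "open_arc (subtopology X mid) (corner_path V (\<lambda>p. - \<xi> p)) (\<lambda>p. Im (- \<xi> p) - Re (- \<xi> p))"
    by (rule corner_open_arc(1)[OF Hd ch' im' 1 2])
  have "mid - {p \<in> V. Re (- \<xi> p) > 0 \<and> Im (- \<xi> p) > 0} = core"
    by (auto simp: mid_def core_def zero_less_mult_iff)
  then show "open_arc.rest (subtopology X mid) (corner_path V (\<lambda>p. - \<xi> p)) = core"
    using corner_open_arc(2)[OF Hd ch' im' 1 2] by simp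
qed

lemma core_mid: "core \<subseteq> mid" "mid \<subseteq> S" by (auto simp: core_def mid_def)

lemma arc1_arc: "open_arc.arc (corner_path V \<xi>) = \<gamma>1"
  and arc2_arc: "open_arc.arc (corner_path V (\<lambda>p. - \<xi> p)) = \<gamma>2"
  by (simp_all add: open_arc.arc_def[OF arc1] open_arc.arc_def[OF arc2] corner_arc_def)

lemma pathin_corner:
  assumes "chart X V \<zeta>" "\<zeta> ` V = ball 0 2" "\<And>t. t \<in> {-1..1} \<Longrightarrow> corner_path V \<zeta> t \<in> Z"
  shows "pathin (subtopology X Z) (\<lambda>t. corner_path V \<zeta> (2 * t - 1))"
proof -
  have "pathin X (\<lambda>t. inv_into V \<zeta> (corner (2 * t - 1)))"
  proof (rule continuous_map_real_affine[OF continuous_map_chart_inverse[OF assms(1) order_refl]])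
    show "continuous_on {0..1} (\<lambda>t. corner (2 * t - 1))"
      by (rule continuous_on_compose2[OF continuous_on_corner]) (auto intro!: continuous_intros)
    show "(\<lambda>t. corner (2 * t - 1)) ` {0..1} \<subseteq> \<zeta> ` V"
      unfolding assms(2) using corner_norm by auto
  qed
  then have "pathin X (\<lambda>t. corner_path V \<zeta> (2 * t - 1))" by (simp add: corner_path_def[OF Hd assms(1,2), abs_def])
  then show ?thesis using assms(3) by (auto simp: pathin_subtopology)
qed

lemma corner_point: 
  assumes "t \<in> {-1..1}"
  shows "corner_path V \<xi> t \<in> V" "\<xi> (corner_path V \<xi> t) = corner t"
    "corner_path V (\<lambda>p. - \<xi> p) t \<in> V" "- \<xi> (corner_path V (\<lambda>p. - \<xi> p) t) = corner t"
  using corner_path[OF Hd ch im, of t] corner_path[OF Hd ch' im', of t] assms by auto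

lemma gamma_chains: "singular_chain 1 (subtopology X S) \<gamma>1" "singular_chain 1 (subtopology X mid) \<gamma>2"
proof -
  have "corner_path V \<xi> t \<in> S" if "t \<in> {-1..1}" for t
    using SV corner_point(1,2)[OF that] corner_in by simp
  then show "singular_chain 1 (subtopology X S) \<gamma>1"
    unfolding corner_arc_def singular_chain_path by (rule pathin_corner[OF ch im])
  have "corner_path V (\<lambda>p. - \<xi> p) t \<in> mid" if "t \<in> {-1..1}" for t
  proof -
    let ?p = "corner_path V (\<lambda>p. - \<xi> p) t"
    have p: "?p \<in> V" "- \<xi> ?p \<in> corner_curve" using corner_point(3,4)[OF that] corner_in[of t] by simp_all
    then have "Re (\<xi> ?p) \<le> 0" by (simp add: corner_curve_def)
    then show ?thesis using SV[OF p(1)] p(2) by (simp add: mid_def)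
  qed
  then show "singular_chain 1 (subtopology X mid) \<gamma>2"
    unfolding corner_arc_def singular_chain_path by (rule pathin_corner[OF ch' im'])
qed

lemma gamma_chain: "singular_chain 1 (subtopology X S) \<gamma>2"
  using singular_chain_mono[OF gamma_chains(2) core_mid(2)] .

lemma corner_ends: "corner (-1) = 1" "corner 1 = \<i>"
  by (simp_all add: corner_def complex_eq_iff)

lemma gamma_boundary:
  "chain_boundary 1 \<gamma>1 = frag_of (point_simplex (inv_into V \<xi> \<i>)) - frag_of (point_simplex (inv_into V \<xi> 1))"
  "chain_boundary 1 \<gamma>2 = frag_of (point_simplex (inv_into V \<xi> (-\<i>))) - frag_of (point_simplex (inv_into V \<xi> (-1)))"
proof -
  have "inv_into V (\<lambda>p. - \<xi> p) z = inv_into V \<xi> (- z)" for z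
  proof -
    have "- \<xi> y = z \<longleftrightarrow> \<xi> y = - z" for y by (metis minus_minus)
    then show ?thesis by (simp add: inv_into_def)
  qed
  then show "chain_boundary 1 \<gamma>1 = frag_of (point_simplex (inv_into V \<xi> \<i>)) - frag_of (point_simplex (inv_into V \<xi> 1))"
    "chain_boundary 1 \<gamma>2 = frag_of (point_simplex (inv_into V \<xi> (-\<i>))) - frag_of (point_simplex (inv_into V \<xi> (-1)))"
    by (simp_all add: corner_arc_def chain_boundary_path corner_path_def[OF Hd ch im] corner_path_def[OF Hd ch' im'] corner_ends)
qed

lemma ends_core: "z \<in> {1, -1, \<i>, -\<i>} \<Longrightarrow> inv_into V \<xi> z \<in> core"
proof -
  assume z: "z \<in> {1, -1, \<i>, -\<i>}"
  then have "z \<in> \<xi> ` V" unfolding im by auto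
  then have *: "inv_into V \<xi> z \<in> V" "\<xi> (inv_into V \<xi> z) = z" using chart_inverse(1,2)[OF ch] by auto
  then have "inv_into V \<xi> z \<in> S" using z SV by (auto simp: corner_curve_def)
  then show ?thesis using * z by (auto simp: core_def)
qed

lemma gamma_boundary_core: "singular_chain 0 (subtopology X core) (chain_boundary 1 \<gamma>1)"
  "singular_chain 0 (subtopology X core) (chain_boundary 1 \<gamma>2)"
proof -
  have "singular_chain 0 (subtopology X core) (frag_of (point_simplex (inv_into V \<xi> z)))" if "z \<in> {1, -1, \<i>, -\<i>}" for z
    using ends_core[OF that] S core_mid by (auto simp: singular_chain_of singular_simplex_0)
  then show "singular_chain 0 (subtopology X core) (chain_boundary 1 \<gamma>1)"
    "singular_chain 0 (subtopology X core) (chain_boundary 1 \<gamma>2)"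
    unfolding gamma_boundary by (simp_all add: singular_chain_diff)
qed

text \<open>\<open>decompose\<close> is applied to the first arc in \<open>S\<close> and to the
  second in \<open>mid\<close>. In between, the chain left over is no longer a cycle: modulo 2 its
  boundary is that of a multiple of the first arc. The ends of this arc lie in \<open>core\<close>,
  so the second application is still possible.\<close>

lemma two_arc_decompose:
  assumes y: "y \<in> mod2_cycles 1 (subtopology X S)"
  obtains e n1 n2 where "singular_chain 1 (subtopology X core) e"
    "y - (e + frag_cmul n1 \<gamma>1 + frag_cmul n2 \<gamma>2) \<in> mod2_boundaries 1 (subtopology X S)"
proof -
  have yc: "singular_chain 1 (subtopology X S) y" using y by (simp add: mod2_cycles_def)
  obtain b where b: "chain_boundary 1 y = frag_cmul 2 b" "singular_chain (1 - Suc 0) (subtopology X S) b"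
    by (rule mod2_cycleE[OF y])
  have b1: "chain_boundary 1 y = 0 + frag_cmul 2 b" "singular_chain 0 (subtopology X S) b" using b by (simp_all add: One_nat_def)
  obtain e1 n1 where e1: "singular_chain 1 (subtopology (subtopology X S) mid) e1"
     "y - (e1 + frag_cmul n1 \<gamma>1) \<in> mod2_boundaries 1 (subtopology X S)"
    using open_arc.decompose[OF arc1 yc b1(1) _ b1(2)] unfolding rest1 arc1_arc by (metis singular_chain_0)
  have e1c: "singular_chain 1 (subtopology X mid) e1" using e1(1) core_mid by (simp add: subtopology_subtopology Int_absorb1)
  have "y - (e1 + frag_cmul n1 \<gamma>1) \<in> mod2_cycles 1 (subtopology X S)" using e1(2) mod2_boundaries_cycles by blast
  then have "y - (y - (e1 + frag_cmul n1 \<gamma>1)) \<in> mod2_cycles 1 (subtopology X S)" by (rule mod2_cycles_diff[OF y])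
  then have "e1 + frag_cmul n1 \<gamma>1 \<in> mod2_cycles 1 (subtopology X S)" by (simp only: diff_diff_eq2 add_diff_cancel_left')
  then obtain b' where b': "chain_boundary 1 (e1 + frag_cmul n1 \<gamma>1) = frag_cmul 2 b'" by (auto simp: mod2_cycles_def)
  then have be: "chain_boundary 1 e1 = frag_cmul (- n1) (chain_boundary 1 \<gamma>1) + frag_cmul 2 b'"
    using frag_cmul_distrib[of "- n1" n1 "chain_boundary 1 \<gamma>1"]
    by (simp add: chain_boundary_add chain_boundary_cmul eq_diff_eq flip: b')
  have bE: "singular_chain 0 (subtopology X core) (frag_cmul (- n1) (chain_boundary 1 \<gamma>1))"
    by (rule singular_chain_cmul[OF gamma_boundary_core(1)])
  have "frag_cmul 2 b' = chain_boundary 1 e1 - frag_cmul (- n1) (chain_boundary 1 \<gamma>1)" using be by simp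
  moreover have "singular_chain 0 (subtopology X mid) (chain_boundary 1 e1)"
    using singular_chain_boundary_alt[of 0] e1c by (simp add: One_nat_def)
  ultimately have "singular_chain 0 (subtopology X mid) (frag_cmul 2 b')"
    using singular_chain_diff singular_chain_mono[OF bE core_mid(1)] by metis
  then have b'm: "singular_chain 0 (subtopology X mid) b'" by (simp add: singular_chain_half)
  have bE': "singular_chain 0 (subtopology (subtopology X mid) core) (frag_cmul (- n1) (chain_boundary 1 \<gamma>1))"
    using bE core_mid by (simp add: subtopology_subtopology Int_absorb1)
  obtain e n2 where e: "singular_chain 1 (subtopology (subtopology X mid) core) e"
     "e1 - (e + frag_cmul n2 \<gamma>2) \<in> mod2_boundaries 1 (subtopology X mid)"
    using open_arc.decompose[OF arc2 e1c be _ b'm] bE' unfolding rest2 arc2_arc by blast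
  have "y - (e1 + frag_cmul n1 \<gamma>1) + (e1 - (e + frag_cmul n2 \<gamma>2)) \<in> mod2_boundaries 1 (subtopology X S)"
    by (rule mod2_add[OF e1(2) mod2_boundaries_mono[OF core_mid(2) e(2)]])
  moreover have "singular_chain 1 (subtopology X core) e" using e(1) core_mid by (simp add: subtopology_subtopology Int_absorb1)
  ultimately show thesis using that[of e n1 n2] by (simp add: algebra_simps)
qed

lemma two_arc_injective:
  assumes e: "e \<in> mod2_cycles 1 (subtopology X core)" and b: "e \<in> mod2_boundaries 1 (subtopology X S)"
  shows "e \<in> mod2_boundaries 1 (subtopology X core)"
proof -
  have s: "subtopology (subtopology X S) mid = subtopology X mid" "subtopology (subtopology X mid) core = subtopology X core"
    using core_mid by (simp_all add: subtopology_subtopology Int_absorb1)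
  have "e \<in> mod2_boundaries 1 (subtopology X mid)"
    using open_arc.injective[OF arc1, of e] mod2_cycles_mono[OF core_mid(1) e] b unfolding rest1 s by blast
  then show ?thesis using open_arc.injective[OF arc2, of e] e unfolding rest2 s by blast
qed

text \<open>Once the first multiplicity is known to be even, its arc may be dropped; what remains
  bounds already in \<open>mid\<close> by injectivity, and the second multiplicity is treated
  there.\<close>

lemma two_arc_parity:
  assumes e: "singular_chain 1 (subtopology X core) e"
    and b: "e + frag_cmul n1 \<gamma>1 + frag_cmul n2 \<gamma>2 \<in> mod2_boundaries 1 (subtopology X S)"
  shows "even n1" "even n2"
proof -
  have s: "subtopology (subtopology X S) mid = subtopology X mid" "subtopology (subtopology X mid) core = subtopology X core"
    using core_mid by (simp_all add: subtopology_subtopology Int_absorb1)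
  let ?e = "e + frag_cmul n2 \<gamma>2"
  have c: "singular_chain 1 (subtopology X mid) ?e"
    by (intro singular_chain_add singular_chain_cmul gamma_chains(2) singular_chain_mono[OF e core_mid(1)])
  have b': "?e + frag_cmul n1 \<gamma>1 \<in> mod2_boundaries 1 (subtopology X S)" using b by (simp add: algebra_simps)
  show n1: "even n1" using open_arc.arc_parity[OF arc1, of ?e n1] c b' unfolding rest1 arc1_arc s by blast
  then obtain k where k: "n1 = 2 * k" by blast
  have "frag_cmul n1 \<gamma>1 \<in> mod2_boundaries 1 (subtopology X S)"
    unfolding k using mod2_even[OF singular_chain_cmul[OF gamma_chains(1), of k]] by (simp add: frag_cmul_cmul)
  then have eb: "?e \<in> mod2_boundaries 1 (subtopology X S)" using mod2_diff[OF b'] by fastforce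
  then have "?e \<in> mod2_cycles 1 (subtopology X mid)" using mod2_boundaries_cycles c by (fastforce simp: mod2_cycles_def)
  then have "?e \<in> mod2_boundaries 1 (subtopology X mid)"
    using open_arc.injective[OF arc1, of ?e] eb unfolding rest1 s by blast
  then show "even n2" using open_arc.arc_parity[OF arc2, of e n2] e unfolding rest2 arc2_arc s by blast
qed

end

section \<open>Switching a smoothing\<close>

lemma frag_cmul_diff_right: "frag_cmul k (a - b) = frag_cmul k a - frag_cmul k b"
  using frag_cmul_distrib2[of k "a - b" b] by simp

text \<open>A null-homologous cycle of the new state \<open>T\<close> is a core chain
  \<open>e\<close> plus multiples \<open>n1\<close>, \<open>n2\<close> of equal parity of its two
  arcs. It is sent to \<open>e\<close> plus \<open>n1\<close> times the sum of the old arcs: this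
  closes up modulo 2 because both pairs of arcs have the same four ends, and is null-homologous
  because all cycles of \<open>S\<close> are. Nothing is lost, since the old arcs are independent of
  the core modulo 2 and core cycles bound in \<open>S\<close> only if they bound in the
  core.\<close>

lemma defect_switch:
  assumes A: "two_corners X V \<zeta> S" and B: "two_corners X V \<xi> T"
    and core: "two_corners.core V \<zeta> S = two_corners.core V \<xi> T"
    and ends: "chain_boundary 1 (corner_arc V \<zeta> + corner_arc V (\<lambda>p. - \<zeta> p)) -
       chain_boundary 1 (corner_arc V \<xi> + corner_arc V (\<lambda>p. - \<xi> p)) = frag_cmul 2 w"
    and null: "mod2_cycles 1 (subtopology X S) \<subseteq> mod2_boundaries 1 X"
    and par: "\<And>e n1 n2. singular_chain 1 (subtopology X (two_corners.core V \<xi> T)) e \<Longrightarrow>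
       e + frag_cmul n1 (corner_arc V \<xi>) + frag_cmul n2 (corner_arc V (\<lambda>p. - \<xi> p)) \<in> null_cycles X T \<Longrightarrow>
       even n1 \<longleftrightarrow> even n2"
  shows "homological_defect X T \<le> homological_defect X S"
proof -
  interpret A: two_corners X V \<zeta> S by (rule A)
  interpret B: two_corners X V \<xi> T by (rule B)
  let ?ZS = "mod2_cycles 1 (subtopology X S)" and ?BS = "mod2_boundaries 1 (subtopology X S)"
    and ?BT = "mod2_boundaries 1 (subtopology X T)" and ?E = "subtopology X B.core"
  have NS: "null_cycles X S = ?ZS" using null by (auto simp: null_cycles_def)
  have EB: "B.core \<subseteq> S" "B.core \<subseteq> T" using A.core_mid B.core_mid core by auto
  have ZE: "z \<in> null_cycles X T \<inter> ?ZS" if "z \<in> mod2_cycles 1 ?E" for z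
    using mod2_cycles_mono[OF EB(1) that] mod2_cycles_mono[OF EB(2) that] null by (auto simp: null_cycles_def)
  \<comment> \<open>A core cycle that bounds in either state bounds in the core, and hence in the
    other state.\<close>
  have down: "z \<in> ?BS" if "z \<in> mod2_cycles 1 ?E" "z \<in> ?BT" for z
    using B.two_arc_injective[OF that] mod2_boundaries_mono[OF EB(1)] by blast
  have up: "z \<in> ?BT" if "z \<in> mod2_cycles 1 ?E" "z \<in> ?BS" for z
    using A.two_arc_injective[of z] that mod2_boundaries_mono[OF EB(2)] core by metis
  have even_arcs: "frag_cmul a c \<in> mod2_boundaries 1 Y" if "even a" "singular_chain 1 Y c" for a c and Y :: "'a topology"
  proof -
    obtain k where "a = 2 * k" using \<open>even a\<close> by blast
    then show ?thesis using mod2_even[OF singular_chain_cmul[OF that(2), of k]] by simp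
  qed
  define g where "g e k = e + frag_cmul k (A.\<gamma>1 + A.\<gamma>2)" for e k
  define rep where "rep c q \<longleftrightarrow> singular_chain 1 ?E (fst q) \<and> even (fst (snd q) - snd (snd q)) \<and>
      c - (fst q + frag_cmul (fst (snd q)) B.\<gamma>1 + frag_cmul (snd (snd q)) B.\<gamma>2) \<in> ?BT" for c and q :: "'a chain \<times> int \<times> int"
  have "\<exists>q. rep c q" if c: "c \<in> null_cycles X T" for c
  proof -
    have cZ: "c \<in> mod2_cycles 1 (subtopology X T)" and cB: "c \<in> mod2_boundaries 1 X" using c by (auto simp: null_cycles_def)
    obtain e n1 n2 where e: "singular_chain 1 ?E e" "c - (e + frag_cmul n1 B.\<gamma>1 + frag_cmul n2 B.\<gamma>2) \<in> ?BT"
      by (rule B.two_arc_decompose[OF cZ])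
    let ?d = "e + frag_cmul n1 B.\<gamma>1 + frag_cmul n2 B.\<gamma>2"
    have "c - (c - ?d) \<in> mod2_cycles 1 (subtopology X T)" "c - (c - ?d) \<in> mod2_boundaries 1 X"
      using mod2_cycles_diff[OF cZ subsetD[OF mod2_boundaries_cycles e(2)]] mod2_diff[OF cB mod2_boundaries_sub[OF e(2)]] by blast+
    moreover have "c - (c - ?d) = ?d" by (simp only: diff_diff_eq2 add_diff_cancel_left')
    ultimately have "?d \<in> null_cycles X T" by (simp only: null_cycles_def Int_iff)
    then have "even n1 \<longleftrightarrow> even n2" using par e(1) by blast
    then show ?thesis using e by (intro exI[of _ "(e, n1, n2)"]) (simp add: rep_def)
  qed
  then obtain q where q: "\<And>c. c \<in> null_cycles X T \<Longrightarrow> rep c (q c)" by metis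
  define f where "f c = g (fst (q c)) (fst (snd (q c)))" for c
  have gcyc: "g e n1 \<in> ?ZS"
    if e: "singular_chain 1 ?E e" "even (n1 - n2)" "e + frag_cmul n1 B.\<gamma>1 + frag_cmul n2 B.\<gamma>2 \<in> mod2_cycles 1 (subtopology X T)" for e n1 n2
  proof -
    obtain b where b: "chain_boundary 1 (e + frag_cmul n1 B.\<gamma>1 + frag_cmul n2 B.\<gamma>2) = frag_cmul 2 b"
      using e(3) by (auto simp: mod2_cycles_def)
    obtain k where k: "n2 = n1 - 2 * k" using e(2) by (metis dvdE diff_diff_eq2 add_diff_cancel_left')
    have "chain_boundary 1 (g e n1) = chain_boundary 1 (e + frag_cmul n1 B.\<gamma>1 + frag_cmul n2 B.\<gamma>2)
       + frag_cmul n1 (chain_boundary 1 (A.\<gamma>1 + A.\<gamma>2) - chain_boundary 1 (B.\<gamma>1 + B.\<gamma>2)) + frag_cmul (2 * k) (chain_boundary 1 B.\<gamma>2)"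
      unfolding g_def k using frag_cmul_distrib[of "- (2 * k)" "2 * k" "chain_boundary 1 B.\<gamma>2"]
      by (simp add: chain_boundary_add chain_boundary_diff chain_boundary_cmul frag_cmul_distrib2 frag_cmul_diff_distrib frag_cmul_diff_right)
    also have "\<dots> = frag_cmul 2 (b + frag_cmul n1 w + frag_cmul k (chain_boundary 1 B.\<gamma>2))"
      unfolding b ends by (simp add: frag_cmul_distrib2 mult.commute)
    finally have "\<exists>b. chain_boundary 1 (g e n1) = frag_cmul 2 b" by blast
    moreover have "singular_chain 1 (subtopology X S) (g e n1)"
      unfolding g_def by (intro singular_chain_add singular_chain_cmul A.gamma_chains(1) A.gamma_chain singular_chain_mono[OF e(1) EB(1)])
    ultimately show ?thesis by (simp add: mod2_cycles_def)
  qed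
  have repcyc: "fst q + frag_cmul (fst (snd q)) B.\<gamma>1 + frag_cmul (snd (snd q)) B.\<gamma>2 \<in> mod2_cycles 1 (subtopology X T)"
    if "rep c q" "c \<in> null_cycles X T" for c q
  proof -
    let ?d = "fst q + frag_cmul (fst (snd q)) B.\<gamma>1 + frag_cmul (snd (snd q)) B.\<gamma>2"
    have "c \<in> mod2_cycles 1 (subtopology X T)" "c - ?d \<in> ?BT" using that by (simp_all add: rep_def null_cycles_def)
    then have "c - (c - ?d) \<in> mod2_cycles 1 (subtopology X T)"
      using mod2_cycles_diff mod2_boundaries_cycles by blast
    then show ?thesis by (simp only: diff_diff_eq2 add_diff_cancel_left')
  qed
  show ?thesis
  proof (rule homological_defect_le)
    show "f c \<in> null_cycles X S" if c: "c \<in> null_cycles X T" for c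
      unfolding NS f_def using gcyc[of "fst (q c)" "fst (snd (q c))" "snd (snd (q c))"] q[OF c] repcyc[OF q[OF c] c] by (simp add: rep_def)
    show "c - d \<in> ?BT" if c: "c \<in> null_cycles X T" and d: "d \<in> null_cycles X T" and fd: "f c - f d \<in> ?BS" for c d
    proof -
      obtain e n1 n2 where qc: "q c = (e, n1, n2)" by (metis surj_pair)
      obtain e' n1' n2' where qd: "q d = (e', n1', n2')" by (metis surj_pair)
      have r: "singular_chain 1 ?E e" "even (n1 - n2)" "c - (e + frag_cmul n1 B.\<gamma>1 + frag_cmul n2 B.\<gamma>2) \<in> ?BT"
        and r': "singular_chain 1 ?E e'" "even (n1' - n2')" "d - (e' + frag_cmul n1' B.\<gamma>1 + frag_cmul n2' B.\<gamma>2) \<in> ?BT"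
        using q[OF c] q[OF d] by (auto simp: qc qd rep_def)
      have ee: "singular_chain 1 ?E (e - e')" using r(1) r'(1) by (rule singular_chain_diff)
      have fe: "f c - f d = (e - e') + frag_cmul (n1 - n1') A.\<gamma>1 + frag_cmul (n1 - n1') A.\<gamma>2"
        by (simp add: f_def qc qd g_def frag_cmul_distrib2 frag_cmul_diff_distrib)
      have ev: "even (n1 - n1')" using A.two_arc_parity(1)[of "e - e'"] ee fd core unfolding fe by metis
      then have ev2: "even (n2 - n2')" using r(2) r'(2) by presburger
      have "frag_cmul (n1 - n1') A.\<gamma>1 + frag_cmul (n1 - n1') A.\<gamma>2 \<in> ?BS"
        by (intro mod2_add even_arcs ev A.gamma_chains(1) A.gamma_chain)
      from mod2_diff[OF fd this] have eS: "e - e' \<in> ?BS" by (simp add: fe)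
      then have "e - e' \<in> mod2_cycles 1 ?E" using ee mod2_boundaries_cycles by (fastforce simp: mod2_cycles_def)
      then have eT: "e - e' \<in> ?BT" using up eS by blast
      have "frag_cmul (n1 - n1') B.\<gamma>1 + frag_cmul (n2 - n2') B.\<gamma>2 \<in> ?BT"
        by (intro mod2_add even_arcs ev ev2 B.gamma_chains(1) B.gamma_chain)
      from mod2_add[OF mod2_add[OF eT this] mod2_diff[OF r(3) r'(3)]]
      show ?thesis by (simp add: frag_cmul_diff_distrib algebra_simps)
    qed
    show "finite (mod2_class (subtopology X S) ` null_cycles X S)" if fin: "finite (mod2_class (subtopology X T) ` null_cycles X T)"
    proof -
      let ?cl = "mod2_class (subtopology X S)"
      \<comment> \<open>In both states the classes of core cycles are distinguished in the same way.
        In \<open>T\<close> they form part of the finite kernel, core cycles being null-homologous;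
        the shift by \<open>c0\<close> does not matter.\<close>
      have fZ: "finite ((\<lambda>z. ?cl (c0 + z)) ` mod2_cycles 1 ?E)" for c0
      proof (rule finite_surj)
        show "finite (mod2_class (subtopology X T) ` mod2_cycles 1 ?E)" using ZE by (intro finite_subset[OF _ fin]) auto
        let ?h = "\<lambda>K. ?cl (c0 + (SOME z. z \<in> mod2_cycles 1 ?E \<and> mod2_class (subtopology X T) z = K))"
        show "(\<lambda>z. ?cl (c0 + z)) ` mod2_cycles 1 ?E \<subseteq> ?h ` (mod2_class (subtopology X T) ` mod2_cycles 1 ?E)"
        proof (rule image_subsetI)
          fix z assume z: "z \<in> mod2_cycles 1 ?E"
          let ?z = "SOME z'. z' \<in> mod2_cycles 1 ?E \<and> mod2_class (subtopology X T) z' = mod2_class (subtopology X T) z"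
          have z': "?z \<in> mod2_cycles 1 ?E \<and> mod2_class (subtopology X T) ?z = mod2_class (subtopology X T) z"
            by (rule someI[of _ z]) (use z in simp)
          have "z - ?z \<in> ?BT" using conjunct2[OF z', symmetric] unfolding mod2_class_eq .
          then have "z - ?z \<in> ?BS" using down mod2_cycles_diff[OF z conjunct1[OF z']] by blast
          then have "?cl (c0 + z) = ?cl (c0 + ?z)" unfolding mod2_class_eq by simp
          then have "?cl (c0 + z) = ?h (mod2_class (subtopology X T) z)" .
          then show "?cl (c0 + z) \<in> ?h ` (mod2_class (subtopology X T) ` mod2_cycles 1 ?E)"
            using imageI[OF imageI[OF z, of "mod2_class (subtopology X T)"], of ?h] by (simp only:)
        qed
      qed
      \<comment> \<open>The parities of the multiplicities of the two arcs divide the cycles of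
        \<open>S\<close> into at most four kinds. Modulo boundaries, two cycles of the same kind
        differ by a core cycle, so each kind contributes finitely many classes.\<close>
      define kind where "kind c p \<longleftrightarrow> (\<exists>e n1 n2. singular_chain 1 ?E e \<and> c - (e + frag_cmul n1 A.\<gamma>1 + frag_cmul n2 A.\<gamma>2) \<in> ?BS
         \<and> p = (even n1, even n2))" for c p
      have kind: "\<exists>p. kind c p" if "c \<in> ?ZS" for c
        using A.two_arc_decompose[OF that] core unfolding kind_def by metis
      have same: "?cl c \<in> (\<lambda>z. ?cl (c0 + z)) ` mod2_cycles 1 ?E"
        if c: "c \<in> ?ZS" "c0 \<in> ?ZS" "kind c p" "kind c0 p" for c c0 p
      proof -
        obtain e n1 n2 where r: "singular_chain 1 ?E e" "c - (e + frag_cmul n1 A.\<gamma>1 + frag_cmul n2 A.\<gamma>2) \<in> ?BS" "p = (even n1, even n2)"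
          using c(3) unfolding kind_def by blast
        obtain e' n1' n2' where r': "singular_chain 1 ?E e'" "c0 - (e' + frag_cmul n1' A.\<gamma>1 + frag_cmul n2' A.\<gamma>2) \<in> ?BS" "p = (even n1', even n2')"
          using c(4) unfolding kind_def by blast
        have "even (n1 - n1')" "even (n2 - n2')" using r(3) r'(3) by auto
        then have "frag_cmul (n1 - n1') A.\<gamma>1 + frag_cmul (n2 - n2') A.\<gamma>2 \<in> ?BS"
          by (intro mod2_add even_arcs A.gamma_chains(1) A.gamma_chain)
        from mod2_add[OF this mod2_diff[OF r(2) r'(2)]]
        have d: "c - (c0 + (e - e')) \<in> ?BS" by (simp add: frag_cmul_diff_distrib algebra_simps)
        have "(c - c0) - (c - (c0 + (e - e'))) \<in> mod2_cycles 1 (subtopology X S)"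
          by (rule mod2_cycles_diff[OF mod2_cycles_diff[OF c(1,2)] subsetD[OF mod2_boundaries_cycles d]])
        then have "e - e' \<in> mod2_cycles 1 (subtopology X S)" by simp
        then have "e - e' \<in> mod2_cycles 1 ?E" using singular_chain_diff[OF r(1) r'(1)] by (auto simp: mod2_cycles_def)
        moreover have "?cl c = ?cl (c0 + (e - e'))" unfolding mod2_class_eq by (rule d)
        ultimately show ?thesis by blast
      qed
      define c0 where "c0 p = (SOME c. c \<in> ?ZS \<and> kind c p)" for p
      have "?cl ` ?ZS \<subseteq> (\<Union>p. (\<lambda>z. ?cl (c0 p + z)) ` mod2_cycles 1 ?E)"
      proof (rule image_subsetI)
        fix c assume c: "c \<in> ?ZS"
        obtain p where p: "kind c p" using kind[OF c] by blast
        have "c0 p \<in> ?ZS \<and> kind (c0 p) p" unfolding c0_def by (rule someI[of _ c]) (use c p in blast)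
        then show "?cl c \<in> (\<Union>p. (\<lambda>z. ?cl (c0 p + z)) ` mod2_cycles 1 ?E)" using same[OF c _ p] by blast
      qed
      moreover have "finite (\<Union>p :: bool \<times> bool. (\<lambda>z. ?cl (c0 p + z)) ` mod2_cycles 1 ?E)" using fZ by (intro finite_UN_I) auto
      ultimately show ?thesis unfolding NS by (rule finite_subset)
    qed
  qed
qed

section \<open>Arcs in a disc\<close>

lemma pathin_join:
  assumes f: "pathin X f" and g: "pathin X g" and fg: "f 1 = g 0"
  shows "pathin X (\<lambda>t. if t \<le> 1/2 then f (2 * t) else g (2 * t - 1))"
  unfolding pathin_def
proof (rule continuous_map_cases_le)
  have *: "continuous_map (subtopology (top_of_set {0..1}) A) X (\<lambda>t. h (a t))"
    if h: "pathin X h" and a: "continuous_on UNIV a" "\<And>t. t \<in> A \<Longrightarrow> t \<in> {0..1} \<Longrightarrow> a t \<in> {0..1}" for h A and a :: "real \<Rightarrow> real"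
  proof -
    have "continuous_map (subtopology (top_of_set {0..1}) A) (top_of_set {0..1}) a"
      using continuous_on_subset[OF a(1)] a(2) by (auto simp: subtopology_subtopology)
    from continuous_map_compose[OF this h[unfolded pathin_def]] show ?thesis by (simp add: o_def)
  qed
  show "continuous_map (subtopology (top_of_set {0..1}) {t \<in> topspace (top_of_set {0..1}). t \<le> 1/2}) X (\<lambda>t. f (2 * t))"
    by (rule *[OF f]) (auto intro!: continuous_intros)
  show "continuous_map (subtopology (top_of_set {0..1}) {t \<in> topspace (top_of_set {0..1}). 1/2 \<le> t}) X (\<lambda>t. g (2 * t - 1))"
    by (rule *[OF g]) (auto intro!: continuous_intros)
  show "f (2 * t) = g (2 * t - 1)" if "t \<in> topspace (top_of_set {0..1})" "t = 1/2" for t unfolding that(2) using fg by simp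
qed auto

text \<open>In the disc a point of \<open>A\<close> and a point of \<open>B\<close> are joined by a
  segment, which is injective. It is cut down to the part from its last time in \<open>A\<close> to
  the first later time in \<open>B\<close>.\<close>

lemma arc_between:
  assumes F: "subtopology X F homeomorphic_space top_of_set (ball (0::complex) 1)" and FX: "F \<subseteq> topspace X"
    and A: "closedin (subtopology X F) A" "A \<noteq> {}" and B: "closedin (subtopology X F) B" "B \<noteq> {}" and AB: "A \<inter> B = {}"
  obtains \<sigma> where "pathin (subtopology X F) \<sigma>" "inj_on \<sigma> {0..1}" "\<sigma> 0 \<in> A" "\<sigma> 1 \<in> B"
    "\<And>t. 0 < t \<Longrightarrow> t < 1 \<Longrightarrow> \<sigma> t \<notin> A \<union> B"
proof -
  obtain h k where hk: "homeomorphic_maps (subtopology X F) (top_of_set (ball (0::complex) 1)) h k"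
    using F unfolding homeomorphic_space_def by blast
  have k: "continuous_map (top_of_set (ball 0 1)) (subtopology X F) k" and h: "continuous_map (subtopology X F) (top_of_set (ball 0 1)) h"
    and kh: "\<And>p. p \<in> F \<Longrightarrow> k (h p) = p" and hk': "\<And>z. z \<in> ball 0 1 \<Longrightarrow> h (k z) = z"
    using hk FX unfolding homeomorphic_maps_def by auto
  obtain a b where ab: "a \<in> A" "b \<in> B" using A(2) B(2) by blast
  have F': "a \<in> F" "b \<in> F" using ab closedin_subset[OF A(1)] closedin_subset[OF B(1)] by auto
  have hab: "h a \<in> ball 0 1" "h b \<in> ball 0 1" using h F' FX by (auto simp: continuous_map_def Pi_iff)
  have ne: "h a \<noteq> h b" using kh F' ab AB by (metis disjoint_iff)
  define l where "l t = (1 - t) *\<^sub>R h a + t *\<^sub>R h b" for t :: real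
  have lb: "l t \<in> ball 0 1" if "t \<in> {0..1}" for t
    unfolding l_def by (rule convexD[OF convex_ball hab]) (use that in auto)
  define s where "s t = k (l t)" for t
  have s: "pathin (subtopology X F) s" unfolding s_def
    by (rule continuous_map_real_affine[OF k]) (use lb in \<open>auto simp: l_def intro!: continuous_intros\<close>)
  have linj: "l t = l u \<Longrightarrow> t = u" for t u
  proof -
    assume "l t = l u"
    then have "(t - u) *\<^sub>R (h b - h a) = 0" by (simp add: l_def algebra_simps)
    then show "t = u" using ne by simp
  qed
  have sinj: "t = u" if "s t = s u" "t \<in> {0..1}" "u \<in> {0..1}" for t u
    using that linj hk' lb unfolding s_def by metis
  have s01: "s 0 = a" "s 1 = b" using kh F' by (simp_all add: s_def l_def)
  have cpt: "compact {t \<in> {0..1}. s t \<in> Z}" if "closedin (subtopology X F) Z" for Z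
  proof -
    have "closedin (top_of_set {0..1}) {t \<in> topspace (top_of_set {0..1}). s t \<in> Z}"
      by (rule closedin_continuous_map_preimage[OF s[unfolded pathin_def] that])
    then have "closedin (top_of_set {0..1}) {t \<in> {0..1}. s t \<in> Z}" by simp
    then show ?thesis using closedin_compact compact_Icc by blast
  qed
  have "{t \<in> {0..1}. s t \<in> A} \<noteq> {}" using s01 ab by (auto intro!: exI[of _ 0])
  then obtain t1 where t1: "t1 \<in> {0..1}" "s t1 \<in> A" "\<And>t. t \<in> {0..1} \<Longrightarrow> s t \<in> A \<Longrightarrow> t \<le> t1"
    using compact_attains_sup[OF cpt[OF A(1)]] by blast
  have "compact ({t \<in> {0..1}. s t \<in> B} \<inter> {t1..1})" by (rule compact_Int[OF cpt[OF B(1)] compact_Icc])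
  moreover have "{t \<in> {0..1}. s t \<in> B} \<inter> {t1..1} \<noteq> {}" 
  proof -
    have "1 \<in> {t \<in> {0..1}. s t \<in> B} \<inter> {t1..1}" using s01 ab t1(1) by simp
    then show ?thesis by blast
  qed
  ultimately obtain t2 where t2: "t2 \<in> {t1..1}" "t2 \<in> {0..1}" "s t2 \<in> B" "\<And>t. t \<in> {0..1} \<Longrightarrow> s t \<in> B \<Longrightarrow> t \<in> {t1..1} \<Longrightarrow> t2 \<le> t"
    using compact_attains_inf[of "{t \<in> {0..1}. s t \<in> B} \<inter> {t1..1}"] by blast
  have lt: "t1 < t2" using t1(2) t2(1,3) AB by (cases "t1 = t2") auto
  define \<sigma> where "\<sigma> t = s (t1 + t * (t2 - t1))" for t
  have inI: "t1 + t * (t2 - t1) \<in> {0..1}" "t1 \<le> t1 + t * (t2 - t1)" "t1 + t * (t2 - t1) \<le> t2" if "t \<in> {0..1}" for t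
  proof -
    have "0 \<le> t * (t2 - t1)" "t * (t2 - t1) \<le> t2 - t1" using that lt by (auto simp: mult_left_le_one_le)
    then show "t1 + t * (t2 - t1) \<in> {0..1}" "t1 \<le> t1 + t * (t2 - t1)" "t1 + t * (t2 - t1) \<le> t2" using t1(1) t2(2) by auto
  qed
  show thesis
  proof (rule that)
    show "pathin (subtopology X F) \<sigma>" unfolding \<sigma>_def
      by (rule continuous_map_real_affine[OF s[unfolded pathin_def]]) (use inI(1) in \<open>auto intro!: continuous_intros\<close>)
    show "inj_on \<sigma> {0..1}"
    proof (rule inj_onI)
      fix t u :: real assume tu: "t \<in> {0..1}" "u \<in> {0..1}" "\<sigma> t = \<sigma> u"
      then have "t1 + t * (t2 - t1) = t1 + u * (t2 - t1)" using sinj inI(1) unfolding \<sigma>_def by blast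
      then show "t = u" using lt by simp
    qed
    show "\<sigma> 0 \<in> A" "\<sigma> 1 \<in> B" using t1 t2 by (simp_all add: \<sigma>_def)
    fix t :: real assume t: "0 < t" "t < 1"
    have "0 < t * (t2 - t1)" "t * (t2 - t1) < t2 - t1" using t lt by auto
    then have strict: "t1 < t1 + t * (t2 - t1)" "t1 + t * (t2 - t1) < t2" by auto
    have i: "t1 + t * (t2 - t1) \<in> {0..1}" "t1 + t * (t2 - t1) \<in> {t1..1}" using inI[of t] t by auto
    show "\<sigma> t \<notin> A \<union> B"
    proof
      assume "\<sigma> t \<in> A \<union> B"
      then show False
      proof
        assume "\<sigma> t \<in> A"
        then show False using t1(3)[OF i(1)] strict by (simp add: \<sigma>_def)
      next
        assume "\<sigma> t \<in> B"
        then show False using t2(4)[OF i(1) _ i(2)] strict by (simp add: \<sigma>_def)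
      qed
    qed
  qed
qed

lemma path_in_component:
  assumes "pathin Y g" "t \<in> {0..1}" "s \<in> {0..1}"
  shows "connected_component_of Y (g s) (g t)"
proof -
  have "connectedin Y (g ` {0..1})" using connectedin_path_image assms(1) by blast
  then show ?thesis unfolding connected_component_of_def using assms(2,3) by blast
qed

text \<open>The indicator function of the component of \<open>p\<close> is constant along paths, so
  its coboundary vanishes on \<open>u\<close>. Evaluating it on the boundary of \<open>u\<close>
  shows that its values at \<open>p\<close> and \<open>q\<close> have the same parity.\<close>

lemma chain_ends_same_component:
  assumes u: "singular_chain 1 Y u"
    and b: "chain_boundary 1 u = frag_of (point_simplex p) + frag_of (point_simplex q) + frag_cmul 2 b"
    and p: "p \<in> topspace Y"
  shows "connected_component_of Y p q"
proof -
  define h where "h x = (if connected_component_of Y p x then 1 else 0 :: int)" for x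
  have "path_diff h \<sigma> = 0" if "\<sigma> \<in> Poly_Mapping.keys u" for \<sigma>
  proof -
    have "singular_simplex 1 Y \<sigma>" using u that by (auto simp: singular_chain_def)
    then have "pathin Y (simplex_path \<sigma>)" by (rule pathin_simplex_path)
    then have "connected_component_of Y (simplex_path \<sigma> 0) (simplex_path \<sigma> 1)" by (rule path_in_component) auto
    then have "connected_component_of Y p (simplex_path \<sigma> 0) \<longleftrightarrow> connected_component_of Y p (simplex_path \<sigma> 1)"
      by (metis connected_component_of_sym connected_component_of_trans)
    then show ?thesis by (simp add: path_diff_def h_def)
  qed
  then have "coeff_sum (path_diff h) u = 0" using coeff_sum_cong[of u "path_diff h" "\<lambda>_. 0"] by (simp add: coeff_sum_def)
  then have "coeff_sum (point_fun h) (chain_boundary 1 u) = 0" by (simp add: coeff_sum_path_diff)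
  then have "h p + h q + 2 * coeff_sum (point_fun h) b = 0" by (simp add: b coeff_sum_add coeff_sum_cmul)
  moreover have "h p = 1" using p by (simp add: h_def connected_component_of_refl)
  ultimately have "h q \<noteq> 0" by presburger
  then show ?thesis by (simp add: h_def split: if_splits)
qed

section \<open>Pushing a state off the diagram\<close>

lemma chart_convex:
  assumes ch: "chart X V \<xi>" and Z: "convex Z" "Z \<subseteq> \<xi> ` V"
  shows "contractible_space (subtopology X {p \<in> V. \<xi> p \<in> Z})" "path_connectedin X {p \<in> V. \<xi> p \<in> Z}"
proof -
  have e: "{p \<in> V. \<xi> p \<in> Z} = inv_into V \<xi> ` Z" by (rule chart_preimage[OF ch Z(2)])
  show c: "contractible_space (subtopology X {p \<in> V. \<xi> p \<in> Z})"
    unfolding e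
  proof (rule contractible_convex_image[OF Z(1) continuous_map_chart_inverse[OF ch Z(2)]])
    show "continuous_map (subtopology X (inv_into V \<xi> ` Z)) euclidean \<xi>"
      by (rule continuous_map_from_subtopology_mono[OF chart_facts(3)[OF ch]]) (auto simp flip: e)
    show "\<xi> (inv_into V \<xi> t) = t" if "t \<in> Z" for t using chart_inverse(2)[OF ch] that Z(2) by blast
  qed
  have "{p \<in> V. \<xi> p \<in> Z} \<subseteq> topspace X" using chart_facts(2)[OF ch] by auto
  then show "path_connectedin X {p \<in> V. \<xi> p \<in> Z}"
    unfolding path_connectedin_def using contractible_imp_path_connected_space[OF c] by simp
qed

lemma convex_Re_Im:
  fixes s :: real
  shows "convex {z. s * Re z > 0}" "convex {z. s * Re z \<ge> 0}" "convex {z. s * Im z > 0}" "convex {z. s * Im z \<ge> 0}"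
  using convex_halfspace_gt[of 0 "complex_of_real s"] convex_halfspace_ge[of 0 "complex_of_real s"]
    convex_halfspace_gt[of 0 "\<i> * complex_of_real s"] convex_halfspace_ge[of 0 "\<i> * complex_of_real s"]
  by (simp_all add: inner_complex_def)

text \<open>The shape required by \<open>two_corners\<close> is matched with the one in
  \<open>state\<close>: strands outside the open unit disc, and the smoothing arcs.\<close>

lemma corner_cases:
  "z \<in> corner_curve \<or> - z \<in> corner_curve \<longleftrightarrow>
     (Im z = 0 \<or> Re z = 0) \<and> norm z \<ge> 1 \<or> \<bar>Re z\<bar> + \<bar>Im z\<bar> = 1 \<and> Re z * Im z \<ge> 0"
proof -
  have n: "norm z = \<bar>Re z\<bar> + \<bar>Im z\<bar>" if "Im z = 0 \<or> Re z = 0"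
    using that cmod_eq_Re[of z] cmod_eq_Im[of z] by auto
  show ?thesis
  proof (cases "Im z = 0 \<or> Re z = 0")
    case True
    then show ?thesis unfolding n[OF True] by (auto simp: corner_curve_def)
  next
    case False
    then show ?thesis by (auto simp: corner_curve_def zero_le_mult_iff)
  qed
qed

lemma segment_quadrant: "z \<in> closed_segment 1 \<i> \<longleftrightarrow> Re z \<ge> 0 \<and> Im z \<ge> 0 \<and> Re z + Im z = 1"
proof
  assume r: "Re z \<ge> 0 \<and> Im z \<ge> 0 \<and> Re z + Im z = 1"
  then have "z = (1 - Im z) *\<^sub>R 1 + Im z *\<^sub>R \<i>" "Im z \<le> 1" by (auto simp: complex_eq_iff)
  then show "z \<in> closed_segment 1 \<i>" using r unfolding closed_segment_def by blast
qed (auto simp: closed_segment_def)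

lemma smoothing_arcs_rotate: "\<i> * z \<in> smoothing_arcs A_smoothing \<longleftrightarrow> z \<in> smoothing_arcs B_smoothing"
  and smoothing_arcs_B: "z \<in> smoothing_arcs B_smoothing \<longleftrightarrow> \<bar>Re z\<bar> + \<bar>Im z\<bar> = 1 \<and> Re z * Im z \<ge> 0"
proof -
  have rot: "w * z \<in> closed_segment (w * a) (w * b) \<longleftrightarrow> z \<in> closed_segment a b" if "w \<noteq> 0" for w z a b :: complex
  proof -
    have "linear ((*) w)" by (simp add: bounded_linear.linear bounded_linear_mult_right)
    then have "closed_segment (w * a) (w * b) = (*) w ` closed_segment a b" by (rule closed_segment_linear_image)
    then show ?thesis using that by auto
  qed
  have A: "\<i> * z \<in> closed_segment \<i> (-1) \<longleftrightarrow> z \<in> closed_segment 1 \<i>" "\<i> * z \<in> closed_segment (-\<i>) 1 \<longleftrightarrow> z \<in> closed_segment (-1) (-\<i>)"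
    using rot[of \<i> z 1 \<i>] rot[of \<i> z "-1" "-\<i>"] by simp_all
  then show "\<i> * z \<in> smoothing_arcs A_smoothing \<longleftrightarrow> z \<in> smoothing_arcs B_smoothing" by simp
  have "z \<in> closed_segment (-1) (-\<i>) \<longleftrightarrow> - z \<in> closed_segment 1 \<i>" using rot[of "-1" z "-1" "-\<i>"] by simp
  then show "z \<in> smoothing_arcs B_smoothing \<longleftrightarrow> \<bar>Re z\<bar> + \<bar>Im z\<bar> = 1 \<and> Re z * Im z \<ge> 0"
    by (auto simp: segment_quadrant zero_le_mult_iff)
qed

locale states = diagram X \<A> n L
  for X :: "'a topology" and \<A> :: "('a set \<times> ('a \<Rightarrow> complex)) set" and n :: nat and L :: "nat \<Rightarrow> real \<Rightarrow> 'a \<times> real" +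
  fixes U :: "'a \<Rightarrow> 'a set" and \<phi> :: "'a \<Rightarrow> 'a \<Rightarrow> complex" and \<kappa> :: real
  assumes sc: "smoothing_charts X \<A> n L U \<phi>" and red: "reduced_diagram X \<A> n L"
    and kappa: "\<kappa> = 1 \<or> \<kappa> = -1"
begin

text \<open>The \<open>B\<close>-smoothing is treated like the \<open>A\<close>-smoothing by a quarter turn of the charts: in the
  coordinate \<open>\<psi> c\<close>, the arcs of the state \<open>S0\<close> always lie in the second and fourth quadrants.\<close>

definition \<omega> :: complex where "\<omega> = (if \<kappa> = 1 then 1 else \<i>)"
definition \<psi> :: "'a \<Rightarrow> 'a \<Rightarrow> complex" where "\<psi> c p = \<omega> * \<phi> c p"
definition base :: smoothing where "base = (if \<kappa> = 1 then A_smoothing else B_smoothing)"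
definition other :: smoothing where "other = (if \<kappa> = 1 then B_smoothing else A_smoothing)"
abbreviation "R \<equiv> topspace X - D"
abbreviation "S0 \<equiv> state n L U \<phi> (\<lambda>_. base)"
abbreviation "S1 c \<equiv> state n L U \<phi> ((\<lambda>_. base)(c := other))"

lemma omega: "norm \<omega> = 1" "\<omega> \<noteq> 0" "cnj \<omega> * \<omega> = 1" by (auto simp: \<omega>_def)

lemma cc: "c \<in> C \<Longrightarrow> crossing_chart X \<A> n L c (U c) (\<phi> c)"
  using sc by (simp add: smoothing_charts_def)

lemma U_disjoint: "c \<in> C \<Longrightarrow> d \<in> C \<Longrightarrow> p \<in> U c \<Longrightarrow> p \<in> U d \<Longrightarrow> c = d"
  using sc unfolding smoothing_charts_def disjoint_family_on_def by blast

lemma UC: "c \<in> C \<Longrightarrow> U c \<inter> C = {c}"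
  using U_disjoint crossing_chartD(3)[OF cc] by blast

lemma psi:
  assumes c: "c \<in> C"
  shows "oriented_chart X \<A> (U c) (\<psi> c)" "chart X (U c) (\<psi> c)" "\<psi> c ` U c = ball 0 2" "c \<in> U c" "\<psi> c c = 0"
    "openin X (U c)" "\<And>p. p \<in> U c \<Longrightarrow> p \<in> D \<longleftrightarrow> Im (\<psi> c p) = 0 \<or> Re (\<psi> c p) = 0"
    "\<And>p. norm (\<psi> c p) = norm (\<phi> c p)" "\<And>p. p \<in> U c \<Longrightarrow> norm (\<psi> c p) < 2"
proof -
  note f = crossing_chartD[OF cc[OF c]]
  show "oriented_chart X \<A> (U c) (\<psi> c)"
  proof -
    have "\<psi> c = (\<lambda>p. (if \<kappa> = 1 then 1 else \<i>) * \<phi> c p)" by (simp add: fun_eq_iff \<psi>_def \<omega>_def)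
    then show ?thesis using f(1) oriented_chart_mult_i[OF atlas f(1)] by (auto split: if_splits)
  qed
  then show "chart X (U c) (\<psi> c)" by (simp add: oriented_chart_def)
  show "c \<in> U c" "openin X (U c)" using f by auto
  show "\<psi> c c = 0" using f(4) by (simp add: \<psi>_def)
  show n: "\<And>p. norm (\<psi> c p) = norm (\<phi> c p)" by (simp add: \<psi>_def norm_mult omega)
  show "\<And>p. p \<in> U c \<Longrightarrow> norm (\<psi> c p) < 2" using f(8) by (simp add: n)
  show "p \<in> D \<longleftrightarrow> Im (\<psi> c p) = 0 \<or> Re (\<psi> c p) = 0" if "p \<in> U c" for p
    using f(7)[OF that] by (auto simp: \<psi>_def \<omega>_def)
  show "\<psi> c ` U c = ball 0 2"
  proof (intro Set.set_eqI iffI)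
    fix z assume "z \<in> \<psi> c ` U c" then show "z \<in> ball 0 2" using f(8) by (auto simp: n)
  next
    fix z :: complex assume "z \<in> ball 0 2"
    then have "cnj \<omega> * z \<in> \<phi> c ` U c" unfolding f(5) by (simp add: norm_mult omega)
    then obtain p where p: "p \<in> U c" "cnj \<omega> * z = \<phi> c p" by blast
    have "\<omega> * (cnj \<omega> * z) = z" by (auto simp: \<omega>_def)
    then have "\<psi> c p = z" unfolding \<psi>_def p(2) .
    then show "z \<in> \<psi> c ` U c" using p by blast
  qed
qed

lemma U_top: "c \<in> C \<Longrightarrow> U c \<subseteq> topspace X" using psi(6) openin_subset by blast

lemma base_arcs: "\<phi> c p \<in> smoothing_arcs base \<longleftrightarrow> \<bar>Re (\<psi> c p)\<bar> + \<bar>Im (\<psi> c p)\<bar> = 1 \<and> Re (\<psi> c p) * Im (\<psi> c p) \<le> 0"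
  and other_arcs: "\<phi> c p \<in> smoothing_arcs other \<longleftrightarrow> \<bar>Re (\<psi> c p)\<bar> + \<bar>Im (\<psi> c p)\<bar> = 1 \<and> Re (\<psi> c p) * Im (\<psi> c p) \<ge> 0"
proof -
  have A: "z \<in> smoothing_arcs A_smoothing \<longleftrightarrow> \<bar>Re z\<bar> + \<bar>Im z\<bar> = 1 \<and> Re z * Im z \<le> 0" for z
  proof -
    have "z \<in> smoothing_arcs A_smoothing \<longleftrightarrow> - \<i> * z \<in> smoothing_arcs B_smoothing"
      using smoothing_arcs_rotate[of "- \<i> * z"] by simp
    also have "\<dots> \<longleftrightarrow> \<bar>Re z\<bar> + \<bar>Im z\<bar> = 1 \<and> Re z * Im z \<le> 0"
      unfolding smoothing_arcs_B by (auto simp: mult.commute add.commute)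
    finally show ?thesis .
  qed
  show "\<phi> c p \<in> smoothing_arcs base \<longleftrightarrow> \<bar>Re (\<psi> c p)\<bar> + \<bar>Im (\<psi> c p)\<bar> = 1 \<and> Re (\<psi> c p) * Im (\<psi> c p) \<le> 0"
    "\<phi> c p \<in> smoothing_arcs other \<longleftrightarrow> \<bar>Re (\<psi> c p)\<bar> + \<bar>Im (\<psi> c p)\<bar> = 1 \<and> Re (\<psi> c p) * Im (\<psi> c p) \<ge> 0"
    unfolding base_def other_def \<psi>_def \<omega>_def if_distribR
    by (auto simp: A smoothing_arcs_B mult.commute add.commute simp del: smoothing_arcs.simps)
qed

lemma state_iff:
  assumes "c \<in> C" "p \<in> U c"
  shows "p \<in> state n L U \<phi> \<sigma> \<longleftrightarrow> p \<in> D \<and> norm (\<psi> c p) \<ge> 1 \<or> \<phi> c p \<in> smoothing_arcs (\<sigma> c)"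
proof -
  have "(p \<in> U d \<and> Q d) \<longleftrightarrow> (d = c \<and> Q c)" if "d \<in> C" for d Q using U_disjoint assms that by blast
  then have "(\<exists>d\<in>C. p \<in> U d \<and> Q d) \<longleftrightarrow> Q c" for Q using assms by blast
  then show ?thesis unfolding state_def using psi(8)[OF assms(1), of p] by (auto simp: not_less)
qed

lemma state_out:
  assumes "\<And>c. c \<in> C \<Longrightarrow> p \<notin> U c" shows "p \<in> state n L U \<phi> \<sigma> \<longleftrightarrow> p \<in> D"
  using assms by (auto simp: state_def)

lemma S0_iff: "c \<in> C \<Longrightarrow> p \<in> U c \<Longrightarrow> p \<in> S0 \<longleftrightarrow> \<i> * \<psi> c p \<in> corner_curve \<or> - (\<i> * \<psi> c p) \<in> corner_curve"
  unfolding corner_cases state_iff base_arcs psi(7) by (auto simp: norm_mult mult.commute add.commute)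

lemma S1_iff: "c \<in> C \<Longrightarrow> p \<in> U c \<Longrightarrow> p \<in> S1 c \<longleftrightarrow> \<psi> c p \<in> corner_curve \<or> - \<psi> c p \<in> corner_curve"
  unfolding corner_cases state_iff fun_upd_same other_arcs psi(7) by auto

lemma state_top: "state n L U \<phi> \<sigma> \<subseteq> topspace X"
  using D_top U_top by (auto simp: state_def)

lemma psi_i:
  assumes c: "c \<in> C"
  shows "chart X (U c) (\<lambda>p. \<i> * \<psi> c p)" "(\<lambda>p. \<i> * \<psi> c p) ` U c = ball 0 2"
proof -
  show "chart X (U c) (\<lambda>p. \<i> * \<psi> c p)"
    using oriented_chart_mult_i[OF atlas psi(1)[OF c]] by (simp add: oriented_chart_def)
  show "(\<lambda>p. \<i> * \<psi> c p) ` U c = ball 0 2"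
  proof (intro Set.set_eqI iffI)
    fix z assume "z \<in> (\<lambda>p. \<i> * \<psi> c p) ` U c" then show "z \<in> ball 0 2" using psi(9)[OF c] by (auto simp: norm_mult)
  next
    fix z :: complex assume "z \<in> ball 0 2"
    then have "- \<i> * z \<in> \<psi> c ` U c" unfolding psi(3)[OF c] by (simp add: norm_mult)
    then obtain p where p: "p \<in> U c" "- \<i> * z = \<psi> c p" by blast
    then have "z = \<i> * \<psi> c p" by (simp flip: p(2))
    then show "z \<in> (\<lambda>p. \<i> * \<psi> c p) ` U c" using p(1) by blast
  qed
qed

lemma S0_corners: "c \<in> C \<Longrightarrow> two_corners X (U c) (\<lambda>p. \<i> * \<psi> c p) S0"
  by (simp add: two_corners_def Hd psi_i state_top S0_iff)

lemma S1_corners: "c \<in> C \<Longrightarrow> two_corners X (U c) (\<psi> c) (S1 c)"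
  by (simp add: two_corners_def Hd psi(2,3) state_top S1_iff)

lemma corner_rest:
  "(z \<in> corner_curve \<or> - z \<in> corner_curve) \<and> \<not> Re z * Im z > 0 \<longleftrightarrow> Re z * Im z = 0 \<and> \<bar>Re z\<bar> + \<bar>Im z\<bar> \<ge> 1"
  by (auto simp: corner_curve_def zero_less_mult_iff)

text \<open>In \<open>U c\<close> both cores are the axes outside the open unit disc, which a
  quarter turn preserves; elsewhere the states do not notice the smoothing at
  \<open>c\<close>.\<close>

lemma same_core:
  assumes c: "c \<in> C"
  shows "two_corners.core (U c) (\<lambda>p. \<i> * \<psi> c p) S0 = two_corners.core (U c) (\<psi> c) (S1 c)"
proof (rule Set.set_eqI)
  fix p
  show "p \<in> two_corners.core (U c) (\<lambda>p. \<i> * \<psi> c p) S0 \<longleftrightarrow> p \<in> two_corners.core (U c) (\<psi> c) (S1 c)"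
  proof (cases "p \<in> U c")
    case True
    then show ?thesis
      using corner_rest[of "\<i> * \<psi> c p"] corner_rest[of "\<psi> c p"] S0_iff[OF c True] S1_iff[OF c True]
      unfolding two_corners.core_def[OF S0_corners[OF c]] two_corners.core_def[OF S1_corners[OF c]]
      by (auto simp: mult.commute add.commute)
  next
    case False
    have "p \<in> S0 \<longleftrightarrow> p \<in> S1 c"
    proof (cases "\<exists>d\<in>C. p \<in> U d")
      case True
      then obtain d where d: "d \<in> C" "p \<in> U d" by blast
      then have "d \<noteq> c" using False by blast
      then show ?thesis using state_iff[OF d] by simp
    next
      case no: False
      then show ?thesis using state_out by blast
    qed
    then show ?thesis using False
      unfolding two_corners.core_def[OF S0_corners[OF c]] two_corners.core_def[OF S1_corners[OF c]] by simp
  qed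
qed

text \<open>The two black corners at a crossing: the fourth (\<open>s = 1\<close>) and second (\<open>s = -1\<close>) quadrant of \<open>\<psi> c\<close>.\<close>

definition black :: "'a \<Rightarrow> real \<Rightarrow> 'a set" where
  "black c s = {p \<in> U c. \<psi> c p \<in> ball 0 2 \<inter> ({z. s * Re z > 0} \<inter> {z. - s * Im z > 0})}"

lemma black_iff: "c \<in> C \<Longrightarrow> p \<in> black c s \<longleftrightarrow> p \<in> U c \<and> s * Re (\<psi> c p) > 0 \<and> s * Im (\<psi> c p) < 0"
  using psi(9) by (auto simp: black_def)

lemma black_R: "c \<in> C \<Longrightarrow> black c s \<subseteq> R"
  using psi(7) U_top by (fastforce simp: black_iff)

lemma black_connected: "c \<in> C \<Longrightarrow> path_connectedin X (black c s)"
  unfolding black_def by (intro chart_convex(2)[OF psi(2)] convex_Int convex_ball convex_Re_Im) (auto simp: psi(3))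

lemma S0_quadrant: "c \<in> C \<Longrightarrow> x \<in> S0 \<Longrightarrow> x \<in> U c \<Longrightarrow> Re (\<psi> c x) * Im (\<psi> c x) \<le> 0 \<and> \<psi> c x \<noteq> 0"
  using S0_iff[of c x] by (auto simp: corner_curve_def mult_nonneg_nonpos mult_nonpos_nonneg complex_eq_iff mult_le_0_iff)

text \<open>The inequality puts \<open>x\<close> on one of the two rays that border the corner
  \<open>black c s\<close>, and by \<open>crossing_side\<close> this corner is on the black side of
  both of them.\<close>

lemma black_germ_crossing:
  assumes c: "c \<in> C" and x: "x \<in> S0" "x \<in> U c" "x \<in> D" and s: "s = 1 \<or> s = -1" and side: "s * Re (\<psi> c x) > s * Im (\<psi> c x)"
    and germ: "\<And>\<Omega> \<xi>. axis_chart \<Omega> \<xi> \<Longrightarrow> x \<in> \<Omega> \<Longrightarrow>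
      \<forall>\<^sub>F t in at_right 0. \<delta> t \<in> \<Omega> \<and> point_side \<kappa> \<xi> x * Im (\<xi> (\<delta> t)) > 0"
  shows "\<forall>\<^sub>F t in at_right 0. \<delta> t \<in> black c s"
proof -
  have z: "Im (\<psi> c x) = 0 \<or> Re (\<psi> c x) = 0" using psi(7)[OF c x(2)] x(3) by simp
  \<comment> \<open>The direction of the ray through \<open>x\<close> in the coordinate
    \<open>\<psi> c\<close>: the real direction \<open>s\<close>, or the imaginary direction on the
    same side of the diagonal. The unit \<open>a\<close> is this direction in the crossing chart
    itself.\<close>
  define v where "v = (if Im (\<psi> c x) = 0 then of_real s else - \<i> * of_real s)"
  define a where "a = cnj \<omega> * v"
  have f: "cnj a * \<phi> c p = cnj v * \<psi> c p" for p by (simp add: a_def \<psi>_def)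
  have a4: "a \<in> {1, -1, \<i>, -\<i>}" using s by (auto simp: a_def v_def \<omega>_def)
  have half: "x \<in> half (U c) (\<phi> c) a"
    unfolding half_def f using x(2) z side by (auto simp: v_def)
  have ps: "point_side \<kappa> (\<lambda>p. cnj a * \<phi> c p) x = (if a = 1 \<or> a = -1 then -\<kappa> else \<kappa>)"
    by (rule crossing_side[OF cc[OF c] c UC[OF c] a4 x(3) half])
  have ps': "(if a = 1 \<or> a = -1 then -\<kappa> else \<kappa>) = (if Im (\<psi> c x) = 0 then -1 else 1)"
    using s kappa by (auto simp: a_def v_def \<omega>_def complex_eq_iff)
  have "\<forall>\<^sub>F t in at_right 0. \<delta> t \<in> half (U c) (\<phi> c) a \<and> point_side \<kappa> (\<lambda>p. cnj a * \<phi> c p) x * Im (cnj a * \<phi> c (\<delta> t)) > 0"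
    by (rule germ[OF axis_chart_half(1)[OF cc[OF c] UC[OF c] a4] half])
  then show ?thesis
  proof eventually_elim
    case (elim t)
    then have "\<delta> t \<in> U c" "Re (cnj v * \<psi> c (\<delta> t)) > 0" "(if Im (\<psi> c x) = 0 then -1 else 1) * Im (cnj v * \<psi> c (\<delta> t)) > 0"
      unfolding ps ps' by (simp_all add: half_def f)
    then show ?case unfolding black_iff[OF c] by (auto simp: v_def split: if_splits)
  qed
qed

text \<open>The requirements of \<open>push_off\<close>, met below by regions that are convex in a
  chart: \<open>Q\<close> includes the adjacent part of the state, \<open>P\<close> is its open
  black part.\<close>

definition good :: "('a \<Rightarrow> real \<Rightarrow> 'a) \<Rightarrow> 'a set \<Rightarrow> 'a set \<Rightarrow> 'a set \<Rightarrow> bool" where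
  "good \<delta> W Q P \<longleftrightarrow> openin X W \<and> S0 \<inter> W \<subseteq> Q \<and> P \<subseteq> Q \<and> P \<subseteq> R \<and> path_connectedin X P \<and>
     contractible_space (subtopology X Q) \<and> (\<forall>x\<in>S0. x \<in> W \<longrightarrow> (\<forall>\<^sub>F t in at_right 0. \<delta> x t \<in> P))"

text \<open>Points of the state on the diagram receive a black germ. The other points lie inside
  smoothing arcs, hence already in a black corner, and stay fixed. In \<open>U c\<close> the state
  misses the diagonal where real and imaginary part agree, so the two half discs beside it are
  suitable neighbourhoods; elsewhere an axis chart is used.\<close>

lemma black_paths:
  obtains \<delta> where "\<And>x. x \<in> S0 \<Longrightarrow> pathin X (\<delta> x) \<and> \<delta> x 0 = x"
    "\<And>x. x \<in> S0 \<Longrightarrow> \<exists>W Q P. good \<delta> W Q P \<and> x \<in> W"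
    "\<And>c x s. c \<in> C \<Longrightarrow> x \<in> S0 \<Longrightarrow> x \<in> U c \<Longrightarrow> s = 1 \<or> s = -1 \<Longrightarrow> s * Re (\<psi> c x) > s * Im (\<psi> c x) \<Longrightarrow>
       \<forall>\<^sub>F t in at_right 0. \<delta> x t \<in> black c s"
proof -
  have S0C: "x \<notin> C" if "x \<in> S0" for x
    using S0_quadrant[of x x] psi(4,5)[of x] that by blast
  have \<kappa>': "\<kappa> \<in> {1, -1}" using kappa by auto
  define bg where "bg x \<delta> \<longleftrightarrow> pathin X \<delta> \<and> \<delta> 0 = x \<and> (\<forall>\<Omega> \<xi>. axis_chart \<Omega> \<xi> \<longrightarrow> x \<in> \<Omega> \<longrightarrow>
      (\<forall>\<^sub>F s in at_right 0. \<delta> s \<in> \<Omega> \<and> point_side \<kappa> \<xi> x * Im (\<xi> (\<delta> s)) > 0))" for x \<delta>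
  have "\<forall>x. \<exists>\<delta>. x \<in> D \<and> x \<notin> C \<longrightarrow> bg x \<delta>" unfolding bg_def using black_germ[OF \<kappa>'] by blast
  then obtain \<delta>' where bg: "\<And>x. x \<in> D \<Longrightarrow> x \<notin> C \<Longrightarrow> bg x (\<delta>' x)" by metis
  have \<delta>': "x \<in> D \<Longrightarrow> x \<notin> C \<Longrightarrow> pathin X (\<delta>' x) \<and> \<delta>' x 0 = x"
    "x \<in> D \<Longrightarrow> x \<notin> C \<Longrightarrow> axis_chart \<Omega> \<xi> \<Longrightarrow> x \<in> \<Omega> \<Longrightarrow>
      \<forall>\<^sub>F s in at_right 0. \<delta>' x s \<in> \<Omega> \<and> point_side \<kappa> \<xi> x * Im (\<xi> (\<delta>' x s)) > 0" for x \<Omega> \<xi>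
    using bg[of x] unfolding bg_def by blast+
  define \<delta> where "\<delta> x = (if x \<in> D then \<delta>' x else (\<lambda>_. x))" for x
  have cross: "\<forall>\<^sub>F t in at_right 0. \<delta> x t \<in> black c s"
    if h: "c \<in> C" "x \<in> S0" "x \<in> U c" "s = 1 \<or> s = -1" "s * Re (\<psi> c x) > s * Im (\<psi> c x)" for c x s
  proof (cases "x \<in> D")
    case True
    then have "\<forall>\<^sub>F t in at_right 0. \<delta>' x t \<in> black c s"
      by (rule black_germ_crossing[OF h(1-3) _ h(4,5)]) (use \<delta>'(2)[OF True S0C[OF h(2)]] in blast)
    then show ?thesis using True by (simp add: \<delta>_def)
  next
    case False
    then have nz: "Im (\<psi> c x) \<noteq> 0" "Re (\<psi> c x) \<noteq> 0" using psi(7)[OF h(1,3)] by auto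
    have "Re (\<psi> c x) * Im (\<psi> c x) \<le> 0" using S0_quadrant[OF h(1-3)] by blast
    then have "x \<in> black c s" using nz h(4,5) unfolding black_iff[OF h(1)] by (auto simp: mult_le_0_iff h(3))
    then show ?thesis using False by (simp add: \<delta>_def)
  qed
  show thesis
  proof (rule that[OF _ _ cross])
    show "pathin X (\<delta> x) \<and> \<delta> x 0 = x" if "x \<in> S0" for x
      using \<delta>'(1) S0C[OF that] state_top that by (auto simp: \<delta>_def pathin_const)
    show "\<exists>W Q P. good \<delta> W Q P \<and> x \<in> W" if x: "x \<in> S0" for x
    proof (cases "\<exists>c\<in>C. x \<in> U c")
      case True
      then obtain c where c: "c \<in> C" "x \<in> U c" by blast
      have "Re (\<psi> c x) \<noteq> Im (\<psi> c x)" using S0_quadrant[OF c(1) x c(2)] by (auto simp: mult_le_0_iff complex_eq_iff)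
      then obtain s :: real where s: "s = 1 \<or> s = -1" "s * Re (\<psi> c x) > s * Im (\<psi> c x)"
        by (cases "Re (\<psi> c x) > Im (\<psi> c x)") (auto intro: that[of 1] that[of "-1"])
      define W where "W = {p \<in> U c. \<psi> c p \<in> {z. s * Im z < s * Re z}}"
      define Q where "Q = {p \<in> U c. \<psi> c p \<in> ball 0 2 \<inter> ({z. s * Re z \<ge> 0} \<inter> {z. - s * Im z \<ge> 0})}"
      have "good \<delta> W Q (black c s)" unfolding good_def
      proof (intro conjI ballI impI)
        show "openin X W" unfolding W_def
          by (rule openin_chart_preimage[OF psi(2)[OF c(1)]]) (intro open_Collect_less continuous_intros)
        show "S0 \<inter> W \<subseteq> Q"
        proof
          fix p assume p: "p \<in> S0 \<inter> W"
          then have "p \<in> U c" "s * Im (\<psi> c p) < s * Re (\<psi> c p)" by (auto simp: W_def)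
          moreover have "Re (\<psi> c p) * Im (\<psi> c p) \<le> 0" using S0_quadrant[OF c(1), of p] p \<open>p \<in> U c\<close> by blast
          ultimately show "p \<in> Q" using s(1) psi(9)[OF c(1), of p] by (auto simp: Q_def mult_le_0_iff)
        qed
        show "black c s \<subseteq> Q" by (auto simp: black_def Q_def)
        show "black c s \<subseteq> R" by (rule black_R[OF c(1)])
        show "path_connectedin X (black c s)" by (rule black_connected[OF c(1)])
        show "contractible_space (subtopology X Q)"
          unfolding Q_def by (intro chart_convex(1)[OF psi(2)[OF c(1)]] convex_Int convex_ball convex_Re_Im) (auto simp: psi(3)[OF c(1)])
        show "\<forall>\<^sub>F t in at_right 0. \<delta> p t \<in> black c s" if "p \<in> S0" "p \<in> W" for p
          by (rule cross[OF c(1) that(1) _ s(1)]) (use that(2) in \<open>auto simp: W_def\<close>)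
      qed
      then show ?thesis using c(2) s(2) by (auto simp: W_def)
    next
      case no: False
      then have xD: "x \<in> D" "x \<notin> C" using state_out x S0C[OF x] by blast+
      obtain \<Omega> f where \<Omega>: "axis_chart \<Omega> f" "x \<in> \<Omega>" by (rule axis_chart_exists[OF xD])
      \<comment> \<open>Off the closed unit discs, in which the smoothing arcs lie, the state
        coincides with the diagram.\<close>
      let ?B = "\<Union>c\<in>C. {p \<in> U c. \<psi> c p \<in> cball 0 1}"
      have clB: "closedin X ?B"
      proof (rule closedin_Union)
        fix Z assume "Z \<in> (\<lambda>c. {p \<in> U c. \<psi> c p \<in> cball 0 1}) ` C"
        then obtain c where c: "c \<in> C" "Z = {p \<in> U c. \<psi> c p \<in> cball 0 1}" by blast
        show "closedin X Z" unfolding c(2) by (rule closedin_chart_preimage[OF psi(2)[OF c(1)] Hd compact_cball]) (auto simp: psi(3)[OF c(1)])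
      qed (use finite_C in simp)
      define \<Omega>' where "\<Omega>' = \<Omega> - ?B"
      have o\<Omega>: "openin X \<Omega>'" unfolding \<Omega>'_def by (intro openin_diff clB axis_chartD(5)[OF \<Omega>(1)])
      have ax': "axis_chart \<Omega>' f" by (rule axis_chart_restrict[OF \<Omega>(1) o\<Omega>]) (auto simp: \<Omega>'_def)
      have x': "x \<in> \<Omega>'" using \<Omega>(2) no by (auto simp: \<Omega>'_def)
      have S0D: "p \<in> S0 \<longleftrightarrow> p \<in> D" if "p \<in> \<Omega>'" for p
      proof (cases "\<exists>c\<in>C. p \<in> U c")
        case True
        then obtain c where c: "c \<in> C" "p \<in> U c" by blast
        then have n1: "norm (\<psi> c p) > 1" using that by (auto simp: \<Omega>'_def not_le)
        then have "\<bar>Re (\<psi> c p)\<bar> + \<bar>Im (\<psi> c p)\<bar> \<noteq> 1" using cmod_le[of "\<psi> c p"] by linarith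
        then show ?thesis using state_iff[OF c] n1 base_arcs by auto
      next
        case False
        then show ?thesis using state_out by blast
      qed
      have "open (f ` \<Omega>')" using axis_chartD(1)[OF ax'] by (simp add: chart_def)
      moreover have "f x \<in> f ` \<Omega>'" using x' by blast
      ultimately obtain r where r: "r > 0" "ball (f x) r \<subseteq> f ` \<Omega>'" by (rule openE)
      define W where "W = {p \<in> \<Omega>'. f p \<in> ball (f x) r}"
      have oW: "openin X W" unfolding W_def by (rule openin_chart_preimage[OF axis_chartD(1)[OF ax'] open_ball])
      have ax: "axis_chart W f" by (rule axis_chart_restrict[OF ax' oW]) (auto simp: W_def)
      have xW: "x \<in> W" using x' r by (simp add: W_def)
      have fW: "f ` W = ball (f x) r" using r(2) by (auto simp: W_def)
      define s where "s = point_side \<kappa> f x"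
      have s: "s = 1 \<or> s = -1" using point_side_values[OF \<kappa>' xD] by (auto simp: s_def)
      define Q where "Q = {p \<in> W. f p \<in> ball (f x) r \<inter> {z. s * Im z \<ge> 0}}"
      define P where "P = {p \<in> W. f p \<in> ball (f x) r \<inter> {z. s * Im z > 0}}"
      have chW: "chart X W f" by (rule axis_chartD(1)[OF ax])
      have WD: "p \<in> D \<longleftrightarrow> Im (f p) = 0" if "p \<in> W" for p using axis_chartD(4)[OF ax that] .
      have "good \<delta> W Q P" unfolding good_def
      proof (intro conjI ballI impI)
        show "openin X W" by (rule oW)
        show "S0 \<inter> W \<subseteq> Q" using S0D WD by (auto simp: Q_def W_def)
        show "P \<subseteq> Q" by (auto simp: P_def Q_def)
        show "P \<subseteq> R" using WD axis_chartD(6)[OF ax] by (auto simp: P_def)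
        show "path_connectedin X P"
          unfolding P_def by (intro chart_convex(2)[OF chW] convex_Int convex_ball convex_Re_Im) (auto simp: fW)
        show "contractible_space (subtopology X Q)"
          unfolding Q_def by (intro chart_convex(1)[OF chW] convex_Int convex_ball convex_Re_Im) (auto simp: fW)
        show "\<forall>\<^sub>F t in at_right 0. \<delta> p t \<in> P" if p: "p \<in> S0" "p \<in> W" for p
        proof -
          have pD: "p \<in> D" using S0D p by (auto simp: W_def)
          have "connected {z \<in> f ` W. Im z = 0}"
          proof -
            have e: "{z \<in> f ` W. Im z = 0} = ball (f x) r \<inter> ({z. 1 * Im z \<ge> 0} \<inter> {z. -1 * Im z \<ge> 0})" unfolding fW by auto
            show ?thesis unfolding e by (intro convex_connected convex_Int convex_ball convex_Re_Im)
          qed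
          then have "point_side \<kappa> f p = s" unfolding s_def by (rule side_constant[OF ax _ p(2) pD xW xD(1)])
          moreover have "\<forall>\<^sub>F t in at_right 0. \<delta>' p t \<in> W \<and> point_side \<kappa> f p * Im (f (\<delta>' p t)) > 0"
            by (rule \<delta>'(2)[OF pD S0C[OF p(1)] ax p(2)])
          ultimately have "\<forall>\<^sub>F t in at_right 0. \<delta>' p t \<in> P"
            by (auto simp: P_def W_def elim!: eventually_mono)
          then show ?thesis using pD by (simp add: \<delta>_def)
        qed
      qed
      then show ?thesis using xW by blast
    qed
  qed
qed

text \<open>By cellularity the faces are contractible pieces of the complement, and a path in the
  complement stays in its face.\<close>

lemma R_cycles: "mod2_cycles 1 (subtopology X R) \<subseteq> mod2_boundaries 1 (subtopology X R)"
proof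
  let ?Y = "subtopology X R"
  fix c assume c: "c \<in> mod2_cycles 1 ?Y"
  have ts: "topspace ?Y = R" by auto
  show "c \<in> mod2_boundaries 1 ?Y"
  proof (rule mod2_cycles_contractible_pieces[OF _ _ _ _ c])
    fix x assume x: "x \<in> topspace ?Y"
    let ?F = "connected_component_of_set ?Y x"
    show "x \<in> ?F" using x by (simp add: connected_component_of_refl)
    show sub: "?F \<subseteq> topspace ?Y" by (rule connected_component_of_subset_topspace)
    have "?F \<in> connected_components_of ?Y" using x by (simp add: connected_components_of_def)
    then have "subtopology X ?F homeomorphic_space top_of_set (ball (0::complex) 1)"
      using red by (auto simp: reduced_diagram_def)
    moreover have "contractible_space (top_of_set (ball (0::complex) 1))"
      by (simp add: contractible_space_top_of_set convex_imp_contractible)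
    ultimately have "contractible_space (subtopology X ?F)" using homeomorphic_space_contractibility by blast
    moreover have "subtopology ?Y ?F = subtopology X ?F" using sub by (simp add: subtopology_subtopology Int_absorb1)
    ultimately show "contractible_space (subtopology ?Y ?F)" by simp
  next
    fix g assume g: "pathin ?Y g"
    show "g ` {0..1} \<subseteq> connected_component_of_set ?Y (g 0) \<and> connected_component_of_set ?Y (g 1) = connected_component_of_set ?Y (g 0)"
    proof
      show "g ` {0..1} \<subseteq> connected_component_of_set ?Y (g 0)" using path_in_component[OF g, of _ 0] by auto
      show "connected_component_of_set ?Y (g 1) = connected_component_of_set ?Y (g 0)"
        using path_in_component[OF g, of 0 1] connected_component_of_equiv by fastforce
    qed
  qed
qed

lemma push_S0:
  assumes \<delta>: "\<And>x. x \<in> S0 \<Longrightarrow> pathin X (\<delta> x) \<and> \<delta> x 0 = x" "\<And>x. x \<in> S0 \<Longrightarrow> \<exists>W Q P. good \<delta> W Q P \<and> x \<in> W"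
    and y: "singular_chain 1 (subtopology X S0) y" and d0: "\<And>x. d0 x > (0::real)"
  obtains u d where "singular_chain 1 (subtopology X R) u" "\<And>x. 0 < d x" "\<And>x. d x \<le> d0 x" "\<And>x. d x \<le> 1"
    "y - u + frag_extend (\<lambda>\<sigma>. frag_of (path_simplex (\<lambda>t. \<delta> (simplex_point \<sigma>) (t * d (simplex_point \<sigma>)))))
        (chain_boundary 1 y) \<in> mod2_boundaries 1 X"
proof (rule push_off[where S = S0 and \<delta> = \<delta> and R = R and \<W> = "{(W, Q, P). good \<delta> W Q P}" and y = y and X = X and ?d0.0 = d0])
  show "pathin X (\<delta> x) \<and> \<delta> x 0 = x" if "x \<in> S0" for x by (rule \<delta>(1)[OF that])
  show "\<exists>W Q P. (W, Q, P) \<in> {(W, Q, P). good \<delta> W Q P} \<and> x \<in> W" if "x \<in> S0" for x using \<delta>(2)[OF that] by blast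
  show "openin X W \<and> S0 \<inter> W \<subseteq> Q \<and> P \<subseteq> Q \<and> P \<subseteq> R \<and> path_connectedin X P \<and> contractible_space (subtopology X Q)"
    if "(W, Q, P) \<in> {(W, Q, P). good \<delta> W Q P}" for W Q P using that by (simp add: good_def)
  show "\<forall>\<^sub>F s in at_right 0. \<delta> x s \<in> P" if "(W, Q, P) \<in> {(W, Q, P). good \<delta> W Q P}" "x \<in> S0" "x \<in> W" for W Q P x
    using that by (simp add: good_def)
qed (use y state_top d0 that in blast)+

text \<open>The boundary of a cycle modulo 2 is even, so the traces left by pushing off are even as
  well. The pushed chain is then itself a cycle in the complement of the diagram and bounds
  there.\<close>

lemma null_S0: "mod2_cycles 1 (subtopology X S0) \<subseteq> mod2_boundaries 1 X"
proof
  fix y assume y: "y \<in> mod2_cycles 1 (subtopology X S0)"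
  then have yc: "singular_chain 1 (subtopology X S0) y" by (simp add: mod2_cycles_def)
  obtain b where b: "chain_boundary 1 y = frag_cmul 2 b" "singular_chain (1 - Suc 0) (subtopology X S0) b"
    by (rule mod2_cycleE[OF y])
  obtain \<delta> where \<delta>: "\<And>x. x \<in> S0 \<Longrightarrow> pathin X (\<delta> x) \<and> \<delta> x 0 = x" "\<And>x. x \<in> S0 \<Longrightarrow> \<exists>W Q P. good \<delta> W Q P \<and> x \<in> W"
    by (rule black_paths) blast
  obtain u d where u: "singular_chain 1 (subtopology X R) u" "\<And>x. 0 < d x" "\<And>x. d x \<le> 1"
    "y - u + frag_extend (\<lambda>\<sigma>. frag_of (path_simplex (\<lambda>t. \<delta> (simplex_point \<sigma>) (t * d (simplex_point \<sigma>)))))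
        (chain_boundary 1 y) \<in> mod2_boundaries 1 X" (is "_ + frag_extend ?f _ \<in> _")
    by (rule push_S0[OF \<delta> yc, of "\<lambda>_. 1"]) auto
  have "singular_chain 1 X (frag_extend ?f b)"
  proof (rule singular_chain_extend)
    fix \<sigma> assume "\<sigma> \<in> Poly_Mapping.keys b"
    then have "singular_simplex 0 (subtopology X S0) \<sigma>" using b(2) by (auto simp: singular_chain_def One_nat_def)
    then obtain x where x: "x \<in> S0" "\<sigma> = point_simplex x" by (auto simp: singular_simplex_0)
    have "pathin X (\<lambda>t. \<delta> x (t * d x))"
    proof (rule continuous_map_real_affine[of "{0..1}" X "\<delta> x"])
      show "continuous_map (top_of_set {0..1}) X (\<delta> x)" using \<delta>(1)[OF x(1)] by (simp add: pathin_def)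
      show "(\<lambda>t. t * d x) ` {0..1} \<subseteq> {0..1}" using u(2,3)[of x] by (auto intro!: mult_le_one simp: less_imp_le)
    qed (intro continuous_intros)
    then show "singular_chain 1 X (?f \<sigma>)" by (simp add: x(2) singular_chain_path)
  qed
  then have "frag_extend ?f (chain_boundary 1 y) \<in> mod2_boundaries 1 X"
    unfolding b(1) frag_extend_double by (rule mod2_even)
  from mod2_diff[OF u(4) this] have yu: "y - u \<in> mod2_boundaries 1 X" by simp
  have "y \<in> mod2_cycles 1 X" using mod2_cycles_mono[of S0 UNIV y 1 X] y by simp
  then have "y - (y - u) \<in> mod2_cycles 1 X" using mod2_cycles_diff subsetD[OF mod2_boundaries_cycles yu] by blast
  then have "u \<in> mod2_cycles 1 X" by simp
  then have "u \<in> mod2_cycles 1 (subtopology X R)" using u(1) by (auto simp: mod2_cycles_def)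
  then have "u \<in> mod2_boundaries 1 X" using R_cycles mod2_boundaries_sub by blast
  from mod2_add[OF yu this] show "y \<in> mod2_boundaries 1 X" by simp
qed

end

section \<open>Loops through a crossing\<close>

lemma join_inj:
  fixes f g :: "real \<Rightarrow> 'a"
  assumes f: "inj_on f {0..1}" and g: "inj_on g {0..1}"
    and fg: "\<And>s t. s \<in> {0..1} \<Longrightarrow> t \<in> {0..1} \<Longrightarrow> f s = g t \<Longrightarrow> s = 1 \<and> t = 0 \<or> s = 0 \<and> t = 1"
    and tu: "0 \<le> t" "t < u" "u \<le> 1"
    and e: "(if t \<le> 1/2 then f (2 * t) else g (2 * t - 1)) = (if u \<le> 1/2 then f (2 * u) else g (2 * u - 1))"
  shows "t = 0 \<and> u = 1 \<and> f 0 = g 1"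
proof -
  consider "u \<le> 1/2" | "t \<le> 1/2" "u > 1/2" | "t > 1/2" by linarith
  then show ?thesis
  proof cases
    case 1
    then have "f (2 * t) = f (2 * u)" using e tu by simp
    then have "2 * t = 2 * u" by (rule inj_onD[OF f]) (use 1 tu in auto)
    then show ?thesis using tu by simp
  next
    case 2
    then have *: "f (2 * t) = g (2 * u - 1)" using e by simp
    have "2 * t = 1 \<and> 2 * u - 1 = 0 \<or> 2 * t = 0 \<and> 2 * u - 1 = 1" by (rule fg[OF _ _ *]) (use 2 tu in auto)
    then show ?thesis using 2 tu * by auto
  next
    case 3
    then have "g (2 * t - 1) = g (2 * u - 1)" using e tu by simp
    then have "2 * t - 1 = 2 * u - 1" by (rule inj_onD[OF g]) (use 3 tu in auto)
    then show ?thesis using tu by simp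
  qed
qed

lemma join_image:
  fixes f g :: "real \<Rightarrow> 'a"
  assumes "f 1 = g 0"
  shows "(\<lambda>t. if t \<le> 1/2 then f (2 * t) else g (2 * t - 1)) ` {0..1} = f ` {0..1} \<union> g ` {0..1}" (is "?j ` _ = _")
proof (intro equalityI subsetI)
  fix y assume "y \<in> ?j ` {0..1}"
  then obtain t where t: "t \<in> {0..1}" "y = ?j t" by blast
  show "y \<in> f ` {0..1} \<union> g ` {0..1}"
  proof (cases "t \<le> 1/2")
    case True
    then have "y = f (2 * t)" "2 * t \<in> {0..1}" using t by auto
    then show ?thesis by blast
  next
    case False
    then have "y = g (2 * t - 1)" "2 * t - 1 \<in> {0..1}" using t by auto
    then show ?thesis by blast
  qed
next
  fix y assume "y \<in> f ` {0..1} \<union> g ` {0..1}"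
  then show "y \<in> ?j ` {0..1}"
  proof
    assume "y \<in> f ` {0..1}"
    then obtain t where t: "t \<in> {0..1}" "y = f t" by blast
    have "y = ?j (t / 2)" using t by simp
    moreover have "t / 2 \<in> {0..1}" using t by simp
    ultimately show ?thesis by (rule image_eqI)
  next
    assume "y \<in> g ` {0..1}"
    then obtain t where t: "t \<in> {0..1}" "y = g t" by blast
    have "(t + 1) / 2 \<le> 1/2 \<longleftrightarrow> t = 0" using t by auto
    then have "y = ?j ((t + 1) / 2)" using t assms by (cases "t = 0") (simp_all add: field_simps)
    moreover have "(t + 1) / 2 \<in> {0..1}" using t by simp
    ultimately show ?thesis by (rule image_eqI)
  qed
qed

text \<open>A homeomorphism of the open unit disc onto the plane that multiplies by positive reals,
  and thereby keeps the signs of both coordinates. It turns a small disc of a chart into the chart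
  onto the plane that \<open>crossing_curve\<close> demands.\<close>

definition to_plane :: "complex \<Rightarrow> complex" where "to_plane z = z / of_real (1 - norm z)"

lemma to_plane:
  assumes "norm z < 1"
  shows "Im (to_plane z) = 0 \<longleftrightarrow> Im z = 0" "Re (to_plane z) \<le> 0 \<longleftrightarrow> Re z \<le> 0" "to_plane z = 0 \<longleftrightarrow> z = 0"
  using assms by (simp_all add: to_plane_def divide_le_0_iff)

lemma to_plane_homeomorphism:
  "homeomorphic_maps (top_of_set (ball 0 1)) euclidean to_plane (\<lambda>y. y / of_real (1 + norm y))"
proof -
  have 1: "norm (y / of_real (1 + norm y)) = norm y / (1 + norm y)" for y :: complex
    unfolding norm_divide norm_of_real by simp
  have 2: "norm (y / of_real (1 + norm y)) < 1" for y :: complex unfolding 1 by (simp add: divide_simps add_pos_nonneg)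
  have 3: "to_plane (y / of_real (1 + norm y)) = y" for y
  proof -
    have p: "1 + norm y > 0" by (simp add: add_pos_nonneg)
    have e: "1 - norm (y / of_real (1 + norm y)) = 1 / (1 + norm y)" unfolding 1 using p by (simp add: field_simps)
    have q: "y / of_real d / of_real (1 / d) = y" if "d \<noteq> 0" for d :: real using that by (simp add: of_real_divide)
    show ?thesis unfolding to_plane_def e by (rule q) (use p in simp)
  qed
  have 4: "to_plane z / of_real (1 + norm (to_plane z)) = z" if "norm z < 1" for z
  proof -
    have "norm (to_plane z) = norm z / (1 - norm z)" using that unfolding to_plane_def norm_divide norm_of_real by simp
    then have "1 + norm (to_plane z) = 1 / (1 - norm z)" using that by (simp add: field_simps)
    moreover have "complex_of_real (1 - norm z) \<noteq> 0" using that unfolding of_real_eq_0_iff by simp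
    ultimately show ?thesis unfolding to_plane_def by (simp del: of_real_diff)
  qed
  have c1: "continuous_on (ball 0 1) to_plane" unfolding to_plane_def
  proof (intro continuous_intros ballI)
    fix z :: complex assume "z \<in> ball 0 1" then show "complex_of_real (1 - norm z) \<noteq> 0" unfolding of_real_eq_0_iff by simp
  qed
  have c2: "continuous_on UNIV (\<lambda>y :: complex. y / of_real (1 + norm y))"
  proof (intro continuous_intros ballI)
    fix y :: complex have "1 + norm y > 0" by (simp add: add_pos_nonneg)
    then show "complex_of_real (1 + norm y) \<noteq> 0" unfolding of_real_eq_0_iff by simp
  qed
  show ?thesis unfolding homeomorphic_maps_def
    using c1 c2 2 3 4 by (auto simp: continuous_map_in_subtopology)
qed

lemma chart_onto_plane:
  assumes ch: "chart X V \<xi>" and r: "r > (0::real)" "ball w r \<subseteq> \<xi> ` V" and a: "norm a = 1"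
  defines "B \<equiv> {p \<in> V. \<xi> p \<in> ball w r}" and "T \<equiv> \<lambda>p. to_plane (a * (\<xi> p - w) / of_real r)"
  shows "chart X B T" "T ` B = UNIV" "\<And>p. p \<in> B \<Longrightarrow> Im (T p) = 0 \<longleftrightarrow> Im (a * (\<xi> p - w)) = 0"
    "\<And>p. p \<in> B \<Longrightarrow> Re (T p) \<le> 0 \<longleftrightarrow> Re (a * (\<xi> p - w)) \<le> 0" "\<And>p. \<xi> p = w \<Longrightarrow> T p = 0"
proof -
  let ?l = "\<lambda>z. a * (z - w) / of_real r"
  have oB: "openin X B" unfolding B_def by (rule openin_chart_preimage[OF ch open_ball])
  have chB: "chart X B \<xi>" by (rule chart_restrict[OF ch oB]) (auto simp: B_def)
  have imB: "\<xi> ` B = ball w r" using r(2) by (auto simp: B_def)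
  have aa: "cnj a * a = 1" "a * cnj a = 1" using a complex_norm_square[of a] by (simp_all add: mult.commute)
  have l1: "norm (?l z) < 1 \<longleftrightarrow> z \<in> ball w r" for z
    using r(1) a by (simp add: norm_divide norm_mult dist_norm norm_minus_commute)
  have hl: "homeomorphic_maps (top_of_set (ball w r)) (top_of_set (ball 0 1)) ?l (\<lambda>y. w + of_real r * (cnj a * y))"
    unfolding homeomorphic_maps_def
  proof (intro conjI ballI)
    show "continuous_map (top_of_set (ball w r)) (top_of_set (ball 0 1)) ?l"
      using l1 r(1) by (auto simp: continuous_map_in_subtopology intro!: continuous_intros)
    have "norm (of_real r * (cnj a * y)) < r" if "norm y < 1" for y using that r(1) a by (simp add: norm_mult)
    then show "continuous_map (top_of_set (ball 0 1)) (top_of_set (ball w r)) (\<lambda>y. w + of_real r * (cnj a * y))"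
      by (auto simp: continuous_map_in_subtopology dist_norm intro!: continuous_intros)
    fix z show "w + of_real r * (cnj a * ?l z) = z" using r(1) aa by (simp flip: mult.assoc)
  next
    fix y show "?l (w + of_real r * (cnj a * y)) = y" using r(1) aa by (simp add: mult.left_commute[of a] flip: mult.assoc)
  qed
  have "homeomorphic_map (top_of_set (ball w r)) euclidean (\<lambda>z. to_plane (?l z))"
    using homeomorphic_maps_compose[OF conjI[OF hl to_plane_homeomorphism]] homeomorphic_maps_imp_map by (fastforce simp: o_def)
  moreover have "homeomorphic_map (subtopology X B) (top_of_set (ball w r)) \<xi>" using chB imB by (simp add: chart_def)
  ultimately have h: "homeomorphic_map (subtopology X B) euclidean T"
    using homeomorphic_map_compose by (fastforce simp: o_def T_def)
  have ts: "topspace (subtopology X B) = B" using openin_subset[OF oB] by auto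
  show im: "T ` B = UNIV" using homeomorphic_imp_surjective_map[OF h] ts by simp
  show "chart X B T" unfolding chart_def im using oB h by simp
  have n1: "norm (?l (\<xi> p)) < 1" if "p \<in> B" for p using that l1 by (simp add: B_def)
  show "Im (T p) = 0 \<longleftrightarrow> Im (a * (\<xi> p - w)) = 0" "Re (T p) \<le> 0 \<longleftrightarrow> Re (a * (\<xi> p - w)) \<le> 0" if "p \<in> B" for p
    unfolding T_def to_plane(1,2)[OF n1[OF that]] using r(1) by (simp_all add: divide_le_0_iff)
  show "T p = 0" if "\<xi> p = w" for p using that by (simp add: T_def to_plane_def)
qed

section \<open>The diagonal through the two black corners, and the faces\<close>

context states begin

text \<open>The line \<open>Im = - Re\<close> in the coordinate \<open>\<psi> c\<close>: positive
  parameters lie in the fourth quadrant, negative ones in the second, so it leads from one black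
  corner through the crossing into the other.\<close>

definition diag :: "'a \<Rightarrow> real \<Rightarrow> 'a" where "diag c s = inv_into (U c) (\<psi> c) (Complex s (- s))"

lemma diag:
  assumes c: "c \<in> C" and s: "\<bar>s\<bar> < 1"
  shows "diag c s \<in> U c" "\<psi> c (diag c s) = Complex s (- s)"
proof -
  have "norm (Complex s (- s)) < 2" using cmod_le[of "Complex s (- s)"] s by simp
  then have "Complex s (- s) \<in> \<psi> c ` U c" unfolding psi(3)[OF c] by simp
  then show "diag c s \<in> U c" "\<psi> c (diag c s) = Complex s (- s)"
    unfolding diag_def using chart_inverse(1,2)[OF psi(2)[OF c]] by auto
qed

lemma diag_eq: "c \<in> C \<Longrightarrow> \<bar>s\<bar> < 1 \<Longrightarrow> \<bar>t\<bar> < 1 \<Longrightarrow> diag c s = diag c t \<longleftrightarrow> s = t"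
  using diag(2) by (metis complex.inject)

lemma diag_of: "c \<in> C \<Longrightarrow> p \<in> U c \<Longrightarrow> \<psi> c p = Complex s (- s) \<Longrightarrow> p = diag c s"
  unfolding diag_def using chart_inverse(3)[OF psi(2)] by metis

lemma diag_0: "c \<in> C \<Longrightarrow> diag c 0 = c"
  using diag_of[of c c 0] psi(4,5) by (simp add: complex_eq_iff)

lemma diag_black: "c \<in> C \<Longrightarrow> 0 < s \<Longrightarrow> s < 1 \<Longrightarrow> diag c s \<in> black c 1"
  "c \<in> C \<Longrightarrow> - 1 < s \<Longrightarrow> s < 0 \<Longrightarrow> diag c s \<in> black c (-1)"
  using diag[of c s] by (auto simp: black_iff)

lemma diag_path:
  assumes c: "c \<in> C" and h: "continuous_on {0..1} h" "\<And>t. t \<in> {0..1} \<Longrightarrow> \<bar>h t\<bar> < 1" "\<And>t. t \<in> {0..1} \<Longrightarrow> diag c (h t) \<in> Z"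
  shows "pathin (subtopology X Z) (\<lambda>t. diag c (h t))"
proof -
  have "pathin X (\<lambda>t. inv_into (U c) (\<psi> c) (Complex (h t) (- h t)))"
  proof (rule continuous_map_real_affine[OF continuous_map_chart_inverse[OF psi(2)[OF c] order_refl]])
    show "continuous_on {0..1} (\<lambda>t. Complex (h t) (- h t))" unfolding Complex_eq by (intro continuous_intros h(1))
    show "(\<lambda>t. Complex (h t) (- h t)) ` {0..1} \<subseteq> \<psi> c ` U c"
      using diag[OF c h(2)] by (metis (no_types, lifting) image_eqI image_subsetI)
  qed
  then show ?thesis using h(3) by (auto simp: pathin_subtopology diag_def)
qed

definition face :: "'a \<Rightarrow> 'a set" where "face q = connected_component_of_set (subtopology X R) q"

lemma face:
  assumes "q \<in> R"
  shows "q \<in> face q" "face q \<subseteq> R" "subtopology X (face q) homeomorphic_space top_of_set (ball (0::complex) 1)"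
proof -
  have ts: "topspace (subtopology X R) = R" by auto
  show "q \<in> face q" using assms by (simp add: face_def connected_component_of_refl)
  show "face q \<subseteq> R" unfolding face_def using connected_component_of_subset_topspace[of "subtopology X R" q] ts by simp
  have "face q \<in> connected_components_of (subtopology X R)"
    unfolding face_def connected_components_of_def ts using assms by blast
  then show "subtopology X (face q) homeomorphic_space top_of_set (ball (0::complex) 1)"
    using red by (auto simp: reduced_diagram_def)
qed

lemma black_face:
  assumes c: "c \<in> C" and q: "q \<in> black c s" shows "black c s \<subseteq> face q"
  unfolding face_def
proof (rule connected_component_of_maximal[OF _ q])
  show "connectedin (subtopology X R) (black c s)"
    using path_connectedin_imp_connectedin[OF black_connected[OF c]] black_R[OF c] by (simp add: connectedin_subtopology)
qed

text \<open>Both halves of the diagonal, up to parameter 1/2, lie in the same face. They are closed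
  in it because the crossing, the only point missing from their closure, is not in the face. The arc
  between them meets the diagonal in its two ends only, so that it closes up to a simple loop
  through \<open>c\<close>.\<close>

lemma arc_in_face:
  assumes c: "c \<in> C" and q: "q \<in> black c 1" "q' \<in> black c (-1)" and same: "q' \<in> face q"
  obtains \<sigma> s1 s2 where "pathin (subtopology X R) \<sigma>" "inj_on \<sigma> {0..1}" "\<sigma> 0 = diag c s1" "\<sigma> 1 = diag c (- s2)"
    "0 < s1" "s1 \<le> 1/2" "0 < s2" "s2 \<le> 1/2" "\<And>t s. 0 < t \<Longrightarrow> t < 1 \<Longrightarrow> \<bar>s\<bar> \<le> 1/2 \<Longrightarrow> \<sigma> t \<noteq> diag c s"
proof -
  have qR: "q \<in> R" using q black_R[OF c] by blast
  note F = face[OF qR]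
  have "face q' = face q"
    using same unfolding face_def by (metis connected_component_of_equiv mem_Collect_eq)
  then have bl: "black c 1 \<subseteq> face q" "black c (-1) \<subseteq> face q" using black_face[OF c] q by blast+
  have cF: "c \<notin> face q" using F(2) c C_sub_D by blast
  define A where "A = diag c ` {0<..1/2}"
  define B where "B = diag c ` {-1/2..<0}"
  \<comment> \<open>Over a compact parameter set the diagonal is closed in \<open>X\<close>;
    intersecting it with the face removes just the parameter 0.\<close>
  have clos: "closedin (subtopology X (face q)) (diag c ` (I - {0}))"
    if I: "compact I" "I \<subseteq> {-1/2..1/2}" for I
  proof -
    let ?Z = "(\<lambda>s. Complex s (- s)) ` I"
    have cZ: "compact ?Z" unfolding Complex_eq by (intro compact_continuous_image continuous_intros I)
    have sZ: "?Z \<subseteq> \<psi> c ` U c"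
    proof
      fix z assume "z \<in> ?Z"
      then obtain s where s: "s \<in> I" "z = Complex s (- s)" by blast
      have "s \<in> {-1/2..1/2}" using s I(2) by blast
      then have "\<bar>s\<bar> \<le> 1/2" by auto
      then have "norm z < 2" using cmod_le[of z] s(2) by simp
      then show "z \<in> \<psi> c ` U c" unfolding psi(3)[OF c] by simp
    qed
    have cl: "closedin X {p \<in> U c. \<psi> c p \<in> ?Z}" by (rule closedin_chart_preimage[OF psi(2)[OF c] Hd cZ sZ])
    have "diag c ` (I - {0}) = {p \<in> U c. \<psi> c p \<in> ?Z} \<inter> face q"
    proof (intro equalityI subsetI)
      fix p assume "p \<in> diag c ` (I - {0})"
      then obtain s where s: "s \<in> I" "s \<noteq> 0" "p = diag c s" by blast
      then have "s \<in> {-1/2..1/2}" using I(2) by blast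
      then have s1: "\<bar>s\<bar> < 1" by auto
      then have "p \<in> face q" using diag_black[OF c, of s] bl s s1 by (cases "s > 0") auto
      then show "p \<in> {p \<in> U c. \<psi> c p \<in> ?Z} \<inter> face q" using diag[OF c s1] s by auto
    next
      fix p assume p: "p \<in> {p \<in> U c. \<psi> c p \<in> ?Z} \<inter> face q"
      then obtain s where s: "s \<in> I" "\<psi> c p = Complex s (- s)" by blast
      have "p = diag c s" by (rule diag_of[OF c _ s(2)]) (use p in blast)
      moreover have "s \<noteq> 0" using cF p calculation diag_0[OF c] by auto
      ultimately show "p \<in> diag c ` (I - {0})" using s by blast
    qed
    then show ?thesis unfolding closedin_subtopology using cl by blast
  qed
  have "{0<..1/2} = {0..1/2} - {0::real}" "{-1/2..<0} = {-1/2..0} - {0::real}" by auto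
  then have cA: "closedin (subtopology X (face q)) A" and cB: "closedin (subtopology X (face q)) B"
    unfolding A_def B_def using clos[of "{0..1/2}"] clos[of "{-1/2..0}"] by auto
  have AB: "A \<inter> B = {}"
  proof -
    have "diag c s \<noteq> diag c t" if "s \<in> {0<..1/2}" "t \<in> {-1/2..<0}" for s t
      using diag_eq[OF c, of s t] that by auto
    then show ?thesis unfolding A_def B_def by blast
  qed
  have ne: "A \<noteq> {}" "B \<noteq> {}" by (auto simp: A_def B_def)
  have FX: "face q \<subseteq> topspace X" using F(2) by blast
  obtain \<sigma> where \<sigma>: "pathin (subtopology X (face q)) \<sigma>" "inj_on \<sigma> {0..1}" "\<sigma> 0 \<in> A" "\<sigma> 1 \<in> B"
    "\<And>t. 0 < t \<Longrightarrow> t < 1 \<Longrightarrow> \<sigma> t \<notin> A \<union> B"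
    by (rule arc_between[OF F(3) FX cA ne(1) cB ne(2) AB]) blast
  obtain s1 where s1: "\<sigma> 0 = diag c s1" "0 < s1" "s1 \<le> 1/2" using \<sigma>(3) by (auto simp: A_def)
  obtain s2 where s2: "\<sigma> 1 = diag c s2" "s2 < 0" "-1/2 \<le> s2" using \<sigma>(4) by (auto simp: B_def)
  have \<sigma>F: "\<sigma> t \<in> face q" if "t \<in> {0..1}" for t using \<sigma>(1) that by (auto simp: pathin_subtopology)
  show thesis
  proof (rule that[of \<sigma> s1 "- s2"])
    show "pathin (subtopology X R) \<sigma>" using \<sigma>(1) F(2) by (auto simp: pathin_subtopology)
    show "\<sigma> t \<noteq> diag c s" if "0 < t" "t < 1" "\<bar>s\<bar> \<le> 1/2" for t s
    proof
      assume e: "\<sigma> t = diag c s"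
      have "s \<noteq> 0" using e cF \<sigma>F[of t] that diag_0[OF c] by auto
      then have "\<sigma> t \<in> A \<union> B" unfolding e A_def B_def using that(3) by (cases "s > 0") auto
      then show False using \<sigma>(5)[OF that(1,2)] by blast
    qed
  qed (use \<sigma> s1 s2 in auto)
qed

end

section \<open>A nugatory curve from black corners joined by a bounding chain\<close>

context states begin

definition seg :: "'a \<Rightarrow> real \<Rightarrow> real \<Rightarrow> 'a chain" where
  "seg c a b = frag_of (path_simplex (\<lambda>t. diag c (a + (b - a) * t)))"

lemma seg_between:
  assumes "a \<le> b" "t \<in> {0..1::real}" shows "a \<le> a + (b - a) * t" "a + (b - a) * t \<le> b"
proof -
  show "a \<le> a + (b - a) * t" using assms by simp
  have "(b - a) * t \<le> b - a" using assms by (simp add: mult_left_le)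
  then show "a + (b - a) * t \<le> b" by simp
qed

lemma seg_pathin:
  assumes c: "c \<in> C" and ab: "- 1 < a" "a \<le> b" "b < 1" and Z: "\<And>s. a \<le> s \<Longrightarrow> s \<le> b \<Longrightarrow> diag c s \<in> Z"
  shows "pathin (subtopology X Z) (\<lambda>t. diag c (a + (b - a) * t))"
proof (rule diag_path[OF c])
  show "continuous_on {0..1} (\<lambda>t. a + (b - a) * t)" by (intro continuous_intros)
  fix t :: real assume t: "t \<in> {0..1}"
  note i = seg_between[OF ab(2) t]
  show "\<bar>a + (b - a) * t\<bar> < 1" using i ab by (simp add: abs_less_iff)
  show "diag c (a + (b - a) * t) \<in> Z" by (rule Z[OF i])
qed

lemma seg_chain:
  assumes "c \<in> C" "- 1 < a" "a \<le> b" "b < 1" "\<And>s. a \<le> s \<Longrightarrow> s \<le> b \<Longrightarrow> diag c s \<in> Z"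
  shows "singular_chain 1 (subtopology X Z) (seg c a b)"
  unfolding seg_def singular_chain_path by (rule seg_pathin[OF assms])

lemma seg_boundary: "chain_boundary 1 (seg c a b) = frag_of (point_simplex (diag c b)) - frag_of (point_simplex (diag c a))"
  by (simp add: seg_def chain_boundary_path)

lemma connecting_chain:
  assumes P: "path_connectedin X P" "p \<in> P" "q \<in> P"
  obtains \<eta> where "singular_chain 1 (subtopology X P) \<eta>"
    "chain_boundary 1 \<eta> = frag_of (point_simplex q) - frag_of (point_simplex p)"
proof -
  have PX: "P \<subseteq> topspace X" "path_connected_space (subtopology X P)" using P(1) by (auto simp: path_connectedin_def)
  then obtain g where g: "pathin (subtopology X P) g" "g 0 = p" "g 1 = q"
    using P(2,3) unfolding path_connected_space_def by (metis topspace_subtopology_subset)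
  show thesis using that[of "frag_of (path_simplex g)"] g by (simp add: singular_chain_path chain_boundary_path)
qed

text \<open>The chain \<open>u\<close> off the diagram joins the two black corners modulo 2, so
  these lie in one face and a loop through \<open>c\<close> inside this face exists. The loop is
  homologous to \<open>x + u\<close> modulo 2: its part near \<open>c\<close> and \<open>x\<close>
  differ by a cycle in the disc \<open>U c\<close>, its part in the face and \<open>u\<close> by a
  cycle off the diagram. Hence it bounds and separates.\<close>

lemma nugatory_of_black_chains:
  assumes c: "c \<in> C" and q: "q \<in> black c 1" "q' \<in> black c (-1)"
    and x: "singular_chain 1 (subtopology X (U c)) x" and u: "singular_chain 1 (subtopology X R) u"
    and bx: "chain_boundary 1 x = frag_of (point_simplex q) + frag_of (point_simplex q') + frag_cmul 2 w"
    and xu: "x + u \<in> mod2_boundaries 1 X"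
  shows "nugatory X \<A> n L c"
proof -
  let ?p = "\<lambda>s. frag_of (point_simplex (diag c s))" and ?q = "frag_of (point_simplex q)" and ?q' = "frag_of (point_simplex q')"
  obtain b where b: "chain_boundary 1 (x + u) = frag_cmul 2 b"
    using subsetD[OF mod2_boundaries_cycles xu] by (auto simp: mod2_cycles_def)
  have bu: "chain_boundary 1 u = ?q + ?q' + frag_cmul 2 (b - w - ?q - ?q')"
  proof -
    have "chain_boundary 1 u = frag_cmul 2 b - chain_boundary 1 x" using b by (simp add: chain_boundary_add algebra_simps)
    then show ?thesis unfolding bx by (simp add: frag_cmul_2)
  qed
  have qR: "q \<in> topspace (subtopology X R)" using q(1) black_R[OF c] by auto
  have same: "q' \<in> face q" using chain_ends_same_component[OF u bu qR] by (simp add: face_def)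
  obtain \<sigma> s1 s2 where \<sigma>: "pathin (subtopology X R) \<sigma>" "inj_on \<sigma> {0..1}" "\<sigma> 0 = diag c s1" "\<sigma> 1 = diag c (- s2)"
    and s: "0 < s1" "s1 \<le> 1/2" "0 < s2" "s2 \<le> 1/2" and avoid: "\<And>t s. 0 < t \<Longrightarrow> t < 1 \<Longrightarrow> \<bar>s\<bar> \<le> 1/2 \<Longrightarrow> \<sigma> t \<noteq> diag c s"
    by (rule arc_in_face[OF c q same]) blast
  have \<sigma>R: "\<sigma> t \<in> R" if "t \<in> {0..1}" for t using \<sigma>(1) that by (auto simp: pathin_subtopology)
  have hit: "t = 0 \<and> r = s1 \<or> t = 1 \<and> r = - s2" if "\<sigma> t = diag c r" "t \<in> {0..1}" "\<bar>r\<bar> \<le> 1/2" for t r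
  proof -
    consider "t = 0" | "t = 1" | "0 < t" "t < 1" using \<open>t \<in> {0..1}\<close> by fastforce
    then show ?thesis
    proof cases
      case 1 then show ?thesis using that \<sigma>(3) diag_eq[OF c, of s1 r] s by auto
    next
      case 2 then show ?thesis using that \<sigma>(4) diag_eq[OF c, of "- s2" r] s by auto
    next
      case 3 then show ?thesis using avoid that by blast
    qed
  qed
  \<comment> \<open>The loop \<open>\<beta>\<close> leaves \<open>c\<close> along the diagonal by
    \<open>f\<close> until time 1/2, follows the arc \<sigma> until 3/4 and returns along the other
    half of the diagonal by \<open>h\<close>.\<close>
  define f where "f t = diag c (0 + (s1 - 0) * t)" for t
  define h where "h t = diag c (- s2 + (0 - - s2) * t)" for t
  define g where "g t = (if t \<le> 1/2 then \<sigma> (2 * t) else h (2 * t - 1))" for t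
  define \<beta> where "\<beta> t = (if t \<le> 1/2 then f (2 * t) else g (2 * t - 1))" for t
  have dX: "diag c r \<in> topspace X" if "\<bar>r\<bar> < 1" for r using diag(1)[OF c that] U_top[OF c] by blast
  have fp: "pathin X f" and hp: "pathin X h"
    unfolding f_def[abs_def] h_def[abs_def] using seg_pathin[OF c, of 0 s1 UNIV] seg_pathin[OF c, of "- s2" 0 UNIV] s by auto
  have ends: "f 0 = c" "f 1 = \<sigma> 0" "\<sigma> 1 = h 0" "h 1 = c" using \<sigma>(3,4) diag_0[OF c] by (simp_all add: f_def h_def)
  have gp: "pathin X g" unfolding g_def[abs_def]
    by (rule pathin_join[where f = \<sigma> and g = h, OF _ hp ends(3)]) (use \<sigma>(1) in \<open>simp add: pathin_subtopology\<close>)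
  have g01: "g 0 = \<sigma> 0" "g 1 = c" using ends by (simp_all add: g_def)
  have \<beta>p: "pathin X \<beta>" unfolding \<beta>_def[abs_def] by (rule pathin_join[where f = f and g = g, OF fp gp]) (simp add: ends g01)
  have \<beta>01: "\<beta> 0 = c" "\<beta> 1 = c" using ends g01 by (simp_all add: \<beta>_def)
  have hin: "- s2 \<le> - s2 + s2 * t \<and> - s2 + s2 * t \<le> 0" if "t \<in> {0..1}" for t using seg_between[of "- s2" 0 t] that s by simp
  have fin: "0 \<le> s1 * t \<and> s1 * t \<le> s1" if "t \<in> {0..1}" for t using seg_between[of 0 s1 t] that s by simp
  have flt: "\<bar>s1 * t\<bar> \<le> 1/2" if "t \<in> {0..1}" for t using fin[OF that] s by linarith
  have hlt: "\<bar>- s2 + s2 * t\<bar> \<le> 1/2" if "t \<in> {0..1}" for t using hin[OF that] s by linarith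
  have fi: "inj_on f {0..1}"
  proof (rule inj_onI)
    fix t t' :: real assume t: "t \<in> {0..1}" "t' \<in> {0..1}" "f t = f t'"
    then have "s1 * t = s1 * t'" using diag_eq[OF c, of "s1 * t" "s1 * t'"] flt[of t] flt[of t']
      by (simp add: f_def)
    then show "t = t'" using s by simp
  qed
  have hi: "inj_on h {0..1}"
  proof (rule inj_onI)
    fix t t' :: real assume t: "t \<in> {0..1}" "t' \<in> {0..1}" "h t = h t'"
    then have "- s2 + s2 * t = - s2 + s2 * t'" using diag_eq[OF c, of "- s2 + s2 * t" "- s2 + s2 * t'"] hlt[of t] hlt[of t']
      by (simp add: h_def)
    then show "t = t'" using s by simp
  qed
  have \<sigma>h: "a = 1 \<and> t = 0" if at: "a \<in> {0..1}" "t \<in> {0..1}" "\<sigma> a = h t" for a t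
  proof -
    have e: "\<sigma> a = diag c (- s2 + s2 * t)" using at(3) by (simp add: h_def)
    have d: "a = 0 \<and> - s2 + s2 * t = s1 \<or> a = 1 \<and> - s2 + s2 * t = - s2"
      by (rule hit[OF e at(1)]) (use hlt[OF at(2)] in auto)
    have "- s2 + s2 * t \<noteq> s1" using hin[OF at(2)] s by linarith
    then have "a = 1" "- s2 + s2 * t = - s2" using d by blast+
    then show ?thesis using s by simp
  qed
  have \<sigma>h': "\<And>s t. s \<in> {0..1} \<Longrightarrow> t \<in> {0..1} \<Longrightarrow> \<sigma> s = h t \<Longrightarrow> s = 1 \<and> t = 0 \<or> s = 0 \<and> t = 1"
    using \<sigma>h by blast
  have gi: "inj_on g {0..1}"
  proof (rule linorder_inj_onI)
    fix t t' :: real assume t: "t < t'" "t \<in> {0..1}" "t' \<in> {0..1}"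
    show "g t \<noteq> g t'"
    proof
      assume e: "g t = g t'"
      have "t = 0 \<and> t' = 1 \<and> \<sigma> 0 = h 1"
        by (rule join_inj[where f = \<sigma> and g = h, OF \<sigma>(2) hi \<sigma>h' _ t(1) _ e[unfolded g_def]]) (use t in auto)
      then have "\<sigma> 0 = h 1" by blast
      from \<sigma>h[OF _ _ this] show False by simp
    qed
  qed auto
  have fg: "a = 1 \<and> t = 0 \<or> a = 0 \<and> t = 1" if at: "a \<in> {0..1}" "t \<in> {0..1}" "f a = g t" for a t
  proof (cases "t \<le> 1/2")
    case True
    then have e: "\<sigma> (2 * t) = diag c (s1 * a)" using at(3) by (simp add: g_def f_def)
    have "2 * t = 0 \<and> s1 * a = s1 \<or> 2 * t = 1 \<and> s1 * a = - s2"
      by (rule hit[OF e]) (use flt[OF at(1)] True at(2) in auto)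
    then show ?thesis using fin[OF at(1)] s by auto
  next
    case False
    let ?t = "2 * t - 1"
    have t': "?t \<in> {0..1}" using False at(2) by auto
    have "diag c (s1 * a) = diag c (- s2 + s2 * ?t)" using at(3) False by (simp add: g_def f_def h_def)
    then have "s1 * a = - s2 + s2 * ?t" using diag_eq[OF c, of "s1 * a" "- s2 + s2 * ?t"] flt[OF at(1)] hlt[OF t'] by simp
    then have "s1 * a = 0" "- s2 + s2 * ?t = 0" using fin[OF at(1)] hin[OF t'] by auto
    moreover have "- s2 + s2 * ?t = s2 * (?t - 1)" by (simp add: algebra_simps)
    ultimately show ?thesis using s by simp
  qed
  have \<beta>i: "inj_on \<beta> {0..<1}"
  proof (rule linorder_inj_onI)
    fix t t' :: real assume t: "t < t'" "t \<in> {0..<1}" "t' \<in> {0..<1}"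
    show "\<beta> t \<noteq> \<beta> t'"
    proof
      assume e: "\<beta> t = \<beta> t'"
      have "t = 0 \<and> t' = 1 \<and> f 0 = g 1"
        by (rule join_inj[where f = f and g = g, OF fi gi fg _ t(1) _ e[unfolded \<beta>_def]]) (use t in auto)
      then show False using t by simp
    qed
  qed auto
  define K where "K = \<beta> ` {0..1}"
  have K1: "K = f ` {0..1} \<union> (\<sigma> ` {0..1} \<union> h ` {0..1})"
  proof -
    have 1: "K = f ` {0..1} \<union> g ` {0..1}" unfolding K_def \<beta>_def[abs_def] by (rule join_image) (simp add: ends g01)
    have 2: "g ` {0..1} = \<sigma> ` {0..1} \<union> h ` {0..1}" unfolding g_def[abs_def] by (rule join_image) (rule ends(3))
    show ?thesis unfolding 1 2 ..
  qed
  have KE: "p \<in> K \<longleftrightarrow> (\<exists>r. - s2 \<le> r \<and> r \<le> s1 \<and> p = diag c r) \<or> p \<in> \<sigma> ` {0..1}" for p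
  proof -
    have "p \<in> f ` {0..1} \<longleftrightarrow> (\<exists>r. 0 \<le> r \<and> r \<le> s1 \<and> p = diag c r)"
    proof
      assume "\<exists>r. 0 \<le> r \<and> r \<le> s1 \<and> p = diag c r"
      then obtain r where r: "0 \<le> r" "r \<le> s1" "p = diag c r" by blast
      then show "p \<in> f ` {0..1}" using s(1) by (intro image_eqI[of _ _ "r / s1"]) (auto simp: f_def)
    qed (use fin in \<open>fastforce simp: f_def\<close>)
    moreover have "p \<in> h ` {0..1} \<longleftrightarrow> (\<exists>r. - s2 \<le> r \<and> r \<le> 0 \<and> p = diag c r)"
    proof
      assume "\<exists>r. - s2 \<le> r \<and> r \<le> 0 \<and> p = diag c r"
      then obtain r where r: "- s2 \<le> r" "r \<le> 0" "p = diag c r" by blast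
      then show "p \<in> h ` {0..1}" using s(3) by (intro image_eqI[of _ _ "(r + s2) / s2"]) (auto simp: h_def)
    qed (use hin in \<open>fastforce simp: h_def\<close>)
    moreover have "(\<exists>r. - s2 \<le> r \<and> r \<le> s1 \<and> p = diag c r) \<longleftrightarrow>
        (\<exists>r. 0 \<le> r \<and> r \<le> s1 \<and> p = diag c r) \<or> (\<exists>r. - s2 \<le> r \<and> r \<le> 0 \<and> p = diag c r)"
    proof (intro iffI; elim disjE exE conjE)
      fix r assume r: "- s2 \<le> r" "r \<le> s1" "p = diag c r"
      show "(\<exists>r. 0 \<le> r \<and> r \<le> s1 \<and> p = diag c r) \<or> (\<exists>r. - s2 \<le> r \<and> r \<le> 0 \<and> p = diag c r)"
        using r by (cases "0 \<le> r") auto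
    next
      fix r assume "0 \<le> r" "r \<le> s1" "p = diag c r"
      then show "\<exists>r. - s2 \<le> r \<and> r \<le> s1 \<and> p = diag c r" using s by (intro exI[of _ r]) auto
    next
      fix r assume "- s2 \<le> r" "r \<le> 0" "p = diag c r"
      then show "\<exists>r. - s2 \<le> r \<and> r \<le> s1 \<and> p = diag c r" using s by (intro exI[of _ r]) auto
    qed
    ultimately show ?thesis unfolding K1 by blast
  qed
  have dR: "diag c r \<in> R" if "r \<noteq> 0" "\<bar>r\<bar> < 1" for r
    using diag_black[OF c, of r] black_R[OF c] that by (cases "r > 0") auto
  have KD: "K \<inter> D = {c}"
  proof -
    have "p = c" if pk: "p \<in> K" "p \<in> D" for p
    proof -
      have "p \<notin> \<sigma> ` {0..1}" using \<sigma>R pk(2) by blast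
      then obtain r where r: "- s2 \<le> r" "r \<le> s1" "p = diag c r" using pk(1) KE by blast
      have "r = 0" using dR[of r] pk(2) r s by (cases "r = 0") auto
      then show ?thesis using r diag_0[OF c] by simp
    qed
    moreover have "c \<in> K" using \<beta>01(1) unfolding K_def by force
    ultimately show ?thesis using c C_sub_D by blast
  qed
  have clK: "closedin X K" and cl\<sigma>: "closedin X (\<sigma> ` {0..1})"
  proof -
    have *: "closedin X (k ` {0..1})" if "pathin X k" for k
    proof -
      have "compactin (top_of_set {0..1}) {0..1::real}" by (simp add: compactin_subtopology)
      then have "compactin X (k ` {0..1})" using image_compactin that unfolding pathin_def by blast
      then show ?thesis using Hd compactin_imp_closedin by blast
    qed
    show "closedin X K" unfolding K_def by (rule *[OF \<beta>p])
    show "closedin X (\<sigma> ` {0..1})" by (rule *) (use \<sigma>(1) in \<open>simp add: pathin_subtopology\<close>)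
  qed
  \<comment> \<open>The separation criterion is applied at the middle of the outgoing diagonal
    piece, away from both the crossing and the arc in the face.\<close>
  define s0 where "s0 = s1 / 2"
  have s0: "0 < s0" "s0 < s1" "s0 \<le> 1/4" using s by (auto simp: s0_def)
  define m where "m = diag c s0"
  define m0 where "m0 = Complex s0 (- s0)"
  have m: "m \<in> U c" "\<psi> c m = m0" unfolding m_def m0_def using diag[OF c, of s0] s0 by auto
  have m\<sigma>: "m \<notin> \<sigma> ` {0..1}"
  proof
    assume "m \<in> \<sigma> ` {0..1}"
    then obtain t where t: "t \<in> {0..1}" "\<sigma> t = diag c s0" by (auto simp: m_def)
    show False using hit[OF t(2,1)] s0 s by auto
  qed
  have "open (\<psi> c ` (U c - \<sigma> ` {0..1}))"
    by (rule chart_facts(4)[OF psi(2)[OF c]]) (use psi(6)[OF c] cl\<sigma> in auto)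
  moreover have "m0 \<in> \<psi> c ` (U c - \<sigma> ` {0..1})" using m m\<sigma> by (metis DiffI image_eqI)
  ultimately obtain r0 where r0: "r0 > 0" "ball m0 r0 \<subseteq> \<psi> c ` (U c - \<sigma> ` {0..1})" by (rule openE)
  \<comment> \<open>At most \<open>r0\<close>, so that the disc misses the arc; at most
    \<open>s0\<close>, so that the diagonal inside it has parameters between 0 and \<open>s1\<close>
    and belongs to the loop.\<close>
  define r where "r = min r0 s0"
  have r: "r > 0" "r \<le> s0" "ball m0 r \<subseteq> \<psi> c ` U c" using r0 s0 by (auto simp: r_def)
  define B where "B = {p \<in> U c. \<psi> c p \<in> ball m0 r}"
  have B\<sigma>: "p \<notin> \<sigma> ` {0..1}" if "p \<in> B" for p
  proof -
    have "\<psi> c p \<in> \<psi> c ` (U c - \<sigma> ` {0..1})" using that r0(2) by (auto simp: B_def r_def)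
    then obtain p' where p': "p' \<in> U c - \<sigma> ` {0..1}" "\<psi> c p = \<psi> c p'" by blast
    then have "p = p'" using chart_facts(1)[OF psi(2)[OF c]] that by (auto simp: B_def dest: inj_onD)
    then show ?thesis using p' by blast
  qed
  \<comment> \<open>The turn by pi/4, which brings the diagonal to the real axis.\<close>
  define a where "a = Complex (1 / sqrt 2) (1 / sqrt 2)"
  have a: "norm a = 1" by (simp add: a_def cmod_def power_divide)
  define T where "T p = to_plane (a * (\<psi> c p - m0) / of_real r)" for p
  have aIm: "Im (a * (z - m0)) = (Re z + Im z) / sqrt 2" and aRe: "Re (a * (z - m0)) = (Re z - Im z - 2 * s0) / sqrt 2" for z
    by (simp_all add: a_def m0_def field_simps)
  note T = chart_onto_plane[OF psi(2)[OF c] r(1,3) a, folded B_def T_def]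
  have TIm: "Im (T p) = 0 \<longleftrightarrow> Re (\<psi> c p) + Im (\<psi> c p) = 0" if "p \<in> B" for p
    using T(3)[OF that] unfolding aIm by simp
  have TRe: "Re (T p) \<le> 0 \<longleftrightarrow> Re (\<psi> c p) - Im (\<psi> c p) \<le> 2 * s0" if "p \<in> B" for p
    using T(4)[OF that] unfolding aRe by (simp add: divide_le_0_iff)
  have KB: "p \<in> K \<longleftrightarrow> Im (T p) = 0" if p: "p \<in> B" for p
    unfolding TIm[OF p]
  proof
    assume "p \<in> K"
    then obtain t where t: "- s2 \<le> t" "t \<le> s1" "p = diag c t" using KE B\<sigma>[OF p] by blast
    then show "Re (\<psi> c p) + Im (\<psi> c p) = 0" using diag(2)[OF c, of t] s by simp
  next
    assume z: "Re (\<psi> c p) + Im (\<psi> c p) = 0"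
    define t where "t = Re (\<psi> c p)"
    have "\<psi> c p = Complex t (- t)" using z by (simp add: t_def complex_eq_iff)
    then have pd: "p = diag c t" using diag_of[OF c] p by (simp add: B_def)
    have "\<bar>t - s0\<bar> \<le> norm (\<psi> c p - m0)" using abs_Re_le_cmod[of "\<psi> c p - m0"] by (simp add: t_def m0_def)
    also have "\<dots> < r" using p by (simp add: B_def dist_norm norm_minus_commute)
    finally have "- s2 \<le> t" "t \<le> s1" using r(2) s by (auto simp: s0_def)
    then show "p \<in> K" using KE pd by blast
  qed
  define e where "e = r / 4"
  have e: "0 < e" "e < s0" "2 * e < r" using r by (auto simp: e_def)
  have near: "diag c t \<in> B" if "\<bar>t - s0\<bar> \<le> e" for t
  proof -
    have "\<bar>t\<bar> < 1" using that e s0 by linarith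
    then have d: "diag c t \<in> U c" "\<psi> c (diag c t) = Complex t (- t)" by (rule diag[OF c])+
    have "norm (\<psi> c (diag c t) - m0) \<le> \<bar>t - s0\<bar> + \<bar>- t + s0\<bar>"
      using cmod_le[of "\<psi> c (diag c t) - m0"] d(2) by (simp add: m0_def)
    also have "\<dots> < r" using that e by linarith
    finally show ?thesis using d(1) by (simp add: B_def dist_norm norm_minus_commute)
  qed
  let ?g = "\<lambda>t. diag c ((s0 - e) + ((s0 + e) - (s0 - e)) * t)"
  define \<sigma>c where "\<sigma>c = frag_of (path_simplex \<sigma>)"
  \<comment> \<open>The loop without the small piece about \<open>m\<close>: the outgoing diagonal
    beyond it, the arc in the face, and the diagonal from its other end through the crossing up to
    the small piece.\<close>
  define v where "v = seg c (s0 + e) s1 + \<sigma>c + seg c (- s2) (s0 - e)"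
  have dK: "diag c t \<in> K" if "- s2 \<le> t" "t \<le> s1" for t using KE that by blast
  have dm: "diag c t \<noteq> m" if "t \<noteq> s0" "\<bar>t\<bar> < 1" for t unfolding m_def using diag_eq[OF c, of t s0] that s0 by simp
  have esum: "s0 + e < s1" using e by (simp add: s0_def)
  have vK: "singular_chain 1 (subtopology X (K - {m})) v"
    unfolding v_def
  proof (intro singular_chain_add)
    show "singular_chain 1 (subtopology X (K - {m})) (seg c (s0 + e) s1)"
      by (rule seg_chain[OF c]) (use s s0 e esum dK dm in auto)
    show "singular_chain 1 (subtopology X (K - {m})) (seg c (- s2) (s0 - e))"
      by (rule seg_chain[OF c]) (use s s0 e esum dK dm in auto)
    show "singular_chain 1 (subtopology X (K - {m})) \<sigma>c"
      unfolding \<sigma>c_def singular_chain_path using \<sigma>(1) m\<sigma> KE by (auto simp: pathin_subtopology)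
  qed
  obtain p1 p2 where p12: "p1 \<in> B" "T p1 = pole" "p2 \<in> B" "T p2 = - pole" using T(2) by (metis UNIV_I imageE)
  have gKB: "pathin (subtopology X (K \<inter> B)) ?g"
    by (rule seg_pathin[OF c]) (use s s0 e esum dK near in auto)
  have curve: "crossing_curve X K B T ?g v m p1 p2"
  proof
    show "Hausdorff_space X" by (rule Hd)
    show "\<exists>V \<zeta>. chart X V (\<zeta> :: 'a \<Rightarrow> complex) \<and> p \<in> V" if "p \<in> topspace X" for p using charts[OF that] atlas by blast
    show "(Re (T (?g 0)) \<le> 0) \<noteq> (Re (T (?g 1)) \<le> 0)"
      using TRe[OF near[of "s0 - e"]] TRe[OF near[of "s0 + e"]] e s0 esum s
        diag(2)[OF c, of "s0 - e"] diag(2)[OF c, of "s0 + e"] by (simp add: add.commute[of e s0])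
    show "m \<in> B" using near[of s0] e by (simp add: m_def)
    show "T m = 0" by (rule T(5)[OF m(2)])
  qed (use clK T(1,2) KB gKB vK p12 in auto)
  have z: "crossing_curve.z ?g v = seg c (s0 - e) (s0 + e) + v"
    unfolding crossing_curve.z_def[OF curve] seg_def ..
  obtain \<eta> where \<eta>: "singular_chain 1 (subtopology X (black c 1)) \<eta>" "chain_boundary 1 \<eta> = ?p s1 - ?q"
    by (rule connecting_chain[OF black_connected[OF c] q(1) diag_black(1)[OF c, of s1]]) (use s in auto)
  obtain \<eta>' where \<eta>': "singular_chain 1 (subtopology X (black c (-1))) \<eta>'" "chain_boundary 1 \<eta>' = ?p (- s2) - ?q'"
    by (rule connecting_chain[OF black_connected[OF c] q(2) diag_black(2)[OF c, of "- s2"]]) (use s in auto)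
  have bU: "black c t \<subseteq> U c" for t by (auto simp: black_iff[OF c])
  define Y where "Y = seg c (s0 - e) (s0 + e) + seg c (s0 + e) s1 + seg c (- s2) (s0 - e)"
  \<comment> \<open>All diagonal pieces together with \<open>x\<close> and the connections
    \<open>\<eta>\<close>, \<open>\<eta>'\<close> in the black corners close up modulo 2 in the disc
    \<open>U c\<close>.\<close>
  have 1: "Y + x + \<eta> + \<eta>' \<in> mod2_boundaries 1 X"
  proof -
    have "singular_chain 1 (subtopology X (U c)) (Y + x + \<eta> + \<eta>')"
      unfolding Y_def
      by (intro singular_chain_add x singular_chain_mono[OF \<eta>(1) bU] singular_chain_mono[OF \<eta>'(1) bU] seg_chain[OF c] diag(1)[OF c])
         (use s s0 e esum in auto)
    moreover have "chain_boundary 1 (Y + x + \<eta> + \<eta>') = frag_cmul 2 (?p s1 + w)"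
      unfolding Y_def by (simp add: chain_boundary_add seg_boundary bx \<eta>(2) \<eta>'(2) frag_cmul_2)
    ultimately have "Y + x + \<eta> + \<eta>' \<in> mod2_cycles 1 (subtopology X (U c))" by (auto simp: mod2_cycles_def)
    moreover have "contractible_space (subtopology X (U c))"
    proof -
      have "{p \<in> U c. \<psi> c p \<in> ball 0 2} = U c" using psi(9)[OF c] by auto
      then show ?thesis using chart_convex(1)[OF psi(2)[OF c] convex_ball, of 0 2] psi(3)[OF c] by simp
    qed
    ultimately show ?thesis using mod2_cycles_contractible mod2_boundaries_sub by blast
  qed
  \<comment> \<open>The same connections close up the arc and \<open>u\<close> off the diagram; in
    the sum of both relations they occur twice.\<close>
  have 2: "\<sigma>c + u + \<eta> + \<eta>' \<in> mod2_boundaries 1 X"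
  proof -
    have "singular_chain 1 (subtopology X R) (\<sigma>c + u + \<eta> + \<eta>')"
      by (intro singular_chain_add u singular_chain_mono[OF \<eta>(1) black_R[OF c]] singular_chain_mono[OF \<eta>'(1) black_R[OF c]])
         (simp add: \<sigma>c_def singular_chain_path \<sigma>(1))
    moreover have "chain_boundary 1 (\<sigma>c + u + \<eta> + \<eta>') = frag_cmul 2 (?p (- s2) + (b - w - ?q - ?q'))"
      by (simp add: chain_boundary_add \<sigma>c_def chain_boundary_path \<sigma>(3,4) bu \<eta>(2) \<eta>'(2) frag_cmul_2)
    ultimately have "\<sigma>c + u + \<eta> + \<eta>' \<in> mod2_cycles 1 (subtopology X R)" by (auto simp: mod2_cycles_def)
    then show ?thesis using R_cycles mod2_boundaries_sub by blast
  qed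
  have 3: "frag_cmul 2 (\<eta> + \<eta>') \<in> mod2_boundaries 1 X"
    using singular_chain_subtopology \<eta>(1) \<eta>'(1) by (intro mod2_even singular_chain_add) blast+
  have "(Y + x + \<eta> + \<eta>') + (\<sigma>c + u + \<eta> + \<eta>') - ((x + u) + frag_cmul 2 (\<eta> + \<eta>')) \<in> mod2_boundaries 1 X"
    by (intro mod2_diff mod2_add 1 2 3 xu)
  moreover have "(Y + x + \<eta> + \<eta>') + (\<sigma>c + u + \<eta> + \<eta>') - ((x + u) + frag_cmul 2 (\<eta> + \<eta>')) = crossing_curve.z ?g v"
    unfolding z unfolding v_def Y_def by (simp add: frag_cmul_2)
  ultimately have "crossing_curve.z ?g v \<in> mod2_boundaries 1 X" by simp
  then have sep: "\<not> connectedin X (topspace X - K)" by (rule crossing_curve.separated[OF curve])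
  have phi: "\<phi> c (diag c t) = cnj \<omega> * Complex t (- t)" if "\<bar>t\<bar> < 1" for t
  proof -
    have "cnj \<omega> * \<psi> c (diag c t) = \<phi> c (diag c t)" using omega(3) by (simp add: \<psi>_def flip: mult.assoc)
    then show ?thesis using diag(2)[OF c that] by simp
  qed
  show ?thesis unfolding nugatory_def
  proof (intro exI[of _ \<beta>] conjI \<beta>p \<beta>01 \<beta>i)
    show "\<not> connectedin X (topspace X - \<beta> ` {0..1})" using sep by (simp add: K_def)
    show "\<beta> ` {0..1} \<inter> D = {c}" using KD by (simp add: K_def)
    show "\<exists>U \<phi>. crossing_chart X \<A> n L c U \<phi> \<and> (\<exists>\<epsilon>>0. \<forall>s t. 0 < s \<and> s < \<epsilon> \<and> 0 < t \<and> t < \<epsilon> \<longrightarrow>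
             \<beta> s \<in> U \<and> \<beta> (1 - t) \<in> U \<and> Re (\<phi> (\<beta> s)) * Re (\<phi> (\<beta> (1 - t))) < 0 \<and> Im (\<phi> (\<beta> s)) * Im (\<phi> (\<beta> (1 - t))) < 0)"
    \<comment> \<open>For times less than 1/4 from either end, \<open>\<beta>\<close> runs on the
      diagonal, with parameters of opposite signs; this also holds for the final piece, which begins
      at 3/4.\<close>
    proof (rule exI[of _ "U c"], rule exI[of _ "\<phi> c"], rule conjI[OF cc[OF c]], rule exI[of _ "1/4"], intro conjI allI impI)
      show "(0::real) < 1/4" by simp
      fix t t' :: real assume "0 < t \<and> t < 1/4 \<and> 0 < t' \<and> t' < 1/4"
      then have t: "0 < t" "t < 1/4" "0 < t'" "t' < 1/4" by auto
      have \<beta>t: "\<beta> t = diag c (s1 * (2 * t))" using t by (simp add: \<beta>_def f_def)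
      have \<beta>t': "\<beta> (1 - t') = diag c (- (s2 * (4 * t')))" using t by (simp add: \<beta>_def g_def h_def algebra_simps)
      have pos: "0 < s1 * (2 * t)" "0 < s2 * (4 * t')" using s t by auto
      have "s1 * (2 * t) < 1 * 1" "s2 * (4 * t') < 1 * 1" using s t by (intro mult_strict_mono; simp)+
      then have lt: "\<bar>s1 * (2 * t)\<bar> < 1" "\<bar>- (s2 * (4 * t'))\<bar> < 1" using pos by (simp_all only: abs_minus_cancel abs_of_pos mult_1)
      have "s1 * (2 * t) * (s2 * (4 * t')) > 0" using pos by (rule mult_pos_pos)
      then have neg: "x * y < 0" if "x = s1 * (2 * t) \<and> y = - (s2 * (4 * t')) \<or> x = - (s1 * (2 * t)) \<and> y = s2 * (4 * t')" for x y
        using that by auto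
      have R: "Re (\<phi> c (\<beta> t)) * Re (\<phi> c (\<beta> (1 - t'))) < 0"
        unfolding \<beta>t \<beta>t' phi[OF lt(1)] phi[OF lt(2)] by (rule neg) (auto simp: \<omega>_def)
      have I: "Im (\<phi> c (\<beta> t)) * Im (\<phi> c (\<beta> (1 - t'))) < 0"
        unfolding \<beta>t \<beta>t' phi[OF lt(1)] phi[OF lt(2)] by (rule neg) (auto simp: \<omega>_def)
      show "\<beta> t \<in> U c" "\<beta> (1 - t') \<in> U c" unfolding \<beta>t \<beta>t' using diag(1)[OF c lt(1)] diag(1)[OF c lt(2)] by auto
      show "Re (\<phi> c (\<beta> t)) * Re (\<phi> c (\<beta> (1 - t'))) < 0" "Im (\<phi> c (\<beta> t)) * Im (\<phi> c (\<beta> (1 - t'))) < 0"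
        by (rule R) (rule I)
    qed
  qed
qed

end

section \<open>Comparison of the two states at a crossing\<close>

context states begin

text \<open>Pushing \<open>e\<close> to the black side leaves traces at \<open>a\<close> and
  \<open>b\<close> that end in the two different black corners; joined to the arc \<gamma> they form
  a chain in \<open>U c\<close>. All other traces are even, because \<open>e + \<gamma>\<close> is a
  cycle modulo 2.\<close>

lemma nugatory_of_core_chain:
  assumes c: "c \<in> C" and e: "singular_chain 1 (subtopology X S0) e"
    and \<gamma>: "singular_chain 1 (subtopology X (U c)) \<gamma>" "chain_boundary 1 \<gamma> = frag_of (point_simplex a) + frag_of (point_simplex b) + frag_cmul 2 w"
    and e\<gamma>: "e + \<gamma> \<in> mod2_boundaries 1 X"
    and a: "a \<in> S0" "a \<in> U c" "Re (\<psi> c a) > Im (\<psi> c a)"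
    and b: "b \<in> S0" "b \<in> U c" "Re (\<psi> c b) < Im (\<psi> c b)"
  shows "nugatory X \<A> n L c"
proof -
  let ?a = "frag_of (point_simplex a)" and ?b = "frag_of (point_simplex b)"
  obtain \<delta> where \<delta>: "\<And>x. x \<in> S0 \<Longrightarrow> pathin X (\<delta> x) \<and> \<delta> x 0 = x" "\<And>x. x \<in> S0 \<Longrightarrow> \<exists>W Q P. good \<delta> W Q P \<and> x \<in> W"
    and black: "\<And>c x s. c \<in> C \<Longrightarrow> x \<in> S0 \<Longrightarrow> x \<in> U c \<Longrightarrow> s = 1 \<or> s = -1 \<Longrightarrow> s * Re (\<psi> c x) > s * Im (\<psi> c x) \<Longrightarrow>
       \<forall>\<^sub>F t in at_right 0. \<delta> x t \<in> black c s"
    by (rule black_paths) (rule that)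
  have "\<forall>\<^sub>F t in at_right 0. \<delta> a t \<in> black c 1" by (rule black[OF c a(1,2)]) (use a(3) in auto)
  then obtain da where da: "da > 0" "\<And>t. 0 < t \<Longrightarrow> t < da \<Longrightarrow> \<delta> a t \<in> black c 1"
    unfolding eventually_at_right_field by blast
  have "\<forall>\<^sub>F t in at_right 0. \<delta> b t \<in> black c (-1)" by (rule black[OF c b(1,2)]) (use b(3) in auto)
  then obtain db where db: "db > 0" "\<And>t. 0 < t \<Longrightarrow> t < db \<Longrightarrow> \<delta> b t \<in> black c (-1)"
    unfolding eventually_at_right_field by blast
  \<comment> \<open>The bound on the times keeps the traces at \<open>a\<close> and \<open>b\<close>
    inside the respective black corner.\<close>
  obtain u d where u: "singular_chain 1 (subtopology X R) u" and d: "\<And>x. 0 < d x" "\<And>x. d x \<le> min da db / 2" "\<And>x. d x \<le> 1"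
    and push: "e - u + frag_extend (\<lambda>\<sigma>. frag_of (path_simplex (\<lambda>t. \<delta> (simplex_point \<sigma>) (t * d (simplex_point \<sigma>)))))
        (chain_boundary 1 e) \<in> mod2_boundaries 1 X" (is "_ + frag_extend ?f _ \<in> _")
    by (rule push_S0[OF \<delta> e, of "\<lambda>_. min da db / 2"]) (use da(1) db(1) in auto)
  define tr where "tr x = frag_of (path_simplex (\<lambda>t. \<delta> x (t * d x)))" for x
  have tr_path: "pathin X (\<lambda>t. \<delta> x (t * d x))" if "x \<in> S0" for x
  proof (rule continuous_map_real_affine[of "{0..1}" X "\<delta> x"])
    show "continuous_map (top_of_set {0..1}) X (\<delta> x)" using \<delta>(1)[OF that] by (simp add: pathin_def)
    show "(\<lambda>t. t * d x) ` {0..1} \<subseteq> {0..1}" using d(1,3)[of x] by (auto intro!: mult_le_one simp: less_imp_le)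
  qed (intro continuous_intros)
  have small: "t * d x < da \<and> t * d x < db" "t > 0 \<Longrightarrow> t * d x > 0" if "t \<in> {0..1}" for t x
  proof -
    have "t * d x \<le> d x" using that d(1)[of x] by (simp add: mult_left_le_one_le)
    then show "t * d x < da \<and> t * d x < db" using d(2)[of x] da(1) db(1) by linarith
    show "t > 0 \<Longrightarrow> t * d x > 0" using d(1)[of x] by simp
  qed
  have bU: "black c s \<subseteq> U c" for s by (auto simp: black_iff[OF c])
  have trU: "singular_chain 1 (subtopology X (U c)) (tr a)" "singular_chain 1 (subtopology X (U c)) (tr b)"
  proof -
    have "\<delta> a (t * d a) \<in> U c" "\<delta> b (t * d b) \<in> U c" if "t \<in> {0..1}" for t
    proof -
      show "\<delta> a (t * d a) \<in> U c"
        using da(2)[of "t * d a"] small[OF that] bU \<delta>(1)[OF a(1)] a(2) that by (cases "t = 0") auto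
      show "\<delta> b (t * d b) \<in> U c"
        using db(2)[of "t * d b"] small[OF that] bU \<delta>(1)[OF b(1)] b(2) that by (cases "t = 0") auto
    qed
    then show "singular_chain 1 (subtopology X (U c)) (tr a)" "singular_chain 1 (subtopology X (U c)) (tr b)"
      unfolding tr_def singular_chain_path using tr_path[OF a(1)] tr_path[OF b(1)] by (auto simp: pathin_subtopology)
  qed
  obtain k where k: "chain_boundary 1 (e + \<gamma>) = frag_cmul 2 k"
    using subsetD[OF mod2_boundaries_cycles e\<gamma>] by (auto simp: mod2_cycles_def)
  have be: "chain_boundary 1 e + ?a + ?b = frag_cmul 2 (k - w)"
  proof -
    have "chain_boundary 1 e = frag_cmul 2 k - chain_boundary 1 \<gamma>" using k by (simp add: chain_boundary_add algebra_simps)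
    then show ?thesis unfolding \<gamma>(2) by (simp add: frag_cmul_2)
  qed
  have pt: "singular_chain 0 (subtopology X S0) ?a" "singular_chain 0 (subtopology X S0) ?b"
    using a(1) b(1) state_top by (auto simp: singular_chain_of singular_simplex_0)
  have "singular_chain 0 (subtopology X S0) (chain_boundary 1 e)"
    using singular_chain_boundary_alt[of 0] e by (simp add: One_nat_def)
  then have "singular_chain 0 (subtopology X S0) (frag_cmul 2 (k - w))" using pt unfolding be[symmetric] by (intro singular_chain_add)
  then have kw: "singular_chain 0 (subtopology X S0) (k - w)" by (simp only: singular_chain_half)
  have "singular_chain 1 X (frag_extend ?f (k - w))"
  proof (rule singular_chain_extend)
    fix \<sigma> assume "\<sigma> \<in> Poly_Mapping.keys (k - w)"
    then have "singular_simplex 0 (subtopology X S0) \<sigma>" using kw by (auto simp: singular_chain_def)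
    then obtain x where x: "x \<in> S0" "\<sigma> = point_simplex x" by (auto simp: singular_simplex_0)
    then show "singular_chain 1 X (?f \<sigma>)" using tr_path[OF x(1)] by (simp add: singular_chain_path)
  qed
  then have "frag_extend ?f (chain_boundary 1 e + ?a + ?b) \<in> mod2_boundaries 1 X"
    unfolding be frag_extend_double by (rule mod2_even)
  moreover have "frag_extend ?f (chain_boundary 1 e + ?a + ?b) = frag_extend ?f (chain_boundary 1 e) + tr a + tr b"
    by (simp add: frag_extend_add tr_def)
  ultimately have fe: "frag_extend ?f (chain_boundary 1 e) + tr a + tr b \<in> mod2_boundaries 1 X" by simp
  have "(e + \<gamma>) - (e - u + frag_extend ?f (chain_boundary 1 e)) + (frag_extend ?f (chain_boundary 1 e) + tr a + tr b) \<in> mod2_boundaries 1 X"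
    by (intro mod2_add mod2_diff e\<gamma> push fe)
  then have xu: "(\<gamma> + tr a + tr b) + u \<in> mod2_boundaries 1 X" by (simp add: algebra_simps)
  show ?thesis
  proof (rule nugatory_of_black_chains[OF c _ _ _ u _ xu])
    show "\<delta> a (d a) \<in> black c 1" "\<delta> b (d b) \<in> black c (-1)"
      using da(2)[of "d a"] db(2)[of "d b"] small[of 1] d(1) by simp_all
    show "singular_chain 1 (subtopology X (U c)) (\<gamma> + tr a + tr b)" by (intro singular_chain_add \<gamma>(1) trU)
    show "chain_boundary 1 (\<gamma> + tr a + tr b) = frag_of (point_simplex (\<delta> a (d a))) + frag_of (point_simplex (\<delta> b (d b))) + frag_cmul 2 w"
      using \<delta>(1)[OF a(1)] \<delta>(1)[OF b(1)] by (simp add: chain_boundary_add \<gamma>(2) tr_def chain_boundary_path)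
  qed
qed

text \<open>If exactly one of the two multiplicities were odd, even multiples could be dropped, and
  a core chain together with one new arc would bound. The ends of a new arc lie on different sides
  of the diagonal \<open>Re = Im\<close>, next to different black corners, so the crossing would be
  nugatory.\<close>

lemma defect_le:
  assumes c: "c \<in> C" shows "homological_defect X (S1 c) \<le> homological_defect X S0"
proof (rule defect_switch[OF S0_corners[OF c] S1_corners[OF c] same_core[OF c] _ null_S0])
  interpret A: two_corners X "U c" "\<lambda>p. \<i> * \<psi> c p" S0 by (rule S0_corners[OF c])
  interpret B: two_corners X "U c" "\<psi> c" "S1 c" by (rule S1_corners[OF c])
  let ?P = "\<lambda>z. frag_of (point_simplex (inv_into (U c) (\<psi> c) z))"
  have inv: "inv_into (U c) (\<lambda>p. \<i> * \<psi> c p) z = inv_into (U c) (\<psi> c) (- \<i> * z)" for z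
  proof -
    have "\<i> * y = z \<longleftrightarrow> y = - \<i> * z" for y by (auto simp: mult.assoc[symmetric])
    then show ?thesis by (simp add: inv_into_def)
  qed
  \<comment> \<open>Old and new arcs join the same four points 1, \<i>, -1, - \<i> in different
    pairs, so their boundaries differ by signs only.\<close>
  show "chain_boundary 1 (A.\<gamma>1 + A.\<gamma>2) - chain_boundary 1 (B.\<gamma>1 + B.\<gamma>2) = frag_cmul 2 (?P 1 + ?P (-1) - ?P \<i> - ?P (-\<i>))"
    unfolding chain_boundary_add A.gamma_boundary B.gamma_boundary inv by (simp add: frag_cmul_2)
  fix e n1 n2
  assume e: "singular_chain 1 (subtopology X B.core) e" and N: "e + frag_cmul n1 B.\<gamma>1 + frag_cmul n2 B.\<gamma>2 \<in> null_cycles X (S1 c)"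
  have eS0: "singular_chain 1 (subtopology X S0) e"
    by (rule singular_chain_mono[OF e]) (use same_core[OF c] A.core_mid in blast)
  have NB: "e + frag_cmul n1 B.\<gamma>1 + frag_cmul n2 B.\<gamma>2 \<in> mod2_boundaries 1 X" using N by (simp add: null_cycles_def)
  have \<gamma>X: "singular_chain 1 X B.\<gamma>1" "singular_chain 1 X B.\<gamma>2"
    using B.gamma_chains(1) B.gamma_chain singular_chain_subtopology by blast+
  have \<gamma>U: "singular_chain 1 (subtopology X (U c)) B.\<gamma>1" "singular_chain 1 (subtopology X (U c)) B.\<gamma>2"
    unfolding corner_arc_def singular_chain_path
    using B.pathin_corner[OF B.ch B.im] B.pathin_corner[OF B.ch' B.im'] B.corner_point(1,3) by auto
  have pt: "inv_into (U c) (\<psi> c) z \<in> S0" "inv_into (U c) (\<psi> c) z \<in> U c" "\<psi> c (inv_into (U c) (\<psi> c) z) = z"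
    if "z \<in> {1, -1, \<i>, -\<i>}" for z
  proof -
    show "inv_into (U c) (\<psi> c) z \<in> S0" using B.ends_core[OF that] same_core[OF c] A.core_mid by blast
    have "z \<in> \<psi> c ` U c" unfolding psi(3)[OF c] using that by auto
    then show "inv_into (U c) (\<psi> c) z \<in> U c" "\<psi> c (inv_into (U c) (\<psi> c) z) = z"
      using chart_inverse(1,2)[OF psi(2)[OF c]] by auto
  qed
  have notnug: "\<not> nugatory X \<A> n L c" using red c by (simp add: reduced_diagram_def)
  show "even n1 \<longleftrightarrow> even n2"
  proof (rule ccontr)
    assume "\<not> (even n1 \<longleftrightarrow> even n2)"
    then consider "odd n1" "even n2" | "even n1" "odd n2" by blast
    then show False
    proof cases
      case 1
      obtain k l where kl: "n1 = 2 * k + 1" "n2 = 2 * l" using 1 by (auto elim!: oddE evenE)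
      have "frag_cmul 2 (frag_cmul k B.\<gamma>1 + frag_cmul l B.\<gamma>2) \<in> mod2_boundaries 1 X"
        by (intro mod2_even singular_chain_add singular_chain_cmul \<gamma>X)
      from mod2_diff[OF NB this] have eb: "e + B.\<gamma>1 \<in> mod2_boundaries 1 X"
        by (simp add: kl frag_cmul_distrib frag_cmul_distrib2 algebra_simps)
      have bd: "chain_boundary 1 B.\<gamma>1 = ?P 1 + ?P \<i> + frag_cmul 2 (- ?P 1)"
        unfolding B.gamma_boundary by (simp add: frag_cmul_2)
      have "nugatory X \<A> n L c"
        by (rule nugatory_of_core_chain[OF c eS0 \<gamma>U(1) bd eb]) (use pt in auto)
      then show False using notnug by blast
    next
      case 2
      obtain k l where kl: "n1 = 2 * k" "n2 = 2 * l + 1" using 2 by (auto elim!: oddE evenE)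
      have "frag_cmul 2 (frag_cmul k B.\<gamma>1 + frag_cmul l B.\<gamma>2) \<in> mod2_boundaries 1 X"
        by (intro mod2_even singular_chain_add singular_chain_cmul \<gamma>X)
      from mod2_diff[OF NB this] have eb: "e + B.\<gamma>2 \<in> mod2_boundaries 1 X"
        by (simp add: kl frag_cmul_distrib frag_cmul_distrib2 algebra_simps)
      have bd: "chain_boundary 1 B.\<gamma>2 = ?P (-\<i>) + ?P (-1) + frag_cmul 2 (- ?P (-1))"
        unfolding B.gamma_boundary by (simp add: frag_cmul_2)
      have "nugatory X \<A> n L c"
        by (rule nugatory_of_core_chain[OF c eS0 \<gamma>U(2) bd eb]) (use pt in auto)
      then show False using notnug by blast
    qed
  qed
qed

end

theorem proposition2p8:
  fixes X :: "'a topology"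
    and \<A> :: "('a set \<times> ('a \<Rightarrow> complex)) set"
    and n :: nat
    and L :: "nat \<Rightarrow> real \<Rightarrow> 'a \<times> real"
  assumes "closed_connected_oriented_surface X \<A>"
    and "link_diagram X \<A> n L"
    and "reduced_diagram X \<A> n L"
    and "alternating n L"
  shows "adequate X \<A> n L"
proof -
  have st: "states X \<A> n L U \<phi> \<kappa>" if "smoothing_charts X \<A> n L U \<phi>" "\<kappa> = 1 \<or> \<kappa> = -1" for U \<phi> \<kappa>
    using assms that by (simp add: states_def states_axioms_def diagram_def)
  have "A_adequate X \<A> n L" unfolding A_adequate_def
  proof (intro allI impI ballI)
    fix U \<phi> c assume U: "smoothing_charts X \<A> n L U \<phi>" and c: "c \<in> crossings n L"
    interpret states X \<A> n L U \<phi> 1 by (rule st[OF U]) simp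
    show "homological_defect X (state n L U \<phi> ((\<lambda>_. A_smoothing)(c := B_smoothing)))
          \<le> homological_defect X (state n L U \<phi> (\<lambda>_. A_smoothing))"
      using defect_le[OF c] by (simp add: base_def other_def)
  qed
  moreover have "B_adequate X \<A> n L" unfolding B_adequate_def
  proof (intro allI impI ballI)
    fix U \<phi> c assume U: "smoothing_charts X \<A> n L U \<phi>" and c: "c \<in> crossings n L"
    interpret states X \<A> n L U \<phi> "-1" by (rule st[OF U]) simp
    show "homological_defect X (state n L U \<phi> ((\<lambda>_. B_smoothing)(c := A_smoothing)))
          \<le> homological_defect X (state n L U \<phi> (\<lambda>_. B_smoothing))"
      using defect_le[OF c] by (simp add: base_def other_def)
  qed
  ultimately show ?thesis by (simp add: adequate_def)
qed

end
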